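(* The functors $\mathrm{C2B}\colon\mathbf{Csys}\to\mathbf{Bsys}$, defined as the composite $\mathbf{Csys}\xrightarrow{\mathrm{CE}}\mathbf{rCEsys}_s\xrightarrow{\mathrm{CE2E}}\mathbf{Esys}_s\xrightarrow{\mathrm{E2B}}\mathbf{Bsys}$, and $\mathrm{B2C}\colon\mathbf{Bsys}\to\mathbf{Csys}$, defined as the composite $\mathbf{Bsys}\xrightarrow{\mathrm{B2E}}\mathbf{Esys}_s\xrightarrow{\mathrm{E2CE}}\mathbf{rCEsys}_s\xrightarrow{\mathrm{C}}\mathbf{Csys}$, establish an equivalence between the category $\mathbf{Csys}$ of C-systems and the category $\mathbf{Bsys}$ of B-systems.
   Context: **Strict categories, stratification.** A strict category is a (small) category regarded as an algebraic structure, so that equality of objects is meaningful. Let $\mathcal C$ be a strict category with a chosen terminal object $1$. A stratification of $\mathcal C$ is a functor $L\colon\mathcal C\to(\mathbb N,\ge)$ such that (1) $L(X)=0$ iff $X=1$; (2) for any $f\colon X\to Y$, $L(X)=L(Y)$ iff $X=Y$ and $f=\mathrm{id}_X$; (3) every $f\colon X\to Y$ with $L(X)=n+m+1$, $L(Y)=n$ has a unique factorization $X=X_{m+1}\to X_m\to\cdots\to X_1\to X_0=Y$ with $L(X_i)=n+i$. Stratifications are unique when they exist. A functor $F$ between stratified categories is stratified if $L_{\mathcal C}=L_{\mathcal D}\circ F$. Slices $\mathcal C/X$ of a stratified category (chosen terminal object $\mathrm{id}_X$) are stratified by $L_X(f\colon Y\to X)=L(Y)-L(X)$. An arrow $f\colon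 X\to Y$ is indecomposable if $L(X)=L(Y)+1$; every $X$ with $L(X)>0$ is the domain of exactly one indecomposable arrow, denoted $\overline X$. **Slice notation.** For a strict category $\mathcal F$ and object $\Gamma$, $A\in\mathcal F/\Gamma$ means $A$ is an object of the slice, i.e. an arrow $A\colon\Gamma.A\to\Gamma$. For $P\in\mathcal F/\Gamma.A$, $A.P:=A\circ P\in\mathcal F/\Gamma$. We identify $(\mathcal F/\Gamma)/A$ with $\mathcal F/\Gamma.A$. **C-systems.** A C-system consists of a strict category $\mathcal C$, a function $\ell\colon\mathrm{Ob}(\mathcal C)\to\mathbb N$, a chosen object $1$, a function $\mathsf{ft}\colon\mathrm{Ob}(\mathcal C)\to\mathrm{Ob}(\mathcal C)$, for each $\Gamma$ with $\ell(\Gamma)>0$ a morphism $\mathsf p_\Gamma\colon\Gamma\to\mathsf{ft}(\Gamma)$, and for each such $\Gamma$ and each $f\colon\Delta\to\mathsf{ft}(\Gamma)$ an object $f^*\Gamma$ and a morphism $\mathsf q(f,\Gamma)\colon f^*\Gamma\to\Gamma$, such that: $\ell^{-1}(0)=\{1\}$; $\ell(\mathsf{ft}(\Gamma))=\ell(\Gamma)-1$ if $\ell(\Gamma)>0$; $\mathsf{ft}(1)=1$; $1$ is terminal; for $\ell(\Gamma)>0$ and $f\colon\Delta\to\mathsf{ft}(\Gamma)$: $\ell(f^*\Gamma)>0$, $\mathsf{ft}(f^*\Gamma)=\Delta$, and the square $\mathsf p_\Gamma\circ\mathsf q(f,\Gamma)=f\circ\mathsf p_{f^*\Gamma}$ commutes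 and is a pullback; $(\mathrm{id}_{\mathsf{ft}(\Gamma)})^*\Gamma=\Gamma$ and $\mathsf q(\mathrm{id}_{\mathsf{ft}(\Gamma)},\Gamma)=\mathrm{id}_\Gamma$; for $g\colon\Delta\to\mathsf{ft}(\Gamma)$, $f\colon E\to\Delta$: $(g\circ f)^*\Gamma=f^*g^*\Gamma$ and $\mathsf q(g\circ f,\Gamma)=\mathsf q(g,\Gamma)\circ\mathsf q(f,g^*\Gamma)$. A morphism of C-systems is a functor strictly preserving $1,\ell,\mathsf{ft},\mathsf p$, and $f^*\Gamma$, $\mathsf q(f,\Gamma)$. $\mathbf{Csys}$ is the resulting category. **CE-systems.** A CE-system consists of two strict categories $\mathcal F,\mathcal C$ with the same objects, an identity-on-objects functor $I\colon\mathcal F\to\mathcal C$, a chosen object $1$ terminal in $\mathcal F$, and, for every $f\colon\Delta\to\Gamma$ in $\mathcal C$ and $A\in\mathcal F/\Gamma$, a choice of $f^*A\in\mathcal F/\Delta$ and of an arrow $\pi_2(f,A)\colon\Delta.f^*A\to\Gamma.A$ in $\mathcal C$ such that $I(A)\circ\pi_2(f,A)=f\circ I(f^*A)$ is a pullback square in $\mathcal C$, functorially: (a) $f^*\mathrm{id}_\Gamma=\mathrm{id}_\Delta$, $\pi_2(f,\mathrm{id}_\Gamma)=f$; (b) $\mathrm{id}_\Gamma^*A=A$, $\pi_2(\mathrm{id}_\Gamma,A)=\mathrm{id}_{\Gamma.A}$; (c) $(f\circ g)^*A=g^*(f^*A)$, $\pi_2(f\circ g,A)=\pi_2(f,A)\circ\pi_2(g,f^*A)$;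 (d) for $P\in\mathcal F/\Gamma.A$, $f^*(A.P)=f^*A\circ\pi_2(f,A)^*P$, $\pi_2(f,A.P)=\pi_2(\pi_2(f,A),P)$. Each $f$ induces a functor $f^*\colon\mathcal F/\Gamma\to\mathcal F/\Delta$. The CE-system is rooted if $1$ is terminal in $\mathcal C$; it is stratified if $\mathcal F$ is stratified and each $f^*\colon\mathcal F/\Gamma\to\mathcal F/\Delta$ is stratified. A CE-homomorphism is a pair of functors $(F_{\mathcal F},F_{\mathcal C})$ commuting with the functors $I$, with $F_{\mathcal F}(1)=1$, $F_{\mathcal F}(f^*A)=(F_{\mathcal C}f)^*(F_{\mathcal F}A)$ and $F_{\mathcal C}(\pi_2(f,A))=\pi_2(F_{\mathcal C}f,F_{\mathcal F}A)$; it is stratified if $F_{\mathcal F}$ is. $\mathbf{rCEsys}_s$ is the category of stratified rooted CE-systems and stratified CE-homomorphisms. **E-systems.** A term structure on a strict category $\mathcal F$ is a family of sets $T(A)$ indexed by all arrows $A$ of $\mathcal F$; a functor with term structure is a functor $G$ with functions $T(A)\to T(G(A))$ for all arrows $A$. Slices $\mathcal F/\Gamma$ inherit the term structure (the terms of an arrow of $\mathcal F/\Gamma$ are those of the underlying arrow of $\mathcal F$); $G$ induces $G/\Gamma\colon\mathcal F/\Gamma\to\mathcal D/G(\Gamma)$. Equalities between functors with term structure are on objects, arrows and terms. A pre-E-system $\mathbb E$ is a strict category $\mathcal F$ with term structure $T$, a chosen terminal object $[\,]$, and: for each $A\in\mathcal F/\Gamma$ and $x\in T(A)$ a functor with term structure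 $S_x\colon\mathcal F/\Gamma.A\to\mathcal F/\Gamma$ with $S_x(\mathrm{id}_{\Gamma.A})=\mathrm{id}_\Gamma$; for each $A\in\mathcal F/\Gamma$ a functor with term structure $W_A\colon\mathcal F/\Gamma\to\mathcal F/\Gamma.A$ with $W_{\mathrm{id}_\Gamma}=\mathrm{id}$, $W_{A.P}=W_P\circ W_A$, $W_A(\mathrm{id}_\Gamma)=\mathrm{id}_{\Gamma.A}$; for each $A\in\mathcal F/\Gamma$ an element $\mathsf{idtm}_A\in T(W_A(A))$. A pre-E-homomorphism is a functor with term structure $H$ with $H([\,])=[\,]$, $(H/\Gamma)\circ S_x=S_{H(x)}\circ(H/\Gamma.A)$, $(H/\Gamma.A)\circ W_A=W_{H(A)}\circ(H/\Gamma)$, $H(\mathsf{idtm}_A)=\mathsf{idtm}_{H(A)}$. The slice $\mathbb E/\Gamma$ is $\mathcal F/\Gamma$ with chosen terminal object $\mathrm{id}_\Gamma$ and the structure inherited from $\mathbb E$. An E-system is a pre-E-system in which (1) each $S_x$ and (2) each $W_A$ is a pre-E-homomorphism (between slices), (3) $S_x\circ W_A=\mathrm{id}_{\mathbb E/\Gamma}$, (4) $S_x(\mathsf{idtm}_A)=x$ for $x\in T(A)$, (5) $S_{\mathsf{idtm}_A}\circ(W_A/A)=\mathrm{id}_{\mathbb E/\Gamma.A}$. E-homomorphisms are pre-E-homomorphisms between E-systems. An E-system is stratified if $\mathcal F$ is stratified and all $W_A$, $S_x$ are stratified; an E-homomorphism is stratified if its underlying functor is. $\mathbf{Esys}_s$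 is the category of stratified E-systems and stratified E-homomorphisms. **B-systems.** A B-frame $\mathbb B$ consists of sets $B_n$, $\tilde B_{n+1}$ ($n\in\mathbb N$), with $B_0=\{*\}$ a singleton, and functions $\mathsf{ft}\colon B_{n+1}\to B_n$, $\partial\colon\tilde B_{n+1}\to B_{n+1}$; $\mathsf{ft}^m\colon B_{n+m}\to B_n$ is the $m$-fold composite. A homomorphism $H$ of B-frames consists of functions $H\colon B_n\to A_n$, $\tilde H\colon\tilde B_{n+1}\to\tilde A_{n+1}$ commuting with $\mathsf{ft}$ and $\partial$. For $X\in B_n$ the slice $\mathbb B/X$ has $(B/X)_m=\{Y\in B_{n+m}\mid\mathsf{ft}^m(Y)=X\}$, $(\tilde B/X)_{m+1}=\{y\in\tilde B_{n+m+1}\mid\mathsf{ft}^{m+1}(\partial y)=X\}$; $H$ induces $H/X\colon\mathbb B/X\to\mathbb A/H(X)$; $(\mathbb B/X)/Y$ is identified with $\mathbb B/Y$. A pre-B-system is a B-frame with homomorphisms of B-frames $S_x\colon\mathbb B/\partial(x)\to\mathbb B/\mathsf{ft}(\partial(x))$ for $x\in\tilde B_{n+1}$, $W_X\colon\mathbb B/\mathsf{ft}(X)\to\mathbb B/X$ for $X\in B_{n+1}$, and functions $\delta\colon B_{n+1}\to\tilde B_{n+2}$ with $\partial(\delta(X))=W_X(X)$. Slices inherit this structure. A pre-B-homomorphism is a homomorphism of B-frames $H$ with $(H/\mathsf{ft}(\partial x))\circ S_x=S_{\tilde H(x)}\circ(H/\partial x)$, $(H/X)\circ W_X=W_{H(X)}\circ(H/\mathsf{ft}(X))$,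 $\tilde H(\delta(X))=\delta(H(X))$. A B-system is a pre-B-system such that all $S_x$ and all $W_X$ are pre-B-homomorphisms, $S_x\circ W_{\partial(x)}=\mathrm{id}$, $\tilde S_x(\delta(\partial(x)))=x$, and $S_{\delta(X)}\circ(W_X/X)=\mathrm{id}_{\mathbb B/X}$. B-homomorphisms are pre-B-homomorphisms between B-systems. $\mathbf{Bsys}$ is the resulting category. **The functor $\mathrm{CE}\colon\mathbf{Csys}\to\mathbf{rCEsys}_s$.** For a C-system with underlying category $\mathcal C$, let $\mathcal F$ be the free category on the graph with vertices the objects of $\mathcal C$ and edges $\mathsf p_\Gamma\colon\Gamma\to\mathsf{ft}(\Gamma)$ ($\ell(\Gamma)>0$), $I\colon\mathcal F\to\mathcal C$ sends a path to its composite, the chosen terminal object is $1$, and the chosen pullbacks along $f\colon\Delta\to\Gamma$ are defined by induction on the length of a path: $f^*\mathrm{id}_\Gamma=\mathrm{id}_\Delta$, $\pi_2(f,\mathrm{id}_\Gamma)=f$; for $p=p'\circ\mathsf p_\Xi$ with $p'\colon\mathsf{ft}(\Xi)\to\Gamma$ and $g=\pi_2(f,p')$, $f^*p=f^*p'\circ\mathsf p_{g^*\Xi}$ and $\pi_2(f,p)=\mathsf q(g,\Xi)$. A morphism $F$ is sent to $(F_{\mathcal F},F)$ with $F_{\mathcal F}$ determined by $\mathsf p_\Gamma\mapsto\mathsf p_{F\Gamma}$. **The functor $\mathrm C\colon\mathbf{rCEsys}_s\to\mathbf{Csys}$.** For a stratified rooted CE-system on $I\colon\mathcal F\to\mathcal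 C$: underlying category $\mathcal C$, chosen object $1$, $\ell(X)=L(X)$, $\mathsf{ft}(1)=1$, and for $L(X)>0$: $\mathsf{ft}(X)=\mathrm{cod}(\overline X)$, $\mathsf p_X=I(\overline X)$, $f^*X=Y.f^*\overline X$ and $\mathsf q(f,X)=\pi_2(f,\overline X)$ for $f\colon Y\to\mathsf{ft}(X)$. A homomorphism $F$ is sent to $F_{\mathcal C}$. **The functor $\mathrm{CE2E}$.** For a CE-system on $I\colon\mathcal F\to\mathcal C$: the underlying category is $\mathcal F$ with its chosen terminal object, $T(A)=\{x\colon\Gamma\to\Gamma.A\text{ in }\mathcal C\mid I(A)\circ x=\mathrm{id}_\Gamma\}$ for $A\in\mathcal F/\Gamma$, $W_A=I(A)^*$, $S_x=x^*$, where $f^*$ acts on terms by pulling back sections (for $B\in\mathcal F/\Gamma$, $Q\in\mathcal F/\Gamma.B$, $y\in T(Q)$, $f^*y$ is the section of $I(\pi_2(f,B)^*Q)$ with $\pi_2(f,B.Q)\circ f^*y=y\circ\pi_2(f,B)$), and $\mathsf{idtm}_A$ is the unique section of $I(W_A(A))$ with $\pi_2(I(A),A)\circ\mathsf{idtm}_A=\mathrm{id}_{\Gamma.A}$. A homomorphism $F$ is sent to $F_{\mathcal F}$ with action on terms given by $F_{\mathcal C}$. It restricts to a functor $\mathbf{rCEsys}_s\to\mathbf{Esys}_s$. **The functor $\mathrm{E2CE}$.** In an E-system, for $A,B\in\mathcal F/\Gamma$ let $\mathrm{thom}(A,B)=T(W_A(B))$; for $f\in\mathrm{thom}(A,B)$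 let $f^*=S_f\circ(W_A/B)\colon\mathbb E/\Gamma.B\to\mathbb E/\Gamma.A$; for $g\in\mathrm{thom}(B,C)$ let $g\cdot f=f^*(g)\in\mathrm{thom}(A,C)$. These are the arrows and composition of a strict category $\mathcal C_{\mathbb E}(\Gamma)$ with the objects of $\mathcal F/\Gamma$ and identities $\mathsf{idtm}_A$. For $x\in T(A)$, $u\in T(S_x(P))$ let $x.u=S_u(S_x(\mathsf{idtm}_{A.P}))\in T(A.P)$. $\mathrm{E2CE}(\mathbb E)$ has category of families $\mathcal F/[\,]$ with chosen terminal object $\mathrm{id}_{[\,]}$, second category $\mathcal C_{\mathbb E}([\,])$, identity-on-objects functor sending an arrow $Q\colon A.Q\to A$ to $W_Q(\mathsf{idtm}_A)\in\mathrm{thom}(A.Q,A)$, and, for $f\in\mathrm{thom}(A,B)$ and $R\in\mathcal F/[\,].B$, chosen pullback given by $f^*R=f^*(R)$ and $\pi_2(f,R)=(W_{f^*R}(f)).\mathsf{idtm}_{f^*R}\in\mathrm{thom}(A.f^*R,B.R)$. An E-homomorphism $H$ is sent to the pair consisting of $H/[\,]$ and the functor acting as $H/[\,]$ on objects and by the action of $H$ on terms on arrows. It restricts to a functor $\mathbf{Esys}_s\to\mathbf{rCEsys}_s$. **The functor $\mathrm{B2E}\colon\mathbf{Bsys}\to\mathbf{Esys}_s$.** For a B-system $\mathbb B$, the underlying category $\mathcal F_{\mathbb B}$ is the free category on the graph with vertices $(n,X)$, $X\in B_n$, and edges $(n+1,X)\to(n,\mathsf{ft}(X))$; its arrows are $(X,k)\colon(n+k,X)\to(n,\mathsf{ft}^k(X))$;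 the terminal object is $(0,* )$. Terms and homomorphisms $S^k_t\colon\mathbb B/X\to\mathbb B/\mathsf{ft}^k(X)$ for $t\in T(X,k)$ are defined by: $T(X,0)=\{*\}$, $S^0_*=\mathrm{id}$; $T(X,1)=\partial^{-1}(X)$, $S^1_x=S_x$; for $k\ge1$, $T(X,k+1)=\coprod_{t\in T(\mathsf{ft}(X),k)}T(S^k_t(X),1)$, $S^{k+1}_{(t,x)}=S_x\circ(S^k_t/X)$. A homomorphism $H$ of B-frames preserving the $S_x$ acts by $(n,X)\mapsto(n,H(X))$, $(X,k)\mapsto(H(X),k)$, and componentwise by $\tilde H$ on terms $(t_1,\dots,t_k)$. Identifying $\mathcal F_{\mathbb B}/(n,X)$ with $\mathcal F_{\mathbb B/X}$, substitution by $t\in T(X,k)$ is the functor with term structure induced by $S^k_t$, weakening by $(X,k)$ is the one induced by $W^k_X=W_X\circ W_{\mathsf{ft}(X)}\circ\cdots\circ W_{\mathsf{ft}^{k-1}(X)}$ ($W_X^0=\mathrm{id}$), and $\mathsf{idtm}_{(X,0)}=*$, $\mathsf{idtm}_{(X,1)}=\delta(X)$, $\mathsf{idtm}_{(X,k+1)}=(\tilde W_X(\mathsf{idtm}_{(\mathsf{ft}(X),k)}),\delta(X))$, with $\tilde W_X$ applied componentwise. **The functor $\mathrm{E2B}\colon\mathbf{Esys}_s\to\mathbf{Bsys}$.** For a stratified E-system: $B_n=\{X\in\mathrm{Ob}(\mathcal F)\mid L(X)=n\}$, $\tilde B_{n+1}=\coprod_{X\in B_{n+1}}T(\overline X)$,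 $\mathsf{ft}(X)=\mathrm{cod}(\overline X)$, $\partial(X,x)=X$. A stratified functor with term structure $F$ induces the homomorphism $X\mapsto F(X)$, $(X,t)\mapsto(F(X),F(t))$. Identifying the B-frame of a slice $\mathcal F/X$ with the slice B-frame over $X$, $S_{(X,t)}$ is induced by $S_t$, $W_X$ is induced by $W_{\overline X}$, and $\delta(X)=(W_X(X),\mathsf{idtm}_{\overline X})$. *)

theory Defs
  imports "HOL-Library.FuncSet"
begin

text \<open>
  Conventions. All small structures live on subsets of the types \<open>'a univ\<close> below, where \<open>'a\<close> is
  arbitrary; this plays the role of the universe of small sets. It is closed under pairing, so that
  every construction stays inside it. As usual in HOL, the operations of a structure are total
  functions of which only the values on the indicated carriers matter. Homomorphisms, on the other
  hand, are required to be \<open>extensional\<close> (equal to \<open>undefined\<close> off the carriers), so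
  that two homomorphisms are equal as soon as they agree on the carriers.
\<close>

datatype 'a univ = Elem 'a | Num (unum: nat) | Pair (ufst: "'a univ") (usnd: "'a univ")

notation Pair ("\<langle>_,/ _\<rangle>")


section \<open>Categories\<close>

record ('o, 'm) category =
  Obj :: "'o set"
  Arr :: "'m set"
  Dom :: "'m \<Rightarrow> 'o"
  Cod :: "'m \<Rightarrow> 'o"
  Ident :: "'o \<Rightarrow> 'm"
  Comp :: "'m \<Rightarrow> 'm \<Rightarrow> 'm"  (infixl "\<cdot>\<index>" 70)

definition hom :: "('o, 'm) category \<Rightarrow> 'o \<Rightarrow> 'o \<Rightarrow> 'm set" where
  "hom C X Y = {f \<in> Arr C. Dom C f = X \<and> Cod C f = Y}"

definition is_category :: "('o, 'm) category \<Rightarrow> bool" where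
  "is_category C \<longleftrightarrow>
     (\<forall>f \<in> Arr C. Dom C f \<in> Obj C \<and> Cod C f \<in> Obj C) \<and>
     (\<forall>X \<in> Obj C. Ident C X \<in> hom C X X) \<and>
     (\<forall>f \<in> Arr C. \<forall>g \<in> Arr C. Dom C g = Cod C f \<longrightarrow> g \<cdot>\<^bsub>C\<^esub> f \<in> hom C (Dom C f) (Cod C g)) \<and>
     (\<forall>f \<in> Arr C. f \<cdot>\<^bsub>C\<^esub> Ident C (Dom C f) = f \<and> Ident C (Cod C f) \<cdot>\<^bsub>C\<^esub> f = f) \<and>
     (\<forall>f \<in> Arr C. \<forall>g \<in> Arr C. \<forall>h \<in> Arr C. Dom C g = Cod C f \<longrightarrow> Dom C h = Cod C g \<longrightarrow>
        (h \<cdot>\<^bsub>C\<^esub> g) \<cdot>\<^bsub>C\<^esub> f = h \<cdot>\<^bsub>C\<^esub> (g \<cdot>\<^bsub>C\<^esub> f))"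

definition is_terminal :: "('o, 'm) category \<Rightarrow> 'o \<Rightarrow> bool" where
  "is_terminal C t \<longleftrightarrow> t \<in> Obj C \<and> (\<forall>X \<in> Obj C. \<exists>!f. f \<in> hom C X t)"

definition is_iso :: "('o, 'm) category \<Rightarrow> 'm \<Rightarrow> bool" where
  "is_iso C f \<longleftrightarrow> f \<in> Arr C \<and>
     (\<exists>g \<in> hom C (Cod C f) (Dom C f).
        g \<cdot>\<^bsub>C\<^esub> f = Ident C (Dom C f) \<and> f \<cdot>\<^bsub>C\<^esub> g = Ident C (Cod C f))"

text \<open>The square \<open>f \<cdot> h = g \<cdot> k\<close> commutes and is a pullback of the cospan \<open>f, g\<close>.\<close>

definition is_pullback :: "('o, 'm) category \<Rightarrow> 'm \<Rightarrow> 'm \<Rightarrow> 'm \<Rightarrow> 'm \<Rightarrow> bool" where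
  "is_pullback C f g h k \<longleftrightarrow>
     f \<in> Arr C \<and> g \<in> Arr C \<and> h \<in> Arr C \<and> k \<in> Arr C \<and>
     Cod C f = Cod C g \<and> Cod C h = Dom C f \<and> Cod C k = Dom C g \<and> Dom C h = Dom C k \<and>
     f \<cdot>\<^bsub>C\<^esub> h = g \<cdot>\<^bsub>C\<^esub> k \<and>
     (\<forall>u \<in> Arr C. \<forall>v \<in> Arr C. Dom C u = Dom C v \<longrightarrow> Cod C u = Dom C f \<longrightarrow> Cod C v = Dom C g \<longrightarrow>
        f \<cdot>\<^bsub>C\<^esub> u = g \<cdot>\<^bsub>C\<^esub> v \<longrightarrow>
        (\<exists>!w. w \<in> hom C (Dom C u) (Dom C h) \<and> h \<cdot>\<^bsub>C\<^esub> w = u \<and> k \<cdot>\<^bsub>C\<^esub> w = v))"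

record ('o, 'm, 'p, 'n) fmap =
  onObj :: "'o \<Rightarrow> 'p"
  onArr :: "'m \<Rightarrow> 'n"

definition is_functor :: "('o, 'm) category \<Rightarrow> ('p, 'n) category \<Rightarrow> ('o, 'm, 'p, 'n) fmap \<Rightarrow> bool" where
  "is_functor C D F \<longleftrightarrow>
     (\<forall>X \<in> Obj C. onObj F X \<in> Obj D) \<and>
     (\<forall>f \<in> Arr C. onArr F f \<in> hom D (onObj F (Dom C f)) (onObj F (Cod C f))) \<and>
     (\<forall>X \<in> Obj C. onArr F (Ident C X) = Ident D (onObj F X)) \<and>
     (\<forall>f \<in> Arr C. \<forall>g \<in> Arr C. Dom C g = Cod C f \<longrightarrow>
        onArr F (g \<cdot>\<^bsub>C\<^esub> f) = onArr F g \<cdot>\<^bsub>D\<^esub> onArr F f)"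

definition fmap_id :: "('o, 'm, 'o, 'm) fmap" where
  "fmap_id = \<lparr>onObj = (\<lambda>X. X), onArr = (\<lambda>f. f)\<rparr>"

definition fmap_comp ::
    "('p, 'n, 'q, 'l) fmap \<Rightarrow> ('o, 'm, 'p, 'n) fmap \<Rightarrow> ('o, 'm, 'q, 'l) fmap"
    (infixl "\<circ>\<^sub>F" 55) where
  "G \<circ>\<^sub>F F = \<lparr>onObj = onObj G \<circ> onObj F, onArr = onArr G \<circ> onArr F\<rparr>"

definition is_nat_iso :: "('o, 'm) category \<Rightarrow> ('p, 'n) category \<Rightarrow>
    ('o, 'm, 'p, 'n) fmap \<Rightarrow> ('o, 'm, 'p, 'n) fmap \<Rightarrow> ('o \<Rightarrow> 'n) \<Rightarrow> bool" where
  "is_nat_iso C D F G \<eta> \<longleftrightarrow>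
     (\<forall>X \<in> Obj C. \<eta> X \<in> hom D (onObj F X) (onObj G X) \<and> is_iso D (\<eta> X)) \<and>
     (\<forall>f \<in> Arr C. \<eta> (Cod C f) \<cdot>\<^bsub>D\<^esub> onArr F f = onArr G f \<cdot>\<^bsub>D\<^esub> \<eta> (Dom C f))"

definition is_equivalence :: "('o, 'm) category \<Rightarrow> ('p, 'n) category \<Rightarrow>
    ('o, 'm, 'p, 'n) fmap \<Rightarrow> ('p, 'n, 'o, 'm) fmap \<Rightarrow> bool" where
  "is_equivalence C D F G \<longleftrightarrow>
     is_category C \<and> is_category D \<and> is_functor C D F \<and> is_functor D C G \<and>
     (\<exists>\<eta>. is_nat_iso C C fmap_id (G \<circ>\<^sub>F F) \<eta>) \<and>
     (\<exists>\<epsilon>. is_nat_iso D D (F \<circ>\<^sub>F G) fmap_id \<epsilon>)"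

definition fmap_restrict :: "('o, 'm) category \<Rightarrow> ('o, 'm, 'p, 'n) fmap \<Rightarrow> ('o, 'm, 'p, 'n) fmap" where
  "fmap_restrict C F = \<lparr>onObj = restrict (onObj F) (Obj C), onArr = restrict (onArr F) (Arr C)\<rparr>"

definition fmap_extensional :: "('o, 'm) category \<Rightarrow> ('o, 'm, 'p, 'n) fmap \<Rightarrow> bool" where
  "fmap_extensional C F \<longleftrightarrow> onObj F \<in> extensional (Obj C) \<and> onArr F \<in> extensional (Arr C)"

text \<open>The category with the given objects, hom-sets, identities and composition; an arrow is a
  homomorphism together with its source and target.\<close>

definition mk_category :: "'s set \<Rightarrow> ('s \<Rightarrow> 's \<Rightarrow> 'h set) \<Rightarrow> ('s \<Rightarrow> 'h) \<Rightarrow> ('s \<Rightarrow> 'h \<Rightarrow> 'h \<Rightarrow> 'h) \<Rightarrow>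
    ('s, 's \<times> 'h \<times> 's) category" where
  "mk_category Obs Homs ids comps =
     \<lparr>Obj = Obs,
      Arr = {(X, h, Y) |X h Y. X \<in> Obs \<and> Y \<in> Obs \<and> h \<in> Homs X Y},
      Dom = (\<lambda>(X, h, Y). X),
      Cod = (\<lambda>(X, h, Y). Y),
      Ident = (\<lambda>X. (X, ids X, X)),
      Comp = (\<lambda>(Y, k, Z) (X, h, Y'). (X, comps X k h, Z))\<rparr>"


section \<open>Strict categories, slices and stratifications\<close>

type_synonym 'a scat = "('a univ, 'a univ) category"
type_synonym 'a sfmap = "('a univ, 'a univ, 'a univ, 'a univ) fmap"

text \<open>\<open>A \<in> over F \<Gamma>\<close> is an arrow \<open>A: \<Gamma>.A \<rightarrow> \<Gamma>\<close>, so \<open>\<Gamma>.A\<close> is \<open>Dom F A\<close> and \<open>A.P\<close> is \<open>A \<cdot> P\<close>.\<close>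

definition over :: "('o, 'm) category \<Rightarrow> 'o \<Rightarrow> 'm set" where
  "over F \<Gamma> = {A \<in> Arr F. Cod F A = \<Gamma>}"

text \<open>The slice as a category: \<open>\<langle>A, P\<rangle>\<close> is the arrow \<open>P: A.P \<rightarrow> A\<close>.\<close>

definition slice_cat :: "'a scat \<Rightarrow> 'a univ \<Rightarrow> 'a scat" where
  "slice_cat F \<Gamma> =
     \<lparr>Obj = over F \<Gamma>,
      Arr = {\<langle>A, P\<rangle> |A P. A \<in> over F \<Gamma> \<and> P \<in> over F (Dom F A)},
      Dom = (\<lambda>a. ufst a \<cdot>\<^bsub>F\<^esub> usnd a),
      Cod = ufst,
      Ident = (\<lambda>A. \<langle>A, Ident F (Dom F A)\<rangle>),
      Comp = (\<lambda>a b. \<langle>ufst a, usnd a \<cdot>\<^bsub>F\<^esub> usnd b\<rangle>)\<rparr>"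

fun comp_list :: "('o, 'm) category \<Rightarrow> 'm list \<Rightarrow> 'm" where
  "comp_list C [] = undefined"
| "comp_list C [f] = f"
| "comp_list C (f # g # fs) = f \<cdot>\<^bsub>C\<^esub> comp_list C (g # fs)"

text \<open>In the last clause \<open>fs ! i\<close> is the arrow \<open>X\<^sub>i\<^sub>+\<^sub>1 \<rightarrow> X\<^sub>i\<close> of the factorization.\<close>

definition is_stratification :: "('o, 'm) category \<Rightarrow> 'o \<Rightarrow> ('o \<Rightarrow> nat) \<Rightarrow> bool" where
  "is_stratification C t L \<longleftrightarrow>
     (\<forall>f \<in> Arr C. L (Dom C f) \<ge> L (Cod C f)) \<and>
     (\<forall>X \<in> Obj C. L X = 0 \<longleftrightarrow> X = t) \<and>
     (\<forall>f \<in> Arr C. L (Dom C f) = L (Cod C f) \<longleftrightarrow> Dom C f = Cod C f \<and> f = Ident C (Dom C f)) \<and>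
     (\<forall>f \<in> Arr C. \<forall>n m. L (Dom C f) = n + m + 1 \<longrightarrow> L (Cod C f) = n \<longrightarrow>
        (\<exists>!fs. length fs = m + 1 \<and>
           (\<forall>i \<le> m. fs ! i \<in> Arr C \<and> L (Dom C (fs ! i)) = n + (i + 1) \<and> L (Cod C (fs ! i)) = n + i) \<and>
           (\<forall>i < m. Dom C (fs ! i) = Cod C (fs ! (i + 1))) \<and>
           comp_list C fs = f))"

definition is_stratified :: "('o, 'm) category \<Rightarrow> 'o \<Rightarrow> bool" where
  "is_stratified C t \<longleftrightarrow> (\<exists>L. is_stratification C t L)"

text \<open>Stratifications are unique on objects, so the choice is immaterial.\<close>

definition lev :: "('o, 'm) category \<Rightarrow> 'o \<Rightarrow> 'o \<Rightarrow> nat" where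
  "lev C t = (SOME L. is_stratification C t L)"

text \<open>The unique indecomposable arrow with domain \<open>X\<close>.\<close>

definition indec :: "('o, 'm) category \<Rightarrow> 'o \<Rightarrow> 'o \<Rightarrow> 'm" where
  "indec C t X = (THE f. f \<in> Arr C \<and> Dom C f = X \<and> lev C t X = lev C t (Cod C f) + 1)"

text \<open>The free category on the graph with vertices \<open>V\<close> and one edge \<open>X \<rightarrow> ft X\<close> for each vertex \<open>X\<close>
  with \<open>l X > 0\<close>, where \<open>l (ft X) = l X - 1\<close>. As every vertex has at most one outgoing edge, a path is
  determined by its source and its length: \<open>\<langle>X, Num k\<rangle>\<close> is the path of length \<open>k\<close> starting at \<open>X\<close>,
  which exists iff \<open>k \<le> l X\<close>.\<close>

definition path_cat :: "'a univ set \<Rightarrow> ('a univ \<Rightarrow> nat) \<Rightarrow> ('a univ \<Rightarrow> 'a univ) \<Rightarrow> 'a scat" where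
  "path_cat V l ft =
     \<lparr>Obj = V,
      Arr = {\<langle>X, Num k\<rangle> |X k. X \<in> V \<and> k \<le> l X},
      Dom = ufst,
      Cod = (\<lambda>a. (ft ^^ unum (usnd a)) (ufst a)),
      Ident = (\<lambda>X. \<langle>X, Num 0\<rangle>),
      Comp = (\<lambda>b a. \<langle>ufst a, Num (unum (usnd a) + unum (usnd b))\<rangle>)\<rparr>"


section \<open>C-systems\<close>

record 'a csys =
  c_cat :: "'a scat"
  c_len :: "'a univ \<Rightarrow> nat"
  c_one :: "'a univ"
  c_ft :: "'a univ \<Rightarrow> 'a univ"
  c_p :: "'a univ \<Rightarrow> 'a univ"
  c_pb :: "'a univ \<Rightarrow> 'a univ \<Rightarrow> 'a univ"
  c_q :: "'a univ \<Rightarrow> 'a univ \<Rightarrow> 'a univ"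

definition is_csys :: "'a csys \<Rightarrow> bool" where
  "is_csys S \<longleftrightarrow> (let C = c_cat S; l = c_len S; ft = c_ft S; p = c_p S; pb = c_pb S; q = c_q S in
     is_category C \<and>
     c_one S \<in> Obj C \<and>
     (\<forall>\<Gamma> \<in> Obj C. l \<Gamma> = 0 \<longleftrightarrow> \<Gamma> = c_one S) \<and>
     (\<forall>\<Gamma> \<in> Obj C. ft \<Gamma> \<in> Obj C) \<and>
     (\<forall>\<Gamma> \<in> Obj C. l \<Gamma> > 0 \<longrightarrow> l (ft \<Gamma>) = l \<Gamma> - 1) \<and>
     ft (c_one S) = c_one S \<and>
     is_terminal C (c_one S) \<and>
     (\<forall>\<Gamma> \<in> Obj C. l \<Gamma> > 0 \<longrightarrow> p \<Gamma> \<in> hom C \<Gamma> (ft \<Gamma>)) \<and>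
     (\<forall>\<Gamma> \<in> Obj C. l \<Gamma> > 0 \<longrightarrow> (\<forall>f \<in> over C (ft \<Gamma>).
        pb f \<Gamma> \<in> Obj C \<and> l (pb f \<Gamma>) > 0 \<and> ft (pb f \<Gamma>) = Dom C f \<and>
        q f \<Gamma> \<in> hom C (pb f \<Gamma>) \<Gamma> \<and>
        is_pullback C (p \<Gamma>) f (q f \<Gamma>) (p (pb f \<Gamma>)))) \<and>
     (\<forall>\<Gamma> \<in> Obj C. l \<Gamma> > 0 \<longrightarrow>
        pb (Ident C (ft \<Gamma>)) \<Gamma> = \<Gamma> \<and> q (Ident C (ft \<Gamma>)) \<Gamma> = Ident C \<Gamma>) \<and>
     (\<forall>\<Gamma> \<in> Obj C. l \<Gamma> > 0 \<longrightarrow> (\<forall>g \<in> over C (ft \<Gamma>). \<forall>f \<in> over C (Dom C g).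
        pb (g \<cdot>\<^bsub>C\<^esub> f) \<Gamma> = pb f (pb g \<Gamma>) \<and>
        q (g \<cdot>\<^bsub>C\<^esub> f) \<Gamma> = q g \<Gamma> \<cdot>\<^bsub>C\<^esub> q f (pb g \<Gamma>))))"

definition is_csys_hom :: "'a csys \<Rightarrow> 'a csys \<Rightarrow> 'a sfmap \<Rightarrow> bool" where
  "is_csys_hom S S' F \<longleftrightarrow>
     is_functor (c_cat S) (c_cat S') F \<and>
     onObj F (c_one S) = c_one S' \<and>
     (\<forall>\<Gamma> \<in> Obj (c_cat S). c_len S' (onObj F \<Gamma>) = c_len S \<Gamma>) \<and>
     (\<forall>\<Gamma> \<in> Obj (c_cat S). onObj F (c_ft S \<Gamma>) = c_ft S' (onObj F \<Gamma>)) \<and>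
     (\<forall>\<Gamma> \<in> Obj (c_cat S). c_len S \<Gamma> > 0 \<longrightarrow> onArr F (c_p S \<Gamma>) = c_p S' (onObj F \<Gamma>)) \<and>
     (\<forall>\<Gamma> \<in> Obj (c_cat S). c_len S \<Gamma> > 0 \<longrightarrow> (\<forall>f \<in> over (c_cat S) (c_ft S \<Gamma>).
        onObj F (c_pb S f \<Gamma>) = c_pb S' (onArr F f) (onObj F \<Gamma>) \<and>
        onArr F (c_q S f \<Gamma>) = c_q S' (onArr F f) (onObj F \<Gamma>)))"

definition Csys :: "('a csys, 'a csys \<times> 'a sfmap \<times> 'a csys) category" where
  "Csys = mk_category {S. is_csys S}
     (\<lambda>S S'. {F. is_csys_hom S S' F \<and> fmap_extensional (c_cat S) F})
     (\<lambda>S. fmap_restrict (c_cat S) fmap_id)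
     (\<lambda>S G F. fmap_restrict (c_cat S) (G \<circ>\<^sub>F F))"


section \<open>CE-systems\<close>

record 'a cesys =
  ce_fam :: "'a scat"
  ce_cat :: "'a scat"
  ce_I :: "'a univ \<Rightarrow> 'a univ"
  ce_one :: "'a univ"
  ce_pb :: "'a univ \<Rightarrow> 'a univ \<Rightarrow> 'a univ"
  ce_pi2 :: "'a univ \<Rightarrow> 'a univ \<Rightarrow> 'a univ"

definition is_cesys :: "'a cesys \<Rightarrow> bool" where
  "is_cesys S \<longleftrightarrow> (let F = ce_fam S; C = ce_cat S; I = ce_I S; pb = ce_pb S; pi2 = ce_pi2 S in
     is_category F \<and> is_category C \<and> Obj F = Obj C \<and>
     is_functor F C \<lparr>onObj = (\<lambda>X. X), onArr = I\<rparr> \<and>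
     is_terminal F (ce_one S) \<and>
     (\<forall>f \<in> Arr C. \<forall>A \<in> over F (Cod C f).
        pb f A \<in> over F (Dom C f) \<and>
        pi2 f A \<in> hom C (Dom F (pb f A)) (Dom F A) \<and>
        is_pullback C (I A) f (pi2 f A) (I (pb f A))) \<and>
     (\<forall>f \<in> Arr C. pb f (Ident F (Cod C f)) = Ident F (Dom C f) \<and> pi2 f (Ident F (Cod C f)) = f) \<and>
     (\<forall>\<Gamma> \<in> Obj F. \<forall>A \<in> over F \<Gamma>.
        pb (Ident C \<Gamma>) A = A \<and> pi2 (Ident C \<Gamma>) A = Ident C (Dom F A)) \<and>
     (\<forall>f \<in> Arr C. \<forall>g \<in> over C (Dom C f). \<forall>A \<in> over F (Cod C f).
        pb (f \<cdot>\<^bsub>C\<^esub> g) A = pb g (pb f A) \<and>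
        pi2 (f \<cdot>\<^bsub>C\<^esub> g) A = pi2 f A \<cdot>\<^bsub>C\<^esub> pi2 g (pb f A)) \<and>
     (\<forall>f \<in> Arr C. \<forall>A \<in> over F (Cod C f). \<forall>P \<in> over F (Dom F A).
        pb f (A \<cdot>\<^bsub>F\<^esub> P) = pb f A \<cdot>\<^bsub>F\<^esub> pb (pi2 f A) P \<and>
        pi2 f (A \<cdot>\<^bsub>F\<^esub> P) = pi2 (pi2 f A) P))"

abbreviation ce_lev :: "'a cesys \<Rightarrow> 'a univ \<Rightarrow> nat" where
  "ce_lev S \<equiv> lev (ce_fam S) (ce_one S)"

abbreviation ce_indec :: "'a cesys \<Rightarrow> 'a univ \<Rightarrow> 'a univ" where
  "ce_indec S \<equiv> indec (ce_fam S) (ce_one S)"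

definition is_rooted_cesys :: "'a cesys \<Rightarrow> bool" where
  "is_rooted_cesys S \<longleftrightarrow> is_terminal (ce_cat S) (ce_one S)"

text \<open>The slice over \<open>\<Gamma>\<close> is stratified by \<open>A \<mapsto> L (\<Gamma>.A) - L \<Gamma>\<close>.\<close>

definition is_stratified_cesys :: "'a cesys \<Rightarrow> bool" where
  "is_stratified_cesys S \<longleftrightarrow>
     is_stratified (ce_fam S) (ce_one S) \<and>
     (\<forall>f \<in> Arr (ce_cat S). \<forall>A \<in> over (ce_fam S) (Cod (ce_cat S) f).
        ce_lev S (Dom (ce_fam S) A) - ce_lev S (Cod (ce_cat S) f) =
        ce_lev S (Dom (ce_fam S) (ce_pb S f A)) - ce_lev S (Dom (ce_cat S) f))"

record 'a cehom =
  ceh_fam :: "'a sfmap"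
  ceh_cat :: "'a sfmap"

definition is_cehom :: "'a cesys \<Rightarrow> 'a cesys \<Rightarrow> 'a cehom \<Rightarrow> bool" where
  "is_cehom S S' H \<longleftrightarrow>
     is_functor (ce_fam S) (ce_fam S') (ceh_fam H) \<and>
     is_functor (ce_cat S) (ce_cat S') (ceh_cat H) \<and>
     (\<forall>X \<in> Obj (ce_fam S). onObj (ceh_fam H) X = onObj (ceh_cat H) X) \<and>
     (\<forall>A \<in> Arr (ce_fam S). onArr (ceh_cat H) (ce_I S A) = ce_I S' (onArr (ceh_fam H) A)) \<and>
     onObj (ceh_fam H) (ce_one S) = ce_one S' \<and>
     (\<forall>f \<in> Arr (ce_cat S). \<forall>A \<in> over (ce_fam S) (Cod (ce_cat S) f).
        onArr (ceh_fam H) (ce_pb S f A) = ce_pb S' (onArr (ceh_cat H) f) (onArr (ceh_fam H) A) \<and>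
        onArr (ceh_cat H) (ce_pi2 S f A) = ce_pi2 S' (onArr (ceh_cat H) f) (onArr (ceh_fam H) A))"

definition is_stratified_cehom :: "'a cesys \<Rightarrow> 'a cesys \<Rightarrow> 'a cehom \<Rightarrow> bool" where
  "is_stratified_cehom S S' H \<longleftrightarrow>
     (\<forall>X \<in> Obj (ce_fam S). ce_lev S X = ce_lev S' (onObj (ceh_fam H) X))"

definition cehom_extensional :: "'a cesys \<Rightarrow> 'a cehom \<Rightarrow> bool" where
  "cehom_extensional S H \<longleftrightarrow>
     fmap_extensional (ce_fam S) (ceh_fam H) \<and> fmap_extensional (ce_cat S) (ceh_cat H)"

definition cehom_restrict :: "'a cesys \<Rightarrow> 'a cehom \<Rightarrow> 'a cehom" where
  "cehom_restrict S H =
     \<lparr>ceh_fam = fmap_restrict (ce_fam S) (ceh_fam H), ceh_cat = fmap_restrict (ce_cat S) (ceh_cat H)\<rparr>"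

definition rCEsys\<^sub>s :: "('a cesys, 'a cesys \<times> 'a cehom \<times> 'a cesys) category" where
  "rCEsys\<^sub>s = mk_category {S. is_cesys S \<and> is_rooted_cesys S \<and> is_stratified_cesys S}
     (\<lambda>S S'. {H. is_cehom S S' H \<and> is_stratified_cehom S S' H \<and> cehom_extensional S H})
     (\<lambda>S. cehom_restrict S \<lparr>ceh_fam = fmap_id, ceh_cat = fmap_id\<rparr>)
     (\<lambda>S K H. cehom_restrict S
        \<lparr>ceh_fam = ceh_fam K \<circ>\<^sub>F ceh_fam H, ceh_cat = ceh_cat K \<circ>\<^sub>F ceh_cat H\<rparr>)"


section \<open>E-systems\<close>

text \<open>A functor with term structure \<open>G: F/\<Gamma> \<rightarrow> F'/\<Delta>\<close> between slices. For \<open>A \<in> over F \<Gamma>\<close> and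
  \<open>P \<in> over F (\<Gamma>.A)\<close>, \<open>s_obj G A \<in> over F' \<Delta>\<close> is its value at the object \<open>A\<close>, \<open>s_arr G A P\<close> is (the
  underlying arrow of) its value at the arrow \<open>P: A.P \<rightarrow> A\<close> of the slice, and \<open>s_tm G A P\<close> is its
  action on the terms of that arrow.\<close>

record 'a sfun =
  s_obj :: "'a univ \<Rightarrow> 'a univ"
  s_arr :: "'a univ \<Rightarrow> 'a univ \<Rightarrow> 'a univ"
  s_tm :: "'a univ \<Rightarrow> 'a univ \<Rightarrow> 'a univ \<Rightarrow> 'a univ"

definition sfun_id :: "'a sfun" where
  "sfun_id = \<lparr>s_obj = (\<lambda>A. A), s_arr = (\<lambda>A P. P), s_tm = (\<lambda>A P t. t)\<rparr>"

definition sfun_comp :: "'a sfun \<Rightarrow> 'a sfun \<Rightarrow> 'a sfun" (infixl "\<circ>\<^sub>S" 55) where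
  "G \<circ>\<^sub>S K =
     \<lparr>s_obj = (\<lambda>A. s_obj G (s_obj K A)),
      s_arr = (\<lambda>A P. s_arr G (s_obj K A) (s_arr K A P)),
      s_tm = (\<lambda>A P t. s_tm G (s_obj K A) (s_arr K A P) (s_tm K A P t))\<rparr>"

text \<open>\<open>G/A: F/\<Gamma>.A \<rightarrow> F'/\<Delta>.G(A)\<close>, under the identification of \<open>(F/\<Gamma>)/A\<close> with \<open>F/\<Gamma>.A\<close>.\<close>

definition sfun_slice :: "'a scat \<Rightarrow> 'a univ \<Rightarrow> 'a sfun \<Rightarrow> 'a sfun" where
  "sfun_slice F A G =
     \<lparr>s_obj = (\<lambda>P. s_arr G A P),
      s_arr = (\<lambda>P Q. s_arr G (A \<cdot>\<^bsub>F\<^esub> P) Q),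
      s_tm = (\<lambda>P Q t. s_tm G (A \<cdot>\<^bsub>F\<^esub> P) Q t)\<rparr>"

record 'a esys =
  e_cat :: "'a scat"
  e_T :: "'a univ \<Rightarrow> 'a univ set"
  e_root :: "'a univ"
  e_S :: "'a univ \<Rightarrow> 'a univ \<Rightarrow> 'a sfun"  \<comment> \<open>\<open>e_S E A x\<close> for \<open>x \<in> T(A)\<close>\<close>
  e_W :: "'a univ \<Rightarrow> 'a sfun"
  e_idtm :: "'a univ \<Rightarrow> 'a univ"

abbreviation e_over :: "'a esys \<Rightarrow> 'a univ \<Rightarrow> 'a univ set" where
  "e_over E \<equiv> over (e_cat E)"

text \<open>\<open>\<Gamma>.A\<close>\<close>

abbreviation e_ext :: "'a esys \<Rightarrow> 'a univ \<Rightarrow> 'a univ" where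
  "e_ext E \<equiv> Dom (e_cat E)"

definition is_sfun :: "'a esys \<Rightarrow> 'a univ \<Rightarrow> 'a esys \<Rightarrow> 'a univ \<Rightarrow> 'a sfun \<Rightarrow> bool" where
  "is_sfun E \<Gamma> E' \<Delta> G \<longleftrightarrow> (let F = e_cat E; F' = e_cat E' in
     (\<forall>A \<in> over F \<Gamma>. s_obj G A \<in> over F' \<Delta>) \<and>
     (\<forall>A \<in> over F \<Gamma>. \<forall>P \<in> over F (Dom F A).
        s_arr G A P \<in> over F' (Dom F' (s_obj G A)) \<and>
        s_obj G (A \<cdot>\<^bsub>F\<^esub> P) = s_obj G A \<cdot>\<^bsub>F'\<^esub> s_arr G A P) \<and>
     (\<forall>A \<in> over F \<Gamma>. s_arr G A (Ident F (Dom F A)) = Ident F' (Dom F' (s_obj G A))) \<and>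
     (\<forall>A \<in> over F \<Gamma>. \<forall>P \<in> over F (Dom F A). \<forall>Q \<in> over F (Dom F P).
        s_arr G A (P \<cdot>\<^bsub>F\<^esub> Q) = s_arr G A P \<cdot>\<^bsub>F'\<^esub> s_arr G (A \<cdot>\<^bsub>F\<^esub> P) Q) \<and>
     (\<forall>A \<in> over F \<Gamma>. \<forall>P \<in> over F (Dom F A). \<forall>t \<in> e_T E P. s_tm G A P t \<in> e_T E' (s_arr G A P)))"

definition sfun_eq :: "'a esys \<Rightarrow> 'a univ \<Rightarrow> 'a sfun \<Rightarrow> 'a sfun \<Rightarrow> bool" where
  "sfun_eq E \<Gamma> G K \<longleftrightarrow>
     (\<forall>A \<in> e_over E \<Gamma>. s_obj G A = s_obj K A) \<and>
     (\<forall>A \<in> e_over E \<Gamma>. \<forall>P \<in> e_over E (e_ext E A). s_arr G A P = s_arr K A P) \<and>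
     (\<forall>A \<in> e_over E \<Gamma>. \<forall>P \<in> e_over E (e_ext E A). \<forall>t \<in> e_T E P. s_tm G A P t = s_tm K A P t)"

text \<open>The action of \<open>G: F/\<Gamma> \<rightarrow> F'/\<Delta>\<close> on the terms of \<open>A \<in> over F \<Gamma>\<close>, regarded as the arrow from \<open>A\<close>
  to the terminal object of the slice.\<close>

definition sfun_tm :: "'a esys \<Rightarrow> 'a sfun \<Rightarrow> 'a univ \<Rightarrow> 'a univ \<Rightarrow> 'a univ" where
  "sfun_tm E G A t = s_tm G (Ident (e_cat E) (Cod (e_cat E) A)) A t"

definition is_pre_esys :: "'a esys \<Rightarrow> bool" where
  "is_pre_esys E \<longleftrightarrow> (let F = e_cat E; S = e_S E; W = e_W E in
     is_category F \<and> is_terminal F (e_root E) \<and>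
     (\<forall>\<Gamma> \<in> Obj F. \<forall>A \<in> over F \<Gamma>. \<forall>x \<in> e_T E A.
        is_sfun E (Dom F A) E \<Gamma> (S A x) \<and> s_obj (S A x) (Ident F (Dom F A)) = Ident F \<Gamma>) \<and>
     (\<forall>\<Gamma> \<in> Obj F. \<forall>A \<in> over F \<Gamma>.
        is_sfun E \<Gamma> E (Dom F A) (W A) \<and> s_obj (W A) (Ident F \<Gamma>) = Ident F (Dom F A)) \<and>
     (\<forall>\<Gamma> \<in> Obj F. sfun_eq E \<Gamma> (W (Ident F \<Gamma>)) sfun_id) \<and>
     (\<forall>\<Gamma> \<in> Obj F. \<forall>A \<in> over F \<Gamma>. \<forall>P \<in> over F (Dom F A).
        sfun_eq E \<Gamma> (W (A \<cdot>\<^bsub>F\<^esub> P)) (W P \<circ>\<^sub>S W A)) \<and>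
     (\<forall>A \<in> Arr F. e_idtm E A \<in> e_T E (s_obj (W A) A)))"

record 'a ehom =
  eh_fun :: "'a sfmap"
  eh_tm :: "'a univ \<Rightarrow> 'a univ \<Rightarrow> 'a univ"  \<comment> \<open>\<open>eh_tm H A\<close> maps \<open>T(A)\<close> to \<open>T(H(A))\<close>\<close>

text \<open>\<open>H/\<Gamma>\<close>; the formulas do not depend on \<open>\<Gamma>\<close>.\<close>

definition ehom_slice :: "'a ehom \<Rightarrow> 'a sfun" where
  "ehom_slice H =
     \<lparr>s_obj = onArr (eh_fun H), s_arr = (\<lambda>A P. onArr (eh_fun H) P), s_tm = (\<lambda>A P t. eh_tm H P t)\<rparr>"

text \<open>The compatibility of a homomorphism with \<open>S\<close>, \<open>W\<close> and \<open>idtm\<close> at an object \<open>\<Gamma>\<close>, in terms of the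
  functor \<open>R\<close> that it induces on the slice over \<open>\<Gamma>\<close>: \<open>R = H/\<Gamma>\<close> (so that \<open>H/\<Gamma>.A\<close> is \<open>R/A\<close>) for a
  homomorphism \<open>H\<close> of E-systems, and \<open>R = G/A\<close> for a homomorphism \<open>G\<close> between slices and an object
  \<open>A\<close> of the source of \<open>G\<close>, whose domain is \<open>\<Gamma>\<close>.\<close>

definition preserves_at :: "'a esys \<Rightarrow> 'a esys \<Rightarrow> 'a univ \<Rightarrow> 'a sfun \<Rightarrow> bool" where
  "preserves_at E E' \<Gamma> R \<longleftrightarrow> (\<forall>A \<in> e_over E \<Gamma>.
     (\<forall>x \<in> e_T E A. sfun_eq E (e_ext E A)
        (R \<circ>\<^sub>S e_S E A x)
        (e_S E' (s_obj R A) (sfun_tm E R A x) \<circ>\<^sub>S sfun_slice (e_cat E) A R)) \<and>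
     sfun_eq E \<Gamma>
        (sfun_slice (e_cat E) A R \<circ>\<^sub>S e_W E A)
        (e_W E' (s_obj R A) \<circ>\<^sub>S R) \<and>
     sfun_tm E (sfun_slice (e_cat E) A R) (s_obj (e_W E A) A) (e_idtm E A) = e_idtm E' (s_obj R A))"

definition is_pre_ehom :: "'a esys \<Rightarrow> 'a esys \<Rightarrow> 'a ehom \<Rightarrow> bool" where
  "is_pre_ehom E E' H \<longleftrightarrow>
     is_functor (e_cat E) (e_cat E') (eh_fun H) \<and>
     (\<forall>A \<in> Arr (e_cat E). \<forall>t \<in> e_T E A. eh_tm H A t \<in> e_T E' (onArr (eh_fun H) A)) \<and>
     onObj (eh_fun H) (e_root E) = e_root E' \<and>
     (\<forall>\<Gamma> \<in> Obj (e_cat E). preserves_at E E' \<Gamma> (ehom_slice H))"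

text \<open>\<open>G\<close> is a pre-E-homomorphism \<open>E/\<Gamma> \<rightarrow> E/\<Delta>\<close>.\<close>

definition is_slice_pre_ehom :: "'a esys \<Rightarrow> 'a univ \<Rightarrow> 'a univ \<Rightarrow> 'a sfun \<Rightarrow> bool" where
  "is_slice_pre_ehom E \<Gamma> \<Delta> G \<longleftrightarrow>
     is_sfun E \<Gamma> E \<Delta> G \<and>
     s_obj G (Ident (e_cat E) \<Gamma>) = Ident (e_cat E) \<Delta> \<and>
     (\<forall>A \<in> e_over E \<Gamma>. preserves_at E E (e_ext E A) (sfun_slice (e_cat E) A G))"

definition is_esys :: "'a esys \<Rightarrow> bool" where
  "is_esys E \<longleftrightarrow> is_pre_esys E \<and> (let F = e_cat E; S = e_S E; W = e_W E; idtm = e_idtm E in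
     \<forall>\<Gamma> \<in> Obj F. \<forall>A \<in> over F \<Gamma>.
       (\<forall>x \<in> e_T E A. is_slice_pre_ehom E (Dom F A) \<Gamma> (S A x)) \<and>
       is_slice_pre_ehom E \<Gamma> (Dom F A) (W A) \<and>
       (\<forall>x \<in> e_T E A. sfun_eq E \<Gamma> (S A x \<circ>\<^sub>S W A) sfun_id) \<and>
       (\<forall>x \<in> e_T E A. sfun_tm E (S A x) (s_obj (W A) A) (idtm A) = x) \<and>
       sfun_eq E (Dom F A) (S (s_obj (W A) A) (idtm A) \<circ>\<^sub>S sfun_slice F A (W A)) sfun_id)"

abbreviation e_lev :: "'a esys \<Rightarrow> 'a univ \<Rightarrow> nat" where
  "e_lev E \<equiv> lev (e_cat E) (e_root E)"

abbreviation e_indec :: "'a esys \<Rightarrow> 'a univ \<Rightarrow> 'a univ" where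
  "e_indec E \<equiv> indec (e_cat E) (e_root E)"

definition is_stratified_sfun :: "'a esys \<Rightarrow> 'a univ \<Rightarrow> 'a univ \<Rightarrow> 'a sfun \<Rightarrow> bool" where
  "is_stratified_sfun E \<Gamma> \<Delta> G \<longleftrightarrow>
     (\<forall>A \<in> e_over E \<Gamma>.
        e_lev E (e_ext E A) - e_lev E \<Gamma> = e_lev E (e_ext E (s_obj G A)) - e_lev E \<Delta>)"

definition is_stratified_esys :: "'a esys \<Rightarrow> bool" where
  "is_stratified_esys E \<longleftrightarrow>
     is_stratified (e_cat E) (e_root E) \<and>
     (\<forall>\<Gamma> \<in> Obj (e_cat E). \<forall>A \<in> e_over E \<Gamma>.
        is_stratified_sfun E \<Gamma> (e_ext E A) (e_W E A) \<and>
        (\<forall>x \<in> e_T E A. is_stratified_sfun E (e_ext E A) \<Gamma> (e_S E A x)))"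

definition is_stratified_ehom :: "'a esys \<Rightarrow> 'a esys \<Rightarrow> 'a ehom \<Rightarrow> bool" where
  "is_stratified_ehom E E' H \<longleftrightarrow>
     (\<forall>X \<in> Obj (e_cat E). e_lev E X = e_lev E' (onObj (eh_fun H) X))"

definition ehom_extensional :: "'a esys \<Rightarrow> 'a ehom \<Rightarrow> bool" where
  "ehom_extensional E H \<longleftrightarrow>
     fmap_extensional (e_cat E) (eh_fun H) \<and>
     (\<forall>A \<in> Arr (e_cat E). eh_tm H A \<in> extensional (e_T E A)) \<and>
     eh_tm H \<in> extensional (Arr (e_cat E))"

definition ehom_restrict :: "'a esys \<Rightarrow> 'a ehom \<Rightarrow> 'a ehom" where
  "ehom_restrict E H =
     \<lparr>eh_fun = fmap_restrict (e_cat E) (eh_fun H),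
      eh_tm = (\<lambda>A \<in> Arr (e_cat E). restrict (eh_tm H A) (e_T E A))\<rparr>"

definition Esys\<^sub>s :: "('a esys, 'a esys \<times> 'a ehom \<times> 'a esys) category" where
  "Esys\<^sub>s = mk_category {E. is_esys E \<and> is_stratified_esys E}
     (\<lambda>E E'. {H. is_pre_ehom E E' H \<and> is_stratified_ehom E E' H \<and> ehom_extensional E H})
     (\<lambda>E. ehom_restrict E \<lparr>eh_fun = fmap_id, eh_tm = (\<lambda>A t. t)\<rparr>)
     (\<lambda>E K H. ehom_restrict E
        \<lparr>eh_fun = eh_fun K \<circ>\<^sub>F eh_fun H,
         eh_tm = (\<lambda>A t. eh_tm K (onArr (eh_fun H) A) (eh_tm H A t))\<rparr>)"


section \<open>B-systems\<close>

text \<open>As the sets \<open>B\<^sub>n\<close> need not be disjoint, all operations take as an additional first argument the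
  index of the set that contains the next one. The family \<open>b_tm\<close> starts at index 1, so we put
  \<open>b_tm B 0 = {}\<close>.\<close>

record 'a bhom =
  bh_ty :: "nat \<Rightarrow> 'a univ \<Rightarrow> 'a univ"
  bh_tm :: "nat \<Rightarrow> 'a univ \<Rightarrow> 'a univ"

record 'a bsys =
  b_ty :: "nat \<Rightarrow> 'a univ set"
  b_tm :: "nat \<Rightarrow> 'a univ set"
  b_ft :: "nat \<Rightarrow> 'a univ \<Rightarrow> 'a univ"
  b_bd :: "nat \<Rightarrow> 'a univ \<Rightarrow> 'a univ"
  b_S :: "nat \<Rightarrow> 'a univ \<Rightarrow> 'a bhom"
  b_W :: "nat \<Rightarrow> 'a univ \<Rightarrow> 'a bhom"
  b_delta :: "nat \<Rightarrow> 'a univ \<Rightarrow> 'a univ"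

definition is_bframe :: "'a bsys \<Rightarrow> bool" where
  "is_bframe B \<longleftrightarrow>
     (\<exists>x. b_ty B 0 = {x}) \<and> b_tm B 0 = {} \<and>
     (\<forall>n. \<forall>X \<in> b_ty B (Suc n). b_ft B (Suc n) X \<in> b_ty B n) \<and>
     (\<forall>n. \<forall>x \<in> b_tm B (Suc n). b_bd B (Suc n) x \<in> b_ty B (Suc n))"

definition is_bframe_hom :: "'a bsys \<Rightarrow> 'a bsys \<Rightarrow> 'a bhom \<Rightarrow> bool" where
  "is_bframe_hom B A H \<longleftrightarrow>
     (\<forall>n. \<forall>X \<in> b_ty B n. bh_ty H n X \<in> b_ty A n) \<and>
     (\<forall>n. \<forall>x \<in> b_tm B (Suc n). bh_tm H (Suc n) x \<in> b_tm A (Suc n)) \<and>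
     (\<forall>n. \<forall>X \<in> b_ty B (Suc n). bh_ty H n (b_ft B (Suc n) X) = b_ft A (Suc n) (bh_ty H (Suc n) X)) \<and>
     (\<forall>n. \<forall>x \<in> b_tm B (Suc n).
        bh_ty H (Suc n) (b_bd B (Suc n) x) = b_bd A (Suc n) (bh_tm H (Suc n) x))"

text \<open>\<open>b_ftm B n m\<close> is \<open>ft\<^sup>m: B\<^sub>n\<^sub>+\<^sub>m \<rightarrow> B\<^sub>n\<close>.\<close>

fun b_ftm :: "'a bsys \<Rightarrow> nat \<Rightarrow> nat \<Rightarrow> 'a univ \<Rightarrow> 'a univ" where
  "b_ftm B n 0 X = X"
| "b_ftm B n (Suc m) X = b_ftm B n m (b_ft B (n + Suc m) X)"

text \<open>The slice over \<open>X \<in> b_ty B n\<close>.\<close>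

definition b_slice :: "'a bsys \<Rightarrow> nat \<Rightarrow> 'a univ \<Rightarrow> 'a bsys" where
  "b_slice B n X =
     \<lparr>b_ty = (\<lambda>m. {Y \<in> b_ty B (n + m). b_ftm B n m Y = X}),
      b_tm = (\<lambda>m. {y \<in> b_tm B (n + m). m > 0 \<and> b_ftm B n m (b_bd B (n + m) y) = X}),
      b_ft = (\<lambda>m. b_ft B (n + m)),
      b_bd = (\<lambda>m. b_bd B (n + m)),
      b_S = (\<lambda>m. b_S B (n + m)),
      b_W = (\<lambda>m. b_W B (n + m)),
      b_delta = (\<lambda>m. b_delta B (n + m))\<rparr>"

text \<open>\<open>H/X\<close> for \<open>X \<in> b_ty B n\<close>.\<close>

definition bhom_slice :: "nat \<Rightarrow> 'a bhom \<Rightarrow> 'a bhom" where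
  "bhom_slice n H = \<lparr>bh_ty = (\<lambda>m. bh_ty H (n + m)), bh_tm = (\<lambda>m. bh_tm H (n + m))\<rparr>"

definition bhom_id :: "'a bhom" where
  "bhom_id = \<lparr>bh_ty = (\<lambda>n X. X), bh_tm = (\<lambda>n x. x)\<rparr>"

definition bhom_comp :: "'a bhom \<Rightarrow> 'a bhom \<Rightarrow> 'a bhom" (infixl "\<circ>\<^sub>B" 55) where
  "K \<circ>\<^sub>B H =
     \<lparr>bh_ty = (\<lambda>n X. bh_ty K n (bh_ty H n X)), bh_tm = (\<lambda>n x. bh_tm K n (bh_tm H n x))\<rparr>"

definition bhom_eq :: "'a bsys \<Rightarrow> 'a bhom \<Rightarrow> 'a bhom \<Rightarrow> bool" where
  "bhom_eq B H K \<longleftrightarrow>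
     (\<forall>n. \<forall>X \<in> b_ty B n. bh_ty H n X = bh_ty K n X) \<and>
     (\<forall>n. \<forall>x \<in> b_tm B n. bh_tm H n x = bh_tm K n x)"

definition is_pre_bsys :: "'a bsys \<Rightarrow> bool" where
  "is_pre_bsys B \<longleftrightarrow>
     is_bframe B \<and>
     (\<forall>n. \<forall>x \<in> b_tm B (Suc n). let X = b_bd B (Suc n) x in
        is_bframe_hom (b_slice B (Suc n) X) (b_slice B n (b_ft B (Suc n) X)) (b_S B (Suc n) x)) \<and>
     (\<forall>n. \<forall>X \<in> b_ty B (Suc n).
        is_bframe_hom (b_slice B n (b_ft B (Suc n) X)) (b_slice B (Suc n) X) (b_W B (Suc n) X)) \<and>
     (\<forall>n. \<forall>X \<in> b_ty B (Suc n).
        b_delta B (Suc n) X \<in> b_tm B (Suc (Suc n)) \<and>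
        b_bd B (Suc (Suc n)) (b_delta B (Suc n) X) = bh_ty (b_W B (Suc n) X) 1 X)"

definition is_pre_bhom :: "'a bsys \<Rightarrow> 'a bsys \<Rightarrow> 'a bhom \<Rightarrow> bool" where
  "is_pre_bhom B A H \<longleftrightarrow>
     is_bframe_hom B A H \<and>
     (\<forall>n. \<forall>x \<in> b_tm B (Suc n). bhom_eq (b_slice B (Suc n) (b_bd B (Suc n) x))
        (bhom_slice n H \<circ>\<^sub>B b_S B (Suc n) x)
        (b_S A (Suc n) (bh_tm H (Suc n) x) \<circ>\<^sub>B bhom_slice (Suc n) H)) \<and>
     (\<forall>n. \<forall>X \<in> b_ty B (Suc n). bhom_eq (b_slice B n (b_ft B (Suc n) X))
        (bhom_slice (Suc n) H \<circ>\<^sub>B b_W B (Suc n) X)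
        (b_W A (Suc n) (bh_ty H (Suc n) X) \<circ>\<^sub>B bhom_slice n H)) \<and>
     (\<forall>n. \<forall>X \<in> b_ty B (Suc n).
        bh_tm H (Suc (Suc n)) (b_delta B (Suc n) X) = b_delta A (Suc n) (bh_ty H (Suc n) X))"

definition is_bsys :: "'a bsys \<Rightarrow> bool" where
  "is_bsys B \<longleftrightarrow>
     is_pre_bsys B \<and>
     (\<forall>n. \<forall>x \<in> b_tm B (Suc n). let X = b_bd B (Suc n) x; \<Gamma> = b_ft B (Suc n) X in
        is_pre_bhom (b_slice B (Suc n) X) (b_slice B n \<Gamma>) (b_S B (Suc n) x) \<and>
        bhom_eq (b_slice B n \<Gamma>) (b_S B (Suc n) x \<circ>\<^sub>B b_W B (Suc n) X) bhom_id \<and>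
        bh_tm (b_S B (Suc n) x) 1 (b_delta B (Suc n) X) = x) \<and>
     (\<forall>n. \<forall>X \<in> b_ty B (Suc n).
        is_pre_bhom (b_slice B n (b_ft B (Suc n) X)) (b_slice B (Suc n) X) (b_W B (Suc n) X) \<and>
        bhom_eq (b_slice B (Suc n) X)
          (b_S B (Suc (Suc n)) (b_delta B (Suc n) X) \<circ>\<^sub>B bhom_slice 1 (b_W B (Suc n) X)) bhom_id)"

definition bhom_extensional :: "'a bsys \<Rightarrow> 'a bhom \<Rightarrow> bool" where
  "bhom_extensional B H \<longleftrightarrow>
     (\<forall>n. bh_ty H n \<in> extensional (b_ty B n)) \<and> (\<forall>n. bh_tm H n \<in> extensional (b_tm B n))"

definition bhom_restrict :: "'a bsys \<Rightarrow> 'a bhom \<Rightarrow> 'a bhom" where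
  "bhom_restrict B H =
     \<lparr>bh_ty = (\<lambda>n. restrict (bh_ty H n) (b_ty B n)), bh_tm = (\<lambda>n. restrict (bh_tm H n) (b_tm B n))\<rparr>"

definition Bsys :: "('a bsys, 'a bsys \<times> 'a bhom \<times> 'a bsys) category" where
  "Bsys = mk_category {B. is_bsys B}
     (\<lambda>B A. {H. is_pre_bhom B A H \<and> bhom_extensional B H})
     (\<lambda>B. bhom_restrict B bhom_id)
     (\<lambda>B K H. bhom_restrict B (K \<circ>\<^sub>B H))"


section \<open>From C-systems to CE-systems\<close>

fun CE_I :: "'a csys \<Rightarrow> 'a univ \<Rightarrow> nat \<Rightarrow> 'a univ" where
  "CE_I S X 0 = Ident (c_cat S) X"
| "CE_I S X (Suc k) = CE_I S (c_ft S X) k \<cdot>\<^bsub>c_cat S\<^esub> c_p S X"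

definition CE_fam :: "'a csys \<Rightarrow> 'a scat" where
  "CE_fam S = path_cat (Obj (c_cat S)) (c_len S) (c_ft S)"

text \<open>\<open>\<pi>\<^sub>2(f, p)\<close> and \<open>f\<^sup>* p\<close> for the path \<open>p\<close> of length \<open>k\<close> starting at \<open>\<Xi>\<close>.\<close>

fun CE_pi2 :: "'a csys \<Rightarrow> 'a univ \<Rightarrow> 'a univ \<Rightarrow> nat \<Rightarrow> 'a univ" where
  "CE_pi2 S f \<Xi> 0 = f"
| "CE_pi2 S f \<Xi> (Suc k) = c_q S (CE_pi2 S f (c_ft S \<Xi>) k) \<Xi>"

fun CE_pb :: "'a csys \<Rightarrow> 'a univ \<Rightarrow> 'a univ \<Rightarrow> nat \<Rightarrow> 'a univ" where
  "CE_pb S f \<Xi> 0 = Ident (CE_fam S) (Dom (c_cat S) f)"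
| "CE_pb S f \<Xi> (Suc k) =
     CE_pb S f (c_ft S \<Xi>) k \<cdot>\<^bsub>CE_fam S\<^esub> \<langle>c_pb S (CE_pi2 S f (c_ft S \<Xi>) k) \<Xi>, Num 1\<rangle>"

definition CE_obj :: "'a csys \<Rightarrow> 'a cesys" where
  "CE_obj S =
     \<lparr>ce_fam = CE_fam S,
      ce_cat = c_cat S,
      ce_I = (\<lambda>p. CE_I S (ufst p) (unum (usnd p))),
      ce_one = c_one S,
      ce_pb = (\<lambda>f p. CE_pb S f (ufst p) (unum (usnd p))),
      ce_pi2 = (\<lambda>f p. CE_pi2 S f (ufst p) (unum (usnd p)))\<rparr>"

definition CE_hom :: "'a csys \<Rightarrow> 'a sfmap \<Rightarrow> 'a cehom" where
  "CE_hom S F = cehom_restrict (CE_obj S)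
     \<lparr>ceh_fam = \<lparr>onObj = onObj F, onArr = (\<lambda>p. \<langle>onObj F (ufst p), usnd p\<rangle>)\<rparr>,
      ceh_cat = F\<rparr>"

definition CE :: "('a csys, 'a csys \<times> 'a sfmap \<times> 'a csys,
    'a cesys, 'a cesys \<times> 'a cehom \<times> 'a cesys) fmap" where
  "CE = \<lparr>onObj = CE_obj, onArr = (\<lambda>(S, F, S'). (CE_obj S, CE_hom S F, CE_obj S'))\<rparr>"


section \<open>From stratified rooted CE-systems to C-systems\<close>

definition CE2C_obj :: "'a cesys \<Rightarrow> 'a csys" where
  "CE2C_obj S =
     \<lparr>c_cat = ce_cat S,
      c_len = ce_lev S,
      c_one = ce_one S,
      c_ft = (\<lambda>X. if X = ce_one S then ce_one S else Cod (ce_fam S) (ce_indec S X)),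
      c_p = (\<lambda>X. ce_I S (ce_indec S X)),
      c_pb = (\<lambda>f X. Dom (ce_fam S) (ce_pb S f (ce_indec S X))),
      c_q = (\<lambda>f X. ce_pi2 S f (ce_indec S X))\<rparr>"

definition CE2C :: "('a cesys, 'a cesys \<times> 'a cehom \<times> 'a cesys,
    'a csys, 'a csys \<times> 'a sfmap \<times> 'a csys) fmap" where
  "CE2C = \<lparr>onObj = CE2C_obj, onArr = (\<lambda>(S, H, S'). (CE2C_obj S, ceh_cat H, CE2C_obj S'))\<rparr>"


section \<open>From CE-systems to E-systems\<close>

definition CE2E_T :: "'a cesys \<Rightarrow> 'a univ \<Rightarrow> 'a univ set" where
  "CE2E_T S A = {x \<in> hom (ce_cat S) (Cod (ce_fam S) A) (Dom (ce_fam S) A).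
     ce_I S A \<cdot>\<^bsub>ce_cat S\<^esub> x = Ident (ce_cat S) (Cod (ce_fam S) A)}"

text \<open>\<open>f\<^sup>*\<close> as a functor with term structure.\<close>

definition CE2E_pb :: "'a cesys \<Rightarrow> 'a univ \<Rightarrow> 'a sfun" where
  "CE2E_pb S f =
     \<lparr>s_obj = (\<lambda>A. ce_pb S f A),
      s_arr = (\<lambda>A P. ce_pb S (ce_pi2 S f A) P),
      s_tm = (\<lambda>B Q y. THE z. z \<in> CE2E_T S (ce_pb S (ce_pi2 S f B) Q) \<and>
        ce_pi2 S f (B \<cdot>\<^bsub>ce_fam S\<^esub> Q) \<cdot>\<^bsub>ce_cat S\<^esub> z = y \<cdot>\<^bsub>ce_cat S\<^esub> ce_pi2 S f B)\<rparr>"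

definition CE2E_obj :: "'a cesys \<Rightarrow> 'a esys" where
  "CE2E_obj S =
     \<lparr>e_cat = ce_fam S,
      e_T = CE2E_T S,
      e_root = ce_one S,
      e_S = (\<lambda>A x. CE2E_pb S x),
      e_W = (\<lambda>A. CE2E_pb S (ce_I S A)),
      e_idtm = (\<lambda>A. THE z. z \<in> CE2E_T S (ce_pb S (ce_I S A) A) \<and>
        ce_pi2 S (ce_I S A) A \<cdot>\<^bsub>ce_cat S\<^esub> z = Ident (ce_cat S) (Dom (ce_fam S) A))\<rparr>"

definition CE2E_hom :: "'a cesys \<Rightarrow> 'a cehom \<Rightarrow> 'a ehom" where
  "CE2E_hom S H = ehom_restrict (CE2E_obj S)
     \<lparr>eh_fun = ceh_fam H, eh_tm = (\<lambda>A x. onArr (ceh_cat H) x)\<rparr>"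

definition CE2E :: "('a cesys, 'a cesys \<times> 'a cehom \<times> 'a cesys,
    'a esys, 'a esys \<times> 'a ehom \<times> 'a esys) fmap" where
  "CE2E = \<lparr>onObj = CE2E_obj, onArr = (\<lambda>(S, H, S'). (CE2E_obj S, CE2E_hom S H, CE2E_obj S'))\<rparr>"


section \<open>From E-systems to CE-systems\<close>

definition thom :: "'a esys \<Rightarrow> 'a univ \<Rightarrow> 'a univ \<Rightarrow> 'a univ set" where
  "thom E A B = e_T E (s_obj (e_W E A) B)"

text \<open>\<open>f\<^sup>*: E/\<Gamma>.B \<rightarrow> E/\<Gamma>.A\<close> for \<open>f \<in> thom E A B\<close>.\<close>

definition thom_pb :: "'a esys \<Rightarrow> 'a univ \<Rightarrow> 'a univ \<Rightarrow> 'a univ \<Rightarrow> 'a sfun" where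
  "thom_pb E A B f = e_S E (s_obj (e_W E A) B) f \<circ>\<^sub>S sfun_slice (e_cat E) B (e_W E A)"

text \<open>\<open>C\<^sub>E(\<Gamma>)\<close>; the arrow \<open>f \<in> thom E A B\<close> is represented as \<open>\<langle>A, \<langle>f, B\<rangle>\<rangle>\<close>.\<close>

definition thom_cat :: "'a esys \<Rightarrow> 'a univ \<Rightarrow> 'a scat" where
  "thom_cat E \<Gamma> =
     \<lparr>Obj = e_over E \<Gamma>,
      Arr = {\<langle>A, \<langle>f, B\<rangle>\<rangle> |A f B. A \<in> e_over E \<Gamma> \<and> B \<in> e_over E \<Gamma> \<and> f \<in> thom E A B},
      Dom = ufst,
      Cod = (\<lambda>a. usnd (usnd a)),
      Ident = (\<lambda>A. \<langle>A, \<langle>e_idtm E A, A\<rangle>\<rangle>),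
      Comp = (\<lambda>b a. let A = ufst a; f = ufst (usnd a); B = usnd (usnd a);
                       g = ufst (usnd b); C = usnd (usnd b)
         in \<langle>A, \<langle>sfun_tm E (thom_pb E A B f) (s_obj (e_W E B) C) g, C\<rangle>\<rangle>)\<rparr>"

text \<open>\<open>x.u\<close> for \<open>x \<in> T(A)\<close> and \<open>u \<in> T(S\<^sub>x(P))\<close>, where \<open>idtm\<close> of \<open>A.P\<close> is a term of the arrow
  \<open>W\<^sub>A\<^sub>.\<^sub>P(A.P)\<close>, whose codomain is the object \<open>P\<close> of the slice on which \<open>S\<^sub>x\<close> acts.\<close>

definition tm_pair :: "'a esys \<Rightarrow> 'a univ \<Rightarrow> 'a univ \<Rightarrow> 'a univ \<Rightarrow> 'a univ \<Rightarrow> 'a univ" where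
  "tm_pair E A P x u = (let AP = A \<cdot>\<^bsub>e_cat E\<^esub> P; S\<^sub>x = e_S E A x; V = s_obj (e_W E AP) AP in
     sfun_tm E (e_S E (s_obj S\<^sub>x P) u) (s_arr S\<^sub>x P V) (s_tm S\<^sub>x P V (e_idtm E AP)))"

text \<open>\<open>\<pi>\<^sub>2(f, R)\<close> for \<open>f \<in> thom E A B\<close> and \<open>R \<in> e_over E (e_ext E B)\<close>.\<close>

definition thom_pi2 :: "'a esys \<Rightarrow> 'a univ \<Rightarrow> 'a univ \<Rightarrow> 'a univ \<Rightarrow> 'a univ \<Rightarrow> 'a univ" where
  "thom_pi2 E A B f R = (let fR = s_obj (thom_pb E A B f) R; W' = e_W E (A \<cdot>\<^bsub>e_cat E\<^esub> fR) in
     tm_pair E (s_obj W' B) (s_arr W' B R)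
       (sfun_tm E (e_W E fR) (s_obj (e_W E A) B) f) (e_idtm E fR))"

definition E2CE_obj :: "'a esys \<Rightarrow> 'a cesys" where
  "E2CE_obj E =
     \<lparr>ce_fam = slice_cat (e_cat E) (e_root E),
      ce_cat = thom_cat E (e_root E),
      ce_I = (\<lambda>a. let A = ufst a; Q = usnd a in
        \<langle>A \<cdot>\<^bsub>e_cat E\<^esub> Q, \<langle>sfun_tm E (e_W E Q) (s_obj (e_W E A) A) (e_idtm E A), A\<rangle>\<rangle>),
      ce_one = Ident (e_cat E) (e_root E),
      ce_pb = (\<lambda>a r. let A = ufst a; f = ufst (usnd a); B = usnd (usnd a); R = usnd r in
        \<langle>A, s_obj (thom_pb E A B f) R\<rangle>),
      ce_pi2 = (\<lambda>a r. let A = ufst a; f = ufst (usnd a); B = usnd (usnd a); R = usnd r in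
        \<langle>A \<cdot>\<^bsub>e_cat E\<^esub> s_obj (thom_pb E A B f) R,
          \<langle>thom_pi2 E A B f R, B \<cdot>\<^bsub>e_cat E\<^esub> R\<rangle>\<rangle>)\<rparr>"

definition E2CE_hom :: "'a esys \<Rightarrow> 'a ehom \<Rightarrow> 'a cehom" where
  "E2CE_hom E H = (let h = onArr (eh_fun H) in cehom_restrict (E2CE_obj E)
     \<lparr>ceh_fam = \<lparr>onObj = h, onArr = (\<lambda>a. \<langle>h (ufst a), h (usnd a)\<rangle>)\<rparr>,
      ceh_cat = \<lparr>onObj = h,
        onArr = (\<lambda>a. let A = ufst a; f = ufst (usnd a); B = usnd (usnd a) in
          \<langle>h A, \<langle>eh_tm H (s_obj (e_W E A) B) f, h B\<rangle>\<rangle>)\<rparr>\<rparr>)"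

definition E2CE :: "('a esys, 'a esys \<times> 'a ehom \<times> 'a esys,
    'a cesys, 'a cesys \<times> 'a cehom \<times> 'a cesys) fmap" where
  "E2CE = \<lparr>onObj = E2CE_obj, onArr = (\<lambda>(E, H, E'). (E2CE_obj E, E2CE_hom E H, E2CE_obj E'))\<rparr>"


section \<open>From B-systems to E-systems\<close>

text \<open>The object \<open>(n, X)\<close> is \<open>\<langle>Num n, X\<rangle>\<close>, so the arrow \<open>(X, k)\<close> with \<open>X \<in> B\<^sub>n\<close> is
  \<open>\<langle>\<langle>Num n, X\<rangle>, Num k\<rangle>\<close>.\<close>

definition B2E_cat :: "'a bsys \<Rightarrow> 'a scat" where
  "B2E_cat B = path_cat {\<langle>Num n, X\<rangle> |n X. X \<in> b_ty B n} (\<lambda>v. unum (ufst v))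
     (\<lambda>v. let n = unum (ufst v); X = usnd v in \<langle>Num (n - 1), b_ft B n X\<rangle>)"

text \<open>\<open>B2E_sub B n k t\<close> is \<open>S\<^sup>k\<^sub>t\<close> for \<open>t \<in> T(X, k)\<close>, \<open>X \<in> B\<^sub>n\<close>. All components of such a \<open>t\<close> lie in the
  set of terms of index \<open>n - k + 1\<close>.\<close>

fun B2E_sub :: "'a bsys \<Rightarrow> nat \<Rightarrow> nat \<Rightarrow> 'a univ \<Rightarrow> 'a bhom" where
  "B2E_sub B n 0 t = bhom_id"
| "B2E_sub B n (Suc 0) t = b_S B n t"
| "B2E_sub B n (Suc (Suc k)) t =
     b_S B (n - Suc k) (usnd t) \<circ>\<^sub>B bhom_slice 1 (B2E_sub B (n - 1) (Suc k) (ufst t))"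

fun B2E_T :: "'a bsys \<Rightarrow> nat \<Rightarrow> 'a univ \<Rightarrow> nat \<Rightarrow> 'a univ set" where
  "B2E_T B n X 0 = {Num 0}"
| "B2E_T B n X (Suc 0) = {x \<in> b_tm B n. b_bd B n x = X}"
| "B2E_T B n X (Suc (Suc k)) =
     {\<langle>t, x\<rangle> |t x. t \<in> B2E_T B (n - 1) (b_ft B n X) (Suc k) \<and>
        x \<in> b_tm B (n - Suc k) \<and>
        b_bd B (n - Suc k) x = bh_ty (B2E_sub B (n - 1) (Suc k) t) 1 X}"

fun B2E_wk :: "'a bsys \<Rightarrow> nat \<Rightarrow> 'a univ \<Rightarrow> nat \<Rightarrow> 'a bhom" where
  "B2E_wk B n X 0 = bhom_id"
| "B2E_wk B n X (Suc k) = b_W B n X \<circ>\<^sub>B B2E_wk B (n - 1) (b_ft B n X) k"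

text \<open>Componentwise application to \<open>t \<in> T(X, k)\<close>.\<close>

fun map_tms :: "('a univ \<Rightarrow> 'a univ) \<Rightarrow> nat \<Rightarrow> 'a univ \<Rightarrow> 'a univ" where
  "map_tms h 0 t = t"
| "map_tms h (Suc 0) t = h t"
| "map_tms h (Suc (Suc k)) t = \<langle>map_tms h (Suc k) (ufst t), h (usnd t)\<rangle>"

fun B2E_idtm :: "'a bsys \<Rightarrow> nat \<Rightarrow> 'a univ \<Rightarrow> nat \<Rightarrow> 'a univ" where
  "B2E_idtm B n X 0 = Num 0"
| "B2E_idtm B n X (Suc 0) = b_delta B n X"
| "B2E_idtm B n X (Suc (Suc k)) =
     \<langle>map_tms (bh_tm (b_W B n X) 1) (Suc k) (B2E_idtm B (n - 1) (b_ft B n X) (Suc k)),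
       b_delta B n X\<rangle>"

text \<open>The functor with term structure induced by \<open>H: B/X \<rightarrow> B/Y\<close> with \<open>X \<in> B\<^sub>n\<close> and \<open>Y \<in> B\<^sub>m\<close>. An object
  of the slice over \<open>(n, X)\<close> is a path \<open>\<langle>\<langle>Num (n + i), Z\<rangle>, Num i\<rangle>\<close> with \<open>Z \<in> (B/X)\<^sub>i\<close>.\<close>

definition B2E_sfun :: "nat \<Rightarrow> nat \<Rightarrow> 'a bhom \<Rightarrow> 'a sfun" where
  "B2E_sfun n m H = (let
       ob = (\<lambda>v. let i = unum (ufst v) - n in \<langle>Num (m + i), bh_ty H i (usnd v)\<rangle>);
       pth = (\<lambda>a. \<langle>ob (ufst a), usnd a\<rangle>)
     in \<lparr>s_obj = pth,
         s_arr = (\<lambda>A P. pth P),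
         s_tm = (\<lambda>A P t. let i = unum (ufst (ufst P)) - n; k = unum (usnd P) in
           map_tms (bh_tm H (i - k + 1)) k t)\<rparr>)"

definition B2E_obj :: "'a bsys \<Rightarrow> 'a esys" where
  "B2E_obj B =
     \<lparr>e_cat = B2E_cat B,
      e_T = (\<lambda>a. B2E_T B (unum (ufst (ufst a))) (usnd (ufst a)) (unum (usnd a))),
      e_root = \<langle>Num 0, the_elem (b_ty B 0)\<rangle>,
      e_S = (\<lambda>a t. let n = unum (ufst (ufst a)); k = unum (usnd a) in
        B2E_sfun n (n - k) (B2E_sub B n k t)),
      e_W = (\<lambda>a. let n = unum (ufst (ufst a)); X = usnd (ufst a); k = unum (usnd a) in
        B2E_sfun (n - k) n (B2E_wk B n X k)),
      e_idtm = (\<lambda>a. B2E_idtm B (unum (ufst (ufst a))) (usnd (ufst a)) (unum (usnd a)))\<rparr>"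

definition B2E_hom :: "'a bsys \<Rightarrow> 'a bhom \<Rightarrow> 'a ehom" where
  "B2E_hom B H = (let ob = (\<lambda>v. \<langle>ufst v, bh_ty H (unum (ufst v)) (usnd v)\<rangle>) in
     ehom_restrict (B2E_obj B)
       \<lparr>eh_fun = \<lparr>onObj = ob, onArr = (\<lambda>a. \<langle>ob (ufst a), usnd a\<rangle>)\<rparr>,
        eh_tm = (\<lambda>a t. let n = unum (ufst (ufst a)); k = unum (usnd a) in
          map_tms (bh_tm H (n - k + 1)) k t)\<rparr>)"

definition B2E :: "('a bsys, 'a bsys \<times> 'a bhom \<times> 'a bsys,
    'a esys, 'a esys \<times> 'a ehom \<times> 'a esys) fmap" where
  "B2E = \<lparr>onObj = B2E_obj, onArr = (\<lambda>(B, H, A). (B2E_obj B, B2E_hom B H, B2E_obj A))\<rparr>"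


section \<open>From stratified E-systems to B-systems\<close>

text \<open>The homomorphism of B-frames induced by \<open>G: F/X \<rightarrow> F/Z\<close>. The identification of the B-frame of
  the slice \<open>F/X\<close> with the slice over \<open>X\<close> of the B-frame of \<open>F\<close> sends an arrow \<open>Y \<rightarrow> X\<close> to \<open>Y\<close>; in a
  stratified category there is at most one such arrow.\<close>

definition E2B_bhom :: "'a esys \<Rightarrow> 'a univ \<Rightarrow> 'a sfun \<Rightarrow> 'a bhom" where
  "E2B_bhom E X G = (let
       arr = (\<lambda>Y. THE a. a \<in> hom (e_cat E) Y X);
       ty = (\<lambda>Y. e_ext E (s_obj G (arr Y)))
     in \<lparr>bh_ty = (\<lambda>m. ty),
         bh_tm = (\<lambda>m y. let Y = ufst y; P = e_indec E Y in
           \<langle>ty Y, s_tm G (arr (Cod (e_cat E) P)) P (usnd y)\<rangle>)\<rparr>)"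

definition E2B_obj :: "'a esys \<Rightarrow> 'a bsys" where
  "E2B_obj E =
     \<lparr>b_ty = (\<lambda>n. {X \<in> Obj (e_cat E). e_lev E X = n}),
      b_tm = (\<lambda>n. {\<langle>X, x\<rangle> |X x. X \<in> Obj (e_cat E) \<and> e_lev E X = n \<and> n > 0 \<and> x \<in> e_T E (e_indec E X)}),
      b_ft = (\<lambda>n X. Cod (e_cat E) (e_indec E X)),
      b_bd = (\<lambda>n y. ufst y),
      b_S = (\<lambda>n y. E2B_bhom E (ufst y) (e_S E (e_indec E (ufst y)) (usnd y))),
      b_W = (\<lambda>n X. E2B_bhom E (Cod (e_cat E) (e_indec E X)) (e_W E (e_indec E X))),
      b_delta = (\<lambda>n X. \<langle>e_ext E (s_obj (e_W E (e_indec E X)) (e_indec E X)),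
        e_idtm E (e_indec E X)\<rangle>)\<rparr>"

definition E2B_hom :: "'a esys \<Rightarrow> 'a ehom \<Rightarrow> 'a bhom" where
  "E2B_hom E H = bhom_restrict (E2B_obj E)
     \<lparr>bh_ty = (\<lambda>n. onObj (eh_fun H)),
      bh_tm = (\<lambda>n y. \<langle>onObj (eh_fun H) (ufst y), eh_tm H (e_indec E (ufst y)) (usnd y)\<rangle>)\<rparr>"

definition E2B :: "('a esys, 'a esys \<times> 'a ehom \<times> 'a esys,
    'a bsys, 'a bsys \<times> 'a bhom \<times> 'a bsys) fmap" where
  "E2B = \<lparr>onObj = E2B_obj, onArr = (\<lambda>(E, H, E'). (E2B_obj E, E2B_hom E H, E2B_obj E'))\<rparr>"


section \<open>The composites\<close>

definition C2B :: "('a csys, 'a csys \<times> 'a sfmap \<times> 'a csys,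
    'a bsys, 'a bsys \<times> 'a bhom \<times> 'a bsys) fmap" where
  "C2B = E2B \<circ>\<^sub>F (CE2E \<circ>\<^sub>F CE)"

definition B2C :: "('a bsys, 'a bsys \<times> 'a bhom \<times> 'a bsys,
    'a csys, 'a csys \<times> 'a sfmap \<times> 'a csys) fmap" where
  "B2C = CE2C \<circ>\<^sub>F (E2CE \<circ>\<^sub>F B2E)"

end

theory Submission
 imports Defs
begin

text \<open>
 The functor \<open>C2B\<close> is fully faithful. A morphism \<open>f: \<Gamma> \<rightarrow> \<Delta>\<close> of a C-system acts by pullback on the
 types and terms over \<open>\<Delta>\<close>, and, by induction on the length of \<open>\<Delta>\<close>, it is recovered from this
 action: \<open>f\<close> is determined by \<open>p\<^sub>\<Delta> f\<close> and by the section of \<open>(p\<^sub>\<Delta> f)\<^sup>*\<Delta>\<close> that it induces, which is the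
 image under \<open>f\<^sup>*\<close> of the generic term of \<open>\<Delta>\<close>. Hence, for a homomorphism \<open>K\<close> from \<open>C2B S\<close> to
 \<open>C2B S'\<close>, every \<open>f\<close> has exactly one counterpart whose action corresponds to that of \<open>f\<close> under \<open>K\<close>,
 and by uniqueness these counterparts form the only morphism of C-systems over \<open>K\<close>. On the other
 side, the comparisons of a B-system with the one of its E-system, of an E-system with the one of its
 CE-system and of a CE-system with the one of its C-system are bijective on types and terms, so
 \<open>C2B \<circ> B2C\<close> is naturally isomorphic to the identity.
\<close>

text \<open>Bijectivity on types and terms is exploited inside the category of B-systems, where a
  bijective homomorphism is invertible; inverse homomorphisms of E-systems and CE-systems are never
  written down. By full faithfulness the unit on C-systems lifts the inverse of the counit, so
  \<open>B2C\<close> after \<open>C2B\<close> is never computed either. One obstacle is that the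
  arrows of the category built from an E-system are bare terms, composed by iterated substitution.
  They correspond to homomorphisms between slices that are compatible with weakening from the base;
  composition becomes composition of functors and connecting arrows become slices of functors, so
  that category and pullback laws turn into equations between functors. Such equations hold only on
  carriers, hence the chains of \<open>sfun_eq\<close> and \<open>bhom_eq\<close>. Another obstacle
  is that levels and indecomposable arrows are defined by choice. They are computed by presenting a
  stratified category as a rooted tree with one edge out of each object other than the root.\<close>

notation sfun_comp (infixl "\<star>" 55) and bhom_comp (infixl "\<ast>" 55)

abbreviation tgt :: "'a univ \<Rightarrow> 'a univ" where
 "tgt a \<equiv> usnd (usnd a)"

section \<open>Categories\<close>

locale cat =
 fixes C :: "('o, 'm) category" (structure)
 assumes is_cat: "is_category C"
begin

lemma dom_obj [simp]: "f \<in> Arr C \<Longrightarrow> Dom C f \<in> Obj C"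
 and cod_obj [simp]: "f \<in> Arr C \<Longrightarrow> Cod C f \<in> Obj C"
 and id_arr [simp]: "X \<in> Obj C \<Longrightarrow> Ident C X \<in> Arr C"
 and dom_id [simp]: "X \<in> Obj C \<Longrightarrow> Dom C (Ident C X) = X"
 and cod_id [simp]: "X \<in> Obj C \<Longrightarrow> Cod C (Ident C X) = X"
 using is_cat unfolding is_category_def hom_def by blast+

lemma comp_arr [simp]: "f \<in> Arr C \<Longrightarrow> g \<in> Arr C \<Longrightarrow> Dom C g = Cod C f \<Longrightarrow> g \<cdot> f \<in> Arr C"
 and dom_comp [simp]: "f \<in> Arr C \<Longrightarrow> g \<in> Arr C \<Longrightarrow> Dom C g = Cod C f \<Longrightarrow> Dom C (g \<cdot> f) = Dom C f"
 and cod_comp [simp]: "f \<in> Arr C \<Longrightarrow> g \<in> Arr C \<Longrightarrow> Dom C g = Cod C f \<Longrightarrow> Cod C (g \<cdot> f) = Cod C g"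
 using is_cat unfolding is_category_def hom_def by blast+

lemma comp_id_dom: "f \<in> Arr C \<Longrightarrow> f \<cdot> Ident C (Dom C f) = f"
 and comp_id_cod: "f \<in> Arr C \<Longrightarrow> Ident C (Cod C f) \<cdot> f = f"
 using is_cat unfolding is_category_def by blast+

lemma comp_id [simp]: "f \<in> Arr C \<Longrightarrow> Dom C f = X \<Longrightarrow> f \<cdot> Ident C X = f"
 and id_comp [simp]: "f \<in> Arr C \<Longrightarrow> Cod C f = X \<Longrightarrow> Ident C X \<cdot> f = f"
 using comp_id_dom comp_id_cod by auto

lemma assoc: "f \<in> Arr C \<Longrightarrow> g \<in> Arr C \<Longrightarrow> h \<in> Arr C \<Longrightarrow> Dom C g = Cod C f \<Longrightarrow> Dom C h = Cod C g \<Longrightarrow>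
  (h \<cdot> g) \<cdot> f = h \<cdot> (g \<cdot> f)"
 using is_cat unfolding is_category_def by blast

lemma iso_comp:
 assumes "is_iso C f" "is_iso C g" "Dom C g = Cod C f"
 shows "is_iso C (g \<cdot> f)"
proof -
 obtain f' where f: "f \<in> Arr C" "f' \<in> Arr C" "Dom C f' = Cod C f" "Cod C f' = Dom C f"
  "f' \<cdot> f = Ident C (Dom C f)" "f \<cdot> f' = Ident C (Cod C f)"
  using assms unfolding is_iso_def hom_def by blast
 obtain g' where g: "g \<in> Arr C" "g' \<in> Arr C" "Dom C g' = Cod C g" "Cod C g' = Dom C g"
  "g' \<cdot> g = Ident C (Dom C g)" "g \<cdot> g' = Ident C (Cod C g)"
  using assms unfolding is_iso_def hom_def by blast
 have "(f' \<cdot> g') \<cdot> (g \<cdot> f) = f' \<cdot> ((g' \<cdot> g) \<cdot> f)"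
  using f(1-4) g(1-4) assms(3) by (simp add: assoc)
 moreover have "(g \<cdot> f) \<cdot> (f' \<cdot> g') = g \<cdot> ((f \<cdot> f') \<cdot> g')"
  using f(1-4) g(1-4) assms(3) by (simp add: assoc)
 ultimately show ?thesis
  using f g assms(3) unfolding is_iso_def hom_def
  by (intro conjI bexI[of _ "f' \<cdot> g'"]) auto
qed

end

lemma functor_arr:
 assumes "is_functor C D F" "f \<in> Arr C"
 shows "onArr F f \<in> Arr D" "Dom D (onArr F f) = onObj F (Dom C f)"
  "Cod D (onArr F f) = onObj F (Cod C f)"
 using assms unfolding is_functor_def hom_def by auto

lemma functor_obj: "is_functor C D F \<Longrightarrow> X \<in> Obj C \<Longrightarrow> onObj F X \<in> Obj D"
 unfolding is_functor_def by auto

lemma functor_id: "is_functor C D F \<Longrightarrow> X \<in> Obj C \<Longrightarrow> onArr F (Ident C X) = Ident D (onObj F X)"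
 unfolding is_functor_def by auto

lemma functor_comp: "is_functor C D F \<Longrightarrow> f \<in> Arr C \<Longrightarrow> g \<in> Arr C \<Longrightarrow> Dom C g = Cod C f \<Longrightarrow>
  onArr F (g \<cdot>\<^bsub>C\<^esub> f) = onArr F g \<cdot>\<^bsub>D\<^esub> onArr F f"
 unfolding is_functor_def by auto

lemma is_functor_comp:
 assumes F: "is_functor C D F" and G: "is_functor D E G"
 shows "is_functor C E (G \<circ>\<^sub>F F)"
 using functor_arr[OF F] functor_obj[OF F] functor_id[OF F] functor_comp[OF F]
  functor_arr[OF G] functor_obj[OF G] functor_id[OF G] functor_comp[OF G]
 unfolding is_functor_def[of C E] by (simp add: fmap_comp_def hom_def)

section \<open>Natural isomorphisms, inverses and equivalences\<close>

lemma nat_iso_trans: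
 assumes D: "is_category D" and C: "\<And>f. f \<in> Arr C \<Longrightarrow> Dom C f \<in> Obj C \<and> Cod C f \<in> Obj C"
  and F: "is_functor C D F" and H: "is_functor C D H"
  and G: "is_functor C D G" and a: "is_nat_iso C D F G \<alpha>" and b: "is_nat_iso C D G H \<beta>"
 shows "is_nat_iso C D F H (\<lambda>X. \<beta> X \<cdot>\<^bsub>D\<^esub> \<alpha> X)"
proof -
 interpret cat D by (rule cat.intro[OF D])
 have al: "\<alpha> X \<in> Arr D" "Dom D (\<alpha> X) = onObj F X" "Cod D (\<alpha> X) = onObj G X" "is_iso D (\<alpha> X)"
  and be: "\<beta> X \<in> Arr D" "Dom D (\<beta> X) = onObj G X" "Cod D (\<beta> X) = onObj H X" "is_iso D (\<beta> X)"
  if "X \<in> Obj C" for X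
  using a b that unfolding is_nat_iso_def hom_def by auto
 have "(\<beta> (Cod C f) \<cdot>\<^bsub>D\<^esub> \<alpha> (Cod C f)) \<cdot>\<^bsub>D\<^esub> onArr F f = onArr H f \<cdot>\<^bsub>D\<^esub> (\<beta> (Dom C f) \<cdot>\<^bsub>D\<^esub> \<alpha> (Dom C f))"
  if f: "f \<in> Arr C" for f
 proof -
  note o = C[OF f, THEN conjunct1] C[OF f, THEN conjunct2]
  note * = al[OF o(1)] al[OF o(2)] be[OF o(1)] be[OF o(2)] functor_arr[OF F f] functor_arr[OF G f]
   functor_arr[OF H f]
  have "(\<beta> (Cod C f) \<cdot>\<^bsub>D\<^esub> \<alpha> (Cod C f)) \<cdot>\<^bsub>D\<^esub> onArr F f = \<beta> (Cod C f) \<cdot>\<^bsub>D\<^esub> (onArr G f \<cdot>\<^bsub>D\<^esub> \<alpha> (Dom C f))"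
   using a f * unfolding is_nat_iso_def by (simp add: assoc)
  also have "... = (\<beta> (Cod C f) \<cdot>\<^bsub>D\<^esub> onArr G f) \<cdot>\<^bsub>D\<^esub> \<alpha> (Dom C f)"
   using * by (simp add: assoc)
  also have "... = onArr H f \<cdot>\<^bsub>D\<^esub> (\<beta> (Dom C f) \<cdot>\<^bsub>D\<^esub> \<alpha> (Dom C f))"
   using b f * unfolding is_nat_iso_def by (simp add: assoc)
  finally show ?thesis .
 qed
 then show ?thesis
  using al be unfolding is_nat_iso_def by (auto simp: hom_def intro: iso_comp)
qed

definition iso_inv :: "('o, 'm) category \<Rightarrow> 'm \<Rightarrow> 'm" where
 "iso_inv C f = (SOME g. g \<in> hom C (Cod C f) (Dom C f) \<and>
   g \<cdot>\<^bsub>C\<^esub> f = Ident C (Dom C f) \<and> f \<cdot>\<^bsub>C\<^esub> g = Ident C (Cod C f))"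

lemma iso_inv:
 assumes "is_iso C f"
 shows "iso_inv C f \<in> Arr C" "Dom C (iso_inv C f) = Cod C f" "Cod C (iso_inv C f) = Dom C f"
  "iso_inv C f \<cdot>\<^bsub>C\<^esub> f = Ident C (Dom C f)" "f \<cdot>\<^bsub>C\<^esub> iso_inv C f = Ident C (Cod C f)"
proof -
 have "\<exists>g. g \<in> hom C (Cod C f) (Dom C f) \<and>
   g \<cdot>\<^bsub>C\<^esub> f = Ident C (Dom C f) \<and> f \<cdot>\<^bsub>C\<^esub> g = Ident C (Cod C f)"
  using assms unfolding is_iso_def by blast
 from someI_ex[OF this] show "iso_inv C f \<in> Arr C" "Dom C (iso_inv C f) = Cod C f" "Cod C (iso_inv C f) = Dom C f"
  "iso_inv C f \<cdot>\<^bsub>C\<^esub> f = Ident C (Dom C f)" "f \<cdot>\<^bsub>C\<^esub> iso_inv C f = Ident C (Cod C f)"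
  unfolding iso_inv_def hom_def by blast+
qed

lemma iso_inv_iso: "is_iso C f \<Longrightarrow> is_iso C (iso_inv C f)"
 using iso_inv[of C f] unfolding is_iso_def hom_def by auto

lemma iso_arr: "is_iso C f \<Longrightarrow> f \<in> Arr C"
 unfolding is_iso_def by blast

lemma (in cat) iso_inv_square:
 assumes a: "is_iso C a" and b: "is_iso C b" and f: "f \<in> Arr C" and g: "g \<in> Arr C"
  and "Dom C f = Dom C a" "Cod C f = Dom C b" "Dom C g = Cod C a" "Cod C g = Cod C b"
  and sq: "b \<cdot> f = g \<cdot> a"
 shows "iso_inv C b \<cdot> g = f \<cdot> iso_inv C a"
proof -
 note * = iso_inv(1-3)[OF a] iso_inv(1-3)[OF b] iso_arr[OF a] iso_arr[OF b] assms(3-8)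
 have "iso_inv C b \<cdot> g = iso_inv C b \<cdot> (g \<cdot> (a \<cdot> iso_inv C a))"
  using * by (simp add: iso_inv(5)[OF a])
 also have "... = iso_inv C b \<cdot> ((g \<cdot> a) \<cdot> iso_inv C a)"
  using * by (simp add: assoc)
 also have "... = (iso_inv C b \<cdot> b) \<cdot> (f \<cdot> iso_inv C a)"
  unfolding sq[symmetric] using * by (simp add: assoc)
 also have "... = f \<cdot> iso_inv C a"
  using * by (simp add: iso_inv(4)[OF b])
 finally show ?thesis .
qed

lemma nat_iso_sym:
 assumes D: "is_category D" and C: "\<And>f. f \<in> Arr C \<Longrightarrow> Dom C f \<in> Obj C \<and> Cod C f \<in> Obj C"
  and F: "is_functor C D F" and G: "is_functor C D G" and a: "is_nat_iso C D F G \<alpha>"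
 shows "is_nat_iso C D G F (\<lambda>X. iso_inv D (\<alpha> X))"
proof -
 interpret cat D by (rule cat.intro[OF D])
 have al: "Dom D (\<alpha> X) = onObj F X" "Cod D (\<alpha> X) = onObj G X" "is_iso D (\<alpha> X)"
  if "X \<in> Obj C" for X
  using a that unfolding is_nat_iso_def hom_def by auto
 have "iso_inv D (\<alpha> (Cod C f)) \<cdot>\<^bsub>D\<^esub> onArr G f = onArr F f \<cdot>\<^bsub>D\<^esub> iso_inv D (\<alpha> (Dom C f))"
  if f: "f \<in> Arr C" for f
  using a f C[OF f] unfolding is_nat_iso_def
  by (intro iso_inv_square) (auto simp: al functor_arr[OF F f] functor_arr[OF G f])
 then show ?thesis
  using al by (auto simp: is_nat_iso_def hom_def iso_inv intro!: iso_inv_iso)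
qed

text \<open>The component of the unit at \<open>X\<close> is the arrow that \<open>F\<close> sends
  to the inverse of the counit at \<open>F X\<close>; fullness provides it. Its invertibility and
  naturality are equations between parallel arrows, so by faithfulness they may be checked after
  applying \<open>F\<close>, where they follow from the counit.\<close>

lemma equivalence_fully_faithful:
 assumes C: "is_category C" and D: "is_category D"
  and F: "is_functor C D F" and G: "is_functor D C G"
  and faithful: "\<And>f g X Y. f \<in> hom C X Y \<Longrightarrow> g \<in> hom C X Y \<Longrightarrow> onArr F f = onArr F g \<Longrightarrow> f = g"
  and full: "\<And>X Y k. X \<in> Obj C \<Longrightarrow> Y \<in> Obj C \<Longrightarrow> k \<in> hom D (onObj F X) (onObj F Y) \<Longrightarrow>
   \<exists>f \<in> hom C X Y. onArr F f = k"
  and iso: "is_nat_iso D D (F \<circ>\<^sub>F G) fmap_id \<epsilon>"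
 shows "is_equivalence C D F G"
proof -
 interpret C: cat C by (rule cat.intro[OF C])
 interpret D: cat D by (rule cat.intro[OF D])
 have eps: "\<epsilon> Y \<in> Arr D" "Dom D (\<epsilon> Y) = onObj F (onObj G Y)" "Cod D (\<epsilon> Y) = Y" "is_iso D (\<epsilon> Y)"
  if "Y \<in> Obj D" for Y
  using iso that unfolding is_nat_iso_def hom_def by (auto simp: fmap_comp_def fmap_id_def)
 have nat: "\<epsilon> (Cod D k) \<cdot>\<^bsub>D\<^esub> onArr F (onArr G k) = k \<cdot>\<^bsub>D\<^esub> \<epsilon> (Dom D k)" if "k \<in> Arr D" for k
  using iso that unfolding is_nat_iso_def by (simp add: fmap_comp_def fmap_id_def)
 let ?i = "\<lambda>X. iso_inv D (\<epsilon> (onObj F X))"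
 let ?GF = "\<lambda>X. onObj G (onObj F X)"
 have FO: "onObj F X \<in> Obj D" "?GF X \<in> Obj C" "onObj F (?GF X) \<in> Obj D" if "X \<in> Obj C" for X
  using functor_obj[OF F] functor_obj[OF G] that by auto
 have i: "?i X \<in> Arr D" "Dom D (?i X) = onObj F X" "Cod D (?i X) = onObj F (?GF X)" if "X \<in> Obj C" for X
  using iso_inv(1-3)[OF eps(4)[OF FO(1)[OF that]]] eps[OF FO(1)[OF that]] by auto
 define \<eta> where "\<eta> = (\<lambda>X. SOME f. f \<in> hom C X (?GF X) \<and> onArr F f = ?i X)"
 have eta: "\<eta> X \<in> Arr C" "Dom C (\<eta> X) = X" "Cod C (\<eta> X) = ?GF X" "onArr F (\<eta> X) = ?i X"
  if X: "X \<in> Obj C" for X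
 proof -
  have "\<exists>f. f \<in> hom C X (?GF X) \<and> onArr F f = ?i X"
   using full[OF X FO(2)[OF X], of "?i X"] i[OF X] unfolding hom_def by blast
  from someI_ex[OF this] show "\<eta> X \<in> Arr C" "Dom C (\<eta> X) = X" "Cod C (\<eta> X) = ?GF X" "onArr F (\<eta> X) = ?i X"
   unfolding \<eta>_def hom_def by blast+
 qed
 have eta_iso: "is_iso C (\<eta> X)" if X: "X \<in> Obj C" for X
 proof -
  note e = eps[OF FO(1)[OF X]] iso_inv[OF eps(4)[OF FO(1)[OF X]]]
  \<comment> \<open>The inverse of the unit component is the preimage of the counit component
    itself.\<close>
  obtain g where g: "g \<in> Arr C" "Dom C g = ?GF X" "Cod C g = X" "onArr F g = \<epsilon> (onObj F X)"
   using full[OF FO(2)[OF X] X, of "\<epsilon> (onObj F X)"] e unfolding hom_def by auto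
  have "g \<cdot>\<^bsub>C\<^esub> \<eta> X = Ident C X"
   using g eta[OF X] X e i[OF X]
   by (intro faithful[of _ X X]) (auto simp: hom_def functor_comp[OF F] functor_id[OF F])
  moreover have "\<eta> X \<cdot>\<^bsub>C\<^esub> g = Ident C (?GF X)"
   using g eta[OF X] X e i[OF X] FO(2)[OF X]
   by (intro faithful[of _ "?GF X" "?GF X"]) (auto simp: hom_def functor_comp[OF F] functor_id[OF F])
  ultimately show ?thesis
   using g eta[OF X] unfolding is_iso_def hom_def by auto
 qed
 have "\<eta> (Cod C f) \<cdot>\<^bsub>C\<^esub> f = onArr G (onArr F f) \<cdot>\<^bsub>C\<^esub> \<eta> (Dom C f)" if f: "f \<in> Arr C" for f
 proof (rule faithful)
  note o = C.dom_obj[OF f] C.cod_obj[OF f]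
  note a = functor_arr[OF F f] functor_arr[OF G functor_arr(1)[OF F f]]
   functor_arr[OF F functor_arr(1)[OF G functor_arr(1)[OF F f]]]
  show "\<eta> (Cod C f) \<cdot>\<^bsub>C\<^esub> f \<in> hom C (Dom C f) (?GF (Cod C f))"
   "onArr G (onArr F f) \<cdot>\<^bsub>C\<^esub> \<eta> (Dom C f) \<in> hom C (Dom C f) (?GF (Cod C f))"
   using f eta[OF o(1)] eta[OF o(2)] a by (auto simp: hom_def)
  have "?i (Cod C f) \<cdot>\<^bsub>D\<^esub> onArr F f = onArr F (onArr G (onArr F f)) \<cdot>\<^bsub>D\<^esub> ?i (Dom C f)"
   using nat[OF a(1)] a eps[OF FO(1)[OF o(1)]] eps[OF FO(1)[OF o(2)]]
   by (intro D.iso_inv_square) auto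
  then show "onArr F (\<eta> (Cod C f) \<cdot>\<^bsub>C\<^esub> f) = onArr F (onArr G (onArr F f) \<cdot>\<^bsub>C\<^esub> \<eta> (Dom C f))"
   using f eta[OF o(1)] eta[OF o(2)] a by (simp add: functor_comp[OF F])
 qed
 then have "is_nat_iso C C fmap_id (G \<circ>\<^sub>F F) \<eta>"
  using eta eta_iso unfolding is_nat_iso_def hom_def by (auto simp: fmap_comp_def fmap_id_def)
 then show ?thesis
  using assms unfolding is_equivalence_def by blast
qed

section \<open>Categories and functors given by hom-sets\<close>

lemma mk_category_simps [simp]:
 "Obj (mk_category Obs Homs ids comps) = Obs"
 "(X, h, Y) \<in> Arr (mk_category Obs Homs ids comps) \<longleftrightarrow> X \<in> Obs \<and> Y \<in> Obs \<and> h \<in> Homs X Y"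
 "Dom (mk_category Obs Homs ids comps) (X, h, Y) = X"
 "Cod (mk_category Obs Homs ids comps) (X, h, Y) = Y"
 "Ident (mk_category Obs Homs ids comps) X = (X, ids X, X)"
 "(Y', k, Z) \<cdot>\<^bsub>mk_category Obs Homs ids comps\<^esub> (X, h, Y) = (X, comps X k h, Z)"
 by (auto simp: mk_category_def)

lemma mk_category_hom:
 "a \<in> hom (mk_category Obs Homs ids comps) X Y \<longleftrightarrow>
  X \<in> Obs \<and> Y \<in> Obs \<and> (\<exists>h \<in> Homs X Y. a = (X, h, Y))"
 by (cases a) (auto simp: hom_def)

lemma is_category_mk_category:
 assumes "\<And>X. X \<in> Obs \<Longrightarrow> ids X \<in> Homs X X"
  and "\<And>X Y Z h k. X \<in> Obs \<Longrightarrow> Y \<in> Obs \<Longrightarrow> Z \<in> Obs \<Longrightarrow> h \<in> Homs X Y \<Longrightarrow> k \<in> Homs Y Z \<Longrightarrow>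
   comps X k h \<in> Homs X Z"
  and "\<And>X Y h. X \<in> Obs \<Longrightarrow> Y \<in> Obs \<Longrightarrow> h \<in> Homs X Y \<Longrightarrow> comps X h (ids X) = h \<and> comps X (ids Y) h = h"
  and "\<And>X Y Z U h k l. X \<in> Obs \<Longrightarrow> Y \<in> Obs \<Longrightarrow> Z \<in> Obs \<Longrightarrow> U \<in> Obs \<Longrightarrow> h \<in> Homs X Y \<Longrightarrow>
   k \<in> Homs Y Z \<Longrightarrow> l \<in> Homs Z U \<Longrightarrow> comps X (comps Y l k) h = comps X l (comps X k h)"
 shows "is_category (mk_category Obs Homs ids comps)"
 unfolding is_category_def using assms by (auto simp: hom_def)

lemma is_functor_mk_category:
 assumes "\<And>X. X \<in> Obs \<Longrightarrow> fo X \<in> Obs'"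
  and "\<And>X Y h. X \<in> Obs \<Longrightarrow> Y \<in> Obs \<Longrightarrow> h \<in> Homs X Y \<Longrightarrow> fh X h \<in> Homs' (fo X) (fo Y)"
  and "\<And>X. X \<in> Obs \<Longrightarrow> fh X (ids X) = ids' (fo X)"
  and "\<And>X Y Z h k. X \<in> Obs \<Longrightarrow> Y \<in> Obs \<Longrightarrow> Z \<in> Obs \<Longrightarrow> h \<in> Homs X Y \<Longrightarrow> k \<in> Homs Y Z \<Longrightarrow>
   fh X (comps X k h) = comps' (fo X) (fh Y k) (fh X h)"
 shows "is_functor (mk_category Obs Homs ids comps) (mk_category Obs' Homs' ids' comps')
  \<lparr>onObj = fo, onArr = (\<lambda>(X, h, Y). (fo X, fh X h, fo Y))\<rparr>"
 unfolding is_functor_def using assms by (auto simp: hom_def)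

section \<open>Stratified categories\<close>

lemma over_iff: "A \<in> over F X \<longleftrightarrow> A \<in> Arr F \<and> Cod F A = X"
 by (auto simp: over_def)

text \<open>A category with a stratification and a terminal object is a tree: every arrow that is not an
 identity factors through the chosen arrow \<open>d X\<close> out of its domain \<open>X\<close>.\<close>

locale rooted_tree = cat C for C :: "('o, 'm) category" (structure) +
 fixes t :: 'o and L :: "'o \<Rightarrow> nat" and d :: "'o \<Rightarrow> 'm"
 assumes terminal: "is_terminal C t"
  and level_mono: "f \<in> Arr C \<Longrightarrow> L (Cod C f) \<le> L (Dom C f)"
  and level_0: "X \<in> Obj C \<Longrightarrow> L X = 0 \<longleftrightarrow> X = t"
  and level_eq: "f \<in> Arr C \<Longrightarrow> L (Dom C f) = L (Cod C f) \<Longrightarrow> Ident C (Dom C f) = f"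
  and step: "X \<in> Obj C \<Longrightarrow> 0 < L X \<Longrightarrow> d X \<in> Arr C \<and> Dom C (d X) = X \<and> L X = Suc (L (Cod C (d X)))"
  and factor: "f \<in> Arr C \<Longrightarrow> L (Cod C f) < L (Dom C f) \<Longrightarrow>
   \<exists>g \<in> Arr C. Dom C g = Cod C (d (Dom C f)) \<and> Cod C g = Cod C f \<and> g \<cdot>\<^bsub>C\<^esub> d (Dom C f) = f"

text \<open>The list is in the order of composition: the head is the arrow applied last, and the
  arrow out of the common domain is the last entry.\<close>

definition chain :: "('o, 'm) category \<Rightarrow> 'm list \<Rightarrow> bool" where
 "chain C fs \<longleftrightarrow> fs \<noteq> [] \<and> set fs \<subseteq> Arr C \<and> successively (\<lambda>f g. Dom C f = Cod C g) fs"

lemma (in cat) comp_list: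
 assumes "chain C fs"
 shows "comp_list C fs \<in> Arr C \<and> Dom C (comp_list C fs) = Dom C (last fs) \<and>
  Cod C (comp_list C fs) = Cod C (hd fs)"
 using assms by (induction fs rule: induct_list012) (auto simp: chain_def)

lemma (in cat) comp_list_snoc:
 assumes "chain C fs" "g \<in> Arr C" "Dom C (last fs) = Cod C g"
 shows "comp_list C (fs @ [g]) = comp_list C fs \<cdot> g"
 using assms
proof (induction fs rule: induct_list012)
 case (3 f f' fs)
 then have "chain C (f' # fs)" by (auto simp: chain_def)
 moreover have "f \<in> Arr C" "Dom C f = Cod C f'" using 3 by (auto simp: chain_def)
 ultimately show ?case
  using 3 comp_list[of "f' # fs"] by (simp add: assoc)
qed (auto simp: chain_def)

lemma chain_snoc: "fs \<noteq> [] \<Longrightarrow> chain C (fs @ [g]) \<longleftrightarrow> chain C fs \<and> g \<in> Arr C \<and> Dom C (last fs) = Cod C g"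
 by (auto simp: chain_def successively_append_iff)

text \<open>The shape conditions of the factorization clause, kept apart from the equation for the
  composite so that they can be split at the last entry.\<close>

definition factors :: "('o, 'm) category \<Rightarrow> ('o \<Rightarrow> nat) \<Rightarrow> nat \<Rightarrow> nat \<Rightarrow> 'm list \<Rightarrow> bool" where
 "factors C L n m fs \<longleftrightarrow> length fs = m + 1 \<and>
   (\<forall>i \<le> m. fs ! i \<in> Arr C \<and> L (Dom C (fs ! i)) = n + (i + 1) \<and> L (Cod C (fs ! i)) = n + i) \<and>
   (\<forall>i < m. Dom C (fs ! i) = Cod C (fs ! (i + 1)))"

lemma factors_0: "factors C L n 0 fs \<longleftrightarrow>
  (\<exists>f \<in> Arr C. fs = [f] \<and> L (Dom C f) = Suc n \<and> L (Cod C f) = n)"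
 by (auto simp: factors_def length_Suc_conv)

text \<open>Factorizations are grown at the domain end, because that is where a rooted tree supplies
  an arrow, the edge \<open>d X\<close> out of the domain.\<close>

lemma factors_Suc: "factors C L n (Suc m) fs \<longleftrightarrow>
  (\<exists>fs' g. fs = fs' @ [g] \<and> factors C L n m fs' \<and> g \<in> Arr C \<and> L (Dom C g) = n + m + 2 \<and>
   L (Cod C g) = n + m + 1 \<and> Dom C (last fs') = Cod C g)" (is "?l = ?r")
proof
 assume l: ?l
 then have ne: "fs \<noteq> []" by (auto simp: factors_def)
 define fs' g where "fs' = butlast fs" and "g = last fs"
 have fs: "fs = fs' @ [g]" using ne by (simp add: fs'_def g_def)
 have len: "length fs' = m + 1" using l by (simp add: factors_def fs)
 then have ne': "fs' \<noteq> []" by auto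
 have *: "fs ! i = (if i = m + 1 then g else fs' ! i)" if "i \<le> Suc m" for i
  using that len by (auto simp: fs nth_append)
 have last: "last fs' = fs' ! m" using len ne' by (simp add: last_conv_nth)
 have a: "fs ! i \<in> Arr C \<and> L (Dom C (fs ! i)) = n + (i + 1) \<and> L (Cod C (fs ! i)) = n + i" if "i \<le> Suc m" for i
  using l that by (simp add: factors_def)
 have b: "Dom C (fs ! i) = Cod C (fs ! (i + 1))" if "i < Suc m" for i
  using l that by (simp add: factors_def)
 have "factors C L n m fs'"
  unfolding factors_def
 proof (intro conjI allI impI)
  show "Dom C (fs' ! i) = Cod C (fs' ! (i + 1))" if "i < m" for i
   using b[of i] *[of i] *[of "i + 1"] that by simp
  show "fs' ! i \<in> Arr C" "L (Dom C (fs' ! i)) = n + (i + 1)" "L (Cod C (fs' ! i)) = n + i" if "i \<le> m" for i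
   using a[of i] *[of i] that by simp_all
 qed (rule len)
 moreover have "g \<in> Arr C \<and> L (Dom C g) = n + m + 2 \<and> L (Cod C g) = n + m + 1"
  using a[of "Suc m"] *[of "Suc m"] by simp
 moreover have "Dom C (last fs') = Cod C g"
  using b[of m] *[of m] *[of "Suc m"] by (simp add: last)
 ultimately show ?r using fs by blast
next
 assume ?r
 then obtain fs' g where r: "fs = fs' @ [g]" "factors C L n m fs'" "g \<in> Arr C" "L (Dom C g) = n + m + 2"
   "L (Cod C g) = n + m + 1" "Dom C (last fs') = Cod C g" by blast
 then have len: "length fs' = m + 1" by (simp add: factors_def)
 then have "last fs' = fs' ! m" by (subst last_conv_nth) auto
 then show ?l
  using r len unfolding factors_def by (auto simp: nth_append less_Suc_eq le_Suc_eq)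
qed

lemma factors_chain: "factors C L n m fs \<Longrightarrow> chain C fs \<and> L (Cod C (hd fs)) = n \<and> L (Dom C (last fs)) = n + m + 1"
proof (induction m arbitrary: fs)
 case 0
 then show ?case by (auto simp: factors_0 chain_def)
next
 case (Suc m)
 then obtain fs' g where *: "fs = fs' @ [g]" "factors C L n m fs'" "g \<in> Arr C" "L (Dom C g) = n + m + 2"
   "L (Cod C g) = n + m + 1" "Dom C (last fs') = Cod C g" unfolding factors_Suc by blast
 then have "fs' \<noteq> []" by (auto simp: factors_def)
 with * Suc.IH[OF *(2)] show ?case by (auto simp: chain_snoc)
qed

lemma is_stratification_factors: "is_stratification C t L \<longleftrightarrow>
   (\<forall>f \<in> Arr C. L (Dom C f) \<ge> L (Cod C f)) \<and>
   (\<forall>X \<in> Obj C. L X = 0 \<longleftrightarrow> X = t) \<and>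
   (\<forall>f \<in> Arr C. L (Dom C f) = L (Cod C f) \<longleftrightarrow> Dom C f = Cod C f \<and> f = Ident C (Dom C f)) \<and>
   (\<forall>f \<in> Arr C. \<forall>n m. L (Dom C f) = n + m + 1 \<longrightarrow> L (Cod C f) = n \<longrightarrow>
    (\<exists>!fs. factors C L n m fs \<and> comp_list C fs = f))"
proof -
 have eq: "factors C L n m fs \<and> comp_list C fs = f \<longleftrightarrow> length fs = m + 1 \<and>
   (\<forall>i \<le> m. fs ! i \<in> Arr C \<and> L (Dom C (fs ! i)) = n + (i + 1) \<and> L (Cod C (fs ! i)) = n + i) \<and>
   (\<forall>i < m. Dom C (fs ! i) = Cod C (fs ! (i + 1))) \<and> comp_list C fs = f" for n m fs f
  unfolding factors_def by blast
 show ?thesis unfolding is_stratification_def eq by (rule refl)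
qed

context rooted_tree
begin

lemma level_eq_cod: "f \<in> Arr C \<Longrightarrow> L (Dom C f) = L (Cod C f) \<Longrightarrow> Cod C f = Dom C f"
 using level_eq[of f] by (metis cod_id dom_obj)

text \<open>When an arrow that lowers the level by one is factored through \<open>d\<close>, the
  remaining factor keeps the level and is therefore an identity.\<close>

lemma step_eq:
 assumes "f \<in> Arr C" "L (Dom C f) = Suc (L (Cod C f))"
 shows "d (Dom C f) = f"
proof -
 obtain g where g: "g \<in> Arr C" "Dom C g = Cod C (d (Dom C f))" "Cod C g = Cod C f" "g \<cdot> d (Dom C f) = f"
  using factor[OF assms(1)] assms(2) by auto
 have s: "d (Dom C f) \<in> Arr C" "L (Dom C f) = Suc (L (Cod C (d (Dom C f))))"
  using step[of "Dom C f"] assms by auto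
 then have "Ident C (Cod C (d (Dom C f))) = g"
  using level_eq[OF g(1)] g assms(2) by simp
 then show ?thesis using g(4) s by auto
qed

text \<open>Two parallel arrows are both identities, or both factor through \<open>d\<close> of the
  common domain; in the second case the remaining factors are parallel and start at a lower
  level.\<close>

lemma thin:
 "a \<in> Arr C \<Longrightarrow> b \<in> Arr C \<Longrightarrow> Dom C a = Dom C b \<Longrightarrow> Cod C a = Cod C b \<Longrightarrow> a = b"
proof (induction "L (Dom C a)" arbitrary: a b rule: less_induct)
 case less
 show ?case
 proof (cases "L (Dom C a) = L (Cod C a)")
  case True
  then show ?thesis using level_eq[OF less(2)] level_eq[OF less(3)] less(4,5) by metis
 next
  case False
  then have lt: "L (Cod C a) < L (Dom C a)" "L (Cod C b) < L (Dom C b)"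
   using level_mono[OF less(2)] less(4,5) by auto
  obtain a' where a': "a' \<in> Arr C" "Dom C a' = Cod C (d (Dom C a))" "Cod C a' = Cod C a"
   "a' \<cdot> d (Dom C a) = a" using factor[OF less(2) lt(1)] by blast
  obtain b' where b': "b' \<in> Arr C" "Dom C b' = Cod C (d (Dom C b))" "Cod C b' = Cod C b"
   "b' \<cdot> d (Dom C b) = b" using factor[OF less(3) lt(2)] by blast
  have "L (Dom C a') < L (Dom C a)" using step[of "Dom C a"] a' less(2) lt by simp
  from less(1)[OF this a'(1) b'(1)] show ?thesis using a' b' less(4,5) by metis
 qed
qed

text \<open>Existence of the factorization iterates \<open>factor\<close>. For uniqueness, the last
  entry lowers the level by one and so is the edge \<open>d\<close> by \<open>step_eq\<close>; the
  composite of the other entries is then determined by \<open>thin\<close>, and the induction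
  hypothesis applies to it.\<close>

lemma is_strat: "is_stratification C t L"
proof -
 have "\<exists>!fs. factors C L n m fs \<and> comp_list C fs = f"
  if "f \<in> Arr C" "L (Dom C f) = n + m + 1" "L (Cod C f) = n" for f n m
  using that
 proof (induction m arbitrary: f)
  case 0
  show ?case
  proof (rule ex1I[of _ "[f]"])
   fix fs assume "factors C L n 0 fs \<and> comp_list C fs = f"
   then show "fs = [f]" by (auto simp: factors_0)
  qed (use 0 in \<open>auto simp: factors_0\<close>)
 next
  case (Suc m)
  let ?X = "Dom C f"
  obtain g where g: "g \<in> Arr C" "Dom C g = Cod C (d ?X)" "Cod C g = Cod C f" "g \<cdot> d ?X = f"
   using factor[OF Suc(2)] Suc(3,4) by auto
  have s: "d ?X \<in> Arr C" "Dom C (d ?X) = ?X" "L ?X = Suc (L (Cod C (d ?X)))"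
   using step[of ?X] Suc(2,3) by auto
  have uniq: "\<exists>!fs. factors C L n m fs \<and> comp_list C fs = g"
   using Suc.IH[OF g(1)] g s Suc(3,4) by simp
  then obtain fs where fs: "factors C L n m fs" "comp_list C fs = g" by blast
  have ch: "chain C fs" "Dom C (last fs) = Dom C g"
   using factors_chain[OF fs(1)] comp_list[of fs] fs(2) by auto
  show ?case
  proof (rule ex1I[of _ "fs @ [d ?X]"], intro conjI)
   show "factors C L n (Suc m) (fs @ [d ?X])"
    using fs ch s g Suc(3) unfolding factors_Suc by (intro exI[of _ fs]) auto
   show "comp_list C (fs @ [d ?X]) = f"
    using comp_list_snoc[OF ch(1) s(1)] ch(2) g fs(2) by simp
   fix hs assume hs: "factors C L n (Suc m) hs \<and> comp_list C hs = f"
   then obtain gs h where h: "hs = gs @ [h]" "factors C L n m gs" "h \<in> Arr C" "L (Dom C h) = n + m + 2"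
    "L (Cod C h) = n + m + 1" "Dom C (last gs) = Cod C h" unfolding factors_Suc by blast
   have cg: "chain C gs" using factors_chain[OF h(2)] by simp
   have comp: "comp_list C gs \<cdot> h = f" using comp_list_snoc[OF cg h(3) h(6)] hs h(1) by simp
   have "Dom C h = ?X" using comp_list[OF cg] comp h by (metis dom_comp)
   then have hd: "h = d ?X" using step_eq[OF h(3)] h(4,5) by simp
   have dg: "Dom C (comp_list C gs) = Cod C (d ?X)" "Cod C (comp_list C gs) = Cod C f"
    using comp_list[OF cg] comp h hd s by (metis, metis cod_comp)
   have "comp_list C gs = g"
    using thin[of "comp_list C gs" g] dg g comp_list[OF cg] by metis
   then have "gs = fs" using uniq fs h(2) by (auto elim: ex1E)
   then show "hs = fs @ [d ?X]" using h(1) hd by simp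
  qed
 qed
 moreover have "L (Dom C f) = L (Cod C f) \<longleftrightarrow> Dom C f = Cod C f \<and> f = Ident C (Dom C f)" if "f \<in> Arr C" for f
  using level_eq[OF that] level_eq_cod[OF that] by metis
 ultimately show ?thesis
  unfolding is_stratification_factors by (intro conjI ballI allI impI level_mono level_0)
qed

end

text \<open>Converse to \<open>is_strat\<close>: the edges are read off from the unique
  factorizations, and factoring through an edge means splitting a factorization at its last
  entry.\<close>

lemma is_stratification_rooted_tree:
 assumes C: "is_category C" and t: "is_terminal C t" and L: "is_stratification C t L"
 shows "\<exists>d. rooted_tree C t L d"
proof -
 interpret cat C by (rule cat.intro[OF C])
 note S = L[unfolded is_stratification_factors]
 have mono: "L (Cod C f) \<le> L (Dom C f)" if "f \<in> Arr C" for f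
  using S[THEN conjunct1] that by blast
 have zero: "L X = 0 \<longleftrightarrow> X = t" if "X \<in> Obj C" for X
  using S[THEN conjunct2, THEN conjunct1, rule_format, OF that] .
 have level_eq: "Ident C (Dom C f) = f" "Cod C f = Dom C f"
  if "f \<in> Arr C" "L (Dom C f) = L (Cod C f)" for f
 proof -
  have "Dom C f = Cod C f \<and> f = Ident C (Dom C f)"
   using S[THEN conjunct2, THEN conjunct2, THEN conjunct1] that by blast
  then show "Ident C (Dom C f) = f" "Cod C f = Dom C f" by auto
 qed
 have ex1: "\<exists>!fs. factors C L n m fs \<and> comp_list C fs = f"
  if "f \<in> Arr C" "L (Dom C f) = n + m + 1" "L (Cod C f) = n" for f n m
  using S[THEN conjunct2, THEN conjunct2, THEN conjunct2] that by blast
 have t_obj: "t \<in> Obj C" using t unfolding is_terminal_def by blast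
 have Lt: "L t = 0" using zero[OF t_obj] by simp
 define bang where "bang X = (THE f. f \<in> hom C X t)" for X
 have bang: "bang X \<in> Arr C" "Dom C (bang X) = X" "Cod C (bang X) = t"
  "f \<in> Arr C \<Longrightarrow> Dom C f = X \<Longrightarrow> Cod C f = t \<Longrightarrow> f = bang X" if "X \<in> Obj C" for X f
 proof -
  have "\<exists>!f. f \<in> hom C X t" using t that unfolding is_terminal_def by blast
  from theI'[OF this] this
  show "bang X \<in> Arr C" "Dom C (bang X) = X" "Cod C (bang X) = t"
   "f \<in> Arr C \<Longrightarrow> Dom C f = X \<Longrightarrow> Cod C f = t \<Longrightarrow> f = bang X"
   unfolding bang_def hom_def by blast+
 qed
 \<comment> \<open>The edge out of \<open>X\<close> is the entry nearest to \<open>X\<close> in the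
   factorization of the unique arrow from \<open>X\<close> to \<open>t\<close>. At \<open>t\<close>
   itself the value is arbitrary.\<close>
 define d where "d X = last (THE fs. factors C L 0 (L X - 1) fs \<and> comp_list C fs = bang X)" for X
 \<comment> \<open>Any arrow \<open>g\<close> out of \<open>X\<close> that lowers the level by one
   is this edge: appended to the factorization of the arrow from its codomain to \<open>t\<close>,
   it completes a factorization of the arrow from \<open>X\<close> to \<open>t\<close>.\<close>
 have d_eq: "d X = g" if g: "g \<in> Arr C" "Dom C g = X" "L X = Suc (L (Cod C g))" for g X
 proof -
  let ?Y = "Cod C g"
  have X: "X \<in> Obj C" and Y: "?Y \<in> Obj C" using g by auto
  have bX: "bang X = bang ?Y \<cdot>\<^bsub>C\<^esub> g"
   using bang[OF X] bang[OF Y] g by (metis comp_arr cod_comp dom_comp)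
  have "\<exists>fs. factors C L 0 (L X - 1) (fs @ [g]) \<and> comp_list C (fs @ [g]) = bang X"
  proof (cases "L ?Y")
   case 0
   then have "?Y = t" using zero[OF Y] by simp
   then have "g = bang X" using bang(4)[OF X] g by simp
   then show ?thesis using g 0 by (intro exI[of _ "[]"]) (auto simp: factors_0)
  next
   case (Suc m)
   then obtain fs where fs: "factors C L 0 m fs" "comp_list C fs = bang ?Y"
    using ex1[of "bang ?Y" 0 m] bang(1-3)[OF Y] Lt by auto
   have ch: "chain C fs" using factors_chain[OF fs(1)] by simp
   have l: "Dom C (last fs) = ?Y" using comp_list[OF ch] fs bang(2)[OF Y] by simp
   have "factors C L 0 (Suc m) (fs @ [g])"
    unfolding factors_Suc using fs g l Suc by auto
   moreover have "comp_list C (fs @ [g]) = bang X" using comp_list_snoc[OF ch g(1) l] fs bX by simp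
   ultimately show ?thesis using g Suc by auto
  qed
  then obtain fs where fs: "factors C L 0 (L X - 1) (fs @ [g]) \<and> comp_list C (fs @ [g]) = bang X"
   by blast
  have "\<exists>!fs. factors C L 0 (L X - 1) fs \<and> comp_list C fs = bang X"
   using ex1[of "bang X" 0 "L X - 1"] bang(1-3)[OF X] Lt g by simp
  then have "(THE fs. factors C L 0 (L X - 1) fs \<and> comp_list C fs = bang X) = fs @ [g]"
   using fs by (rule the1_equality)
  then show ?thesis by (simp add: d_def)
 qed
 have fact: "\<exists>g \<in> Arr C. Dom C g = Cod C (d (Dom C f)) \<and> Cod C g = Cod C f \<and>
   g \<cdot>\<^bsub>C\<^esub> d (Dom C f) = f \<and> d (Dom C f) \<in> Arr C \<and> Dom C (d (Dom C f)) = Dom C f \<and>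
   L (Dom C f) = Suc (L (Cod C (d (Dom C f))))"
  if f: "f \<in> Arr C" "L (Cod C f) < L (Dom C f)" for f
 proof -
  obtain m where m: "L (Dom C f) = L (Cod C f) + m + 1" using f by (metis less_natE add_Suc_right Suc_eq_plus1)
  obtain fs where fs: "factors C L (L (Cod C f)) m fs" "comp_list C fs = f"
   using ex1[OF f(1) m] by auto
  show ?thesis
  proof (cases m)
   case 0
   then have "d (Dom C f) = f" using d_eq[OF f(1)] m by simp
   then show ?thesis using f m 0
    by (intro bexI[of _ "Ident C (Cod C f)"]) auto
  next
   case (Suc k)
   then obtain gs g where g: "fs = gs @ [g]" "factors C L (L (Cod C f)) k gs" "g \<in> Arr C"
    "L (Dom C g) = L (Cod C f) + k + 2" "L (Cod C g) = L (Cod C f) + k + 1" "Dom C (last gs) = Cod C g"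
    using fs(1) unfolding Suc factors_Suc by blast
   have ch: "chain C gs" using factors_chain[OF g(2)] by simp
   have f_eq: "f = comp_list C gs \<cdot>\<^bsub>C\<^esub> g" using comp_list_snoc[OF ch g(3,6)] fs(2) g(1) by simp
   moreover have "Dom C g = Dom C f" using f_eq comp_list[OF ch] g by simp
   moreover from this have "d (Dom C f) = g" using d_eq[OF g(3)] g by simp
   moreover have "Cod C (comp_list C gs) = Cod C f" using f_eq comp_list[OF ch] g by simp
   ultimately show ?thesis
    using comp_list[OF ch] g m Suc
    by (intro bexI[of _ "comp_list C gs"]) auto
  qed
 qed
 have "rooted_tree C t L d"
 proof (unfold_locales, goal_cases)
  case (5 X)
  then show ?case using fact[of "bang X"] bang(1-3)[of X] Lt by auto
 next
  case (6 f)
  then show ?case using fact[of f] by blast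
 qed (use t mono zero level_eq in auto)
 then show ?thesis by blast
qed

text \<open>Each of \<open>d X\<close> and \<open>d' X\<close> factors through the other, so their
  codomains have the same level and the arrow between these codomains is an identity. The levels
  then agree by induction, the codomain of the common edge being lower than
  \<open>X\<close>.\<close>

lemma rooted_tree_unique:
 assumes "rooted_tree C t L d" "rooted_tree C t L' d'" "X \<in> Obj C"
 shows "L X = L' X \<and> (0 < L X \<longrightarrow> d X = d' X)"
 using assms(3)
proof (induction "L X" arbitrary: X rule: less_induct)
 case less
 interpret A: rooted_tree C t L d by fact
 interpret B: rooted_tree C t L' d' by fact
 show ?case
 proof (cases "L X = 0")
  case True
  then show ?thesis using A.level_0[OF less(2)] B.level_0[OF less(2)] by simp
 next
  case False
  then have "0 < L X" by simp
  have "0 < L' X" using False A.level_0[OF less(2)] B.level_0[OF less(2)] by simp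
  note a = A.step[OF less(2) \<open>0 < L X\<close>]
  note b = B.step[OF less(2) \<open>0 < L' X\<close>]
  have IH: "L (Cod C (d X)) = L' (Cod C (d X))" using less(1)[of "Cod C (d X)"] a by simp
  have ca: "Cod C (d X) \<noteq> X" and cb: "Cod C (d' X) \<noteq> X" using a b by (metis n_not_Suc_n)+
  have "L' (Cod C (d X)) < L' X"
   using B.level_mono[of "d X"] B.level_eq_cod[of "d X"] a ca by (metis nat_less_le)
  then obtain g where g: "g \<in> Arr C" "Dom C g = Cod C (d' X)" "Cod C g = Cod C (d X)" "d X = g \<cdot>\<^bsub>C\<^esub> d' X"
   using B.factor[of "d X"] a by auto
  have "L (Cod C (d' X)) < L X"
   using A.level_mono[of "d' X"] A.level_eq_cod[of "d' X"] b cb by (metis nat_less_le)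
  then obtain g' where g': "g' \<in> Arr C" "Dom C g' = Cod C (d X)" "Cod C g' = Cod C (d' X)"
   using A.factor[of "d' X"] b by auto
  have "L (Cod C (d X)) = L (Cod C (d' X))"
   using A.level_mono[OF g(1)] A.level_mono[OF g'(1)] g g' by simp
  then have "Ident C (Cod C (d' X)) = g" using A.level_eq[OF g(1)] g by simp
  then have eq: "d X = d' X" using g b by auto
  then show ?thesis using a b IH by simp
 qed
qed

locale strat_cat = cat C for C :: "('o, 'm) category" (structure) +
 fixes t :: 'o
 assumes is_term: "is_terminal C t" and strat: "is_stratified C t"

text \<open>\<open>lev\<close> and \<open>indec\<close> are defined by choice; this evaluates them
  wherever levels and edges are known explicitly, as in path categories and in the slice over the
  root.\<close>

lemma rooted_tree_lev:
 assumes "rooted_tree C t L d"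
 shows "is_stratified C t" "X \<in> Obj C \<Longrightarrow> lev C t X = L X"
  "X \<in> Obj C \<Longrightarrow> 0 < L X \<Longrightarrow> indec C t X = d X"
proof -
 interpret rooted_tree C t L d by fact
 show s: "is_stratified C t" using is_strat unfolding is_stratified_def by blast
 then have "is_stratification C t (lev C t)" unfolding is_stratified_def lev_def by (rule someI_ex)
 then obtain d' where d': "rooted_tree C t (lev C t) d'"
  using is_stratification_rooted_tree[OF is_cat terminal] by blast
 interpret B: rooted_tree C t "lev C t" d' by fact
 note u = rooted_tree_unique[OF assms d']
 show "lev C t X = L X" if "X \<in> Obj C" using u[OF that] by simp
 assume X: "X \<in> Obj C" "0 < L X"
 have "indec C t X = d' X"
  unfolding indec_def
 proof (rule the_equality)
  show "d' X \<in> Arr C \<and> Dom C (d' X) = X \<and> lev C t X = lev C t (Cod C (d' X)) + 1"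
   using B.step[OF X(1)] u[OF X(1)] X(2) by simp
  show "f = d' X" if "f \<in> Arr C \<and> Dom C f = X \<and> lev C t X = lev C t (Cod C f) + 1" for f
   using B.step_eq[of f] that by simp
 qed
 then show "indec C t X = d X" using u[OF X(1)] X(2) by simp
qed

lemma (in strat_cat) rooted_tree: "rooted_tree C t (lev C t) (indec C t)"
proof -
 have "is_stratification C t (lev C t)" using strat unfolding is_stratified_def lev_def by (rule someI_ex)
 then obtain d' where d': "rooted_tree C t (lev C t) d'"
  using is_stratification_rooted_tree[OF is_cat is_term] by blast
 interpret B: rooted_tree C t "lev C t" d' by fact
 note i = rooted_tree_lev(3)[OF d']
 show ?thesis
  using B.terminal B.level_mono B.level_0 B.level_eq B.step B.factor
  by unfold_locales (auto simp: i)
qed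

sublocale strat_cat \<subseteq> rooted_tree C t "lev C t" "indec C t"
 by (rule rooted_tree)

context strat_cat
begin

lemma base_obj [simp]: "t \<in> Obj C"
 using terminal unfolding is_terminal_def by blast

lemma lev_base [simp]: "lev C t t = 0"
 using level_0[OF base_obj] by simp

lemma indec [simp]:
 assumes "X \<in> Obj C" "0 < lev C t X"
 shows "indec C t X \<in> Arr C" "Dom C (indec C t X) = X" "lev C t (Cod C (indec C t X)) = lev C t X - 1"
 using step[OF assms] by auto

lemma indec_eq: "f \<in> Arr C \<Longrightarrow> lev C t (Dom C f) = Suc (lev C t (Cod C f)) \<Longrightarrow> indec C t (Dom C f) = f"
 by (rule step_eq)

definition bang :: "'o \<Rightarrow> 'm" where
 "bang X = (THE f. f \<in> hom C X t)"

lemma bang [simp]: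
 assumes "X \<in> Obj C"
 shows "bang X \<in> Arr C" "Dom C (bang X) = X" "Cod C (bang X) = t"
proof -
 have "\<exists>!f. f \<in> hom C X t" using terminal assms unfolding is_terminal_def by blast
 from theI'[OF this] show "bang X \<in> Arr C" "Dom C (bang X) = X" "Cod C (bang X) = t"
  unfolding bang_def hom_def by blast+
qed

lemma bang_eq: "f \<in> Arr C \<Longrightarrow> Cod C f = t \<Longrightarrow> bang (Dom C f) = f"
 by (rule thin) auto

lemma bang_comp: "f \<in> Arr C \<Longrightarrow> bang (Cod C f) \<cdot> f = bang (Dom C f)"
 by (rule thin) auto

lemma bang_base: "bang t = Ident C t"
 by (rule thin) auto

lemma over_base: "A \<in> over C t \<longleftrightarrow> (\<exists>X \<in> Obj C. A = bang X)"
proof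
 assume "A \<in> over C t"
 then show "\<exists>X \<in> Obj C. A = bang X" using bang_eq[of A] by (intro bexI[of _ "Dom C A"]) (auto simp: over_def)
qed (auto simp: over_def)

lemma the_arr: "f \<in> Arr C \<Longrightarrow> Dom C f = X \<Longrightarrow> Cod C f = Y \<Longrightarrow> (THE a. a \<in> hom C X Y) = f"
 by (rule the_equality) (auto simp: hom_def intro: thin)

text \<open>Every arrow is a path of indecomposable arrows; the induction removes the one out of the
  domain.\<close>

lemma arr_induct [consumes 1, case_names ident step]:
 assumes "f \<in> Arr C"
  and "\<And>X. X \<in> Obj C \<Longrightarrow> P (Ident C X)"
  and "\<And>g X. X \<in> Obj C \<Longrightarrow> 0 < lev C t X \<Longrightarrow> g \<in> Arr C \<Longrightarrow> Dom C g = Cod C (indec C t X) \<Longrightarrow> P g \<Longrightarrow>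
   P (g \<cdot> indec C t X)"
 shows "P f"
 using assms(1)
proof (induction "lev C t (Dom C f)" arbitrary: f rule: less_induct)
 case less
 show ?case
 proof (cases "lev C t (Dom C f) = lev C t (Cod C f)")
  case True
  then show ?thesis using level_eq[OF less(2)] assms(2)[of "Dom C f"] less(2) by simp
 next
  case False
  then have lt: "lev C t (Cod C f) < lev C t (Dom C f)" using level_mono[OF less(2)] by simp
  then obtain g where g: "g \<in> Arr C" "Dom C g = Cod C (indec C t (Dom C f))" "g \<cdot> indec C t (Dom C f) = f"
   using factor[OF less(2)] by blast
  have "P g" using less(1)[of g] g lt less(2) by simp
  then show ?thesis using assms(3)[of "Dom C f" g] g lt less(2) by simp
 qed
qed

end

section \<open>The slice over the root\<close>

lemma is_category_slice:
 assumes "is_category F"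
 shows "is_category (slice_cat F \<Gamma>)"
proof -
 interpret cat F by (rule cat.intro[OF assms])
 show ?thesis
  unfolding is_category_def
 proof (intro conjI ballI impI, goal_cases)
  case (4 f g)
  then obtain A P B Q where "f = \<langle>A, P\<rangle>" "A \<in> over F \<Gamma>" "P \<in> over F (Dom F A)"
   "g = \<langle>B, Q\<rangle>" "B \<in> over F \<Gamma>" "Q \<in> over F (Dom F B)"
   by (auto simp: slice_cat_def)
  moreover from this have "A = B \<cdot>\<^bsub>F\<^esub> Q" using 4(3) by (simp add: slice_cat_def)
  ultimately show ?case by (simp add: slice_cat_def over_def hom_def assoc)
 next
  case (7 f g h)
  then obtain A P B Q D R where "f = \<langle>A, P\<rangle>" "A \<in> over F \<Gamma>" "P \<in> over F (Dom F A)"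
   "g = \<langle>B, Q\<rangle>" "B \<in> over F \<Gamma>" "Q \<in> over F (Dom F B)"
   "h = \<langle>D, R\<rangle>" "D \<in> over F \<Gamma>" "R \<in> over F (Dom F D)"
   by (auto simp: slice_cat_def)
  moreover from this have "A = B \<cdot>\<^bsub>F\<^esub> Q" "B = D \<cdot>\<^bsub>F\<^esub> R" using 7(4,5) by (simp_all add: slice_cat_def)
  ultimately show ?case by (simp add: slice_cat_def over_def assoc)
 qed (auto simp: slice_cat_def over_def hom_def)
qed

text \<open>An object of the slice over the root is the unique arrow out of its domain, so the slice
  is a copy of the category with the same levels and edges. The families of \<open>E2CE_obj\<close>
  form this slice, and their levels are obtained from here.\<close>

lemma slice_tree:
 fixes C :: "'a scat"
 assumes "strat_cat C t"
 shows "rooted_tree (slice_cat C t) (Ident C t) (\<lambda>A. lev C t (Dom C A))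
   (\<lambda>A. \<langle>strat_cat.bang C t (Cod C (indec C t (Dom C A))), indec C t (Dom C A)\<rangle>)"
proof -
 interpret strat_cat C t by (rule assms)
 interpret S: cat "slice_cat C t" by (rule cat.intro[OF is_category_slice[OF is_cat]])
 have arrE: "\<exists>B P. a = \<langle>B, P\<rangle> \<and> B \<in> Arr C \<and> Cod C B = t \<and> P \<in> Arr C \<and> Cod C P = Dom C B"
  if "a \<in> Arr (slice_cat C t)" for a
  using that unfolding slice_cat_def over_def by auto
 have fact: "\<exists>b \<in> Arr (slice_cat C t). Dom (slice_cat C t) b = bang (Cod C (indec C t (Dom C A))) \<and>
   Cod (slice_cat C t) b = B \<and> b \<cdot>\<^bsub>slice_cat C t\<^esub> \<langle>bang (Cod C (indec C t (Dom C A))), indec C t (Dom C A)\<rangle> = \<langle>B, P\<rangle>"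
  if h: "B \<in> over C t" "P \<in> over C (Dom C B)" "A = B \<cdot>\<^bsub>C\<^esub> P" "lev C t (Dom C B) < lev C t (Dom C P)" for A B P
 proof -
  have a: "P \<in> Arr C" "Cod C P = Dom C B" "B \<in> Arr C" "Cod C B = t" "Dom C A = Dom C P"
   using h by (auto simp: over_def)
  then obtain g where g: "g \<in> Arr C" "Dom C g = Cod C (indec C t (Dom C P))" "Cod C g = Cod C P"
    "g \<cdot>\<^bsub>C\<^esub> indec C t (Dom C P) = P"
   using factor[of P] h(4) by auto
  have "B \<cdot>\<^bsub>C\<^esub> g = bang (Cod C (indec C t (Dom C P)))"
   using g a bang_eq[of "B \<cdot>\<^bsub>C\<^esub> g"] by simp
  then show ?thesis
   using g a by (intro bexI[of _ "\<langle>B, g\<rangle>"]) (auto simp: slice_cat_def over_def)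
 qed
 show ?thesis
 proof (unfold_locales, goal_cases)
  case 1
  show ?case unfolding is_terminal_def
  proof (intro conjI ballI)
   show "Ident C t \<in> Obj (slice_cat C t)" by (simp add: slice_cat_def over_def)
   fix A assume A: "A \<in> Obj (slice_cat C t)"
   then have A': "A \<in> Arr C" "Cod C A = t" unfolding slice_cat_def over_def by simp_all
   show "\<exists>!f. f \<in> hom (slice_cat C t) A (Ident C t)"
   proof (rule ex1I[of _ "\<langle>Ident C t, A\<rangle>"])
    show "\<langle>Ident C t, A\<rangle> \<in> hom (slice_cat C t) A (Ident C t)"
     using A' by (simp add: slice_cat_def over_def hom_def)
    fix f assume "f \<in> hom (slice_cat C t) A (Ident C t)"
    then have f: "f \<in> Arr (slice_cat C t)" "ufst f = Ident C t" "ufst f \<cdot>\<^bsub>C\<^esub> usnd f = A"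
     unfolding hom_def by (auto simp: slice_cat_def)
    obtain B P where "f = \<langle>B, P\<rangle>" "P \<in> Arr C" "Cod C P = Dom C B" using arrE[OF f(1)] by blast
    then show "f = \<langle>Ident C t, A\<rangle>" using f(2,3) by simp
   qed
  qed
 next
  case (2 a)
  obtain B P where "a = \<langle>B, P\<rangle>" "B \<in> Arr C" "Cod C B = t" "P \<in> Arr C" "Cod C P = Dom C B" using arrE[OF 2] by blast
  then show ?case using level_mono[of P] by (simp add: slice_cat_def)
 next
  case (3 A)
  then have A: "A \<in> Arr C" "Cod C A = t" unfolding slice_cat_def over_def by simp_all
  have "A = Ident C t" if "Dom C A = t" using bang_eq[OF A] bang_base that by simp
  then show ?case using level_0[of "Dom C A"] A(1) by auto
 next
  case (4 a)
  obtain B P where a: "a = \<langle>B, P\<rangle>" "P \<in> Arr C" "Cod C P = Dom C B" "B \<in> Arr C" "Cod C B = t"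
   using arrE[OF 4(1)] by blast
  then have l: "lev C t (Dom C P) = lev C t (Cod C P)" using 4(2) by (simp add: slice_cat_def)
  have i: "Ident C (Dom C P) = P" by (rule level_eq[OF a(2) l])
  have d: "Dom C P = Dom C B" using level_eq_cod[OF a(2) l] a(3) by simp
  have "B \<cdot>\<^bsub>C\<^esub> P = B" using a i d by (metis comp_id)
  then show ?case using a i d by (simp add: slice_cat_def)
 next
  case (5 A)
  then have A: "A \<in> Arr C" "Cod C A = t" "0 < lev C t (Dom C A)" unfolding slice_cat_def over_def by simp_all
  have "bang (Cod C (indec C t (Dom C A))) \<cdot>\<^bsub>C\<^esub> indec C t (Dom C A) = A"
   using A by (simp add: bang_comp bang_eq)
  then show ?case using A by (simp add: slice_cat_def over_def)
 next
  case (6 a)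
  obtain B P where a: "a = \<langle>B, P\<rangle>" "B \<in> over C t" "P \<in> over C (Dom C B)"
   using arrE[OF 6(1)] by (auto simp: over_def)
  then show ?case using fact[OF a(2,3) refl] 6(2) by (simp add: slice_cat_def over_def)
 qed
qed

section \<open>Path categories of rooted graphs\<close>

locale path_tree =
 fixes V :: "'a univ set" and l :: "'a univ \<Rightarrow> nat" and ft :: "'a univ \<Rightarrow> 'a univ" and t :: "'a univ"
 assumes base: "t \<in> V" and l_0: "X \<in> V \<Longrightarrow> l X = 0 \<longleftrightarrow> X = t"
  and ft_V: "X \<in> V \<Longrightarrow> 0 < l X \<Longrightarrow> ft X \<in> V" and l_ft: "X \<in> V \<Longrightarrow> 0 < l X \<Longrightarrow> l (ft X) = l X - 1"
begin

lemma ftk: "X \<in> V \<Longrightarrow> k \<le> l X \<Longrightarrow> (ft ^^ k) X \<in> V \<and> l ((ft ^^ k) X) = l X - k"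
proof (induction k)
 case (Suc k)
 then show ?case using ft_V[of "(ft ^^ k) X"] l_ft[of "(ft ^^ k) X"] by auto
qed auto

lemma path_cat_simps [simp]:
 "Obj (path_cat V l ft) = V"
 "\<langle>X, Num k\<rangle> \<in> Arr (path_cat V l ft) \<longleftrightarrow> X \<in> V \<and> k \<le> l X"
 "Dom (path_cat V l ft) a = ufst a"
 "Cod (path_cat V l ft) a = (ft ^^ unum (usnd a)) (ufst a)"
 "Ident (path_cat V l ft) X = \<langle>X, Num 0\<rangle>"
 "b \<cdot>\<^bsub>path_cat V l ft\<^esub> a = \<langle>ufst a, Num (unum (usnd a) + unum (usnd b))\<rangle>"
 by (auto simp: path_cat_def)

lemma path_arrE:
 assumes "a \<in> Arr (path_cat V l ft)"
 obtains X k where "a = \<langle>X, Num k\<rangle>" "X \<in> V" "k \<le> l X"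
 using assms by (auto simp: path_cat_def)

lemma is_category_path: "is_category (path_cat V l ft)"
 unfolding is_category_def
proof (intro conjI ballI impI, goal_cases)
 case (4 f g)
 obtain X k where f: "f = \<langle>X, Num k\<rangle>" "X \<in> V" "k \<le> l X" using 4(1) by (rule path_arrE)
 obtain Y j where g: "g = \<langle>Y, Num j\<rangle>" "Y \<in> V" "j \<le> l Y" using 4(2) by (rule path_arrE)
 show ?case using f g 4(3) ftk[OF f(2,3)] by (auto simp: hom_def funpow_add add.commute[of k j])
next
 case (7 f g h)
 then show ?case by (auto simp: add.assoc)
qed (auto elim!: path_arrE simp: ftk hom_def)

text \<open>A path of length \<open>k\<close> lowers \<open>l\<close> by \<open>k\<close>, so the
  only path from \<open>X\<close> to the root is the one of length \<open>l X\<close>; the edges are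
  the paths of length 1.\<close>

lemma path_rooted_tree: "rooted_tree (path_cat V l ft) t l (\<lambda>X. \<langle>X, Num 1\<rangle>)"
proof -
 interpret P: cat "path_cat V l ft" by (rule cat.intro[OF is_category_path])
 show ?thesis
 proof (unfold_locales, goal_cases)
  case 1
  have "\<exists>!f. f \<in> hom (path_cat V l ft) X t" if X: "X \<in> V" for X
  proof (rule ex1I[of _ "\<langle>X, Num (l X)\<rangle>"])
   show "\<langle>X, Num (l X)\<rangle> \<in> hom (path_cat V l ft) X t"
    using X ftk[OF X, of "l X"] l_0 by (auto simp: hom_def)
   fix f assume "f \<in> hom (path_cat V l ft) X t"
   then obtain k where k: "f = \<langle>X, Num k\<rangle>" "k \<le> l X" "(ft ^^ k) X = t"
    by (auto simp: hom_def elim!: path_arrE)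
   then show "f = \<langle>X, Num (l X)\<rangle>" using ftk[OF X k(2)] l_0[OF base] by auto
  qed
  then show ?case unfolding is_terminal_def using base by simp
 next
  case (6 f)
  then obtain X k where f: "f = \<langle>X, Num k\<rangle>" "X \<in> V" "k \<le> l X" by (auto elim: path_arrE)
  then obtain j where j: "k = Suc j" using 6(2) by (cases k) auto
  have "0 < l X" using f j by simp
  then show ?case using f ft_V[OF f(2)] l_ft[OF f(2)]
   by (intro bexI[of _ "\<langle>ft X, Num j\<rangle>"]) (auto simp: j funpow_swap1)
 qed (auto elim!: path_arrE simp: ftk l_0 l_ft ft_V)
qed

lemma path_lev: "X \<in> V \<Longrightarrow> lev (path_cat V l ft) t X = l X"
 and path_indec: "X \<in> V \<Longrightarrow> 0 < l X \<Longrightarrow> indec (path_cat V l ft) t X = \<langle>X, Num 1\<rangle>"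
 using rooted_tree_lev[OF path_rooted_tree] by auto

end

section \<open>Pullback squares\<close>

context cat
begin

lemma pullback_simps:
 assumes "is_pullback C f g h k"
 shows "f \<in> Arr C" "g \<in> Arr C" "h \<in> Arr C" "k \<in> Arr C" "Cod C f = Cod C g" "Cod C h = Dom C f"
  "Cod C k = Dom C g" "Dom C h = Dom C k" "f \<cdot> h = g \<cdot> k"
 using assms unfolding is_pullback_def by blast+

lemma pullback_ex:
 assumes "is_pullback C f g h k" "u \<in> Arr C" "v \<in> Arr C" "Dom C u = Dom C v" "Cod C u = Dom C f"
  "Cod C v = Dom C g" "f \<cdot> u = g \<cdot> v"
 shows "\<exists>w. w \<in> Arr C \<and> Dom C w = Dom C u \<and> Cod C w = Dom C h \<and> h \<cdot> w = u \<and> k \<cdot> w = v"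
proof -
 have "\<exists>!w. w \<in> hom C (Dom C u) (Dom C h) \<and> h \<cdot> w = u \<and> k \<cdot> w = v"
  using assms unfolding is_pullback_def by blast
 then show ?thesis by (auto simp: hom_def)
qed

lemma pullback_eqI:
 assumes pb: "is_pullback C f g h k" and w: "w \<in> Arr C" "Cod C w = Dom C h" and w': "w' \<in> Arr C" "Cod C w' = Dom C h"
  and eq: "Dom C w = Dom C w'" "h \<cdot> w = h \<cdot> w'" "k \<cdot> w = k \<cdot> w'"
 shows "w = w'"
proof -
 note 1 = pullback_simps[OF pb]
 have "(f \<cdot> h) \<cdot> w = (g \<cdot> k) \<cdot> w" by (simp only: 1(9))
 then have sq: "f \<cdot> (h \<cdot> w) = g \<cdot> (k \<cdot> w)"
  using 1(1-8) w by (simp add: assoc)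
 let ?u = "h \<cdot> w" and ?v = "k \<cdot> w"
 have a: "?u \<in> Arr C" "?v \<in> Arr C" "Dom C ?u = Dom C ?v" "Cod C ?u = Dom C f" "Cod C ?v = Dom C g" "Dom C ?u = Dom C w"
  using 1(1-8) w by auto
 have "\<exists>!x. x \<in> hom C (Dom C ?u) (Dom C h) \<and> h \<cdot> x = ?u \<and> k \<cdot> x = ?v"
  using pb a sq unfolding is_pullback_def by blast
 moreover have "w \<in> hom C (Dom C ?u) (Dom C h) \<and> h \<cdot> w = ?u \<and> k \<cdot> w = ?v"
  using w a(6) by (simp add: hom_def)
 moreover have "w' \<in> hom C (Dom C ?u) (Dom C h) \<and> h \<cdot> w' = ?u \<and> k \<cdot> w' = ?v"
  using w' a(6) eq(1) eq(2,3)[symmetric] by (simp add: hom_def)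
 ultimately show ?thesis by (blast elim: ex1E)
qed

lemma pullbackI:
 assumes "f \<in> Arr C" "g \<in> Arr C" "h \<in> Arr C" "k \<in> Arr C" "Cod C f = Cod C g" "Cod C h = Dom C f"
  "Cod C k = Dom C g" "Dom C h = Dom C k" "f \<cdot> h = g \<cdot> k"
  and ex: "\<And>u v. u \<in> Arr C \<Longrightarrow> v \<in> Arr C \<Longrightarrow> Dom C u = Dom C v \<Longrightarrow> Cod C u = Dom C f \<Longrightarrow> Cod C v = Dom C g \<Longrightarrow>
   f \<cdot> u = g \<cdot> v \<Longrightarrow>
   \<exists>w. w \<in> Arr C \<and> Dom C w = Dom C u \<and> Cod C w = Dom C h \<and> h \<cdot> w = u \<and> k \<cdot> w = v"
  and uniq: "\<And>w w'. w \<in> Arr C \<Longrightarrow> w' \<in> Arr C \<Longrightarrow> Dom C w = Dom C w' \<Longrightarrow> Cod C w = Dom C h \<Longrightarrow> Cod C w' = Dom C h \<Longrightarrow>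
   h \<cdot> w = h \<cdot> w' \<Longrightarrow> k \<cdot> w = k \<cdot> w' \<Longrightarrow> w = w'"
 shows "is_pullback C f g h k"
proof -
 have "\<exists>!w. w \<in> hom C (Dom C u) (Dom C h) \<and> h \<cdot> w = u \<and> k \<cdot> w = v"
  if uv: "u \<in> Arr C" "v \<in> Arr C" "Dom C u = Dom C v" "Cod C u = Dom C f" "Cod C v = Dom C g"
   "f \<cdot> u = g \<cdot> v" for u v
 proof -
  obtain w where w: "w \<in> Arr C" "Dom C w = Dom C u" "Cod C w = Dom C h" "h \<cdot> w = u" "k \<cdot> w = v"
   using ex[OF uv] by blast
  show ?thesis
  proof (rule ex1I[of _ w])
   show "w' = w" if "w' \<in> hom C (Dom C u) (Dom C h) \<and> h \<cdot> w' = u \<and> k \<cdot> w' = v" for w'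
    using uniq[of w' w] w that by (auto simp: hom_def)
  qed (use w in \<open>auto simp: hom_def\<close>)
 qed
 then show ?thesis using assms(1-9) by (simp add: is_pullback_def)
qed

text \<open>Pullbacks along a path are assembled in this way from the pullbacks along its
  edges.\<close>

lemma pullback_paste:
 assumes pa: "is_pullback C a f g b" and pc: "is_pullback C c g h e"
 shows "is_pullback C (a \<cdot> c) f h (b \<cdot> e)"
proof (rule pullbackI)
 note 1 = pullback_simps(1-8)[OF pa] and 2 = pullback_simps(1-8)[OF pc]
 note a = 1 2
 show "a \<cdot> c \<in> Arr C" "f \<in> Arr C" "h \<in> Arr C" "b \<cdot> e \<in> Arr C" "Cod C (a \<cdot> c) = Cod C f"
  "Cod C h = Dom C (a \<cdot> c)" "Cod C (b \<cdot> e) = Dom C f" "Dom C h = Dom C (b \<cdot> e)"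
  using a by simp_all
 have "(a \<cdot> c) \<cdot> h = a \<cdot> (c \<cdot> h)" using a by (simp add: assoc)
 also have "... = (a \<cdot> g) \<cdot> e" using a by (simp add: assoc pullback_simps(9)[OF pc])
 also have "... = f \<cdot> (b \<cdot> e)" using a by (simp add: assoc pullback_simps(9)[OF pa])
 finally show "(a \<cdot> c) \<cdot> h = f \<cdot> (b \<cdot> e)" .
 fix u v assume uv: "u \<in> Arr C" "v \<in> Arr C" "Dom C u = Dom C v" "Cod C u = Dom C (a \<cdot> c)" "Cod C v = Dom C f"
  "(a \<cdot> c) \<cdot> u = f \<cdot> v"
 have cu: "Cod C u = Dom C c" using uv(4) a by simp
 have "a \<cdot> (c \<cdot> u) = f \<cdot> v" using uv a cu by (simp add: assoc)
 then obtain x where x: "x \<in> Arr C" "Dom C x = Dom C (c \<cdot> u)" "Cod C x = Dom C g" "g \<cdot> x = c \<cdot> u" "b \<cdot> x = v"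
  using pullback_ex[OF pa, of "c \<cdot> u" v] uv cu a by auto
 have dx: "Dom C x = Dom C u" using x(2) uv(1) cu a by simp
 obtain w where w: "w \<in> Arr C" "Dom C w = Dom C u" "Cod C w = Dom C h" "h \<cdot> w = u" "e \<cdot> w = x"
  using pullback_ex[OF pc uv(1) x(1) dx[symmetric] cu x(3) x(4)[symmetric]] by blast
 have "(b \<cdot> e) \<cdot> w = v" using w x(5) a by (simp add: assoc)
 then show "\<exists>w. w \<in> Arr C \<and> Dom C w = Dom C u \<and> Cod C w = Dom C h \<and> h \<cdot> w = u \<and> (b \<cdot> e) \<cdot> w = v"
  using w by blast
next
 note 1 = pullback_simps(1-8)[OF pa] and 2 = pullback_simps(1-8)[OF pc]
 note a = 1 2
 fix w w' assume w: "w \<in> Arr C" "w' \<in> Arr C" "Dom C w = Dom C w'" "Cod C w = Dom C h" "Cod C w' = Dom C h"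
  "h \<cdot> w = h \<cdot> w'" "(b \<cdot> e) \<cdot> w = (b \<cdot> e) \<cdot> w'"
 have eq: "g \<cdot> (e \<cdot> x) = c \<cdot> (h \<cdot> x)" if "x \<in> Arr C" "Cod C x = Dom C h" for x
 proof -
  have "g \<cdot> (e \<cdot> x) = (g \<cdot> e) \<cdot> x" using that a by (simp add: assoc)
  also have "... = c \<cdot> (h \<cdot> x)" using that a unfolding pullback_simps(9)[OF pc, symmetric] by (simp add: assoc)
  finally show ?thesis .
 qed
 have "e \<cdot> w = e \<cdot> w'"
  by (rule pullback_eqI[OF pa])
   (use w(1-5) w(7) a eq[OF w(1,4)] eq[OF w(2,5)] w(6) in \<open>simp_all add: assoc\<close>)
 then show "w = w'" using w by (blast intro: pullback_eqI[OF pc])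
qed

lemma pullback_id: "f \<in> Arr C \<Longrightarrow> is_pullback C (Ident C (Cod C f)) f f (Ident C (Dom C f))"
 by (rule pullbackI) auto

end

section \<open>The axioms of C-systems and CE-systems on their carriers\<close>

locale csys =
 fixes S :: "'a csys"
 assumes is_csys: "is_csys S"

abbreviation (in csys) "CS \<equiv> c_cat S"

abbreviation (in csys) csys_comp (infixl "\<odot>" 70) where
 "g \<odot> f \<equiv> g \<cdot>\<^bsub>c_cat S\<^esub> f"

sublocale csys \<subseteq> cat "c_cat S"
 using is_csys unfolding is_csys_def Let_def cat_def by blast

context csys
begin

lemma one_obj [simp]: "c_one S \<in> Obj CS"
 and len_0: "X \<in> Obj CS \<Longrightarrow> c_len S X = 0 \<longleftrightarrow> X = c_one S"
 and ft_obj [simp]: "X \<in> Obj CS \<Longrightarrow> c_ft S X \<in> Obj CS"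
 and ft_one [simp]: "c_ft S (c_one S) = c_one S"
 and c_terminal: "is_terminal CS (c_one S)"
proof -
 show "c_one S \<in> Obj CS" "c_ft S (c_one S) = c_one S" "is_terminal CS (c_one S)"
  using is_csys unfolding is_csys_def Let_def by simp_all
 show "X \<in> Obj CS \<Longrightarrow> c_len S X = 0 \<longleftrightarrow> X = c_one S"
  using is_csys unfolding is_csys_def Let_def by simp
 show "X \<in> Obj CS \<Longrightarrow> c_ft S X \<in> Obj CS"
  using is_csys unfolding is_csys_def Let_def by simp
qed

text \<open>Truncated subtraction makes the formula hold at \<open>c_one S\<close> as well, where
  both sides are 0. Iterates of \<open>c_ft S\<close> can then be treated uniformly.\<close>

lemma len_ft: "X \<in> Obj CS \<Longrightarrow> c_len S (c_ft S X) = c_len S X - 1"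
proof -
 assume X: "X \<in> Obj CS"
 have "0 < c_len S X \<Longrightarrow> c_len S (c_ft S X) = c_len S X - 1"
  using is_csys X unfolding is_csys_def Let_def by blast
 then show ?thesis using len_0[OF X] by (cases "c_len S X") auto
qed

lemma p_arr [simp]:
 assumes "X \<in> Obj CS" "0 < c_len S X"
 shows "c_p S X \<in> Arr CS" "Dom CS (c_p S X) = X" "Cod CS (c_p S X) = c_ft S X"
 using is_csys assms unfolding is_csys_def Let_def hom_def by blast+

lemma q_arr [simp]:
 assumes "X \<in> Obj CS" "0 < c_len S X" "f \<in> Arr CS" "Cod CS f = c_ft S X"
 shows "c_pb S f X \<in> Obj CS" "0 < c_len S (c_pb S f X)" "c_ft S (c_pb S f X) = Dom CS f"
  "c_q S f X \<in> Arr CS" "Dom CS (c_q S f X) = c_pb S f X" "Cod CS (c_q S f X) = X"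
  and q_pullback: "is_pullback CS (c_p S X) f (c_q S f X) (c_p S (c_pb S f X))"
proof -
 have "\<forall>\<Gamma> \<in> Obj CS. c_len S \<Gamma> > 0 \<longrightarrow> (\<forall>f \<in> over CS (c_ft S \<Gamma>).
    c_pb S f \<Gamma> \<in> Obj CS \<and> c_len S (c_pb S f \<Gamma>) > 0 \<and> c_ft S (c_pb S f \<Gamma>) = Dom CS f \<and>
    c_q S f \<Gamma> \<in> hom CS (c_pb S f \<Gamma>) \<Gamma> \<and>
    is_pullback CS (c_p S \<Gamma>) f (c_q S f \<Gamma>) (c_p S (c_pb S f \<Gamma>)))"
  using is_csys unfolding is_csys_def Let_def by blast
 then have "c_pb S f X \<in> Obj CS \<and> c_len S (c_pb S f X) > 0 \<and> c_ft S (c_pb S f X) = Dom CS f \<and>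
    c_q S f X \<in> hom CS (c_pb S f X) X \<and>
    is_pullback CS (c_p S X) f (c_q S f X) (c_p S (c_pb S f X))"
  using assms by (auto simp: over_def)
 then show "c_pb S f X \<in> Obj CS" "0 < c_len S (c_pb S f X)" "c_ft S (c_pb S f X) = Dom CS f"
  "c_q S f X \<in> Arr CS" "Dom CS (c_q S f X) = c_pb S f X" "Cod CS (c_q S f X) = X"
  "is_pullback CS (c_p S X) f (c_q S f X) (c_p S (c_pb S f X))"
  by (auto simp: hom_def)
qed

lemma len_pb: "X \<in> Obj CS \<Longrightarrow> 0 < c_len S X \<Longrightarrow> f \<in> Arr CS \<Longrightarrow> Cod CS f = c_ft S X \<Longrightarrow>
  c_len S (c_pb S f X) = Suc (c_len S (Dom CS f))"
 using len_ft[of "c_pb S f X"] q_arr[of X f] by simp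

lemma pb_id:
 assumes "X \<in> Obj CS" "0 < c_len S X"
 shows "c_pb S (Ident CS (c_ft S X)) X = X" "c_q S (Ident CS (c_ft S X)) X = Ident CS X"
 using is_csys assms unfolding is_csys_def Let_def by blast+

lemma pb_comp:
 assumes "X \<in> Obj CS" "0 < c_len S X" "g \<in> Arr CS" "Cod CS g = c_ft S X"
  "f \<in> Arr CS" "Cod CS f = Dom CS g"
 shows "c_pb S (g \<odot> f) X = c_pb S f (c_pb S g X)"
  "c_q S (g \<odot> f) X = c_q S g X \<odot> c_q S f (c_pb S g X)"
proof -
 have "\<forall>\<Gamma> \<in> Obj CS. c_len S \<Gamma> > 0 \<longrightarrow> (\<forall>g \<in> over CS (c_ft S \<Gamma>). \<forall>f \<in> over CS (Dom CS g).
    c_pb S (g \<odot> f) \<Gamma> = c_pb S f (c_pb S g \<Gamma>) \<and>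
    c_q S (g \<odot> f) \<Gamma> = c_q S g \<Gamma> \<odot> c_q S f (c_pb S g \<Gamma>))"
  using is_csys unfolding is_csys_def Let_def by blast
 then show "c_pb S (g \<odot> f) X = c_pb S f (c_pb S g X)"
  "c_q S (g \<odot> f) X = c_q S g X \<odot> c_q S f (c_pb S g X)"
  using assms by (auto simp: over_def)
qed

lemma path_tree: "path_tree (Obj CS) (c_len S) (c_ft S) (c_one S)"
 by unfold_locales (auto simp: len_0 len_ft)

end

locale cesys =
 fixes S :: "'a cesys"
 assumes is_cesys: "is_cesys S"

sublocale cesys \<subseteq> F: cat "ce_fam S"
 using is_cesys unfolding is_cesys_def Let_def cat_def by blast

sublocale cesys \<subseteq> C: cat "ce_cat S"
 using is_cesys unfolding is_cesys_def Let_def cat_def by blast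

context cesys
begin

abbreviation "CC \<equiv> ce_cat S"
abbreviation ce_comp (infixl "\<odot>" 70) where "g \<odot> f \<equiv> g \<cdot>\<^bsub>CC\<^esub> f"
abbreviation "FF \<equiv> ce_fam S"

lemma obj_eq [simp]: "Obj (ce_cat S) = Obj (ce_fam S)"
 and one_terminal: "is_terminal (ce_fam S) (ce_one S)"
 and I_functor: "is_functor (ce_fam S) (ce_cat S) \<lparr>onObj = (\<lambda>X. X), onArr = ce_I S\<rparr>"
proof -
 have "Obj FF = Obj CC \<and> is_functor FF CC \<lparr>onObj = (\<lambda>X. X), onArr = ce_I S\<rparr> \<and> is_terminal FF (ce_one S)"
  using is_cesys unfolding is_cesys_def Let_def by blast
 then show "Obj (ce_cat S) = Obj (ce_fam S)" "is_terminal (ce_fam S) (ce_one S)"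
  "is_functor (ce_fam S) (ce_cat S) \<lparr>onObj = (\<lambda>X. X), onArr = ce_I S\<rparr>" by auto
qed

lemma I_arr [simp]: "A \<in> Arr FF \<Longrightarrow> ce_I S A \<in> Arr CC"
 "A \<in> Arr FF \<Longrightarrow> Dom CC (ce_I S A) = Dom FF A"
 "A \<in> Arr FF \<Longrightarrow> Cod CC (ce_I S A) = Cod FF A"
 using functor_arr[OF I_functor] by auto

lemma I_id [simp]: "X \<in> Obj FF \<Longrightarrow> ce_I S (Ident FF X) = Ident CC X"
 using functor_id[OF I_functor] by auto

lemma I_comp: "A \<in> Arr FF \<Longrightarrow> P \<in> Arr FF \<Longrightarrow> Dom FF A = Cod FF P \<Longrightarrow>
  ce_I S (A \<cdot>\<^bsub>FF\<^esub> P) = ce_I S A \<odot> ce_I S P"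
 using functor_comp[OF I_functor] by auto

lemma dom_C_obj [simp]: "f \<in> Arr CC \<Longrightarrow> Dom CC f \<in> Obj FF" "f \<in> Arr CC \<Longrightarrow> Cod CC f \<in> Obj FF"
 using C.dom_obj C.cod_obj by auto

lemma id_C [simp]: "X \<in> Obj FF \<Longrightarrow> Ident CC X \<in> Arr CC" "X \<in> Obj FF \<Longrightarrow> Dom CC (Ident CC X) = X"
 "X \<in> Obj FF \<Longrightarrow> Cod CC (Ident CC X) = X"
 using C.id_arr C.dom_id C.cod_id by auto

lemma pb_arr [simp]:
 assumes "f \<in> Arr CC" "A \<in> Arr FF" "Cod FF A = Cod CC f"
 shows "ce_pb S f A \<in> Arr FF" "Cod FF (ce_pb S f A) = Dom CC f"
  "ce_pi2 S f A \<in> Arr CC" "Dom CC (ce_pi2 S f A) = Dom FF (ce_pb S f A)" "Cod CC (ce_pi2 S f A) = Dom FF A"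
  and pb_pullback: "is_pullback CC (ce_I S A) f (ce_pi2 S f A) (ce_I S (ce_pb S f A))"
proof -
 have "\<forall>f \<in> Arr CC. \<forall>A \<in> over FF (Cod CC f).
    ce_pb S f A \<in> over FF (Dom CC f) \<and>
    ce_pi2 S f A \<in> hom CC (Dom FF (ce_pb S f A)) (Dom FF A) \<and>
    is_pullback CC (ce_I S A) f (ce_pi2 S f A) (ce_I S (ce_pb S f A))"
  using is_cesys unfolding is_cesys_def Let_def by blast
 then have "ce_pb S f A \<in> over FF (Dom CC f) \<and>
    ce_pi2 S f A \<in> hom CC (Dom FF (ce_pb S f A)) (Dom FF A) \<and>
    is_pullback CC (ce_I S A) f (ce_pi2 S f A) (ce_I S (ce_pb S f A))"
  using assms by (auto simp: over_def)
 then show "ce_pb S f A \<in> Arr FF" "Cod FF (ce_pb S f A) = Dom CC f"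
  "ce_pi2 S f A \<in> Arr CC" "Dom CC (ce_pi2 S f A) = Dom FF (ce_pb S f A)" "Cod CC (ce_pi2 S f A) = Dom FF A"
  "is_pullback CC (ce_I S A) f (ce_pi2 S f A) (ce_I S (ce_pb S f A))"
  by (auto simp: hom_def over_def)
qed

lemma pb_square:
 assumes "f \<in> Arr CC" "A \<in> Arr FF" "Cod FF A = Cod CC f"
 shows "ce_I S A \<odot> ce_pi2 S f A = f \<odot> ce_I S (ce_pb S f A)"
 using pb_pullback[OF assms] unfolding is_pullback_def by blast

lemma pb_ident [simp]:
 assumes "f \<in> Arr CC" "Cod CC f = X"
 shows "ce_pb S f (Ident FF X) = Ident FF (Dom CC f)" "ce_pi2 S f (Ident FF X) = f"
proof -
 have "\<forall>f \<in> Arr CC. ce_pb S f (Ident FF (Cod CC f)) = Ident FF (Dom CC f) \<and> ce_pi2 S f (Ident FF (Cod CC f)) = f"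
  using is_cesys unfolding is_cesys_def Let_def by blast
 then show "ce_pb S f (Ident FF X) = Ident FF (Dom CC f)" "ce_pi2 S f (Ident FF X) = f" using assms by auto
qed

lemma ident_pb [simp]:
 assumes "A \<in> Arr FF" "Cod FF A = X"
 shows "ce_pb S (Ident CC X) A = A" "ce_pi2 S (Ident CC X) A = Ident CC (Dom FF A)"
proof -
 have "\<forall>\<Gamma> \<in> Obj FF. \<forall>A \<in> over FF \<Gamma>.
    ce_pb S (Ident CC \<Gamma>) A = A \<and> ce_pi2 S (Ident CC \<Gamma>) A = Ident CC (Dom FF A)"
  using is_cesys unfolding is_cesys_def Let_def by blast
 then show "ce_pb S (Ident CC X) A = A" "ce_pi2 S (Ident CC X) A = Ident CC (Dom FF A)"
  using assms by (auto simp: over_def)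
qed

lemma comp_pb:
 assumes "f \<in> Arr CC" "g \<in> Arr CC" "Cod CC g = Dom CC f" "A \<in> Arr FF" "Cod FF A = Cod CC f"
 shows "ce_pb S (f \<odot> g) A = ce_pb S g (ce_pb S f A)"
  "ce_pi2 S (f \<odot> g) A = ce_pi2 S f A \<odot> ce_pi2 S g (ce_pb S f A)"
proof -
 have "\<forall>f \<in> Arr CC. \<forall>g \<in> over CC (Dom CC f). \<forall>A \<in> over FF (Cod CC f).
    ce_pb S (f \<odot> g) A = ce_pb S g (ce_pb S f A) \<and>
    ce_pi2 S (f \<odot> g) A = ce_pi2 S f A \<odot> ce_pi2 S g (ce_pb S f A)"
  using is_cesys unfolding is_cesys_def Let_def by blast
 then show "ce_pb S (f \<odot> g) A = ce_pb S g (ce_pb S f A)"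
  "ce_pi2 S (f \<odot> g) A = ce_pi2 S f A \<odot> ce_pi2 S g (ce_pb S f A)"
  using assms by (auto simp: over_def)
qed

lemma pb_comp:
 assumes "f \<in> Arr CC" "A \<in> Arr FF" "Cod FF A = Cod CC f" "P \<in> Arr FF" "Cod FF P = Dom FF A"
 shows "ce_pb S f (A \<cdot>\<^bsub>FF\<^esub> P) = ce_pb S f A \<cdot>\<^bsub>FF\<^esub> ce_pb S (ce_pi2 S f A) P"
  "ce_pi2 S f (A \<cdot>\<^bsub>FF\<^esub> P) = ce_pi2 S (ce_pi2 S f A) P"
proof -
 have "\<forall>f \<in> Arr CC. \<forall>A \<in> over FF (Cod CC f). \<forall>P \<in> over FF (Dom FF A).
    ce_pb S f (A \<cdot>\<^bsub>FF\<^esub> P) = ce_pb S f A \<cdot>\<^bsub>FF\<^esub> ce_pb S (ce_pi2 S f A) P \<and>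
    ce_pi2 S f (A \<cdot>\<^bsub>FF\<^esub> P) = ce_pi2 S (ce_pi2 S f A) P"
  using is_cesys unfolding is_cesys_def Let_def by blast
 then show "ce_pb S f (A \<cdot>\<^bsub>FF\<^esub> P) = ce_pb S f A \<cdot>\<^bsub>FF\<^esub> ce_pb S (ce_pi2 S f A) P"
  "ce_pi2 S f (A \<cdot>\<^bsub>FF\<^esub> P) = ce_pi2 S (ce_pi2 S f A) P"
  using assms by (auto simp: over_def)
qed

end

locale strat_cesys = cesys S for S :: "'a cesys" +
 assumes is_rooted: "is_rooted_cesys S" and is_strat: "is_stratified_cesys S"

sublocale strat_cesys \<subseteq> T: strat_cat "ce_fam S" "ce_one S"
 by unfold_locales (use one_terminal is_strat in \<open>auto simp: is_stratified_cesys_def\<close>)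

text \<open>The stratification axiom equates two truncated differences. Arrows never raise the
  level, so the difference on the side of the pullback is exact and can be solved for the level of
  its domain.\<close>

lemma (in strat_cesys) lev_pb:
 assumes "f \<in> Arr CC" "A \<in> Arr FF" "Cod FF A = Cod CC f"
 shows "ce_lev S (Dom FF (ce_pb S f A)) = ce_lev S (Dom FF A) - ce_lev S (Cod CC f) + ce_lev S (Dom CC f)"
proof -
 have "ce_lev S (Dom FF A) - ce_lev S (Cod CC f) = ce_lev S (Dom FF (ce_pb S f A)) - ce_lev S (Dom CC f)"
  using is_strat assms unfolding is_stratified_cesys_def by (auto simp: over_def)
 moreover have "ce_lev S (Dom CC f) \<le> ce_lev S (Dom FF (ce_pb S f A))"
  using T.level_mono[of "ce_pb S f A"] assms by simp
 ultimately show ?thesis by simp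
qed

section \<open>The category of C-systems\<close>

lemma fmap_restrict_simps [simp]:
 "X \<in> Obj C \<Longrightarrow> onObj (fmap_restrict C F) X = onObj F X"
 "f \<in> Arr C \<Longrightarrow> onArr (fmap_restrict C F) f = onArr F f"
 by (auto simp: fmap_restrict_def)

lemma fmap_comp_simps [simp]:
 "onObj (G \<circ>\<^sub>F F) X = onObj G (onObj F X)" "onArr (G \<circ>\<^sub>F F) f = onArr G (onArr F f)"
 "onObj fmap_id X = X" "onArr fmap_id f = f"
 by (auto simp: fmap_comp_def fmap_id_def)

lemma fmap_extensional_restrict [simp]: "fmap_extensional C (fmap_restrict C F)"
 by (auto simp: fmap_extensional_def fmap_restrict_def)

lemma fmap_eqI:
 assumes "fmap_extensional C F" "fmap_extensional C G"
  and "\<And>X. X \<in> Obj C \<Longrightarrow> onObj F X = onObj G X" "\<And>f. f \<in> Arr C \<Longrightarrow> onArr F f = onArr G f"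
 shows "F = G"
 using assms unfolding fmap_extensional_def
 by (intro fmap.equality extensionalityI[of _ "Obj C"] extensionalityI[of _ "Arr C"]) auto

lemma (in cat) functor_restrict: "is_functor C D (fmap_restrict C F) \<longleftrightarrow> is_functor C D F"
 unfolding is_functor_def by auto

lemma is_functor_id: "is_functor C C fmap_id"
 by (simp add: is_functor_def fmap_id_def hom_def)

locale csys_hom = S: csys S + S': csys S' for S S' :: "'a csys" +
 fixes F :: "'a sfmap"
 assumes is_hom: "is_csys_hom S S' F"
begin

lemma is_fun: "is_functor (c_cat S) (c_cat S') F"
 using is_hom unfolding is_csys_hom_def by blast

lemma hom_obj [simp]: "X \<in> Obj (c_cat S) \<Longrightarrow> onObj F X \<in> Obj (c_cat S')"
 using functor_obj[OF is_fun] .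

lemma hom_arr [simp]: "f \<in> Arr (c_cat S) \<Longrightarrow> onArr F f \<in> Arr (c_cat S')"
 "f \<in> Arr (c_cat S) \<Longrightarrow> Dom (c_cat S') (onArr F f) = onObj F (Dom (c_cat S) f)"
 "f \<in> Arr (c_cat S) \<Longrightarrow> Cod (c_cat S') (onArr F f) = onObj F (Cod (c_cat S) f)"
 using functor_arr[OF is_fun] by auto

lemma hom_id [simp]: "X \<in> Obj (c_cat S) \<Longrightarrow> onArr F (Ident (c_cat S) X) = Ident (c_cat S') (onObj F X)"
 using functor_id[OF is_fun] .

lemma hom_comp: "f \<in> Arr (c_cat S) \<Longrightarrow> g \<in> Arr (c_cat S) \<Longrightarrow> Dom (c_cat S) g = Cod (c_cat S) f \<Longrightarrow>
  onArr F (g \<cdot>\<^bsub>c_cat S\<^esub> f) = onArr F g \<cdot>\<^bsub>c_cat S'\<^esub> onArr F f"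
 using functor_comp[OF is_fun] .

lemma hom_one [simp]: "onObj F (c_one S) = c_one S'"
 and hom_len [simp]: "X \<in> Obj (c_cat S) \<Longrightarrow> c_len S' (onObj F X) = c_len S X"
 and hom_ft: "X \<in> Obj (c_cat S) \<Longrightarrow> onObj F (c_ft S X) = c_ft S' (onObj F X)"
 and hom_p: "X \<in> Obj (c_cat S) \<Longrightarrow> 0 < c_len S X \<Longrightarrow> onArr F (c_p S X) = c_p S' (onObj F X)"
 and hom_q: "X \<in> Obj (c_cat S) \<Longrightarrow> 0 < c_len S X \<Longrightarrow> f \<in> Arr (c_cat S) \<Longrightarrow> Cod (c_cat S) f = c_ft S X \<Longrightarrow>
   onObj F (c_pb S f X) = c_pb S' (onArr F f) (onObj F X) \<and>
   onArr F (c_q S f X) = c_q S' (onArr F f) (onObj F X)"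
 using is_hom unfolding is_csys_hom_def over_def by auto

end

lemma csys_hom_id: "is_csys S \<Longrightarrow> is_csys_hom S S fmap_id"
 unfolding is_csys_hom_def by (auto simp: is_csys_def Let_def is_functor_id)

lemma csys_hom_comp:
 assumes "csys_hom S S' F" "csys_hom S' S'' G"
 shows "is_csys_hom S S'' (G \<circ>\<^sub>F F)"
proof -
 interpret F: csys_hom S S' F by fact
 interpret G: csys_hom S' S'' G by fact
 show ?thesis
  unfolding is_csys_hom_def
  using is_functor_comp[OF F.is_fun G.is_fun]
  by (auto simp: over_def F.hom_ft G.hom_ft F.hom_p G.hom_p F.hom_q G.hom_q)
qed

text \<open>Every condition on a homomorphism evaluates it on the carriers, so passing to the
  extensional representative does not affect any of them.\<close>

lemma csys_hom_restrict:
 assumes "is_csys S"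
 shows "is_csys_hom S S' (fmap_restrict (c_cat S) F) \<longleftrightarrow> is_csys_hom S S' F"
proof -
 interpret csys S by (rule csys.intro[OF assms])
 show ?thesis
  unfolding is_csys_hom_def functor_restrict by (auto simp: over_def)
qed

lemma csys_homI: "is_csys S \<Longrightarrow> is_csys S' \<Longrightarrow> is_csys_hom S S' F \<Longrightarrow> csys_hom S S' F"
 by (simp add: csys_hom_def csys_def csys_hom_axioms_def)

lemma is_category_Csys: "is_category Csys"
 unfolding Csys_def
proof (rule is_category_mk_category, goal_cases)
 case (1 S)
 then show ?case by (simp add: csys_hom_restrict csys_hom_id)
next
 case (2 S S' S'' F G)
 then have "is_csys_hom S S'' (G \<circ>\<^sub>F F)" using csys_hom_comp[OF csys_homI csys_homI, of S S' F S'' G] by simp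
 then show ?case using 2 by (simp add: csys_hom_restrict)
next
 case (3 S S' F)
 then interpret csys_hom S S' F by (simp add: csys_homI)
 show ?case using 3 by (auto intro!: fmap_eqI[of "c_cat S"])
next
 case (4 S S' S'' T F G H)
 interpret F: csys_hom S S' F using 4 by (simp add: csys_homI)
 interpret G: csys_hom S' S'' G using 4 by (simp add: csys_homI)
 show ?case by (auto intro!: fmap_eqI[of "c_cat S"])
qed

section \<open>From C-systems to CE-systems\<close>

context csys
begin

abbreviation fts :: "nat \<Rightarrow> 'a univ \<Rightarrow> 'a univ" where
 "fts k \<equiv> c_ft S ^^ k"

lemma fts_obj [simp]: "X \<in> Obj CS \<Longrightarrow> fts k X \<in> Obj CS"
 by (induction k) auto

lemma len_fts: "X \<in> Obj CS \<Longrightarrow> c_len S (fts k X) = c_len S X - k"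
 by (induction k) (auto simp: len_ft)

text \<open>The object at which the pulled back path starts. Pulling back keeps the length of a
  path, so this object determines \<open>CE_pb\<close> completely and the recursion through
  composites of paths disappears.\<close>

fun ppb :: "'a univ \<Rightarrow> 'a univ \<Rightarrow> nat \<Rightarrow> 'a univ" where
 "ppb f X 0 = Dom CS f"
| "ppb f X (Suc k) = c_pb S (CE_pi2 S f (c_ft S X) k) X"

interpretation P: path_tree "Obj CS" "c_len S" "c_ft S" "c_one S"
 by (rule path_tree)

lemma CE_fam_simps [simp]:
 "Obj (CE_fam S) = Obj CS"
 "\<langle>X, Num k\<rangle> \<in> Arr (CE_fam S) \<longleftrightarrow> X \<in> Obj CS \<and> k \<le> c_len S X"
 "Dom (CE_fam S) a = ufst a"
 "Cod (CE_fam S) a = fts (unum (usnd a)) (ufst a)"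
 "Ident (CE_fam S) X = \<langle>X, Num 0\<rangle>"
 "b \<cdot>\<^bsub>CE_fam S\<^esub> a = \<langle>ufst a, Num (unum (usnd a) + unum (usnd b))\<rangle>"
 by (auto simp: CE_fam_def)

lemma CE_arrE:
 assumes "a \<in> Arr (CE_fam S)"
 obtains X k where "a = \<langle>X, Num k\<rangle>" "X \<in> Obj CS" "k \<le> c_len S X"
 using assms P.path_arrE unfolding CE_fam_def by blast

lemma CE_pb: "CE_pb S f X k = \<langle>ppb f X k, Num k\<rangle>"
proof (induction k arbitrary: X)
 case (Suc k)
 then show ?case by simp
qed simp

lemma CE_I [simp]:
 assumes "X \<in> Obj CS" "k \<le> c_len S X"
 shows "CE_I S X k \<in> Arr CS" "Dom CS (CE_I S X k) = X" "Cod CS (CE_I S X k) = fts k X"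
proof -
 have "CE_I S X k \<in> Arr CS \<and> Dom CS (CE_I S X k) = X \<and> Cod CS (CE_I S X k) = fts k X"
  using assms
 proof (induction k arbitrary: X)
  case (Suc k)
  have "k \<le> c_len S (c_ft S X)" using Suc by (simp add: len_ft)
  then show ?case using Suc.IH[of "c_ft S X"] Suc.prems by (simp add: funpow_swap1)
 qed simp
 then show "CE_I S X k \<in> Arr CS" "Dom CS (CE_I S X k) = X" "Cod CS (CE_I S X k) = fts k X"
  by auto
qed

lemma CE_I_add:
 assumes "X \<in> Obj CS" "j + k \<le> c_len S X"
 shows "CE_I S X (j + k) = CE_I S (fts j X) k \<odot> CE_I S X j"
 using assms
proof (induction j arbitrary: X)
 case 0
 then show ?case by simp
next
 case (Suc j)
 have le: "j + k \<le> c_len S (c_ft S X)" "j \<le> c_len S (c_ft S X)" using Suc by (simp_all add: len_ft)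
 have "k \<le> c_len S (fts j (c_ft S X))" using Suc.prems by (simp add: len_fts len_ft)
 then show ?case using Suc.IH[of "c_ft S X"] Suc.prems le by (simp add: assoc funpow_swap1)
qed

text \<open>Induction on the length of the path: the square of a path with one more edge is the
  pasting of the square of the shorter path with the canonical square of \<open>X\<close> along the
  connecting arrow obtained so far.\<close>

lemma CE_pi2_facts:
 assumes "X \<in> Obj CS" "k \<le> c_len S X" "f \<in> Arr CS" "Cod CS f = fts k X"
 shows "CE_pi2 S f X k \<in> Arr CS \<and> Dom CS (CE_pi2 S f X k) = ppb f X k \<and>
  Cod CS (CE_pi2 S f X k) = X \<and> ppb f X k \<in> Obj CS \<and>
  c_len S (ppb f X k) = c_len S (Dom CS f) + k \<and> fts k (ppb f X k) = Dom CS f \<and>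
  is_pullback CS (CE_I S X k) f (CE_pi2 S f X k) (CE_I S (ppb f X k) k)"
 using assms
proof (induction k arbitrary: X)
 case 0
 then show ?case using pullback_id[of f] by simp
next
 case (Suc k)
 let ?Y = "c_ft S X" and ?g = "CE_pi2 S f (c_ft S X) k"
 have "k \<le> c_len S ?Y" "Cod CS f = fts k ?Y" using Suc.prems by (simp_all add: len_ft funpow_swap1)
 note IH = Suc.IH[OF ft_obj[OF Suc.prems(1)] this(1) Suc.prems(3) this(2)]
 have X: "0 < c_len S X" using Suc.prems by simp
 have g: "?g \<in> Arr CS" "Cod CS ?g = ?Y" using IH by auto
 note q = q_arr[OF Suc.prems(1) X g]
 have "is_pullback CS (CE_I S ?Y k \<odot> c_p S X) f (c_q S ?g X)
   (CE_I S (ppb f ?Y k) k \<odot> c_p S (c_pb S ?g X))"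
  using IH q_pullback[OF Suc.prems(1) X g] by (intro pullback_paste) auto
 \<comment> \<open>This identifies the composite on the side of the pasted square with
   \<open>CE_I\<close> of the pulled back path, whose first edge is
   \<open>c_p S (c_pb S ?g X)\<close>.\<close>
 moreover have "c_ft S (c_pb S ?g X) = ppb f ?Y k" using q IH by simp
 ultimately show ?case
  using q IH len_pb[OF Suc.prems(1) X g] by (simp add: funpow_swap1 del: funpow.simps) (simp add: funpow_swap1)
qed

lemma CE_pi2_id:
 assumes "X \<in> Obj CS" "k \<le> c_len S X"
 shows "ppb (Ident CS (fts k X)) X k = X \<and> CE_pi2 S (Ident CS (fts k X)) X k = Ident CS X"
 using assms
proof (induction k arbitrary: X)
 case (Suc k)
 have "k \<le> c_len S (c_ft S X)" using Suc.prems by (simp add: len_ft)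
 then show ?case using Suc.IH[of "c_ft S X"] Suc.prems pb_id[of X] by (simp add: funpow_swap1)
qed simp

lemma CE_pi2_comp:
 assumes "X \<in> Obj CS" "k \<le> c_len S X" "f \<in> Arr CS" "Cod CS f = fts k X"
  "g \<in> Arr CS" "Cod CS g = Dom CS f"
 shows "ppb (f \<odot> g) X k = ppb g (ppb f X k) k \<and>
  CE_pi2 S (f \<odot> g) X k = CE_pi2 S f X k \<odot> CE_pi2 S g (ppb f X k) k"
 using assms
proof (induction k arbitrary: X)
 case (Suc k)
 let ?Y = "c_ft S X"
 let ?f = "CE_pi2 S f (c_ft S X) k"
 let ?g = "CE_pi2 S g (ppb f (c_ft S X) k) k"
 have a: "k \<le> c_len S ?Y" "Cod CS f = fts k ?Y" using Suc.prems by (simp_all add: len_ft funpow_swap1)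
 note IH = Suc.IH[OF ft_obj[OF Suc.prems(1)] a(1) Suc.prems(3) a(2) Suc.prems(5,6)]
 note F = CE_pi2_facts[OF ft_obj[OF Suc.prems(1)] a(1) Suc.prems(3) a(2)]
 have G: "?g \<in> Arr CS \<and> Cod CS ?g = ppb f ?Y k"
  using CE_pi2_facts[of "ppb f ?Y k" k g] F Suc.prems by simp
 have X: "0 < c_len S X" using Suc.prems by simp
 have ft: "c_ft S (c_pb S ?f X) = ppb f ?Y k" using q_arr[OF Suc.prems(1) X, of ?f] F by simp
 show ?case using IH ft pb_comp[OF Suc.prems(1) X, of ?f ?g] F G by simp
qed simp

text \<open>Clause (d) of CE-systems for paths: the \<open>j\<close> edges next to \<open>X\<close>
  are pulled back along the connecting arrow of the remaining \<open>k\<close> edges. The last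
  assumption settles \<open>j = 0\<close>, where \<open>ppb\<close> is by definition a
  domain.\<close>

lemma CE_pi2_add:
 assumes "X \<in> Obj CS" "j + k \<le> c_len S X"
  "Dom CS (CE_pi2 S f (fts j X) k) = ppb f (fts j X) k"
 shows "ppb f X (j + k) = ppb (CE_pi2 S f (fts j X) k) X j \<and>
  CE_pi2 S f X (j + k) = CE_pi2 S (CE_pi2 S f (fts j X) k) X j"
 using assms
proof (induction j arbitrary: X)
 case (Suc j)
 have "j + k \<le> c_len S (c_ft S X)" using Suc.prems by (simp add: len_ft)
 then show ?case using Suc.IH[of "c_ft S X"] Suc.prems by (simp add: funpow_swap1)
qed simp

lemma CE_obj_simps [simp]:
 "ce_fam (CE_obj S) = CE_fam S" "ce_cat (CE_obj S) = c_cat S" "ce_one (CE_obj S) = c_one S"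
 "ce_I (CE_obj S) \<langle>X, Num k\<rangle> = CE_I S X k"
 "ce_pb (CE_obj S) f \<langle>X, Num k\<rangle> = \<langle>ppb f X k, Num k\<rangle>"
 "ce_pi2 (CE_obj S) f \<langle>X, Num k\<rangle> = CE_pi2 S f X k"
 by (auto simp: CE_obj_def CE_pb)

lemma CE_lev [simp]: "X \<in> Obj CS \<Longrightarrow> lev (CE_fam S) (c_one S) X = c_len S X"
 and CE_indec: "X \<in> Obj CS \<Longrightarrow> 0 < c_len S X \<Longrightarrow> indec (CE_fam S) (c_one S) X = \<langle>X, Num 1\<rangle>"
 using P.path_lev P.path_indec unfolding CE_fam_def by auto

lemma CE_over: "A \<in> over (CE_fam S) X \<longleftrightarrow> (\<exists>Y k. A = \<langle>Y, Num k\<rangle> \<and> Y \<in> Obj CS \<and> k \<le> c_len S Y \<and> fts k Y = X)"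
 unfolding over_def by (auto elim!: CE_arrE)

lemma is_cesys_CE: "is_cesys (CE_obj S)"
 unfolding is_cesys_def Let_def CE_obj_simps
proof (intro conjI ballI, goal_cases)
 case 1
 show ?case unfolding CE_fam_def by (rule P.is_category_path)
next
 case 2
 show ?case by (rule is_cat)
next
 case 3
 show ?case by simp
next
 case 4
 have c: "CE_I S X (i + k) = CE_I S (fts i X) k \<odot> CE_I S X i"
  if "X \<in> Obj CS" "i \<le> c_len S X" "k \<le> c_len S (fts i X)" for X i k
  using CE_I_add[of X i k] that by (simp add: len_fts)
 have e: "ce_I (CE_obj S) = (\<lambda>p. CE_I S (ufst p) (unum (usnd p)))" by (simp add: CE_obj_def)
 show ?case unfolding is_functor_def e
  by (auto elim!: CE_arrE simp: hom_def c)
next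
 case 5
 show ?case using rooted_tree.terminal[OF P.path_rooted_tree] unfolding CE_fam_def .
next
 case (6 f A)
 then obtain X k where A: "A = \<langle>X, Num k\<rangle>" "X \<in> Obj CS" "k \<le> c_len S X" "fts k X = Cod CS f"
  by (auto simp: CE_over)
 then show ?case using CE_pi2_facts[of X k f] 6 by (simp add: over_def)
next
 case (7 f A)
 then obtain X k where A: "A = \<langle>X, Num k\<rangle>" "X \<in> Obj CS" "k \<le> c_len S X" "fts k X = Cod CS f"
  by (auto simp: CE_over)
 then show ?case using CE_pi2_facts[of X k f] 7 by (simp add: hom_def)
next
 case (8 f A)
 then obtain X k where A: "A = \<langle>X, Num k\<rangle>" "X \<in> Obj CS" "k \<le> c_len S X" "fts k X = Cod CS f"
  by (auto simp: CE_over)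
 then show ?case using CE_pi2_facts[of X k f] 8 by simp
next
 case (11 \<Gamma> A)
 then obtain X k where A: "A = \<langle>X, Num k\<rangle>" "X \<in> Obj CS" "k \<le> c_len S X" "fts k X = \<Gamma>"
  by (auto simp: CE_over)
 then show ?case using CE_pi2_id[of X k] by simp
next
 case (12 \<Gamma> A)
 then obtain X k where A: "A = \<langle>X, Num k\<rangle>" "X \<in> Obj CS" "k \<le> c_len S X" "fts k X = \<Gamma>"
  by (auto simp: CE_over)
 then show ?case using CE_pi2_id[of X k] by simp
next
 case (13 f g A)
 then obtain X k where A: "A = \<langle>X, Num k\<rangle>" "X \<in> Obj CS" "k \<le> c_len S X" "fts k X = Cod CS f"
  by (auto simp: CE_over)
 then show ?case using CE_pi2_comp[of X k f g] 13 by (simp add: over_def)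
next
 case (14 f g A)
 then obtain X k where A: "A = \<langle>X, Num k\<rangle>" "X \<in> Obj CS" "k \<le> c_len S X" "fts k X = Cod CS f"
  by (auto simp: CE_over)
 then show ?case using CE_pi2_comp[of X k f g] 14 by (simp add: over_def)
next
 case (15 f A P)
 then obtain X k where A: "A = \<langle>X, Num k\<rangle>" "X \<in> Obj CS" "k \<le> c_len S X" "fts k X = Cod CS f"
  by (auto simp: CE_over)
 obtain Y j where P: "P = \<langle>Y, Num j\<rangle>" "Y \<in> Obj CS" "j \<le> c_len S Y" "fts j Y = X"
  using 15(3) A by (auto simp: CE_over)
 show ?case using CE_pi2_add[of Y j k f] CE_pi2_facts[of X k f] A P 15 len_fts[of Y j] by simp
next
 case (16 f A P)
 then obtain X k where A: "A = \<langle>X, Num k\<rangle>" "X \<in> Obj CS" "k \<le> c_len S X" "fts k X = Cod CS f"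
  by (auto simp: CE_over)
 obtain Y j where P: "P = \<langle>Y, Num j\<rangle>" "Y \<in> Obj CS" "j \<le> c_len S Y" "fts j Y = X"
  using 16(3) A by (auto simp: CE_over)
 show ?case using CE_pi2_add[of Y j k f] CE_pi2_facts[of X k f] A P 16 len_fts[of Y j] by simp
qed simp_all

lemma is_rooted_CE: "is_rooted_cesys (CE_obj S)"
 using c_terminal by (simp add: is_rooted_cesys_def)

text \<open>The level of an object is its length in the C-system, and pulling back keeps the length
  of a path.\<close>

lemma is_stratified_CE: "is_stratified_cesys (CE_obj S)"
 unfolding is_stratified_cesys_def
proof (intro conjI ballI)
 show "is_stratified (ce_fam (CE_obj S)) (ce_one (CE_obj S))"
  using rooted_tree_lev(1)[OF P.path_rooted_tree] by (simp add: CE_fam_def)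
 fix f A assume f: "f \<in> Arr (ce_cat (CE_obj S))" and "A \<in> over (ce_fam (CE_obj S)) (Cod (ce_cat (CE_obj S)) f)"
 then obtain X k where A: "A = \<langle>X, Num k\<rangle>" "X \<in> Obj CS" "k \<le> c_len S X" "fts k X = Cod CS f"
  by (auto simp: CE_over)
 have "c_len S (Cod CS f) = c_len S X - k" using A len_fts[of X k] by simp
 then show "ce_lev (CE_obj S) (Dom (ce_fam (CE_obj S)) A) - ce_lev (CE_obj S) (Cod (ce_cat (CE_obj S)) f) =
   ce_lev (CE_obj S) (Dom (ce_fam (CE_obj S)) (ce_pb (CE_obj S) f A)) - ce_lev (CE_obj S) (Dom (ce_cat (CE_obj S)) f)"
  using CE_pi2_facts[of X k f] A f by simp
qed

end

section \<open>Homomorphisms of CE-systems and functoriality of \<open>CE\<close>\<close>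

lemma cehom_restrict_simps [simp]:
 "ceh_fam (cehom_restrict S H) = fmap_restrict (ce_fam S) (ceh_fam H)"
 "ceh_cat (cehom_restrict S H) = fmap_restrict (ce_cat S) (ceh_cat H)"
 by (auto simp: cehom_restrict_def)

lemma cehom_extensional_restrict [simp]: "cehom_extensional S (cehom_restrict S H)"
 by (auto simp: cehom_extensional_def)

lemma cehom_eqI: "ceh_fam H = ceh_fam K \<Longrightarrow> ceh_cat H = ceh_cat K \<Longrightarrow> (H :: 'a cehom) = K"
 by (rule cehom.equality) auto

lemma cehom_restrict:
 assumes "is_cesys S"
 shows "is_cehom S S' (cehom_restrict S H) \<longleftrightarrow> is_cehom S S' H"
proof -
 interpret cesys S by (rule cesys.intro[OF assms])
 have one: "ce_one S \<in> Obj FF" using one_terminal unfolding is_terminal_def by blast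
 show ?thesis
  unfolding is_cehom_def cehom_restrict_simps F.functor_restrict C.functor_restrict
  using one by (auto simp: over_def)
qed

lemma (in csys_hom) hom_fts: "X \<in> Obj (c_cat S) \<Longrightarrow> onObj F (S.fts k X) = S'.fts k (onObj F X)"
 by (induction k) (auto simp: hom_ft)

lemma (in csys_hom) hom_CE_I: "X \<in> Obj (c_cat S) \<Longrightarrow> k \<le> c_len S X \<Longrightarrow> onArr F (CE_I S X k) = CE_I S' (onObj F X) k"
proof (induction k arbitrary: X)
 case (Suc k)
 have "k \<le> c_len S (c_ft S X)" using Suc.prems by (simp add: S.len_ft)
 then show ?case using Suc by (simp add: hom_comp hom_p hom_ft)
qed simp

lemma (in csys_hom) hom_CE_pi2:
 "X \<in> Obj (c_cat S) \<Longrightarrow> k \<le> c_len S X \<Longrightarrow> f \<in> Arr (c_cat S) \<Longrightarrow> Cod (c_cat S) f = S.fts k X \<Longrightarrow>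
  onObj F (S.ppb f X k) = S'.ppb (onArr F f) (onObj F X) k \<and>
  onArr F (CE_pi2 S f X k) = CE_pi2 S' (onArr F f) (onObj F X) k"
proof (induction k arbitrary: X)
 case (Suc k)
 have "k \<le> c_len S (c_ft S X)" "Cod (c_cat S) f = S.fts k (c_ft S X)"
  using Suc.prems by (simp_all add: S.len_ft funpow_swap1)
 then show ?case using Suc hom_q[of X "CE_pi2 S f (c_ft S X) k"] S.CE_pi2_facts[of "c_ft S X" k f]
  by (simp add: hom_ft)
qed simp

lemma (in csys_hom) is_cehom_CE:
 "is_cehom (CE_obj S) (CE_obj S') (CE_hom S F)" "is_stratified_cehom (CE_obj S) (CE_obj S') (CE_hom S F)"
proof -
 show "is_stratified_cehom (CE_obj S) (CE_obj S') (CE_hom S F)"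
  by (simp add: is_stratified_cehom_def CE_hom_def)
 let ?H = "\<lparr>ceh_fam = \<lparr>onObj = onObj F, onArr = (\<lambda>p. \<langle>onObj F (ufst p), usnd p\<rangle>)\<rparr>, ceh_cat = F\<rparr>"
 have "is_cehom (CE_obj S) (CE_obj S') ?H"
  unfolding is_cehom_def S.CE_obj_simps S'.CE_obj_simps
 proof (intro conjI ballI, goal_cases)
  case 1
  show ?case unfolding is_functor_def by (auto elim!: S.CE_arrE simp: hom_fts hom_def)
 next
  case 2
  show ?case using is_fun by simp
 next
  case (4 A)
  then show ?case by (auto elim!: S.CE_arrE simp: hom_CE_I)
 next
  case (6 f A)
  then show ?case using hom_CE_pi2 by (auto simp: S.CE_over)
 next
  case (7 f A)
  then show ?case using hom_CE_pi2 by (auto simp: S.CE_over)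
 qed simp_all
 then show "is_cehom (CE_obj S) (CE_obj S') (CE_hom S F)"
  unfolding CE_hom_def by (simp add: cehom_restrict S.is_cesys_CE)
qed

lemma is_functor_CE: "is_functor Csys rCEsys\<^sub>s CE"
 unfolding Csys_def rCEsys\<^sub>s_def CE_def
proof (rule is_functor_mk_category, goal_cases)
 case (1 S)
 then interpret csys S by (simp add: csys_def)
 show ?case by (simp add: is_cesys_CE is_rooted_CE is_stratified_CE)
next
 case (2 S S' F)
 then interpret csys_hom S S' F by (simp add: csys_homI)
 show ?case using is_cehom_CE by (simp add: CE_hom_def)
next
 case (3 S)
 then interpret csys S by (simp add: csys_def)
 show ?case
  by (rule cehom_eqI; rule fmap_eqI[of "CE_fam S"] fmap_eqI[of "c_cat S"])
   (auto elim!: CE_arrE simp: CE_hom_def)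
next
 case (4 S S' S'' F G)
 interpret F: csys_hom S S' F using 4 by (simp add: csys_homI)
 interpret G: csys_hom S' S'' G using 4 by (simp add: csys_homI)
 show ?case
  by (rule cehom_eqI; rule fmap_eqI[of "CE_fam S"] fmap_eqI[of "c_cat S"])
   (auto elim!: F.S.CE_arrE simp: CE_hom_def)
qed

section \<open>From stratified rooted CE-systems to C-systems\<close>

context strat_cesys
begin

lemma CE2C_simps [simp]:
 "c_cat (CE2C_obj S) = CC" "c_len (CE2C_obj S) = ce_lev S" "c_one (CE2C_obj S) = ce_one S"
 "c_p (CE2C_obj S) X = ce_I S (ce_indec S X)"
 "c_pb (CE2C_obj S) f X = Dom FF (ce_pb S f (ce_indec S X))"
 "c_q (CE2C_obj S) f X = ce_pi2 S f (ce_indec S X)"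
 by (auto simp: CE2C_obj_def)

lemma CE2C_ft: "X \<in> Obj FF \<Longrightarrow> 0 < ce_lev S X \<Longrightarrow> c_ft (CE2C_obj S) X = Cod FF (ce_indec S X)"
 and CE2C_ft_one: "c_ft (CE2C_obj S) (ce_one S) = ce_one S"
 by (auto simp: CE2C_obj_def)

text \<open>Pullback is stratified and so keeps a level drop of one: pulling back an indecomposable
  arrow gives an indecomposable arrow. Hence the new object has the domain of \<open>f\<close> as
  its \<open>ft\<close>, and pullbacks in the C-system can be iterated.\<close>

lemma indec_pb:
 assumes "X \<in> Obj FF" "0 < ce_lev S X" "f \<in> Arr CC" "Cod CC f = Cod FF (ce_indec S X)"
 shows "0 < ce_lev S (Dom FF (ce_pb S f (ce_indec S X)))"
  "ce_indec S (Dom FF (ce_pb S f (ce_indec S X))) = ce_pb S f (ce_indec S X)"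
proof -
 have "ce_lev S (Dom FF (ce_pb S f (ce_indec S X))) = Suc (ce_lev S (Dom CC f))"
  using assms lev_pb[of f "ce_indec S X"] by simp
 then show "0 < ce_lev S (Dom FF (ce_pb S f (ce_indec S X)))"
  "ce_indec S (Dom FF (ce_pb S f (ce_indec S X))) = ce_pb S f (ce_indec S X)"
  using assms T.indec_eq[of "ce_pb S f (ce_indec S X)"] by simp_all
qed

text \<open>The clauses of a C-system are those of a CE-system read at the indecomposable
  arrows.\<close>

lemma is_csys_CE2C: "is_csys (CE2C_obj S)"
 unfolding is_csys_def Let_def CE2C_simps
proof (intro conjI ballI impI, goal_cases)
 case (3 X)
 then show ?case by (simp add: T.level_0)
next
 case (4 X)
 then show ?case using T.level_0[of X] by (cases "X = ce_one S") (auto simp: CE2C_obj_def)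
next
 case 7
 show ?case using is_rooted by (simp add: is_rooted_cesys_def)
qed (auto simp: C.is_cat CE2C_ft CE2C_ft_one hom_def over_def indec_pb pb_pullback comp_pb)

end

locale strat_cehom = S: strat_cesys S + S': strat_cesys S' for S S' :: "'a cesys" +
 fixes H :: "'a cehom"
 assumes is_hom: "is_cehom S S' H" and is_strat_hom: "is_stratified_cehom S S' H"
begin

lemma fam_functor: "is_functor (ce_fam S) (ce_fam S') (ceh_fam H)"
 and cat_functor: "is_functor (ce_cat S) (ce_cat S') (ceh_cat H)"
 using is_hom unfolding is_cehom_def by blast+

lemma obj_agree: "X \<in> Obj (ce_fam S) \<Longrightarrow> onObj (ceh_cat H) X = onObj (ceh_fam H) X"
 and hom_I: "A \<in> Arr (ce_fam S) \<Longrightarrow> onArr (ceh_cat H) (ce_I S A) = ce_I S' (onArr (ceh_fam H) A)"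
 and hom_one: "onObj (ceh_fam H) (ce_one S) = ce_one S'"
 and hom_pb: "f \<in> Arr (ce_cat S) \<Longrightarrow> A \<in> Arr (ce_fam S) \<Longrightarrow> Cod (ce_fam S) A = Cod (ce_cat S) f \<Longrightarrow>
  onArr (ceh_fam H) (ce_pb S f A) = ce_pb S' (onArr (ceh_cat H) f) (onArr (ceh_fam H) A) \<and>
  onArr (ceh_cat H) (ce_pi2 S f A) = ce_pi2 S' (onArr (ceh_cat H) f) (onArr (ceh_fam H) A)"
 using is_hom unfolding is_cehom_def over_def by auto

lemma hom_lev: "X \<in> Obj (ce_fam S) \<Longrightarrow> ce_lev S' (onObj (ceh_fam H) X) = ce_lev S X"
 using is_strat_hom unfolding is_stratified_cehom_def by auto

text \<open>The image of an indecomposable arrow again lowers the level by one, and only one arrow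
  out of a given object does so.\<close>

lemma hom_indec:
 assumes "X \<in> Obj (ce_fam S)" "0 < ce_lev S X"
 shows "onArr (ceh_fam H) (ce_indec S X) = ce_indec S' (onObj (ceh_fam H) X)"
 using S'.T.indec_eq[of "onArr (ceh_fam H) (ce_indec S X)"] functor_arr[OF fam_functor] assms
 by (simp add: hom_lev)

lemma is_csys_hom_CE2C: "is_csys_hom (CE2C_obj S) (CE2C_obj S') (ceh_cat H)"
 unfolding is_csys_hom_def S.CE2C_simps S'.CE2C_simps
proof (intro conjI ballI impI, goal_cases)
 case 1
 show ?case by (rule cat_functor)
next
 case (4 X)
 show ?case
 proof (cases "ce_lev S X = 0")
  case True
  then show ?thesis using 4 by (simp add: S.T.level_0 S.CE2C_ft_one S'.CE2C_ft_one obj_agree hom_one)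
 next
  case False
  then show ?thesis using 4 hom_indec[of X]
   by (simp add: obj_agree S.CE2C_ft S'.CE2C_ft hom_lev functor_obj[OF fam_functor] functor_arr[OF fam_functor])
    (metis S.T.indec(1) functor_arr(3)[OF fam_functor] neq0_conv)
 qed
next
 case (6 X f)
 then show ?case using hom_pb[of f "ce_indec S X"] hom_indec[of X]
  by (simp add: over_def S.CE2C_ft obj_agree)
   (metis S.pb_arr(1) S.T.indec(1) S.F.dom_obj functor_arr(2)[OF fam_functor] obj_agree)
next
 case (7 X f)
 then show ?case using hom_pb[of f "ce_indec S X"] hom_indec[of X]
  by (simp add: over_def S.CE2C_ft obj_agree)
qed (auto simp: obj_agree hom_one hom_lev hom_I hom_indec)

end

lemma strat_cesysI: "is_cesys S \<Longrightarrow> is_rooted_cesys S \<Longrightarrow> is_stratified_cesys S \<Longrightarrow> strat_cesys S"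
 by (simp add: strat_cesys_def cesys_def strat_cesys_axioms_def)

lemma strat_cehomI: "is_cesys S \<Longrightarrow> is_rooted_cesys S \<Longrightarrow> is_stratified_cesys S \<Longrightarrow>
 is_cesys S' \<Longrightarrow> is_rooted_cesys S' \<Longrightarrow> is_stratified_cesys S' \<Longrightarrow> is_cehom S S' H \<Longrightarrow>
 is_stratified_cehom S S' H \<Longrightarrow> strat_cehom S S' H"
 by (simp add: strat_cehom_def strat_cehom_axioms_def strat_cesysI)

lemma is_functor_CE2C: "is_functor rCEsys\<^sub>s Csys CE2C"
 unfolding Csys_def rCEsys\<^sub>s_def CE2C_def
proof (rule is_functor_mk_category, goal_cases)
 case (1 S)
 then interpret strat_cesys S by (simp add: strat_cesysI)
 show ?case by (simp add: is_csys_CE2C)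
next
 case (2 S S' H)
 then interpret strat_cehom S S' H by (simp add: strat_cehomI)
 show ?case using 2 is_csys_hom_CE2C by (simp add: cehom_extensional_def)
next
 case (3 S)
 then interpret strat_cesys S by (simp add: strat_cesysI)
 show ?case by simp
next
 case (4 S S' S'' H K)
 then interpret strat_cesys S by (simp add: strat_cesysI)
 show ?case by simp
qed

abbreviation "e_arr E \<equiv> Arr (e_cat E)"
abbreviation "e_cod E \<equiv> Cod (e_cat E)"

section \<open>Functors with term structure between slices\<close>

lemma sfun_comp_simps [simp]:
 "s_obj (G \<star> K) A = s_obj G (s_obj K A)"
 "s_arr (G \<star> K) A P = s_arr G (s_obj K A) (s_arr K A P)"
 "s_tm (G \<star> K) A P t = s_tm G (s_obj K A) (s_arr K A P) (s_tm K A P t)"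
 by (auto simp: sfun_comp_def)

lemma sfun_slice_simps [simp]:
 "s_obj (sfun_slice F A G) P = s_arr G A P"
 "s_arr (sfun_slice F A G) P Q = s_arr G (A \<cdot>\<^bsub>F\<^esub> P) Q"
 "s_tm (sfun_slice F A G) P Q t = s_tm G (A \<cdot>\<^bsub>F\<^esub> P) Q t"
 by (auto simp: sfun_slice_def)

lemma sfun_id_simps [simp]: "s_obj sfun_id A = A" "s_arr sfun_id A P = P" "s_tm sfun_id A P t = t"
 by (auto simp: sfun_id_def)

lemma sassoc: "(H \<star> G) \<star> K = H \<star> (G \<star> K)"
 by (simp add: sfun_comp_def)

lemma sfun_comp_id [simp]: "G \<star> sfun_id = G" "sfun_id \<star> G = G"
 by (auto simp: sfun_comp_def sfun_id_def)

lemma seqI: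
 assumes "\<And>A. A \<in> e_arr E \<Longrightarrow> e_cod E A = \<Gamma> \<Longrightarrow> s_obj G A = s_obj K A"
  "\<And>A P. A \<in> e_arr E \<Longrightarrow> e_cod E A = \<Gamma> \<Longrightarrow> P \<in> e_arr E \<Longrightarrow>
   e_cod E P = e_ext E A \<Longrightarrow> s_arr G A P = s_arr K A P"
  "\<And>A P t. A \<in> e_arr E \<Longrightarrow> e_cod E A = \<Gamma> \<Longrightarrow> P \<in> e_arr E \<Longrightarrow>
   e_cod E P = e_ext E A \<Longrightarrow> t \<in> e_T E P \<Longrightarrow> s_tm G A P t = s_tm K A P t"
 shows "sfun_eq E \<Gamma> G K"
 using assms by (simp add: sfun_eq_def over_def)

lemma seqD:
 assumes "sfun_eq E \<Gamma> G K" "A \<in> e_arr E" "e_cod E A = \<Gamma>"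
 shows "s_obj G A = s_obj K A"
  "P \<in> e_arr E \<Longrightarrow> e_cod E P = e_ext E A \<Longrightarrow> s_arr G A P = s_arr K A P"
  "P \<in> e_arr E \<Longrightarrow> e_cod E P = e_ext E A \<Longrightarrow> t \<in> e_T E P \<Longrightarrow> s_tm G A P t = s_tm K A P t"
 using assms by (simp_all add: sfun_eq_def over_def)

lemma sfun_eq_refl [simp]: "sfun_eq E \<Gamma> G G"
 by (simp add: sfun_eq_def)

lemma seq_sym: "sfun_eq E \<Gamma> G K \<Longrightarrow> sfun_eq E \<Gamma> K G"
 by (simp add: sfun_eq_def)

lemma seq_trans [trans]: "sfun_eq E \<Gamma> G K \<Longrightarrow> sfun_eq E \<Gamma> K L \<Longrightarrow> sfun_eq E \<Gamma> G L"
 by (simp add: sfun_eq_def)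

lemma is_sfunI:
 assumes "\<And>A. A \<in> e_arr E \<Longrightarrow> e_cod E A = \<Gamma> \<Longrightarrow>
   s_obj G A \<in> e_arr E' \<and> e_cod E' (s_obj G A) = \<Delta>"
  and "\<And>A P. A \<in> e_arr E \<Longrightarrow> e_cod E A = \<Gamma> \<Longrightarrow> P \<in> e_arr E \<Longrightarrow>
   e_cod E P = e_ext E A \<Longrightarrow>
   s_arr G A P \<in> e_arr E' \<and> e_cod E' (s_arr G A P) = e_ext E' (s_obj G A) \<and>
   s_obj G (A \<cdot>\<^bsub>e_cat E\<^esub> P) = s_obj G A \<cdot>\<^bsub>e_cat E'\<^esub> s_arr G A P"
  and "\<And>A. A \<in> e_arr E \<Longrightarrow> e_cod E A = \<Gamma> \<Longrightarrow>
   s_arr G A (Ident (e_cat E) (e_ext E A)) = Ident (e_cat E') (e_ext E' (s_obj G A))"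
  and "\<And>A P Q. A \<in> e_arr E \<Longrightarrow> e_cod E A = \<Gamma> \<Longrightarrow> P \<in> e_arr E \<Longrightarrow>
   e_cod E P = e_ext E A \<Longrightarrow> Q \<in> e_arr E \<Longrightarrow> e_cod E Q = e_ext E P \<Longrightarrow>
   s_arr G A (P \<cdot>\<^bsub>e_cat E\<^esub> Q) = s_arr G A P \<cdot>\<^bsub>e_cat E'\<^esub> s_arr G (A \<cdot>\<^bsub>e_cat E\<^esub> P) Q"
  and "\<And>A P t. A \<in> e_arr E \<Longrightarrow> e_cod E A = \<Gamma> \<Longrightarrow> P \<in> e_arr E \<Longrightarrow>
   e_cod E P = e_ext E A \<Longrightarrow> t \<in> e_T E P \<Longrightarrow> s_tm G A P t \<in> e_T E' (s_arr G A P)"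
 shows "is_sfun E \<Gamma> E' \<Delta> G"
 unfolding is_sfun_def Let_def over_def using assms by simp

lemma sfun_obj:
 assumes "is_sfun E \<Gamma> E' \<Delta> G" "A \<in> e_arr E" "e_cod E A = \<Gamma>"
 shows "s_obj G A \<in> e_arr E'" "e_cod E' (s_obj G A) = \<Delta>"
  "s_arr G A (Ident (e_cat E) (e_ext E A)) = Ident (e_cat E') (e_ext E' (s_obj G A))"
 using assms unfolding is_sfun_def Let_def over_def by auto

lemma sfun_arr:
 assumes "is_sfun E \<Gamma> E' \<Delta> G" "A \<in> e_arr E" "e_cod E A = \<Gamma>"
  "P \<in> e_arr E" "e_cod E P = e_ext E A"
 shows "s_arr G A P \<in> e_arr E'" "e_cod E' (s_arr G A P) = e_ext E' (s_obj G A)"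
  "s_obj G (A \<cdot>\<^bsub>e_cat E\<^esub> P) = s_obj G A \<cdot>\<^bsub>e_cat E'\<^esub> s_arr G A P"
  "t \<in> e_T E P \<Longrightarrow> s_tm G A P t \<in> e_T E' (s_arr G A P)"
  "Q \<in> e_arr E \<Longrightarrow> e_cod E Q = e_ext E P \<Longrightarrow>
   s_arr G A (P \<cdot>\<^bsub>e_cat E\<^esub> Q) = s_arr G A P \<cdot>\<^bsub>e_cat E'\<^esub> s_arr G (A \<cdot>\<^bsub>e_cat E\<^esub> P) Q"
 using assms unfolding is_sfun_def Let_def over_def by auto

lemma sfun_eq_comp:
 assumes "sfun_eq E \<Gamma> K K'" "is_sfun E \<Gamma> E' \<Delta> K" "sfun_eq E' \<Delta> G G'"
 shows "sfun_eq E \<Gamma> (G \<star> K) (G' \<star> K')"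
proof (rule seqI, goal_cases)
 case (1 A)
 then show ?case using seqD[OF assms(1)] seqD[OF assms(3)] sfun_obj[OF assms(2)] by simp
next
 case (2 A P)
 then show ?case using seqD[OF assms(1) 2(1,2)] seqD(2)[OF assms(3), of "s_obj K A" "s_arr K A P"]
   sfun_obj[OF assms(2) 2(1,2)] sfun_arr[OF assms(2) 2] by simp
next
 case (3 A P t)
 then show ?case using seqD[OF assms(1) 3(1,2)]
   seqD(3)[OF assms(3), of "s_obj K A" "s_arr K A P" "s_tm K A P t"]
   sfun_obj[OF assms(2) 3(1,2)] sfun_arr[OF assms(2) 3(1-4)] by simp
qed

text \<open>\<open>K\<close> has to land in the carriers over \<open>\<Delta>\<close>, since only
  there \<open>G\<close> and \<open>G'\<close> are known to agree.\<close>

lemma seq_left: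
 assumes "sfun_eq E' \<Delta> G G'" "is_sfun E \<Gamma> E' \<Delta> K"
 shows "sfun_eq E \<Gamma> (G \<star> K) (G' \<star> K)"
 using assms by (intro sfun_eq_comp) auto

lemma seq_right:
 assumes "sfun_eq E \<Gamma> K K'"
 shows "sfun_eq E \<Gamma> (G \<star> K) (G \<star> K')"
 using assms by (auto simp: sfun_eq_def)

locale esys_cat = cat "e_cat E" for E :: "'a esys"
begin

lemma sfun_comp:
 assumes E': "cat (e_cat E')" and K: "is_sfun E \<Gamma> E' \<Delta> K" and G: "is_sfun E' \<Delta> E'' \<Theta> G"
 shows "is_sfun E \<Gamma> E'' \<Theta> (G \<star> K)"
proof (rule is_sfunI, goal_cases)
 case (1 A)
 then show ?case using sfun_obj[OF K 1] sfun_obj[OF G] by simp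
next
 case (2 A P)
 then show ?case using sfun_arr[OF K 2] sfun_obj[OF K 2(1,2)] sfun_arr[OF G, of "s_obj K A" "s_arr K A P"] by simp
next
 case (3 A)
 then show ?case using sfun_obj[OF K 3] sfun_obj[OF G, of "s_obj K A"] by simp
next
 case (4 A P Q)
 let ?AP = "A \<cdot>\<^bsub>e_cat E\<^esub> P"
 have AP: "?AP \<in> e_arr E" "e_cod E ?AP = \<Gamma>" "e_ext E ?AP = e_ext E P" using 4 by auto
 note o = sfun_obj[OF K 4(1,2)] and a = sfun_arr[OF K 4(1-4)]
  and q = sfun_arr(1,2)[OF K AP(1,2) 4(5)]
 have "e_cod E' (s_arr K ?AP Q) = e_ext E' (s_obj K ?AP)" using q AP 4(6) by simp
 moreover have "e_ext E' (s_obj K ?AP) = e_ext E' (s_arr K A P)"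
  using a(1-3) o(1,2) E' by (simp add: cat.dom_comp)
 ultimately have "s_arr G (s_obj K A) (s_arr K A P \<cdot>\<^bsub>e_cat E'\<^esub> s_arr K ?AP Q) =
   s_arr G (s_obj K A) (s_arr K A P) \<cdot>\<^bsub>e_cat E''\<^esub> s_arr G (s_obj K A \<cdot>\<^bsub>e_cat E'\<^esub> s_arr K A P) (s_arr K ?AP Q)"
  using sfun_arr(5)[OF G o(1,2) a(1,2)] q AP 4(6) by simp
 then show ?case using a(5)[OF 4(5,6)] a(3) by simp
next
 case (5 A P t)
 then show ?case using sfun_arr[OF K 5(1-4)] sfun_obj[OF K 5(1,2)]
   sfun_arr(4)[OF G, of "s_obj K A" "s_arr K A P" "s_tm K A P t"] by simp
qed

lemma sfun_slice:
 assumes "cat (e_cat E')" and G: "is_sfun E \<Gamma> E' \<Delta> G" and A: "A \<in> e_arr E" "e_cod E A = \<Gamma>"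
 shows "is_sfun E (e_ext E A) E' (e_ext E' (s_obj G A)) (sfun_slice (e_cat E) A G)"
proof -
 interpret E': cat "e_cat E'" by fact
 note o = sfun_obj[OF G] and a = sfun_arr[OF G]
 note oA = o[OF A]
 have d: "e_ext E' (s_arr G A P) = e_ext E' (s_obj G (A \<cdot>\<^bsub>e_cat E\<^esub> P))"
  if "P \<in> e_arr E" "e_cod E P = e_ext E A" for P
  using a[OF A that] oA by simp
 show ?thesis
 proof (rule is_sfunI, goal_cases)
  case (1 P)
  then show ?case using a[OF A 1] by simp
 next
  case (2 P Q)
  then show ?case using a[OF A 2(1,2)] a[of "A \<cdot>\<^bsub>e_cat E\<^esub> P" Q] A d[OF 2(1,2)] by simp
 next
  case (3 P)
  then show ?case using o[of "A \<cdot>\<^bsub>e_cat E\<^esub> P"] A d[OF 3(1,2)] by simp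
 next
  case (4 P Q R)
  then show ?case using a(5)[of "A \<cdot>\<^bsub>e_cat E\<^esub> P" Q R] A by (simp add: assoc)
 next
  case (5 P Q t)
  then show ?case using a(4)[of "A \<cdot>\<^bsub>e_cat E\<^esub> P" Q t] A by simp
 qed
qed

lemma seq_slice:
 assumes "sfun_eq E \<Gamma> G K" "A \<in> e_arr E" "e_cod E A = \<Gamma>"
 shows "sfun_eq E (e_ext E A) (sfun_slice (e_cat E) A G) (sfun_slice (e_cat E) A K)"
 using assms seqD[OF assms(1)] by (intro seqI) simp_all

lemma slice_comp:
 assumes "is_sfun E \<Gamma> E' \<Delta> K" "A \<in> e_arr E" "e_cod E A = \<Gamma>"
 shows "sfun_eq E (e_ext E A) (sfun_slice (e_cat E) A (G \<star> K))
  (sfun_slice (e_cat E') (s_obj K A) G \<star> sfun_slice (e_cat E) A K)"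
 using sfun_arr(3)[OF assms] by (intro seqI) simp_all

lemma slice_slice:
 assumes "A \<in> e_arr E" "P \<in> e_arr E" "e_cod E P = e_ext E A"
 shows "sfun_eq E (e_ext E P) (sfun_slice (e_cat E) P (sfun_slice (e_cat E) A G))
  (sfun_slice (e_cat E) (A \<cdot>\<^bsub>e_cat E\<^esub> P) G)"
 using assms by (intro seqI) (simp_all add: assoc)

text \<open>An object \<open>A\<close> of a slice is at the same time an arrow from \<open>A\<close>
  to the terminal object. As \<open>G\<close> preserves the terminal object, its value on this arrow
  is its value on the object.\<close>

lemma sfun_arr_id:
 assumes "is_sfun E \<Gamma> E' \<Delta> G" "cat (e_cat E')" "\<Gamma> \<in> Obj (e_cat E)"
  "s_obj G (Ident (e_cat E) \<Gamma>) = Ident (e_cat E') \<Delta>" "A \<in> e_arr E" "e_cod E A = \<Gamma>"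
 shows "s_arr G (Ident (e_cat E) \<Gamma>) A = s_obj G A"
proof -
 interpret E': cat "e_cat E'" by fact
 note i = sfun_obj[OF assms(1), of "Ident (e_cat E) \<Gamma>"]
 have D: "\<Delta> \<in> Obj (e_cat E')" using i assms E'.cod_obj by (metis cod_id id_arr)
 have "s_obj G A = Ident (e_cat E') \<Delta> \<cdot>\<^bsub>e_cat E'\<^esub> s_arr G (Ident (e_cat E) \<Gamma>) A"
  using sfun_arr(3)[OF assms(1), of "Ident (e_cat E) \<Gamma>" A] assms by simp
 then show ?thesis using sfun_arr(1,2)[OF assms(1), of "Ident (e_cat E) \<Gamma>" A] assms D by simp
qed

lemma slice_id:
 assumes "is_sfun E \<Gamma> E' \<Delta> G" "cat (e_cat E')" "\<Gamma> \<in> Obj (e_cat E)" "s_obj G (Ident (e_cat E) \<Gamma>) = Ident (e_cat E') \<Delta>"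
 shows "sfun_eq E \<Gamma> (sfun_slice (e_cat E) (Ident (e_cat E) \<Gamma>) G) G"
 using sfun_arr_id[OF assms] assms(3) by (intro seqI) simp_all

lemma sfun_tm_in:
 assumes "is_sfun E \<Gamma> E' \<Delta> G" "cat (e_cat E')" "\<Gamma> \<in> Obj (e_cat E)"
  "s_obj G (Ident (e_cat E) \<Gamma>) = Ident (e_cat E') \<Delta>" "A \<in> e_arr E" "e_cod E A = \<Gamma>" "x \<in> e_T E A"
 shows "sfun_tm E G A x \<in> e_T E' (s_obj G A)"
 using sfun_arr(4)[OF assms(1), of "Ident (e_cat E) \<Gamma>" A x] sfun_arr_id[OF assms(1-6)] assms
 by (simp add: sfun_tm_def)

lemma sfun_tm_eq:
 assumes "sfun_eq E \<Gamma> G K" "A \<in> e_arr E" "e_cod E A = \<Gamma>" "x \<in> e_T E A"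
 shows "sfun_tm E G A x = sfun_tm E K A x"
 using seqD(3)[OF assms(1), of "Ident (e_cat E) \<Gamma>" A x] assms by (auto simp: sfun_tm_def)

lemma sfun_tm_slice:
 assumes "A \<in> e_arr E" "e_cod E P = e_ext E A"
 shows "sfun_tm E (sfun_slice (e_cat E) A G) P x = s_tm G A P x"
 using assms by (simp add: sfun_tm_def)

lemma sfun_tm_comp:
 assumes "is_sfun E \<Gamma> E' \<Delta> K" "cat (e_cat E')" "\<Gamma> \<in> Obj (e_cat E)"
  "s_obj K (Ident (e_cat E) \<Gamma>) = Ident (e_cat E') \<Delta>" "A \<in> e_arr E" "e_cod E A = \<Gamma>"
 shows "sfun_tm E (G \<star> K) A x = sfun_tm E' G (s_obj K A) (sfun_tm E K A x)"
 using sfun_arr_id[OF assms] sfun_obj(2)[OF assms(1,5,6)] assms by (simp add: sfun_tm_def)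

end

section \<open>E-systems\<close>

locale pre_esys =
 fixes E :: "'a esys"
 assumes is_pre_esys: "is_pre_esys E"

sublocale pre_esys \<subseteq> esys_cat E
 using is_pre_esys by (simp add: is_pre_esys_def Let_def esys_cat_def cat_def)

context pre_esys
begin

abbreviation "F \<equiv> e_cat E"
abbreviation e_comp (infixl "\<odot>" 70) where "A \<odot> P \<equiv> A \<cdot>\<^bsub>F\<^esub> P"
abbreviation "T \<equiv> e_T E"
abbreviation "S \<equiv> e_S E"
abbreviation "W \<equiv> e_W E"
abbreviation "idtm \<equiv> e_idtm E"
abbreviation "sl \<equiv> sfun_slice (e_cat E)"
abbreviation "tm \<equiv> sfun_tm E"
abbreviation "eqv \<equiv> sfun_eq E"
abbreviation "sfn \<Gamma> \<Delta> G \<equiv> is_sfun E \<Gamma> E \<Delta> G"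
abbreviation "hm \<equiv> is_slice_pre_ehom E"

lemma e_terminal: "is_terminal F (e_root E)"
 and W_id: "X \<in> Obj F \<Longrightarrow> eqv X (W (Ident F X)) sfun_id"
 using is_pre_esys by (simp_all add: is_pre_esys_def Let_def)

lemma
 assumes A: "A \<in> Arr F"
 shows S_sfun: "x \<in> T A \<Longrightarrow> sfn (Dom F A) (Cod F A) (S A x)"
  and S_ident [simp]: "x \<in> T A \<Longrightarrow> s_obj (S A x) (Ident F (Dom F A)) = Ident F (Cod F A)"
  and W_sfun: "sfn (Cod F A) (Dom F A) (W A)"
  and W_ident [simp]: "s_obj (W A) (Ident F (Cod F A)) = Ident F (Dom F A)"
  and W_comp: "P \<in> Arr F \<Longrightarrow> Cod F P = Dom F A \<Longrightarrow> eqv (Cod F A) (W (A \<odot> P)) (W P \<star> W A)"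
  and idtm_in [simp]: "idtm A \<in> T (s_obj (W A) A)"
 using is_pre_esys A cod_obj[OF A] unfolding is_pre_esys_def Let_def over_def by blast+

lemma W_arr [simp]:
 assumes "A \<in> Arr F" "B \<in> Arr F" "Cod F B = Cod F A"
 shows "s_obj (W A) B \<in> Arr F" "Cod F (s_obj (W A) B) = Dom F A"
 using sfun_obj[OF W_sfun[OF assms(1)] assms(2,3)] by auto

lemma S_arr [simp]:
 assumes "A \<in> Arr F" "x \<in> T A" "B \<in> Arr F" "Cod F B = Dom F A"
 shows "s_obj (S A x) B \<in> Arr F" "Cod F (s_obj (S A x) B) = Cod F A"
 using sfun_obj[OF S_sfun[OF assms(1,2)] assms(3,4)] by auto

lemma presD:
 assumes "preserves_at E E' \<Gamma> R" "A \<in> Arr F" "Cod F A = \<Gamma>"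
 shows "x \<in> T A \<Longrightarrow> eqv (Dom F A) (R \<star> S A x) (e_S E' (s_obj R A) (tm R A x) \<star> sl A R)"
  "eqv \<Gamma> (sl A R \<star> W A) (e_W E' (s_obj R A) \<star> R)"
  "tm (sl A R) (s_obj (W A) A) (idtm A) = e_idtm E' (s_obj R A)"
 using assms unfolding preserves_at_def over_def by auto

lemma preserves_atI:
 assumes "\<And>A x. A \<in> Arr F \<Longrightarrow> Cod F A = \<Gamma> \<Longrightarrow> x \<in> T A \<Longrightarrow>
   eqv (Dom F A) (R \<star> S A x) (e_S E' (s_obj R A) (tm R A x) \<star> sl A R)"
  "\<And>A. A \<in> Arr F \<Longrightarrow> Cod F A = \<Gamma> \<Longrightarrow> eqv \<Gamma> (sl A R \<star> W A) (e_W E' (s_obj R A) \<star> R)"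
  "\<And>A. A \<in> Arr F \<Longrightarrow> Cod F A = \<Gamma> \<Longrightarrow> tm (sl A R) (s_obj (W A) A) (idtm A) = e_idtm E' (s_obj R A)"
 shows "preserves_at E E' \<Gamma> R"
 using assms unfolding preserves_at_def over_def by auto

text \<open>Functors such as slices of composites are computed only up to agreement on carriers, so
  compatibility must be transportable along it.\<close>

lemma preserves_at_cong:
 assumes p: "preserves_at E E' \<Gamma> R" and eq: "eqv \<Gamma> R R'"
 shows "preserves_at E E' \<Gamma> R'"
proof (rule preserves_atI)
 fix A assume A: "A \<in> Arr F" "Cod F A = \<Gamma>"
 note o = seqD(1)[OF eq A]
 note sle = seq_slice[OF eq A]
 { fix x assume x: "x \<in> T A"
  have t: "tm R' A x = tm R A x" using sfun_tm_eq[OF eq A x] by simp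
  have "eqv (Dom F A) (R' \<star> S A x) (R \<star> S A x)"
   using S_sfun[OF A(1) x] A by (intro seq_left[OF seq_sym[OF eq]]) simp
  also have "eqv (Dom F A) ... (e_S E' (s_obj R A) (tm R A x) \<star> sl A R)"
   by (rule presD(1)[OF p A x])
  also have "eqv (Dom F A) ... (e_S E' (s_obj R A) (tm R A x) \<star> sl A R')"
   by (rule seq_right[OF sle])
  finally show "eqv (Dom F A) (R' \<star> S A x) (e_S E' (s_obj R' A) (tm R' A x) \<star> sl A R')"
   by (simp add: t o) }
 have "eqv \<Gamma> (sl A R' \<star> W A) (sl A R \<star> W A)"
  using W_sfun[OF A(1)] A(2) by (intro seq_left[OF seq_sym[OF sle]]) simp
 also have "eqv \<Gamma> ... (e_W E' (s_obj R A) \<star> R)" by (rule presD(2)[OF p A])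
 also have "eqv \<Gamma> ... (e_W E' (s_obj R A) \<star> R')" by (rule seq_right[OF eq])
 finally show "eqv \<Gamma> (sl A R' \<star> W A) (e_W E' (s_obj R' A) \<star> R')" by (simp add: o)
 show "tm (sl A R') (s_obj (W A) A) (idtm A) = e_idtm E' (s_obj R' A)"
  using presD(3)[OF p A] sfun_tm_eq[OF sle, of "s_obj (W A) A" "idtm A"] A o by simp
qed

text \<open>The squares for \<open>R\<close> and for \<open>Q\<close> are pasted. Preservation of
  the terminal object by \<open>R\<close> ensures that a term of \<open>A\<close> is sent to a term
  of the object that \<open>R\<close> assigns to \<open>A\<close>.\<close>

lemma preserves_at_comp:
 assumes "pre_esys E'" and R: "is_sfun E \<Gamma> E' \<Delta> R" "s_obj R (Ident F \<Gamma>) = Ident (e_cat E') \<Delta>" "\<Gamma> \<in> Obj F"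
  and p: "preserves_at E E' \<Gamma> R" and q: "preserves_at E' E'' \<Delta> Q"
 shows "preserves_at E E'' \<Gamma> (Q \<star> R)"
proof (rule preserves_atI)
 interpret E': pre_esys E' by fact
 fix A assume A: "A \<in> Arr F" "Cod F A = \<Gamma>"
 note RA = sfun_obj[OF R(1) A]
 have slR: "is_sfun E (Dom F A) E' (e_ext E' (s_obj R A)) (sl A R)"
  by (rule sfun_slice[OF E'.cat_axioms R(1) A])
 note slc = slice_comp[OF R(1) A, of Q]
 { fix x assume x: "x \<in> T A"
  have xt: "tm R A x \<in> e_T E' (s_obj R A)"
   by (rule sfun_tm_in[OF R(1) E'.cat_axioms R(3,2) A x])
  have t: "tm (Q \<star> R) A x = E'.tm Q (s_obj R A) (tm R A x)"
   by (rule sfun_tm_comp[OF R(1) E'.cat_axioms R(3,2) A])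
  have "eqv (Dom F A) (Q \<star> (R \<star> S A x)) (Q \<star> (e_S E' (s_obj R A) (tm R A x) \<star> sl A R))"
   by (rule seq_right[OF presD(1)[OF p A x]])
  also have "eqv (Dom F A) ... ((e_S E'' (s_obj Q (s_obj R A)) (E'.tm Q (s_obj R A) (tm R A x)) \<star>
    E'.sl (s_obj R A) Q) \<star> sl A R)"
   unfolding sassoc[symmetric]
   by (rule seq_left[OF E'.presD(1)[OF q RA(1,2) xt] slR])
  also have "eqv (Dom F A) ... (e_S E'' (s_obj Q (s_obj R A)) (E'.tm Q (s_obj R A) (tm R A x)) \<star>
    sl A (Q \<star> R))"
   unfolding sassoc by (rule seq_right[OF seq_sym[OF slc]])
  finally show "eqv (Dom F A) ((Q \<star> R) \<star> S A x)
    (e_S E'' (s_obj (Q \<star> R) A) (tm (Q \<star> R) A x) \<star> sl A (Q \<star> R))"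
   by (simp add: t sassoc) }
 have W: "is_sfun E \<Gamma> E (Dom F A) (W A)" using W_sfun[OF A(1)] A(2) by simp
 have "eqv \<Gamma> (sl A (Q \<star> R) \<star> W A) ((E'.sl (s_obj R A) Q \<star> sl A R) \<star> W A)"
  by (rule seq_left[OF slc W])
 also have "eqv \<Gamma> ... (E'.sl (s_obj R A) Q \<star> (e_W E' (s_obj R A) \<star> R))"
  unfolding sassoc by (rule seq_right[OF presD(2)[OF p A]])
 also have "eqv \<Gamma> ... ((e_W E'' (s_obj Q (s_obj R A)) \<star> Q) \<star> R)"
  unfolding sassoc[symmetric]
  by (rule seq_left[OF E'.presD(2)[OF q RA(1,2)] R(1)])
 finally show "eqv \<Gamma> (sl A (Q \<star> R) \<star> W A) (e_W E'' (s_obj (Q \<star> R) A) \<star> (Q \<star> R))"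
  by (simp add: sassoc)
 let ?V = "s_obj (W A) A" and ?RV = "s_obj (e_W E' (s_obj R A)) (s_obj R A)"
 have V: "?V \<in> Arr F" "Cod F ?V = Dom F A" using A by auto
 have slRi: "s_obj (sl A R) (Ident F (Dom F A)) = Ident (e_cat E') (e_ext E' (s_obj R A))" using RA by simp
 have RV: "s_obj (sl A R) ?V = ?RV"
  using seqD(1)[OF presD(2)[OF p A] A] by simp
 have "tm (sl A (Q \<star> R)) ?V (idtm A) = tm (E'.sl (s_obj R A) Q \<star> sl A R) ?V (idtm A)"
  using A V by (intro sfun_tm_eq[OF slc]) auto
 also have "... = E'.tm (E'.sl (s_obj R A) Q) ?RV (tm (sl A R) ?V (idtm A))"
  using sfun_tm_comp[OF slR E'.cat_axioms dom_obj[OF A(1)] slRi V, of "E'.sl (s_obj R A) Q" "idtm A"] RV by simp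
 also have "... = e_idtm E'' (s_obj (Q \<star> R) A)"
  using E'.presD(3)[OF q RA(1,2)] presD(3)[OF p A] by simp
 finally show "tm (sl A (Q \<star> R)) ?V (idtm A) = e_idtm E'' (s_obj (Q \<star> R) A)" .
qed

lemma hm_sfun: "hm \<Gamma> \<Delta> G \<Longrightarrow> sfn \<Gamma> \<Delta> G"
 and hm_ident: "hm \<Gamma> \<Delta> G \<Longrightarrow> s_obj G (Ident F \<Gamma>) = Ident F \<Delta>"
 by (simp_all add: is_slice_pre_ehom_def)

lemma hm_preserves_slice: "hm \<Gamma> \<Delta> G \<Longrightarrow> A \<in> Arr F \<Longrightarrow> Cod F A = \<Gamma> \<Longrightarrow> preserves_at E E (Dom F A) (sl A G)"
 by (simp add: is_slice_pre_ehom_def over_def)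

lemma hmI:
 assumes "sfn \<Gamma> \<Delta> G" "s_obj G (Ident F \<Gamma>) = Ident F \<Delta>"
  "\<And>A. A \<in> Arr F \<Longrightarrow> Cod F A = \<Gamma> \<Longrightarrow> preserves_at E E (Dom F A) (sl A G)"
 shows "hm \<Gamma> \<Delta> G"
 using assms by (simp add: is_slice_pre_ehom_def over_def)

text \<open>The definition of a homomorphism between slices speaks only of the functors
  \<open>sl A G\<close>; at the identity this functor is \<open>G\<close> itself up to
  \<open>sfun_eq\<close>.\<close>

lemma hm_pres:
 assumes "hm \<Gamma> \<Delta> G" "\<Gamma> \<in> Obj F"
 shows "preserves_at E E \<Gamma> G"
 using hm_preserves_slice[OF assms(1), of "Ident F \<Gamma>"] assms(2)
  preserves_at_cong[OF _ slice_id[OF hm_sfun[OF assms(1)] cat_axioms assms(2) hm_ident[OF assms(1)]]] by simp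

lemma hm_slice:
 assumes G: "hm \<Gamma> \<Delta> G" and A: "A \<in> Arr F" "Cod F A = \<Gamma>"
 shows "hm (Dom F A) (Dom F (s_obj G A)) (sl A G)"
proof (rule hmI)
 show "sfn (Dom F A) (Dom F (s_obj G A)) (sl A G)" by (rule sfun_slice[OF cat_axioms hm_sfun[OF G] A])
 show "s_obj (sl A G) (Ident F (Dom F A)) = Ident F (Dom F (s_obj G A))" using sfun_obj[OF hm_sfun[OF G] A] by simp
 fix P assume P: "P \<in> Arr F" "Cod F P = Dom F A"
 show "preserves_at E E (Dom F P) (sl P (sl A G))"
  using hm_preserves_slice[OF G, of "A \<odot> P"] A P
  by (intro preserves_at_cong[OF _ seq_sym[OF slice_slice[OF A(1) P]]]) simp
qed

lemma hm_comp:
 assumes K: "hm \<Gamma> \<Delta> K" and G: "hm \<Delta> \<Theta> G" and X: "\<Gamma> \<in> Obj F"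
 shows "hm \<Gamma> \<Theta> (G \<star> K)"
proof (rule hmI)
 show "sfn \<Gamma> \<Theta> (G \<star> K)" by (rule sfun_comp[OF cat_axioms hm_sfun[OF K] hm_sfun[OF G]])
 show "s_obj (G \<star> K) (Ident F \<Gamma>) = Ident F \<Theta>" using hm_ident[OF K] hm_ident[OF G] by simp
 fix A assume A: "A \<in> Arr F" "Cod F A = \<Gamma>"
 note KA = sfun_obj[OF hm_sfun[OF K] A]
 have "preserves_at E E (Dom F A) (sl (s_obj K A) G \<star> sl A K)"
  using hm_slice[OF K A] A KA
  by (intro preserves_at_comp[OF pre_esys_axioms _ _ _ hm_preserves_slice[OF K A] hm_preserves_slice[OF G KA(1,2)]])
   (auto simp: hm_sfun)
 then show "preserves_at E E (Dom F A) (sl A (G \<star> K))"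
  by (rule preserves_at_cong[OF _ seq_sym[OF slice_comp[OF hm_sfun[OF K] A]]])
qed

lemma hm_tm_in: "hm \<Gamma> \<Delta> G \<Longrightarrow> A \<in> Arr F \<Longrightarrow> Cod F A = \<Gamma> \<Longrightarrow> x \<in> T A \<Longrightarrow> tm G A x \<in> T (s_obj G A)"
 using sfun_tm_in[OF hm_sfun cat_axioms _ hm_ident] cod_obj by blast

lemma hm_obj: "hm \<Gamma> \<Delta> G \<Longrightarrow> A \<in> Arr F \<Longrightarrow> Cod F A = \<Gamma> \<Longrightarrow> s_obj G A \<in> Arr F \<and> Cod F (s_obj G A) = \<Delta>"
 using sfun_obj[OF hm_sfun] by blast

lemma tm_comp:
 "hm \<Gamma> \<Delta> K \<Longrightarrow> A \<in> Arr F \<Longrightarrow> Cod F A = \<Gamma> \<Longrightarrow> tm (G \<star> K) A x = tm G (s_obj K A) (tm K A x)"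
 using sfun_tm_comp[OF hm_sfun cat_axioms _ hm_ident] cod_obj by blast

lemma hm_id: "\<Gamma> \<in> Obj F \<Longrightarrow> hm \<Gamma> \<Gamma> sfun_id"
proof (rule hmI)
 have s: "eqv X (sl A sfun_id) sfun_id" if "A \<in> Arr F" for A X
  using that by (intro seqI) auto
 show "sfn \<Gamma> \<Gamma> sfun_id" by (rule is_sfunI) auto
 show "preserves_at E E (Dom F A) (sl A sfun_id)" if A: "A \<in> Arr F" "Cod F A = \<Gamma>" for A
 proof (rule preserves_at_cong[OF _ seq_sym[OF s[OF A(1)]]], rule preserves_atI)
  fix B assume B: "B \<in> Arr F" "Cod F B = Dom F A"
  show "eqv (Dom F B) (sfun_id \<star> S B x) (S (s_obj sfun_id B) (tm sfun_id B x) \<star> sl B sfun_id)" for x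
   using seq_right[OF seq_sym[OF s[OF B(1)]], of "Dom F B" "S B x"] by (simp add: sfun_tm_def)
  have "eqv (Dom F A) (sl B sfun_id \<star> W B) (sfun_id \<star> W B)"
   using W_sfun[OF B(1)] B by (intro seq_left[OF s[OF B(1)]]) auto
  then show "eqv (Dom F A) (sl B sfun_id \<star> W B) (W (s_obj sfun_id B) \<star> sfun_id)" by simp
  show "tm (sl B sfun_id) (s_obj (W B) B) (idtm B) = idtm (s_obj sfun_id B)" using B by (simp add: sfun_tm_def)
 qed
qed simp

end

locale esys = pre_esys +
 assumes is_esys: "is_esys E"
begin

lemma
 assumes A: "A \<in> Arr F"
 shows W_hm: "hm (Cod F A) (Dom F A) (W A)"
  and S_hm: "x \<in> T A \<Longrightarrow> hm (Dom F A) (Cod F A) (S A x)"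
  and S_W: "x \<in> T A \<Longrightarrow> eqv (Cod F A) (S A x \<star> W A) sfun_id"
  and S_idtm: "x \<in> T A \<Longrightarrow> tm (S A x) (s_obj (W A) A) (idtm A) = x"
  and S_idtm_W: "eqv (Dom F A) (S (s_obj (W A) A) (idtm A) \<star> sl A (W A)) sfun_id"
proof -
 have ob: "Cod F A \<in> Obj F" and ov: "A \<in> over F (Cod F A)" using A by (auto simp: over_def)
 have "(\<forall>x \<in> e_T E A. is_slice_pre_ehom E (Dom F A) (Cod F A) (S A x)) \<and>
    is_slice_pre_ehom E (Cod F A) (Dom F A) (W A) \<and>
    (\<forall>x \<in> e_T E A. sfun_eq E (Cod F A) (S A x \<star> W A) sfun_id) \<and>
    (\<forall>x \<in> e_T E A. sfun_tm E (S A x) (s_obj (W A) A) (idtm A) = x) \<and>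
    sfun_eq E (Dom F A) (S (s_obj (W A) A) (idtm A) \<star> sfun_slice F A (W A)) sfun_id"
  using is_esys[unfolded is_esys_def Let_def, THEN conjunct2, THEN bspec, THEN bspec, OF ob ov] .
 then show "hm (Cod F A) (Dom F A) (W A)" "x \<in> T A \<Longrightarrow> hm (Dom F A) (Cod F A) (S A x)"
  "x \<in> T A \<Longrightarrow> eqv (Cod F A) (S A x \<star> W A) sfun_id"
  "x \<in> T A \<Longrightarrow> tm (S A x) (s_obj (W A) A) (idtm A) = x"
  "eqv (Dom F A) (S (s_obj (W A) A) (idtm A) \<star> sl A (W A)) sfun_id" by auto
qed

text \<open>\<open>rel A B G\<close>: \<open>G: E/\<Gamma>.B \<rightarrow> E/\<Gamma>.A\<close> is a homomorphism over \<open>E/\<Gamma>\<close>. These are exactly the functors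
 \<open>f\<^sup>*\<close> for \<open>f \<in> thom A B\<close>, and \<open>f\<close> is recovered as the value at \<open>idtm B\<close>; hence equations between
 terms of \<open>thom\<close> may be checked on the functors.\<close>

definition rel :: "'a univ \<Rightarrow> 'a univ \<Rightarrow> 'a sfun \<Rightarrow> bool" where
 "rel A B G \<longleftrightarrow> hm (Dom F B) (Dom F A) G \<and> eqv (Cod F B) (G \<star> W B) (W A)"

abbreviation point :: "'a univ \<Rightarrow> 'a sfun \<Rightarrow> 'a univ" where
 "point B G \<equiv> tm G (s_obj (W B) B) (idtm B)"

abbreviation "pbf \<equiv> thom_pb E"

lemma rel_obj: "rel A B G \<Longrightarrow> B \<in> Arr F \<Longrightarrow> P \<in> Arr F \<Longrightarrow> Cod F P = Cod F B \<Longrightarrow>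
  s_obj G (s_obj (W B) P) = s_obj (W A) P"
 unfolding rel_def using seqD(1)[of E "Cod F B" "G \<star> W B" "W A" P] by auto

lemma rel_point:
 assumes "rel A B G" "B \<in> Arr F"
 shows "point B G \<in> T (s_obj (W A) B)"
proof -
 have "point B G \<in> T (s_obj G (s_obj (W B) B))"
  using assms unfolding rel_def by (intro hm_tm_in[where \<Gamma> = "Dom F B"]) auto
 then show ?thesis using rel_obj[OF assms(1,2,2)] by simp
qed

text \<open>The generic term determines \<open>G\<close>: precompose \<open>G\<close> with
  \<open>S_idtm_W\<close>, move \<open>G\<close> past the substitution of \<open>idtm B\<close>,
  which becomes the substitution of \<open>point B G\<close>, and replace
  \<open>G \<star> W B\<close> by \<open>W A\<close> inside the slice.\<close>

lemma rel_pbf: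
 assumes G: "rel A B G" and AB: "A \<in> Arr F" "B \<in> Arr F" "Cod F A = Cod F B"
 shows "eqv (Dom F B) G (pbf A B (point B G))"
proof -
 let ?V = "s_obj (W B) B"
 have V: "?V \<in> Arr F" "Cod F ?V = Dom F B" using AB by auto
 have GV: "s_obj G ?V = s_obj (W A) B" using rel_obj[OF G AB(2,2)] by simp
 have hG: "hm (Dom F B) (Dom F A) G" and eq: "eqv (Cod F B) (G \<star> W B) (W A)" using G by (auto simp: rel_def)
 have slW: "sfn (Dom F B) (Dom F ?V) (sl B (W B))" by (rule hm_sfun[OF hm_slice[OF W_hm[OF AB(2)] AB(2) refl]])
 have "eqv (Dom F B) (G \<star> sfun_id) (G \<star> (S ?V (idtm B) \<star> sl B (W B)))"
  by (rule seq_right[OF seq_sym[OF S_idtm_W[OF AB(2)]]])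
 also have "eqv (Dom F B) ... ((S (s_obj G ?V) (point B G) \<star> sl ?V G) \<star> sl B (W B))"
  unfolding sassoc[symmetric]
  by (rule seq_left[OF presD(1)[OF hm_pres[OF hG] V idtm_in] slW]) (use AB in auto)
 also have "eqv (Dom F B) ... (S (s_obj G ?V) (point B G) \<star> sl B (G \<star> W B))"
  unfolding sassoc
  by (rule seq_right[OF seq_sym[OF slice_comp[OF hm_sfun[OF W_hm[OF AB(2)]] AB(2) refl]]])
 also have "eqv (Dom F B) ... (S (s_obj G ?V) (point B G) \<star> sl B (W A))"
  by (rule seq_right[OF seq_slice[OF eq AB(2) refl]])
 finally show ?thesis by (simp add: thom_pb_def GV)
qed

lemma point_eq: "eqv (Dom F B) G K \<Longrightarrow> B \<in> Arr F \<Longrightarrow> point B G = point B K"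
 by (rule sfun_tm_eq) auto

text \<open>Converse to \<open>rel_pbf\<close>. Weakening by \<open>A\<close> commutes with
  weakening by \<open>B\<close>, and substituting \<open>f\<close> cancels the weakened weakening,
  so the functor lies over the base. Weakening also preserves \<open>idtm B\<close>, and
  substituting \<open>f\<close> into the resulting generic term returns \<open>f\<close>.\<close>

lemma pbf_rel:
 assumes AB: "A \<in> Arr F" "B \<in> Arr F" "Cod F A = Cod F B" and f: "f \<in> T (s_obj (W A) B)"
 shows "rel A B (pbf A B f)" "point B (pbf A B f) = f"
proof -
 let ?V = "s_obj (W A) B"
 have V: "?V \<in> Arr F" "Cod F ?V = Dom F A" using AB by auto
 have hW: "hm (Dom F B) (Dom F ?V) (sl B (W A))"
  by (rule hm_slice[OF W_hm[OF AB(1)] AB(2) AB(3)[symmetric]])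
 have hS: "hm (Dom F ?V) (Dom F A) (S ?V f)" using S_hm[OF V(1) f] V by simp
 have pres: "preserves_at E E (Cod F B) (W A)" using hm_pres[OF W_hm[OF AB(1)]] AB by simp
 note pr = presD[OF pres AB(2) refl]
 have "eqv (Cod F B) (pbf A B f \<star> W B) (S ?V f \<star> (W ?V \<star> W A))"
  unfolding thom_pb_def sassoc by (rule seq_right[OF pr(2)])
 also have "eqv (Cod F B) ... (sfun_id \<star> W A)"
  unfolding sassoc[symmetric]
  by (rule seq_left[OF S_W[OF V(1) f]]) (use W_sfun[OF AB(1)] AB V in simp)
 finally have "eqv (Cod F B) (pbf A B f \<star> W B) (W A)" by simp
 moreover have "hm (Dom F B) (Dom F A) (pbf A B f)"
  unfolding thom_pb_def using AB by (intro hm_comp[OF hW hS]) simp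
 ultimately show "rel A B (pbf A B f)" by (simp add: rel_def)
 have "point B (pbf A B f) = tm (S ?V f) (s_obj (sl B (W A)) (s_obj (W B) B)) (tm (sl B (W A)) (s_obj (W B) B) (idtm B))"
  unfolding thom_pb_def using AB by (intro tm_comp[OF hW]) auto
 also have "... = tm (S ?V f) (s_obj (W ?V) ?V) (idtm ?V)"
  using pr(3) seqD(1)[OF pr(2) AB(2) refl] by simp
 also have "... = f" by (rule S_idtm[OF V(1) f])
 finally show "point B (pbf A B f) = f" .
qed

lemma rel_comp:
 assumes G: "rel A B G" and K: "rel D A K" and AB: "A \<in> Arr F" "B \<in> Arr F" "Cod F A = Cod F B"
 shows "rel D B (K \<star> G)"
 unfolding rel_def
proof
 have g: "hm (Dom F B) (Dom F A) G" "eqv (Cod F B) (G \<star> W B) (W A)"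
  and k: "hm (Dom F A) (Dom F D) K" "eqv (Cod F A) (K \<star> W A) (W D)" using G K by (auto simp: rel_def)
 show "hm (Dom F B) (Dom F D) (K \<star> G)" using hm_comp[OF g(1) k(1)] AB by simp
 have "eqv (Cod F B) (K \<star> (G \<star> W B)) (K \<star> W A)" by (rule seq_right[OF g(2)])
 also have "eqv (Cod F B) ... (W D)" using k(2) AB by simp
 finally show "eqv (Cod F B) ((K \<star> G) \<star> W B) (W D)" by (simp add: sassoc)
qed

lemma rel_id: "A \<in> Arr F \<Longrightarrow> rel A A sfun_id"
 by (simp add: rel_def hm_id)

lemma point_id: "point A sfun_id = idtm A"
 by (simp add: sfun_tm_def)

text \<open>This makes weakening by \<open>Q\<close> the functor of the arrow \<open>I(Q)\<close> in
  the category of terms.\<close>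

lemma rel_W:
 assumes "A \<in> Arr F" "Q \<in> Arr F" "Cod F Q = Dom F A"
 shows "rel (A \<odot> Q) A (W Q)"
 unfolding rel_def using assms W_hm[OF assms(2)] seq_sym[OF W_comp[OF assms]] by simp

lemma point_comp:
 assumes G: "rel A B G" and K: "rel D A K" and AB: "A \<in> Arr F" "B \<in> Arr F" "Cod F A = Cod F B"
 shows "point B (K \<star> G) = tm K (s_obj (W A) B) (point B G)"
proof -
 have "point B (K \<star> G) = tm K (s_obj G (s_obj (W B) B)) (point B G)"
  using G AB by (intro tm_comp) (auto simp: rel_def)
 then show ?thesis using rel_obj[OF G AB(2,2)] by simp
qed

text \<open>Weakening by an identity is the identity, so the substitution \<open>S ?i x\<close>,
  which cancels it, is the identity too; but it sends \<open>idtm\<close> to \<open>x\<close>. This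
  is what makes the constructed CE-system rooted.\<close>

lemma T_ident:
 assumes X: "X \<in> Obj F" and x: "x \<in> T (Ident F X)"
 shows "x = idtm (Ident F X)"
proof -
 let ?i = "Ident F X"
 have i: "?i \<in> Arr F" "Cod F ?i = X" "Dom F ?i = X" using X by auto
 have Wi: "s_obj (W ?i) ?i = ?i" using seqD(1)[OF W_id[OF X] i(1,2)] by simp
 have "eqv X (S ?i x) (S ?i x \<star> W ?i)"
  using seq_right[OF seq_sym[OF W_id[OF X]], of "S ?i x"] by simp
 also have "eqv X ... sfun_id" using S_W[OF i(1) x] X by simp
 finally have e: "eqv X (S ?i x) sfun_id" .
 have "tm (S ?i x) ?i (idtm ?i) = tm sfun_id ?i (idtm ?i)"
  using idtm_in[OF i(1)] unfolding Wi by (intro sfun_tm_eq[OF e i(1,2)])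
 moreover have "tm (S ?i x) ?i (idtm ?i) = x" using S_idtm[OF i(1) x] Wi by simp
 ultimately show ?thesis by (simp add: sfun_tm_def)
qed

end

section \<open>From E-systems to CE-systems\<close>

lemma slice_cat_simps [simp]:
 "Obj (slice_cat F \<Gamma>) = over F \<Gamma>"
 "\<langle>A, P\<rangle> \<in> Arr (slice_cat F \<Gamma>) \<longleftrightarrow> A \<in> over F \<Gamma> \<and> P \<in> over F (Dom F A)"
 "Dom (slice_cat F \<Gamma>) a = ufst a \<cdot>\<^bsub>F\<^esub> usnd a"
 "Cod (slice_cat F \<Gamma>) a = ufst a"
 "Ident (slice_cat F \<Gamma>) A = \<langle>A, Ident F (Dom F A)\<rangle>"
 "a \<cdot>\<^bsub>slice_cat F \<Gamma>\<^esub> b = \<langle>ufst a, usnd a \<cdot>\<^bsub>F\<^esub> usnd b\<rangle>"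
 by (auto simp: slice_cat_def)

lemma slice_arrE:
 assumes "a \<in> Arr (slice_cat F \<Gamma>)"
 obtains A P where "a = \<langle>A, P\<rangle>" "A \<in> Arr F" "Cod F A = \<Gamma>" "P \<in> Arr F" "Cod F P = Dom F A"
 using assms unfolding slice_cat_def over_def by auto

lemma slice_overE:
 assumes "r \<in> over (slice_cat F \<Gamma>) A"
 obtains R where "r = \<langle>A, R\<rangle>" "R \<in> Arr F" "Cod F R = Dom F A" "A \<in> Arr F" "Cod F A = \<Gamma>"
 using assms by (auto simp: over_def[of "slice_cat F \<Gamma>"] elim!: slice_arrE)

context esys
begin

definition afun :: "'a univ \<Rightarrow> 'a sfun" where
 "afun a = pbf (ufst a) (tgt a) (ufst (usnd a))"

text \<open>Inverse to \<open>afun\<close> on functors satisfying \<open>rel\<close>, up to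
  \<open>sfun_eq\<close>. The correspondence is contravariant: an arrow from \<open>A\<close> to
  \<open>B\<close> acts from the slice over the domain of \<open>B\<close> to the slice over the
  domain of \<open>A\<close>.\<close>

definition arr_of :: "'a univ \<Rightarrow> 'a univ \<Rightarrow> 'a sfun \<Rightarrow> 'a univ" where
 "arr_of A B G = \<langle>A, \<langle>point B G, B\<rangle>\<rangle>"

text \<open>The connecting arrow of \<open>a\<close> and \<open>R\<close> described by its functor,
  the slice of \<open>afun a\<close> at \<open>R\<close>. Its agreement with the term formula
  \<open>thom_pi2\<close> is the content of \<open>E2CE_pi2\<close>.\<close>

abbreviation "p2 a R \<equiv> arr_of (ufst a \<odot> s_obj (afun a) R) (tgt a \<odot> R) (sl R (afun a))"
abbreviation "TC \<equiv> thom_cat E"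

lemma thom_cat_simps [simp]:
 "Obj (TC \<Gamma>) = over F \<Gamma>" "Dom (TC \<Gamma>) a = ufst a" "Cod (TC \<Gamma>) a = tgt a"
 "Ident (TC \<Gamma>) A = \<langle>A, \<langle>idtm A, A\<rangle>\<rangle>"
 by (auto simp: thom_cat_def)

lemma thom_arr: "a \<in> Arr (TC \<Gamma>) \<longleftrightarrow> (\<exists>A f B. a = \<langle>A, \<langle>f, B\<rangle>\<rangle> \<and> A \<in> Arr F \<and> Cod F A = \<Gamma> \<and>
  B \<in> Arr F \<and> Cod F B = \<Gamma> \<and> f \<in> T (s_obj (W A) B))"
 unfolding thom_cat_def thom_def over_def by auto

lemma thom_arrD:
 assumes "a \<in> Arr (TC \<Gamma>)"
 shows "ufst a \<in> Arr F" "Cod F (ufst a) = \<Gamma>" "tgt a \<in> Arr F" "Cod F (tgt a) = \<Gamma>"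
  "rel (ufst a) (tgt a) (afun a)" "arr_of (ufst a) (tgt a) (afun a) = a"
 using assms pbf_rel unfolding thom_arr afun_def arr_of_def by auto

lemma arr_of:
 assumes "rel A B G" "A \<in> Arr F" "Cod F A = \<Gamma>" "B \<in> Arr F" "Cod F B = \<Gamma>"
 shows "arr_of A B G \<in> Arr (TC \<Gamma>)" "eqv (Dom F B) (afun (arr_of A B G)) G"
proof -
 show "arr_of A B G \<in> Arr (TC \<Gamma>)"
  using rel_point[OF assms(1,4)] assms unfolding thom_arr arr_of_def by auto
 have "Cod F A = Cod F B" using assms by simp
 then show "eqv (Dom F B) (afun (arr_of A B G)) G"
  using seq_sym[OF rel_pbf[OF assms(1,2,4)]] by (simp add: afun_def arr_of_def)
qed

text \<open>A term is the value of its functor at the generic term. All equations between arrows of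
  the category of terms are verified on functors through this lemma.\<close>

lemma thom_eqI:
 assumes "a \<in> Arr (TC \<Gamma>)" "b \<in> Arr (TC \<Gamma>)" "ufst a = ufst b" "tgt a = tgt b"
  "eqv (Dom F (tgt a)) (afun a) (afun b)"
 shows "a = b"
proof -
 have "point (tgt a) (afun a) = point (tgt b) (afun b)"
  using point_eq[OF assms(5)] thom_arrD(3)[OF assms(1)] assms(4) by simp
 then have "arr_of (ufst a) (tgt a) (afun a) = arr_of (ufst b) (tgt b) (afun b)"
  using assms(3,4) by (simp add: arr_of_def)
 then show ?thesis using thom_arrD(6)[OF assms(1)] thom_arrD(6)[OF assms(2)] by simp
qed

text \<open>Composition is by definition the action of \<open>afun a\<close> on the term of
  \<open>b\<close>. That term is a value at \<open>idtm\<close>, so the composite is the value at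
  \<open>idtm\<close> of the composite functor, taken in the opposite order.\<close>

lemma thom_comp:
 assumes a: "a \<in> Arr (TC \<Gamma>)" and b: "b \<in> Arr (TC \<Gamma>)" and ab: "ufst b = tgt a"
 shows "b \<cdot>\<^bsub>TC \<Gamma>\<^esub> a = arr_of (ufst a) (tgt b) (afun a \<star> afun b)"
  "b \<cdot>\<^bsub>TC \<Gamma>\<^esub> a \<in> Arr (TC \<Gamma>)"
  "ufst (b \<cdot>\<^bsub>TC \<Gamma>\<^esub> a) = ufst a" "usnd (usnd (b \<cdot>\<^bsub>TC \<Gamma>\<^esub> a)) = tgt b"
  "eqv (Dom F (tgt b)) (afun (b \<cdot>\<^bsub>TC \<Gamma>\<^esub> a)) (afun a \<star> afun b)"
proof -
 note A = thom_arrD[OF a] and B = thom_arrD[OF b]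
 have r: "rel (tgt a) (tgt b) (afun b)" using B(5) ab by simp
 have c: "Cod F (tgt a) = Cod F (tgt b)" using A B by simp
 have "point (tgt b) (afun a \<star> afun b) =
   tm (afun a) (s_obj (W (tgt a)) (tgt b)) (point (tgt b) (afun b))"
  by (rule point_comp[OF r A(5) A(3) B(3) c])
 moreover have "point (tgt b) (afun b) = ufst (usnd b)"
  using B(6) b by (auto simp: arr_of_def thom_arr)
 ultimately show e: "b \<cdot>\<^bsub>TC \<Gamma>\<^esub> a = arr_of (ufst a) (tgt b) (afun a \<star> afun b)"
  by (simp add: thom_cat_def Let_def arr_of_def afun_def)
 note o = arr_of[OF rel_comp[OF r A(5) A(3) B(3) c] A(1,2) B(3,4)]
 show "b \<cdot>\<^bsub>TC \<Gamma>\<^esub> a \<in> Arr (TC \<Gamma>)"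
  "eqv (Dom F (tgt b)) (afun (b \<cdot>\<^bsub>TC \<Gamma>\<^esub> a)) (afun a \<star> afun b)"
  unfolding e by (fact o)+
 show "ufst (b \<cdot>\<^bsub>TC \<Gamma>\<^esub> a) = ufst a" "usnd (usnd (b \<cdot>\<^bsub>TC \<Gamma>\<^esub> a)) = tgt b"
  unfolding e by (simp_all add: arr_of_def)
qed

lemma thom_ident:
 assumes "A \<in> Arr F" "Cod F A = \<Gamma>"
 shows "\<langle>A, \<langle>idtm A, A\<rangle>\<rangle> \<in> Arr (TC \<Gamma>)" "eqv (Dom F A) (afun \<langle>A, \<langle>idtm A, A\<rangle>\<rangle>) sfun_id"
 using arr_of[OF rel_id[OF assms(1)] assms assms] by (simp_all add: arr_of_def point_id)

lemma afun_sfun: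
 assumes "a \<in> Arr (TC \<Gamma>)"
 shows "sfn (Dom F (tgt a)) (Dom F (ufst a)) (afun a)"
 using thom_arrD(5)[OF assms] hm_sfun by (auto simp: rel_def)

text \<open>The unit and associativity laws are those of composition of functors.\<close>

lemma is_category_thom: "is_category (TC \<Gamma>)"
 unfolding is_category_def hom_def
proof (intro conjI ballI impI, goal_cases)
 case (1 f)
 then show ?case using thom_arrD[OF 1] by (simp add: over_def)
next
 case (2 f)
 then show ?case using thom_arrD[OF 2] by (simp add: over_def)
next
 case (3 A)
 then show ?case using thom_ident[of A \<Gamma>] by (simp add: over_def)
next
 case (4 f g)
 then show ?case using thom_comp[of f \<Gamma> g] by simp
next
 case (5 f)
 note f = thom_arrD[OF 5]
 note i = thom_ident[OF f(1,2)]
 have e: "ufst f = usnd (usnd \<langle>ufst f, \<langle>idtm (ufst f), ufst f\<rangle>\<rangle>)" by simp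
 note c = thom_comp[OF i(1) 5 e]
 have "eqv (Dom F (tgt f)) (afun (f \<cdot>\<^bsub>TC \<Gamma>\<^esub> \<langle>ufst f, \<langle>idtm (ufst f), ufst f\<rangle>\<rangle>)) (afun f)"
  using seq_trans[OF c(5) seq_left[OF i(2) afun_sfun[OF 5]]] by simp
 then show ?case using c(2-4) 5 by - (rule thom_eqI[of _ \<Gamma>], simp_all)
next
 case (6 f)
 note f = thom_arrD[OF 6]
 note i = thom_ident[OF f(3,4)]
 have e: "ufst \<langle>tgt f, \<langle>idtm (tgt f), tgt f\<rangle>\<rangle> = tgt f" by simp
 note c = thom_comp[OF 6 i(1) e]
 have "eqv (Dom F (tgt f)) (afun (\<langle>tgt f, \<langle>idtm (tgt f), tgt f\<rangle>\<rangle> \<cdot>\<^bsub>TC \<Gamma>\<^esub> f)) (afun f)"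
  using seq_trans[OF c(5)[unfolded univ.sel] seq_right[OF i(2)]] by simp
 then show ?case using c(2-4) 6 by - (rule thom_eqI[of _ \<Gamma>], simp_all)
next
 case (7 f g h)
 have e: "ufst g = tgt f" "ufst h = tgt g" using 7(4,5) by simp_all
 note gf = thom_comp[OF 7(1,2) e(1)] and hg = thom_comp[OF 7(2,3) e(2)]
 have e': "ufst h = usnd (usnd (g \<cdot>\<^bsub>TC \<Gamma>\<^esub> f))" "ufst (h \<cdot>\<^bsub>TC \<Gamma>\<^esub> g) = tgt f"
  using e gf(4) hg(3) by simp_all
 note l = thom_comp[OF 7(1) hg(2) e'(2)] and r = thom_comp[OF gf(2) 7(3) e'(1)]
 let ?X = "Dom F (tgt h)"
 have "eqv ?X (afun ((h \<cdot>\<^bsub>TC \<Gamma>\<^esub> g) \<cdot>\<^bsub>TC \<Gamma>\<^esub> f)) (afun f \<star> afun (h \<cdot>\<^bsub>TC \<Gamma>\<^esub> g))"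
  using l(5) hg(4) by simp
 also have "eqv ?X ... ((afun f \<star> afun g) \<star> afun h)"
  unfolding sassoc by (rule seq_right[OF hg(5)])
 also have "eqv ?X ... (afun (g \<cdot>\<^bsub>TC \<Gamma>\<^esub> f) \<star> afun h)"
  using seq_left[OF seq_sym[OF gf(5)]] afun_sfun[OF 7(3)] e by simp
 also have "eqv ?X ... (afun (h \<cdot>\<^bsub>TC \<Gamma>\<^esub> (g \<cdot>\<^bsub>TC \<Gamma>\<^esub> f)))"
  by (rule seq_sym[OF r(5)])
 finally show ?case using l r hg gf by - (rule thom_eqI[of _ \<Gamma>], simp_all)
qed

text \<open>Weakening by \<open>B \<odot> R\<close> is weakening by \<open>B\<close> followed by
  weakening by \<open>R\<close>. The homomorphism \<open>G\<close> commutes with the latter and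
  turns the former into \<open>W A\<close>.\<close>

lemma rel_slice:
 assumes G: "rel A B G" and AB: "A \<in> Arr F" "B \<in> Arr F" "Cod F A = Cod F B" and R: "R \<in> Arr F" "Cod F R = Dom F B"
 shows "rel (A \<odot> s_obj G R) (B \<odot> R) (sl R G)"
 unfolding rel_def
proof
 have g: "hm (Dom F B) (Dom F A) G" "eqv (Cod F B) (G \<star> W B) (W A)" using G by (auto simp: rel_def)
 note GR = hm_obj[OF g(1) R]
 show "hm (Dom F (B \<odot> R)) (Dom F (A \<odot> s_obj G R)) (sl R G)"
  using hm_slice[OF g(1) R] GR AB R by simp
 note pr = presD(2)[OF hm_pres[OF g(1) dom_obj[OF AB(2)]] R]
 have WB: "sfn (Cod F B) (Dom F B) (W B)" using W_sfun[OF AB(2)] .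
 have "eqv (Cod F B) (sl R G \<star> W (B \<odot> R)) (sl R G \<star> (W R \<star> W B))"
  by (rule seq_right[OF W_comp[OF AB(2) R]])
 also have "eqv (Cod F B) ... (W (s_obj G R) \<star> (G \<star> W B))"
  unfolding sassoc[symmetric] by (rule seq_left[OF pr WB])
 also have "eqv (Cod F B) ... (W (s_obj G R) \<star> W A)" by (rule seq_right[OF g(2)])
 also have "eqv (Cod F B) ... (W (A \<odot> s_obj G R))"
  using seq_sym[OF W_comp[OF AB(1)]] GR AB(3) by simp
 finally show "eqv (Cod F (B \<odot> R)) (sl R G \<star> W (B \<odot> R)) (W (A \<odot> s_obj G R))"
  using AB R by simp
qed

text \<open>The pairing formula is the value at the generic term of \<open>B \<odot> R\<close> of a
  composite of one weakening and two substitutions. The first substitution turns the weakening into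
  \<open>W ?fR\<close> after \<open>?f\<close>; in the slice over \<open>R\<close>, the substitution
  of \<open>idtm ?fR\<close> then cancels \<open>W ?fR\<close> and leaves the slice of
  \<open>?f\<close>.\<close>

lemma thom_pi2:
 assumes AB: "A \<in> Arr F" "B \<in> Arr F" "Cod F A = Cod F B" and f: "f \<in> T (s_obj (W A) B)"
  and R: "R \<in> Arr F" "Cod F R = Dom F B"
 shows "thom_pi2 E A B f R = point (B \<odot> R) (sl R (pbf A B f))"
proof -
 let ?f = "pbf A B f"
 let ?fR = "s_obj ?f R"
 let ?V = "s_obj (W A) B"
 let ?W' = "W (A \<odot> ?fR)"
 let ?B' = "s_obj ?W' B"
 let ?P = "s_arr ?W' B R"
 let ?x = "tm (W ?fR) ?V f"
 let ?Sx = "S ?B' ?x"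
 note relf = pbf_rel[OF AB f]
 have hf: "hm (Dom F B) (Dom F A) ?f" using relf by (simp add: rel_def)
 have fR: "?fR \<in> Arr F" "Cod F ?fR = Dom F A" using hm_obj[OF hf R] by auto
 have AfR: "A \<odot> ?fR \<in> Arr F" "Cod F (A \<odot> ?fR) = Cod F B" "Dom F (A \<odot> ?fR) = Dom F ?fR" using AB fR by auto
 have V: "?V \<in> Arr F" "Cod F ?V = Dom F A" using AB by auto
 have BR: "B \<odot> R \<in> Arr F" "Cod F (B \<odot> R) = Cod F B" "Dom F (B \<odot> R) = Dom F R" using AB R by auto
 have W': "eqv (Cod F B) ?W' (W ?fR \<star> W A)" using W_comp[OF AB(1) fR] AB by simp
 have B': "?B' = s_obj (W ?fR) ?V" using seqD(1)[OF W' AB(2) refl] by simp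
 have B'a: "?B' \<in> Arr F" "Cod F ?B' = Dom F ?fR" using AB fR AfR by auto
 have hW': "hm (Cod F B) (Dom F ?fR) ?W'" using W_hm[OF AfR(1)] AfR by simp
 have hWfR: "hm (Dom F A) (Dom F ?fR) (W ?fR)" using W_hm[OF fR(1)] fR by simp
 have x: "?x \<in> T ?B'" unfolding B' by (rule hm_tm_in[OF hWfR V f])
 have hSx: "hm (Dom F ?B') (Dom F ?fR) ?Sx" using S_hm[OF B'a(1) x] B'a by simp
 have hWA: "hm (Cod F B) (Dom F A) (W A)" using W_hm[OF AB(1)] AB by simp
 have slW': "hm (Dom F B) (Dom F ?B') (sl B ?W')" by (rule hm_slice[OF hW' AB(2) refl])
 \<comment> \<open>Weakening by \<open>?fR\<close> is a homomorphism, hence commutes with the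
   substitution of \<open>f\<close> and turns it into the substitution of the weakened term
   \<open>?x\<close>.\<close>
 have e1: "eqv (Dom F B) (?Sx \<star> sl B ?W') (W ?fR \<star> ?f)"
 proof -
  have "eqv (Dom F B) (?Sx \<star> sl B ?W') (?Sx \<star> sl B (W ?fR \<star> W A))"
   by (rule seq_right[OF seq_slice[OF W' AB(2) refl]])
  also have "eqv (Dom F B) ... (?Sx \<star> (sl ?V (W ?fR) \<star> sl B (W A)))"
   by (rule seq_right[OF slice_comp[OF hm_sfun[OF hWA] AB(2) refl]])
  also have "eqv (Dom F B) ... ((W ?fR \<star> S ?V f) \<star> sl B (W A))"
   unfolding sassoc[symmetric] B'
   by (rule seq_left[OF seq_sym[OF presD(1)[OF hm_pres[OF hWfR dom_obj[OF AB(1)]] V f]]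
    hm_sfun[OF hm_slice[OF hWA AB(2) refl]]])
  finally show ?thesis by (simp add: thom_pb_def sassoc)
 qed
 have P: "?P \<in> Arr F" "Cod F ?P = Dom F ?B'"
  and W'BR: "s_obj ?W' (B \<odot> R) = ?B' \<odot> ?P"
  using sfun_arr[OF hm_sfun[OF hW'] AB(2) refl R] by auto
 have dP: "Dom F (s_obj ?W' (B \<odot> R)) = Dom F ?P" using W'BR P B'a by simp
 have hslBR: "hm (Dom F R) (Dom F ?P) (sl (B \<odot> R) ?W')"
  using hm_slice[OF hW' BR(1,2)] BR(3) dP by simp
 have SxP: "s_obj ?Sx ?P = s_obj (W ?fR) ?fR" using seqD(1)[OF e1 R] by simp
 \<comment> \<open>The functor whose value at \<open>idtm (B \<odot> R)\<close> is the defining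
   formula of \<open>thom_pi2\<close>: weaken, substitute \<open>?x\<close>, then substitute
   \<open>idtm ?fR\<close>.\<close>
 let ?K = "S (s_obj (W ?fR) ?fR) (idtm ?fR) \<star> (sl ?P ?Sx \<star> sl (B \<odot> R) ?W')"
 have "eqv (Dom F R) (sl ?P ?Sx \<star> sl (B \<odot> R) ?W') (sl ?P ?Sx \<star> sl R (sl B ?W'))"
  by (rule seq_right[OF seq_sym[OF slice_slice[OF AB(2) R]]])
 also have "eqv (Dom F R) ... (sl R (?Sx \<star> sl B ?W'))"
  using seq_sym[OF slice_comp[OF hm_sfun[OF slW'] R]] by simp
 also have "eqv (Dom F R) ... (sl R (W ?fR \<star> ?f))" by (rule seq_slice[OF e1 R])
 also have "eqv (Dom F R) ... (sl ?fR (W ?fR) \<star> sl R ?f)" by (rule slice_comp[OF hm_sfun[OF hf] R])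
 finally have e2: "eqv (Dom F R) (sl ?P ?Sx \<star> sl (B \<odot> R) ?W') (sl ?fR (W ?fR) \<star> sl R ?f)" .
 have "eqv (Dom F R) ?K ((S (s_obj (W ?fR) ?fR) (idtm ?fR) \<star> sl ?fR (W ?fR)) \<star> sl R ?f)"
  unfolding sassoc by (rule seq_right[OF e2])
 also have "eqv (Dom F R) ... (sfun_id \<star> sl R ?f)"
  by (rule seq_left[OF S_idtm_W[OF fR(1)] hm_sfun[OF hm_slice[OF hf R]]])
 finally have K: "eqv (Dom F R) ?K (sl R ?f)" by simp
 let ?U = "s_obj (W (B \<odot> R)) (B \<odot> R)"
 let ?AP = "?B' \<odot> ?P"
 have U: "?U \<in> Arr F" "Cod F ?U = Dom F R" using BR by auto
 note prW = presD[OF hm_pres[OF hW' cod_obj[OF AB(2)]] BR(1,2)]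
 have id: "tm (sl (B \<odot> R) ?W') ?U (idtm (B \<odot> R)) = idtm ?AP" using prW(3) W'BR by simp
 have obU: "s_obj (sl (B \<odot> R) ?W') ?U = s_obj (W ?AP) ?AP"
  using seqD(1)[OF prW(2) BR(1,2)] W'BR by simp
 have AP: "?AP \<in> Arr F" "Dom F ?AP = Dom F ?P" using P B'a by auto
 have "point (B \<odot> R) ?K = tm (S (s_obj (W ?fR) ?fR) (idtm ?fR)) (s_obj (sl ?P ?Sx \<star> sl (B \<odot> R) ?W') ?U)
   (tm (sl ?P ?Sx \<star> sl (B \<odot> R) ?W') ?U (idtm (B \<odot> R)))"
  by (rule tm_comp[OF hm_comp[OF hslBR hm_slice[OF hSx P] dom_obj[OF R(1)]] U])
 also have "tm (sl ?P ?Sx \<star> sl (B \<odot> R) ?W') ?U (idtm (B \<odot> R)) = tm (sl ?P ?Sx) (s_obj (W ?AP) ?AP) (idtm ?AP)"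
  using tm_comp[OF hslBR U] obU id by simp
 also have "... = s_tm ?Sx ?P (s_obj (W ?AP) ?AP) (idtm ?AP)"
  using AP P by (intro sfun_tm_slice) auto
 also have "s_obj (sl ?P ?Sx \<star> sl (B \<odot> R) ?W') ?U = s_arr ?Sx ?P (s_obj (W ?AP) ?AP)"
  using obU by simp
 finally have "point (B \<odot> R) ?K = thom_pi2 E A B f R"
  by (simp add: thom_pi2_def tm_pair_def Let_def SxP)
 moreover have "point (B \<odot> R) ?K = point (B \<odot> R) (sl R ?f)"
  using K BR by (intro point_eq) auto
 ultimately show ?thesis by simp
qed

lemma E2CE_simps [simp]:
 "ce_fam (E2CE_obj E) = slice_cat F (e_root E)" "ce_cat (E2CE_obj E) = TC (e_root E)"
 "ce_one (E2CE_obj E) = Ident F (e_root E)"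
 "ce_I (E2CE_obj E) \<langle>A, Q\<rangle> = arr_of (A \<odot> Q) A (W Q)"
 "ce_pb (E2CE_obj E) a \<langle>B, R\<rangle> = \<langle>ufst a, s_obj (pbf (ufst a) (tgt a) (ufst (usnd a))) R\<rangle>"
 by (auto simp: E2CE_obj_def arr_of_def Let_def)

lemma E2CE_pb: "a \<in> Arr (TC \<Gamma>) \<Longrightarrow> ce_pb (E2CE_obj E) a \<langle>B, R\<rangle> = \<langle>ufst a, s_obj (afun a) R\<rangle>"
 by (simp add: afun_def)

lemma E2CE_pi2:
 assumes "a \<in> Arr (TC \<Gamma>)" "R \<in> Arr F" "Cod F R = Dom F (tgt a)"
 shows "ce_pi2 (E2CE_obj E) a \<langle>tgt a, R\<rangle> =
  p2 a R"
 using assms thom_pi2[of "ufst a" "tgt a" "ufst (usnd a)" R]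
 by (auto simp: E2CE_obj_def arr_of_def Let_def afun_def thom_arr)

lemma thom_I:
 assumes "A \<in> Arr F" "Cod F A = \<Gamma>" "Q \<in> Arr F" "Cod F Q = Dom F A"
 shows "arr_of (A \<odot> Q) A (W Q) \<in> Arr (TC \<Gamma>)"
  "eqv (Dom F A) (afun (arr_of (A \<odot> Q) A (W Q))) (W Q)"
 using arr_of[OF rel_W[OF assms(1,3,4)]] assms by auto

lemma pi2_arr:
 assumes a: "a \<in> Arr (TC \<Gamma>)" and R: "R \<in> Arr F" "Cod F R = Dom F (tgt a)"
 shows "p2 a R \<in> Arr (TC \<Gamma>)"
  "eqv (Dom F R) (afun (p2 a R)) (sl R (afun a))"
  "s_obj (afun a) R \<in> Arr F" "Cod F (s_obj (afun a) R) = Dom F (ufst a)"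
proof -
 note A = thom_arrD[OF a]
 show o: "s_obj (afun a) R \<in> Arr F" "Cod F (s_obj (afun a) R) = Dom F (ufst a)"
  using sfun_obj[OF afun_sfun[OF a] R] by auto
 have "Cod F (ufst a) = Cod F (tgt a)" using A by simp
 note r = rel_slice[OF A(5) A(1,3) this R]
 show "p2 a R \<in> Arr (TC \<Gamma>)"
  "eqv (Dom F R) (afun (p2 a R)) (sl R (afun a))"
  using arr_of[OF r] A o R by auto
qed

lemma arr_of_simps [simp]: "ufst (arr_of A B G) = A" "usnd (usnd (arr_of A B G)) = B"
 by (auto simp: arr_of_def)

text \<open>The square commutes because \<open>afun a\<close> commutes with weakening by
  \<open>R\<close>. An arrow into the pullback is determined by its composites because its functor
  can be reassembled from theirs: the composite with the projection supplies the action on the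
  slice, and the composite with the connecting arrow supplies the term to substitute.\<close>

lemma thom_pullback:
 assumes a: "a \<in> Arr (TC \<Gamma>)" and R: "R \<in> Arr F" "Cod F R = Dom F (tgt a)"
 defines "A \<equiv> ufst a" and "B \<equiv> tgt a" and "fR \<equiv> s_obj (afun a) R"
 shows "is_pullback (TC \<Gamma>) (arr_of (B \<odot> R) B (W R)) a
   (arr_of (A \<odot> fR) (B \<odot> R) (sl R (afun a))) (arr_of (A \<odot> fR) A (W fR))"
  (is "is_pullback ?C ?i a ?h ?k")
proof -
 interpret C: cat ?C by (rule cat.intro[OF is_category_thom])
 note D = thom_arrD[OF a, folded A_def B_def]
 note pi = pi2_arr[OF a R, folded A_def B_def fR_def]
 have R': "Cod F R = Dom F B" using R by (simp add: B_def)
 note I = thom_I[OF D(3,4) R(1) R'] and K = thom_I[OF D(1,2) pi(3,4)]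
 have ha: "hm (Dom F B) (Dom F A) (afun a)" using D(5) by (simp add: rel_def)
 have af: "eqv (Dom F B) (sl R (afun a) \<star> W R) (W fR \<star> afun a)"
  using presD(2)[OF hm_pres[OF ha dom_obj[OF D(3)]] R(1) R'] by (simp add: fR_def)
 have comp: "eqv (Dom F (tgt g)) (afun (g \<cdot>\<^bsub>?C\<^esub> f)) (Ff \<star> Gg)"
  if "f \<in> Arr ?C" "g \<in> Arr ?C" "ufst g = tgt f" "eqv (Dom F (tgt f)) (afun f) Ff"
   "eqv (Dom F (tgt g)) (afun g) Gg" for f g Ff Gg
  using seq_trans[OF thom_comp(5)[OF that(1-3)] sfun_eq_comp[OF that(5) afun_sfun[OF that(2)] that(4)[folded that(3)]]] .
 show ?thesis
 proof (rule C.pullbackI)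
  have "eqv (Dom F B) (afun (?i \<cdot>\<^bsub>?C\<^esub> ?h)) (sl R (afun a) \<star> W R)"
   using comp[OF pi(1) I(1), of "sl R (afun a)" "W R"] pi(2) I(2) D R R' by simp
  also note af
  also have "eqv (Dom F B) (W fR \<star> afun a) (afun (a \<cdot>\<^bsub>?C\<^esub> ?k))"
   using seq_sym[OF comp[OF K(1) a, of "W fR" "afun a"]] K(2) D by (simp add: A_def B_def)
  finally show "?i \<cdot>\<^bsub>?C\<^esub> ?h = a \<cdot>\<^bsub>?C\<^esub> ?k"
   using thom_comp(2-4)[OF pi(1) I(1)] thom_comp(2-4)[OF K(1) a]
   by - (rule thom_eqI[of _ \<Gamma>], simp_all add: A_def B_def)
  fix u v assume uv: "u \<in> Arr ?C" "v \<in> Arr ?C" "Dom ?C u = Dom ?C v" "Cod ?C u = Dom ?C ?i" "Cod ?C v = Dom ?C a"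
   "?i \<cdot>\<^bsub>?C\<^esub> u = a \<cdot>\<^bsub>?C\<^esub> v"
  txt \<open>Here \<open>u\<close> is the arrow into \<open>B.R\<close> and \<open>v\<close> the arrow into \<open>A\<close>; the arrow \<open>w\<close> into the pullback
   acts by \<open>S\<^sub>z \<circ> v\<^sup>*/fR\<close> with \<open>z = u\<^sup>*(idtm R)\<close>.\<close>
  have uv': "tgt u = B \<odot> R" "tgt v = A" "ufst v = ufst u" using uv by (simp_all add: A_def)
  note U = thom_arrD[OF uv(1)] and V = thom_arrD[OF uv(2)]
  have hu: "hm (Dom F R) (Dom F (ufst u)) (afun u)" using U(5) D R R' by (simp add: rel_def uv')
  have hv: "hm (Dom F A) (Dom F (ufst u)) (afun v)" using V(5) by (simp add: rel_def uv')
  have "eqv (Dom F B) (afun u \<star> W R) (afun (?i \<cdot>\<^bsub>?C\<^esub> u))"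
   using seq_sym[OF comp[OF uv(1) I(1), of "afun u" "W R"]] I(2) by (simp add: uv')
  also have "eqv (Dom F B) ... (afun v \<star> afun a)"
   unfolding uv(6) using comp[OF uv(2) a, of "afun v" "afun a"] by (simp add: uv' A_def B_def)
  finally have sq: "eqv (Dom F B) (afun u \<star> W R) (afun v \<star> afun a)" .
  let ?Z = "s_obj (afun v) fR" and ?z = "point R (afun u)"
  have RR: "s_obj (W R) R \<in> Arr F" "Cod F (s_obj (W R) R) = Dom F R" using R by auto
  have Z: "s_obj (afun u) (s_obj (W R) R) = ?Z" using seqD(1)[OF sq R(1) R'] by (simp add: fR_def)
  have z: "?z \<in> T ?Z" using hm_tm_in[OF hu RR idtm_in[OF R(1)]] Z by simp
  have Za: "?Z \<in> Arr F" "Cod F ?Z = Dom F (ufst u)" using hm_obj[OF hv pi(3,4)] by auto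
  let ?w = "S ?Z ?z \<star> sl fR (afun v)"
  have hS: "hm (Dom F ?Z) (Dom F (ufst u)) (S ?Z ?z)" using S_hm[OF Za(1) z] Za by simp
  have hslv: "hm (Dom F fR) (Dom F ?Z) (sl fR (afun v))" by (rule hm_slice[OF hv pi(3,4)])
  have hw: "hm (Dom F fR) (Dom F (ufst u)) ?w" using hm_comp[OF hslv hS] pi(3) by simp
  \<comment> \<open>The equation for the projection to \<open>A\<close>: weakening by
    \<open>fR\<close> becomes weakening by \<open>?Z\<close>, which the substitution of
    \<open>?z\<close> cancels.\<close>
  have "eqv (Dom F A) (?w \<star> W fR) (S ?Z ?z \<star> (W ?Z \<star> afun v))"
   unfolding sassoc
   by (rule seq_right[OF presD(2)[OF hm_pres[OF hv dom_obj[OF D(1)]] pi(3,4)]])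
  also have "eqv (Dom F A) ... (sfun_id \<star> afun v)"
   unfolding sassoc[symmetric]
   using S_W[OF Za(1) z] by (intro seq_left[OF _ hm_sfun[OF hv]]) (simp add: Za)
  finally have w1: "eqv (Dom F A) (?w \<star> W fR) (afun v)" by simp
  have slW: "sfn (Dom F R) (Dom F (s_obj (W R) R)) (sl R (W R))"
   using hm_sfun[OF hm_slice[OF W_hm[OF R(1)] R(1) refl]] .
  \<comment> \<open>The equation for the arrow to \<open>B \<odot> R\<close>: the commuting square
    replaces \<open>afun v \<star> afun a\<close> by \<open>afun u \<star> W R\<close>, then
    \<open>afun u\<close> is moved in front of the substitution of \<open>idtm R\<close>, and
    \<open>S_idtm_W\<close> cancels the rest.\<close>
  have "eqv (Dom F R) (?w \<star> sl R (afun a)) (S ?Z ?z \<star> sl R (afun v \<star> afun a))"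
   unfolding sassoc fR_def
   by (rule seq_right[OF seq_sym[OF slice_comp[OF hm_sfun[OF ha] R(1) R']]])
  also have "eqv (Dom F R) ... (S ?Z ?z \<star> sl R (afun u \<star> W R))"
   by (rule seq_right[OF seq_slice[OF seq_sym[OF sq] R(1) R']])
  also have "eqv (Dom F R) ... (S ?Z ?z \<star> (sl (s_obj (W R) R) (afun u) \<star> sl R (W R)))"
   by (rule seq_right[OF slice_comp[OF W_sfun[OF R(1)] R(1) refl]])
  also have "eqv (Dom F R) ... ((afun u \<star> S (s_obj (W R) R) (idtm R)) \<star> sl R (W R))"
   unfolding sassoc[symmetric]
   by (rule seq_left[OF _ slW])
    (rule seq_sym[OF presD(1)[OF hm_pres[OF hu dom_obj[OF R(1)]] RR idtm_in[OF R(1)], unfolded Z]])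
  also have "eqv (Dom F R) ... (afun u \<star> sfun_id)"
   unfolding sassoc by (rule seq_right[OF S_idtm_W[OF R(1)]])
  finally have w2: "eqv (Dom F R) (?w \<star> sl R (afun a)) (afun u)" by simp
  have relw: "rel (ufst u) (A \<odot> fR) ?w"
   unfolding rel_def
  proof
   show "hm (Dom F (A \<odot> fR)) (Dom F (ufst u)) ?w" using hw D pi by simp
   have "eqv (Cod F A) (?w \<star> W (A \<odot> fR)) (?w \<star> (W fR \<star> W A))"
    by (rule seq_right[OF W_comp[OF D(1) pi(3,4)]])
   also have "eqv (Cod F A) ... (afun v \<star> W A)"
    unfolding sassoc[of ?w, symmetric] by (rule seq_left[OF w1 W_sfun[OF D(1)]])
   also have "eqv (Cod F A) ... (W (ufst u))" using V(5) by (simp add: rel_def uv')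
   finally show "eqv (Cod F (A \<odot> fR)) (?w \<star> W (A \<odot> fR)) (W (ufst u))" using D pi by simp
  qed
  let ?a = "arr_of (ufst u) (A \<odot> fR) ?w"
  have wa: "?a \<in> Arr ?C" "eqv (Dom F fR) (afun ?a) ?w"
   using arr_of[OF relw U(1,2), of] D pi by auto
  have h: "?h \<cdot>\<^bsub>?C\<^esub> ?a = u"
  proof (rule thom_eqI[of _ \<Gamma>])
   have "eqv (Dom F R) (afun (?h \<cdot>\<^bsub>?C\<^esub> ?a)) (?w \<star> sl R (afun a))"
    using comp[OF wa(1) pi(1), of ?w "sl R (afun a)"] pi wa(2) D R R' by simp
   then show "eqv (Dom F (usnd (usnd (?h \<cdot>\<^bsub>?C\<^esub> ?a)))) (afun (?h \<cdot>\<^bsub>?C\<^esub> ?a)) (afun u)"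
    using seq_trans[OF _ w2] thom_comp(4)[OF wa(1) pi(1)] D R R' by simp
  qed (use thom_comp(2-4)[OF wa(1) pi(1)] uv uv' in simp_all)
  moreover have "?k \<cdot>\<^bsub>?C\<^esub> ?a = v"
  proof (rule thom_eqI[of _ \<Gamma>])
   have "eqv (Dom F A) (afun (?k \<cdot>\<^bsub>?C\<^esub> ?a)) (?w \<star> W fR)"
    using comp[OF wa(1) K(1), of ?w "W fR"] pi wa(2) K D by simp
   then show "eqv (Dom F (usnd (usnd (?k \<cdot>\<^bsub>?C\<^esub> ?a)))) (afun (?k \<cdot>\<^bsub>?C\<^esub> ?a)) (afun v)"
    using seq_trans[OF _ w1] thom_comp(4)[OF wa(1) K(1)] by simp
  qed (use thom_comp(2-4)[OF wa(1) K(1)] uv uv' in simp_all)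
  ultimately show "\<exists>w. w \<in> Arr ?C \<and> Dom ?C w = Dom ?C u \<and> Cod ?C w = Dom ?C ?h \<and>
    ?h \<cdot>\<^bsub>?C\<^esub> w = u \<and> ?k \<cdot>\<^bsub>?C\<^esub> w = v"
   using wa(1) by (intro exI[of _ ?a]) simp
 next
  fix w w' assume w: "w \<in> Arr ?C" "w' \<in> Arr ?C" "Dom ?C w = Dom ?C w'" "Cod ?C w = Dom ?C ?h" "Cod ?C w' = Dom ?C ?h"
   "?h \<cdot>\<^bsub>?C\<^esub> w = ?h \<cdot>\<^bsub>?C\<^esub> w'" "?k \<cdot>\<^bsub>?C\<^esub> w = ?k \<cdot>\<^bsub>?C\<^esub> w'"
  let ?FF = "s_obj (W fR) fR"
  have FF: "?FF \<in> Arr F" "Cod F ?FF = Dom F fR" using pi by auto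
  have slW: "sfn (Dom F fR) (Dom F ?FF) (sl fR (W fR))"
   using hm_sfun[OF hm_slice[OF W_hm[OF pi(3)] pi(3) refl]] .
  \<comment> \<open>The functor of \<open>x\<close> in terms of its two composites: precompose it
    with \<open>S_idtm_W\<close> at \<open>fR\<close> and move \<open>afun x\<close> past the
    substitution. The term that is substituted is recognized as the value of the other composite at
    \<open>idtm R\<close>.\<close>
  have key: "eqv (Dom F fR) (afun x) (S (s_obj (afun (?k \<cdot>\<^bsub>?C\<^esub> x)) fR)
    (tm (afun (?h \<cdot>\<^bsub>?C\<^esub> x)) (s_obj (W R) R) (idtm R)) \<star> sl fR (afun (?k \<cdot>\<^bsub>?C\<^esub> x)))"
   if x: "x \<in> Arr ?C" "tgt x = A \<odot> fR" for x
  proof -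
   have hx: "hm (Dom F fR) (Dom F (ufst x)) (afun x)" using thom_arrD(5)[OF x(1)] D pi by (simp add: rel_def x(2))
   have k: "eqv (Dom F A) (afun (?k \<cdot>\<^bsub>?C\<^esub> x)) (afun x \<star> W fR)"
    using comp[OF x(1) K(1), of "afun x" "W fR"] K(2) x by simp
   have h: "eqv (Dom F R) (afun (?h \<cdot>\<^bsub>?C\<^esub> x)) (afun x \<star> sl R (afun a))"
    using comp[OF x(1) pi(1), of "afun x" "sl R (afun a)"] pi(2) x D R R' by simp
   have RR: "s_obj (W R) R \<in> Arr F" "Cod F (s_obj (W R) R) = Dom F R" using R by auto
   have sla: "hm (Dom F R) (Dom F fR) (sl R (afun a))" using hm_slice[OF ha R(1) R'] by (simp add: fR_def)
   have "tm (afun (?h \<cdot>\<^bsub>?C\<^esub> x)) (s_obj (W R) R) (idtm R) =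
     tm (afun x) (s_obj (sl R (afun a)) (s_obj (W R) R)) (tm (sl R (afun a)) (s_obj (W R) R) (idtm R))"
    using sfun_tm_eq[OF h RR idtm_in[OF R(1)]] tm_comp[OF sla RR] by simp
   also have "... = tm (afun x) ?FF (idtm fR)"
    using presD(3)[OF hm_pres[OF ha dom_obj[OF D(3)]] R(1) R'] seqD(1)[OF af R(1) R']
    by (simp add: fR_def)
   finally have z: "tm (afun (?h \<cdot>\<^bsub>?C\<^esub> x)) (s_obj (W R) R) (idtm R) = tm (afun x) ?FF (idtm fR)" .
   have o: "s_obj (afun (?k \<cdot>\<^bsub>?C\<^esub> x)) fR = s_obj (afun x) ?FF" using seqD(1)[OF k pi(3,4)] by simp
   have "eqv (Dom F fR) (afun x \<star> sfun_id) (afun x \<star> (S ?FF (idtm fR) \<star> sl fR (W fR)))"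
    by (rule seq_right[OF seq_sym[OF S_idtm_W[OF pi(3)]]])
   also have "eqv (Dom F fR) ... ((S (s_obj (afun x) ?FF) (tm (afun x) ?FF (idtm fR)) \<star> sl ?FF (afun x)) \<star> sl fR (W fR))"
    unfolding sassoc[symmetric]
    by (rule seq_left[OF presD(1)[OF hm_pres[OF hx dom_obj[OF pi(3)]] FF idtm_in[OF pi(3)]] slW])
   also have "eqv (Dom F fR) ... (S (s_obj (afun x) ?FF) (tm (afun x) ?FF (idtm fR)) \<star> sl fR (afun x \<star> W fR))"
    unfolding sassoc
    by (rule seq_right[OF seq_sym[OF slice_comp[OF W_sfun[OF pi(3)] pi(3) refl]]])
   also have "eqv (Dom F fR) ... (S (s_obj (afun x) ?FF) (tm (afun x) ?FF (idtm fR)) \<star> sl fR (afun (?k \<cdot>\<^bsub>?C\<^esub> x)))"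
    by (rule seq_right[OF seq_slice[OF seq_sym[OF k] pi(3,4)]])
   finally show ?thesis by (simp add: z o)
  qed
  have "tgt w = A \<odot> fR" "usnd (usnd w') = A \<odot> fR" using w by simp_all
  note kk = key[OF w(1) this(1)] key[OF w(2) this(2)] this
  have "eqv (Dom F fR) (afun w) (afun w')"
   using seq_trans[OF kk(1)[unfolded w(6,7)] seq_sym[OF kk(2)]] .
  then show "w = w'" using w kk D pi by - (rule thom_eqI[OF w(1,2)], simp_all)
 qed (use I K pi D a R in \<open>simp_all add: A_def B_def\<close>)
qed

end

locale strat_esys = esys +
 assumes is_stratified: "is_stratified_esys E"

sublocale strat_esys \<subseteq> T: strat_cat "e_cat E" "e_root E"
 using is_stratified e_terminal
 by unfold_locales (auto simp: is_stratified_esys_def)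

context strat_esys
begin

lemma lev_W:
 assumes "A \<in> Arr F" "B \<in> Arr F" "Cod F B = Cod F A"
 shows "e_lev E (Dom F (s_obj (W A) B)) = e_lev E (Dom F B) - e_lev E (Cod F A) + e_lev E (Dom F A)"
proof -
 have "e_lev E (Dom F B) - e_lev E (Cod F A) = e_lev E (Dom F (s_obj (W A) B)) - e_lev E (Dom F A)"
 proof -
  have "is_stratified_sfun E (Cod F A) (Dom F A) (W A)"
   using is_stratified assms(1) cod_obj[OF assms(1)] unfolding is_stratified_esys_def over_def by blast
  then show ?thesis using assms unfolding is_stratified_sfun_def over_def by blast
 qed
 then show ?thesis using T.level_mono[of "s_obj (W A) B"] assms by simp
qed

lemma lev_S:
 assumes "A \<in> Arr F" "x \<in> T A" "B \<in> Arr F" "Cod F B = Dom F A"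
 shows "e_lev E (Dom F (s_obj (S A x) B)) = e_lev E (Dom F B) - e_lev E (Dom F A) + e_lev E (Cod F A)"
proof -
 have "e_lev E (Dom F B) - e_lev E (Dom F A) = e_lev E (Dom F (s_obj (S A x) B)) - e_lev E (Cod F A)"
 proof -
  have "is_stratified_sfun E (Dom F A) (Cod F A) (S A x)"
   using is_stratified assms(1,2) cod_obj[OF assms(1)] unfolding is_stratified_esys_def over_def by blast
  then show ?thesis using assms unfolding is_stratified_sfun_def over_def by blast
 qed
 then show ?thesis using T.level_mono[of "s_obj (S A x) B"] assms by simp
qed

text \<open>Through \<open>E2CE_pb\<close> and \<open>E2CE_pi2\<close>, the clauses on pulled back
  families become statements about values of functors on objects, and those on connecting arrows
  become statements about slices of functors.\<close>

lemma is_cesys_E2CE: "is_cesys (E2CE_obj E)"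
 unfolding is_cesys_def Let_def E2CE_simps
proof (intro conjI ballI, goal_cases)
 let ?C = "TC (e_root E)"
 {
  case 1
  show ?case by (rule is_category_slice[OF is_cat])
 next
  case 2
  show ?case by (rule is_category_thom)
 next
  case 3
  show ?case by simp
 next
  case 4
  show ?case unfolding is_functor_def fmap.select_convs
  proof (intro conjI ballI impI, goal_cases)
   case (2 f)
   then show ?case by (auto elim!: slice_arrE simp: hom_def thom_I)
  next
   case (3 A)
   then have A: "A \<in> Arr F" "Cod F A = e_root E" by (auto simp: over_def)
   have i: "Ident F (Dom F A) \<in> Arr F" "Cod F (Ident F (Dom F A)) = Dom F A" using A by auto
   show ?case using thom_I[OF A i] thom_ident[OF A] A
    by - (rule thom_eqI[of _ "e_root E"], auto intro: seq_trans[OF _ seq_trans[OF W_id seq_sym]])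
  next
   case (4 f g)
   obtain A P where f: "f = \<langle>A, P\<rangle>" "A \<in> Arr F" "Cod F A = e_root E" "P \<in> Arr F" "Cod F P = Dom F A"
    using 4(1) by (rule slice_arrE)
   obtain B Q where g: "g = \<langle>B, Q\<rangle>" "B \<in> Arr F" "Cod F B = e_root E" "Q \<in> Arr F" "Cod F Q = Dom F B"
    using 4(2) by (rule slice_arrE)
   have A: "A = B \<odot> Q" using 4(3) f g by simp
   have P: "Cod F P = Dom F Q" using f g A by simp
   note I1 = thom_I[OF f(2-5)] and I2 = thom_I[OF g(2-5)]
   have QP: "Q \<odot> P \<in> Arr F" "Cod F (Q \<odot> P) = Dom F B" using f g P by auto
   note I3 = thom_I[OF g(2,3) QP]
   have e: "ufst (arr_of (B \<odot> Q) B (W Q)) = usnd (usnd (arr_of (A \<odot> P) A (W P)))" by (simp add: A)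
   note c = thom_comp[OF I1(1) I2(1) e]
   have "eqv (Dom F B) (afun (arr_of (B \<odot> (Q \<odot> P)) B (W (Q \<odot> P)))) (W P \<star> W Q)"
    using seq_trans[OF I3(2)] W_comp[OF g(4) f(4) P] g by simp
   also have "eqv (Dom F B) ... (afun (arr_of (A \<odot> P) A (W P)) \<star> afun (arr_of (B \<odot> Q) B (W Q)))"
    by (rule seq_sym, rule sfun_eq_comp[OF I2(2), where E' = E and \<Delta> = "Dom F (B \<odot> Q)"])
     (use afun_sfun[OF I2(1)] I1(2) A in simp_all)
   finally have "eqv (Dom F B) (afun (arr_of (B \<odot> (Q \<odot> P)) B (W (Q \<odot> P))))
     (afun (arr_of (B \<odot> Q) B (W Q) \<cdot>\<^bsub>?C\<^esub> arr_of (A \<odot> P) A (W P)))"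
    using seq_trans[OF _ seq_sym[OF c(5)]] by simp
   then have "arr_of (B \<odot> (Q \<odot> P)) B (W (Q \<odot> P)) = arr_of (B \<odot> Q) B (W Q) \<cdot>\<^bsub>?C\<^esub> arr_of (A \<odot> P) A (W P)"
    using c(2-4) I3(1) f g P A by - (rule thom_eqI[of _ "e_root E"], auto simp: assoc)
   then show ?case by (simp add: f g)
  qed simp
 next
  case 5
  show ?case using rooted_tree.terminal[OF slice_tree[OF T.strat_cat_axioms]] .
 next
  case (6 a r)
  then obtain R where "r = \<langle>tgt a, R\<rangle>" "R \<in> Arr F" "Cod F R = Dom F (tgt a)"
   by (auto elim: slice_overE)
  then show ?case using pi2_arr[OF 6(1)] thom_arrD[OF 6(1)] by (simp add: E2CE_pb[OF 6(1)] over_def del: E2CE_simps(5))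
 next
  case (7 a r)
  then obtain R where r: "r = \<langle>tgt a, R\<rangle>" "R \<in> Arr F" "Cod F R = Dom F (tgt a)"
   by (auto elim: slice_overE)
  show ?case using pi2_arr[OF 7(1) r(2,3)]
   by (simp add: r(1) E2CE_pb[OF 7(1)] E2CE_pi2[OF 7(1) r(2,3)] hom_def del: E2CE_simps(5))
 next
  case (8 a r)
  then obtain R where r: "r = \<langle>tgt a, R\<rangle>" "R \<in> Arr F" "Cod F R = Dom F (tgt a)"
   by (auto elim: slice_overE)
  show ?case using thom_pullback[OF 8(1) r(2,3)]
   by (simp add: r(1) E2CE_pb[OF 8(1)] E2CE_pi2[OF 8(1) r(2,3)] del: E2CE_simps(5))
 next
  case (9 a)
  note A = thom_arrD[OF 9]
  have "s_obj (afun a) (Ident F (Dom F (tgt a))) = Ident F (Dom F (ufst a))"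
   using A(5) hm_ident by (auto simp: rel_def)
  then show ?case by (simp add: E2CE_pb[OF 9] del: E2CE_simps(5))
 next
  case (10 a)
  note A = thom_arrD[OF 10]
  let ?i = "Ident F (Dom F (tgt a))"
  have i: "?i \<in> Arr F" "Cod F ?i = Dom F (tgt a)" "Dom F ?i = Dom F (tgt a)" using A by auto
  have oi: "s_obj (afun a) ?i = Ident F (Dom F (ufst a))"
   using A(5) hm_ident by (auto simp: rel_def)
  have "eqv (Dom F (tgt a)) (sl ?i (afun a)) (afun a)"
   using slice_id[OF afun_sfun[OF 10] cat_axioms] A oi by simp
  then have "arr_of (ufst a \<odot> s_obj (afun a) ?i) (tgt a \<odot> ?i) (sl ?i (afun a)) = a"
   using pi2_arr(1,2)[OF 10 i(1,2)] 10 oi A i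
   by - (rule thom_eqI[of _ "e_root E"], auto intro: seq_trans)
  then show ?case using E2CE_pi2[OF 10 i(1,2)] by simp
 next
  case (11 A r)
  then obtain R where r: "r = \<langle>A, R\<rangle>" "R \<in> Arr F" "Cod F R = Dom F A" "A \<in> Arr F" "Cod F A = e_root E"
   by (auto elim: slice_overE)
  show ?case using thom_ident[OF r(4,5)] seqD(1)[OF thom_ident(2)[OF r(4,5)] r(2,3)]
   by (simp add: r(1) E2CE_pb[of _ "e_root E"] del: E2CE_simps(5))
 next
  case (12 A r)
  then obtain R where r: "r = \<langle>A, R\<rangle>" "R \<in> Arr F" "Cod F R = Dom F A" "A \<in> Arr F" "Cod F A = e_root E"
   by (auto elim: slice_overE)
  let ?i = "\<langle>A, \<langle>idtm A, A\<rangle>\<rangle>"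
  note i = thom_ident[OF r(4,5)]
  have R': "Cod F R = Dom F (usnd (usnd ?i))" using r by simp
  have o: "s_obj (afun ?i) R = R" using seqD(1)[OF i(2) r(2,3)] by simp
  note p = pi2_arr(1,2)[OF i(1) r(2) R']
  have AR: "A \<odot> R \<in> Arr F" "Cod F (A \<odot> R) = e_root E" "Dom F (A \<odot> R) = Dom F R" using r by auto
  have "eqv (Dom F R) (sl R (afun ?i)) (sl R sfun_id)" by (rule seq_slice[OF i(2) r(2,3)])
  also have "eqv (Dom F R) ... sfun_id" using r by (intro seqI) auto
  also have "eqv (Dom F R) ... (afun \<langle>A \<odot> R, \<langle>idtm (A \<odot> R), A \<odot> R\<rangle>\<rangle>)"
   using seq_sym[OF thom_ident(2)[OF AR(1,2)]] AR by simp
  finally have "arr_of (A \<odot> R) (A \<odot> R) (sl R (afun ?i)) = \<langle>A \<odot> R, \<langle>idtm (A \<odot> R), A \<odot> R\<rangle>\<rangle>"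
   using p o thom_ident(1)[OF AR(1,2)] AR by - (rule thom_eqI[of _ "e_root E"], auto intro: seq_trans)
  then show ?case using E2CE_pi2[OF i(1) r(2) R'] o r by simp
 next
  case (13 a b r)
  then obtain R where r: "r = \<langle>tgt a, R\<rangle>" "R \<in> Arr F" "Cod F R = Dom F (tgt a)"
   by (auto elim: slice_overE)
  have ab: "b \<in> Arr ?C" "ufst a = tgt b" using 13 by (auto simp: over_def)
  note c = thom_comp[OF ab(1) 13(1) ab(2)]
  have "s_obj (afun (a \<cdot>\<^bsub>?C\<^esub> b)) R = s_obj (afun b) (s_obj (afun a) R)"
   using seqD(1)[OF c(5) r(2,3)] by simp
  then show ?case using c(3) by (simp add: r(1) E2CE_pb[OF c(2)] E2CE_pb[OF 13(1)] E2CE_pb[OF ab(1)] del: E2CE_simps(5))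
 next
  case (14 a b r)
  then obtain R where r: "r = \<langle>tgt a, R\<rangle>" "R \<in> Arr F" "Cod F R = Dom F (tgt a)"
   by (auto elim: slice_overE)
  have ab: "b \<in> Arr ?C" "ufst a = tgt b" using 14 by (auto simp: over_def)
  note c = thom_comp[OF ab(1) 14(1) ab(2)]
  let ?aR = "s_obj (afun a) R"
  note pa = pi2_arr[OF 14(1) r(2,3)]
  have aR: "?aR \<in> Arr F" "Cod F ?aR = Dom F (tgt b)" using pa ab by auto
  note pb = pi2_arr[OF ab(1) aR]
  have R': "Cod F R = Dom F (usnd (usnd (a \<cdot>\<^bsub>?C\<^esub> b)))" using r c by simp
  note pc = pi2_arr[OF c(2) r(2) R']
  have oc: "s_obj (afun (a \<cdot>\<^bsub>?C\<^esub> b)) R = s_obj (afun b) ?aR"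
   using seqD(1)[OF c(5) r(2,3)] by simp
  let ?pa = "p2 a R"
  let ?pb = "p2 b ?aR"
  let ?pc = "arr_of (ufst (a \<cdot>\<^bsub>?C\<^esub> b) \<odot> s_obj (afun (a \<cdot>\<^bsub>?C\<^esub> b)) R) (usnd (usnd (a \<cdot>\<^bsub>?C\<^esub> b)) \<odot> R) (sl R (afun (a \<cdot>\<^bsub>?C\<^esub> b)))"
  have e: "ufst ?pa = usnd (usnd ?pb)" using ab by simp
  note cc = thom_comp[OF pb(1) pa(1) e]
  have BR: "tgt a \<in> Arr F" using thom_arrD[OF 14(1)] by simp
  have dBR: "Dom F (tgt a \<odot> R) = Dom F R" using BR r by simp
  have "eqv (Dom F R) (afun ?pc) (sl R (afun b \<star> afun a))"
   by (rule seq_trans[OF pc(2) seq_slice[OF c(5) r(2,3)]])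
  also have "eqv (Dom F R) ... (sl ?aR (afun b) \<star> sl R (afun a))"
   by (rule slice_comp[OF afun_sfun[OF 14(1)] r(2,3)])
  also have "eqv (Dom F R) ... (afun ?pb \<star> afun ?pa)"
  proof (rule seq_sym, rule sfun_eq_comp[OF pa(2)])
   show "sfn (Dom F R) (Dom F (ufst a \<odot> ?aR)) (afun ?pa)" using afun_sfun[OF pa(1)] dBR by simp
   show "eqv (Dom F (ufst a \<odot> ?aR)) (afun ?pb) (sl ?aR (afun b))"
    using pb(2) thom_arrD[OF 14(1)] pa by simp
  qed
  also have "eqv (Dom F R) ... (afun (?pa \<cdot>\<^bsub>?C\<^esub> ?pb))" using seq_sym[OF cc(5)] dBR by simp
  finally have "?pc = ?pa \<cdot>\<^bsub>?C\<^esub> ?pb"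
   using pc(1) cc(2-4) c(3,4) oc dBR by - (rule thom_eqI[of _ "e_root E"], simp_all)
  then show ?case using E2CE_pi2[OF c(2) r(2) R'] E2CE_pi2[OF 14(1) r(2,3)] E2CE_pi2[OF ab(1) aR] c(4) ab(2)
   by (simp add: r(1) E2CE_pb[OF 14(1)] del: E2CE_simps(5))
 next
  case (15 a r q)
  then obtain R where r: "r = \<langle>tgt a, R\<rangle>" "R \<in> Arr F" "Cod F R = Dom F (tgt a)"
   by (auto elim: slice_overE)
  obtain Q where q: "q = \<langle>tgt a \<odot> R, Q\<rangle>" "Q \<in> Arr F" "Cod F Q = Dom F R"
   using 15(3) thom_arrD[OF 15(1)] r by (auto elim: slice_overE)
  note p = pi2_arr[OF 15(1) r(2,3)]
  show ?case
   using sfun_arr(3)[OF afun_sfun[OF 15(1)] r(2,3) q(2,3)] seqD(1)[OF p(2) q(2,3)]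
   by (simp add: r(1) q(1) E2CE_pb[OF 15(1)] E2CE_pi2[OF 15(1) r(2,3)] E2CE_pb[OF p(1)] del: E2CE_simps(5))
 next
  case (16 a r q)
  then obtain R where r: "r = \<langle>tgt a, R\<rangle>" "R \<in> Arr F" "Cod F R = Dom F (tgt a)"
   by (auto elim: slice_overE)
  note A = thom_arrD[OF 16(1)]
  obtain Q where q: "q = \<langle>tgt a \<odot> R, Q\<rangle>" "Q \<in> Arr F" "Cod F Q = Dom F R"
   using 16(3) A r by (auto elim: slice_overE)
  let ?pa = "p2 a R"
  note p = pi2_arr[OF 16(1) r(2,3)]
  have RQ: "R \<odot> Q \<in> Arr F" "Cod F (R \<odot> Q) = Dom F (tgt a)" "Dom F (R \<odot> Q) = Dom F Q" using r q by auto
  note pl = pi2_arr[OF 16(1) RQ(1,2)]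
  have Q': "Cod F Q = Dom F (usnd (usnd ?pa))" using q A r by simp
  note pr = pi2_arr[OF p(1) q(2) Q']
  have o: "s_obj (afun ?pa) Q = s_arr (afun a) R Q" using seqD(1)[OF p(2) q(2,3)] by simp
  have so: "s_obj (afun a) (R \<odot> Q) = s_obj (afun a) R \<odot> s_arr (afun a) R Q"
   using sfun_arr(3)[OF afun_sfun[OF 16(1)] r(2,3) q(2,3)] .
  note ar = sfun_arr(1,2)[OF afun_sfun[OF 16(1)] r(2,3) q(2,3)]
  let ?l = "p2 a (R \<odot> Q)"
  let ?r = "arr_of (ufst ?pa \<odot> s_obj (afun ?pa) Q) (usnd (usnd ?pa) \<odot> Q) (sl Q (afun ?pa))"
  have "eqv (Dom F Q) (afun ?l) (sl (R \<odot> Q) (afun a))" using pl(2) RQ by simp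
  also have "eqv (Dom F Q) ... (sl Q (sl R (afun a)))" by (rule seq_sym[OF slice_slice[OF r(2) q(2,3)]])
  also have "eqv (Dom F Q) ... (sl Q (afun ?pa))" by (rule seq_slice[OF seq_sym[OF p(2)] q(2,3)])
  also have "eqv (Dom F Q) ... (afun ?r)" by (rule seq_sym[OF pr(2)])
  finally have "?l = ?r"
   using pl(1) pr(1) A r q p o so ar RQ by - (rule thom_eqI[of _ "e_root E"], simp_all add: assoc)
  then show ?case using E2CE_pi2[OF 16(1) RQ(1,2)] E2CE_pi2[OF 16(1) r(2,3)] E2CE_pi2[OF p(1) q(2) Q']
   by (simp add: r(1) q(1))
 }
qed

text \<open>An arrow from \<open>A\<close> to the identity of the root is a term of
  \<open>W A\<close> applied to that identity, which is again an identity; \<open>T_ident\<close>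
  says that it has exactly one term.\<close>

lemma is_rooted_E2CE: "is_rooted_cesys (E2CE_obj E)"
 unfolding is_rooted_cesys_def is_terminal_def
proof (intro conjI ballI)
 let ?i = "Ident F (e_root E)"
 show "ce_one (E2CE_obj E) \<in> Obj (ce_cat (E2CE_obj E))" by (simp add: over_def)
 fix A assume "A \<in> Obj (ce_cat (E2CE_obj E))"
 then have A: "A \<in> Arr F" "Cod F A = e_root E" by (auto simp: over_def)
 have WA: "s_obj (W A) ?i = Ident F (Dom F A)" using W_ident[OF A(1)] A by simp
 have iD: "Ident F (Dom F A) \<in> Arr F" using A by simp
 have "idtm (Ident F (Dom F A)) \<in> T (Ident F (Dom F A))"
  using idtm_in[OF iD] seqD(1)[OF W_id[OF dom_obj[OF A(1)]] iD] A by simp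
 then have a: "\<langle>A, \<langle>idtm (Ident F (Dom F A)), ?i\<rangle>\<rangle> \<in> hom (ce_cat (E2CE_obj E)) A (ce_one (E2CE_obj E))"
  using A WA by (simp add: hom_def thom_arr)
 have "f = \<langle>A, \<langle>idtm (Ident F (Dom F A)), ?i\<rangle>\<rangle>" if f: "f \<in> hom (ce_cat (E2CE_obj E)) A (ce_one (E2CE_obj E))" for f
 proof -
  obtain g where g: "f = \<langle>A, \<langle>g, ?i\<rangle>\<rangle>" "g \<in> T (s_obj (W A) ?i)"
   using f by (auto simp: hom_def thom_arr)
  then have "g = idtm (Ident F (Dom F A))" using T_ident[OF dom_obj[OF A(1)], of g] WA by simp
  then show ?thesis using g by simp
 qed
 with a show "\<exists>!f. f \<in> hom (ce_cat (E2CE_obj E)) A (ce_one (E2CE_obj E))" by (rule ex1I)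
qed

lemma E2CE_lev: "A \<in> Arr F \<Longrightarrow> Cod F A = e_root E \<Longrightarrow> ce_lev (E2CE_obj E) A = e_lev E (Dom F A)"
 using rooted_tree_lev(2)[OF slice_tree[OF T.strat_cat_axioms]] by (simp add: over_def)

text \<open>The functor is a weakening followed by a substitution, and each preserves the level
  relative to the base of its slice. Monotonicity of levels makes the truncated differences exact,
  so that they can be combined.\<close>

lemma lev_afun:
 assumes a: "a \<in> Arr (TC \<Gamma>)" and R: "R \<in> Arr F" "Cod F R = Dom F (tgt a)"
 shows "e_lev E (Dom F (s_obj (afun a) R)) = e_lev E (Dom F R) - e_lev E (Dom F (tgt a)) + e_lev E (Dom F (ufst a))"
proof -
 note A = thom_arrD[OF a]
 let ?A = "ufst a" and ?B = "tgt a" and ?f = "ufst (usnd a)"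
 let ?V = "s_obj (W ?A) ?B" and ?R = "s_arr (W ?A) ?B R"
 have f: "?f \<in> T ?V" using a by (auto simp: thom_arr)
 have BA: "Cod F ?B = Cod F ?A" using A by simp
 note s = sfun_arr[OF W_sfun[OF A(1)] A(3) BA R]
 have V: "?V \<in> Arr F" "Cod F ?V = Dom F ?A" using A by auto
 have BR: "?B \<odot> R \<in> Arr F" "Dom F (?B \<odot> R) = Dom F R" "Cod F (?B \<odot> R) = Cod F ?A" using A R by auto
 have "Dom F (s_obj (W ?A) (?B \<odot> R)) = Dom F ?R" using s V by simp
 then have 1: "e_lev E (Dom F ?R) = e_lev E (Dom F R) - e_lev E (Cod F ?A) + e_lev E (Dom F ?A)"
  using lev_W[OF A(1) BR(1,3)] BR by simp
 have 2: "e_lev E (Dom F ?V) = e_lev E (Dom F ?B) - e_lev E (Cod F ?A) + e_lev E (Dom F ?A)"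
  using lev_W[OF A(1,3) BA] .
 have 3: "e_lev E (Dom F (s_obj (S ?V ?f) ?R)) = e_lev E (Dom F ?R) - e_lev E (Dom F ?V) + e_lev E (Dom F ?A)"
  using lev_S[OF V(1) f, of ?R] s V by simp
 have "e_lev E (Cod F ?A) \<le> e_lev E (Dom F ?B)" "e_lev E (Dom F ?B) \<le> e_lev E (Dom F R)"
  using T.level_mono[OF A(3)] T.level_mono[OF R(1)] BA R by simp_all
 then show ?thesis using 1 2 3 by (simp add: afun_def thom_pb_def)
qed

lemma is_stratified_E2CE: "is_stratified_cesys (E2CE_obj E)"
 unfolding is_stratified_cesys_def
proof (intro conjI ballI)
 show "is_stratified (ce_fam (E2CE_obj E)) (ce_one (E2CE_obj E))"
  using rooted_tree_lev(1)[OF slice_tree[OF T.strat_cat_axioms]] by simp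
 fix a r assume a: "a \<in> Arr (ce_cat (E2CE_obj E))" and "r \<in> over (ce_fam (E2CE_obj E)) (Cod (ce_cat (E2CE_obj E)) a)"
 then obtain R where r: "r = \<langle>tgt a, R\<rangle>" "R \<in> Arr F" "Cod F R = Dom F (tgt a)"
  by (auto elim: slice_overE)
 have a': "a \<in> Arr (TC (e_root E))" using a by simp
 note A = thom_arrD[OF a']
 note p = pi2_arr[OF a' r(2,3)]
 show "ce_lev (E2CE_obj E) (Dom (ce_fam (E2CE_obj E)) r) - ce_lev (E2CE_obj E) (Cod (ce_cat (E2CE_obj E)) a) =
   ce_lev (E2CE_obj E) (Dom (ce_fam (E2CE_obj E)) (ce_pb (E2CE_obj E) a r)) - ce_lev (E2CE_obj E) (Dom (ce_cat (E2CE_obj E)) a)"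
  using lev_afun[OF a' r(2,3)] A r p
   E2CE_lev[of "tgt a \<odot> R"] E2CE_lev[of "tgt a"] E2CE_lev[of "ufst a"]
   E2CE_lev[of "ufst a \<odot> s_obj (afun a) R"]
  by (simp add: E2CE_pb[OF a'] del: E2CE_simps(5))
qed

end

section \<open>Homomorphisms of E-systems and their action on arrows of terms\<close>

lemma ehom_slice_simps [simp]:
 "s_obj (ehom_slice H) A = onArr (eh_fun H) A" "s_arr (ehom_slice H) A P = onArr (eh_fun H) P"
 "s_tm (ehom_slice H) A P t = eh_tm H P t" "sfun_tm E (ehom_slice H) A t = eh_tm H A t"
 "sfun_slice F A (ehom_slice H) = ehom_slice H"
 by (auto simp: ehom_slice_def sfun_tm_def sfun_slice_def)

lemma slice_ehom_comp: "sfun_slice F A (ehom_slice H \<star> G) = ehom_slice H \<star> sfun_slice F A G"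
 by (simp add: sfun_slice_def sfun_comp_def ehom_slice_def)

locale esys_hom = E: esys E + E': esys E' for E E' :: "'a esys" +
 fixes H :: "'a ehom"
 assumes is_hom: "is_pre_ehom E E' H"
begin

abbreviation "hs \<equiv> ehom_slice H"
abbreviation "ho \<equiv> onArr (eh_fun H)"

lemma hfun: "is_functor E.F E'.F (eh_fun H)"
 and h_tm: "A \<in> Arr E.F \<Longrightarrow> t \<in> E.T A \<Longrightarrow> eh_tm H A t \<in> E'.T (ho A)"
 and h_root: "onObj (eh_fun H) (e_root E) = e_root E'"
 and h_pres: "\<Gamma> \<in> Obj E.F \<Longrightarrow> preserves_at E E' \<Gamma> hs"
 using is_hom unfolding is_pre_ehom_def by blast+

lemma h_arr [simp]:
 assumes "A \<in> Arr E.F"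
 shows "ho A \<in> Arr E'.F" "Dom E'.F (ho A) = onObj (eh_fun H) (Dom E.F A)" "Cod E'.F (ho A) = onObj (eh_fun H) (Cod E.F A)"
 using functor_arr[OF hfun assms] by auto

lemma h_id: "X \<in> Obj E.F \<Longrightarrow> ho (Ident E.F X) = Ident E'.F (onObj (eh_fun H) X)"
 using functor_id[OF hfun] .

lemma h_comp: "A \<in> Arr E.F \<Longrightarrow> P \<in> Arr E.F \<Longrightarrow> Dom E.F A = Cod E.F P \<Longrightarrow> ho (A \<cdot>\<^bsub>E.F\<^esub> P) = ho A \<cdot>\<^bsub>E'.F\<^esub> ho P"
 using functor_comp[OF hfun] by simp

lemma hs_sfun: "is_sfun E \<Gamma> E' (onObj (eh_fun H) \<Gamma>) hs"
 by (rule is_sfunI) (auto simp: h_comp h_id h_tm)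

lemma h_W: "A \<in> Arr E.F \<Longrightarrow> Cod E.F A = \<Gamma> \<Longrightarrow> sfun_eq E \<Gamma> (hs \<star> E.W A) (E'.W (ho A) \<star> hs)"
 using E.presD(2)[OF h_pres, of \<Gamma> A] by auto

lemma h_S: "A \<in> Arr E.F \<Longrightarrow> x \<in> E.T A \<Longrightarrow>
  sfun_eq E (Dom E.F A) (hs \<star> E.S A x) (E'.S (ho A) (eh_tm H A x) \<star> hs)"
 using E.presD(1)[OF h_pres, of "Cod E.F A" A x] by auto

lemma h_idtm: "A \<in> Arr E.F \<Longrightarrow> eh_tm H (s_obj (E.W A) A) (E.idtm A) = E'.idtm (ho A)"
 using E.presD(3)[OF h_pres, of "Cod E.F A" A] by auto

lemma h_W_obj: "A \<in> Arr E.F \<Longrightarrow> B \<in> Arr E.F \<Longrightarrow> Cod E.F B = Cod E.F A \<Longrightarrow>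
  ho (s_obj (E.W A) B) = s_obj (E'.W (ho A)) (ho B)"
 using seqD(1)[OF h_W, of A "Cod E.F A" B] by simp

text \<open>The relation \<open>hs \<star> G\<close> equals \<open>G' \<star> hs\<close> says that
  \<open>H\<close> intertwines \<open>G\<close> with \<open>G'\<close>. It passes to slices here, to
  composites in \<open>int_comp\<close>, and it holds for the functors of corresponding terms by
  \<open>int_pbf\<close>.\<close>

lemma int_slice:
 assumes "sfun_eq E X (hs \<star> G) (G' \<star> hs)" "R \<in> Arr E.F" "Cod E.F R = X"
 shows "sfun_eq E (Dom E.F R) (hs \<star> E.sl R G) (E'.sl (ho R) G' \<star> hs)"
 using seq_trans[OF E.seq_slice[OF assms] E.slice_comp[OF hs_sfun assms(2,3)]]
 by (simp add: slice_ehom_comp)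

text \<open>Both sides of the intertwining relation are evaluated at \<open>idtm B\<close>, which
  \<open>H\<close> preserves.\<close>

lemma int_point:
 assumes G: "E.hm (Dom E.F B) \<Theta> G" and B: "B \<in> Arr E.F" and eq: "sfun_eq E (Dom E.F B) (hs \<star> G) (G' \<star> hs)"
 shows "eh_tm H (s_obj G (s_obj (E.W B) B)) (E.point B G) = E'.point (ho B) G'"
proof -
 let ?V = "s_obj (E.W B) B"
 have V: "?V \<in> Arr E.F" "Cod E.F ?V = Dom E.F B" using B by auto
 have "eh_tm H (s_obj G ?V) (E.point B G) = E.tm (hs \<star> G) ?V (E.idtm B)"
  using E.tm_comp[OF G V, of hs] by simp
 also have "... = E.tm (G' \<star> hs) ?V (E.idtm B)"
  by (rule E.sfun_tm_eq[OF eq V]) (use B in simp)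
 also have "... = E'.tm G' (ho ?V) (eh_tm H ?V (E.idtm B))"
  using E.sfun_tm_comp[OF hs_sfun E'.cat_axioms, of "Dom E.F B" ?V G'] V B by (simp add: h_id)
 also have "... = E'.point (ho B) G'" using B by (simp add: h_idtm h_W_obj)
 finally show ?thesis .
qed

lemma int_comp:
 assumes "sfun_eq E Y (hs \<star> G) (G' \<star> hs)" "sfun_eq E X (hs \<star> K) (K' \<star> hs)" "is_sfun E X E Y K"
 shows "sfun_eq E X (hs \<star> (G \<star> K)) ((G' \<star> K') \<star> hs)"
proof -
 have "sfun_eq E X ((hs \<star> G) \<star> K) ((G' \<star> hs) \<star> K)" by (rule seq_left[OF assms(1,3)])
 also have "sfun_eq E X ... (G' \<star> (K' \<star> hs))" unfolding sassoc by (rule seq_right[OF assms(2)])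
 finally show ?thesis by (simp add: sassoc)
qed

lemma int_pbf:
 assumes AB: "A \<in> Arr E.F" "B \<in> Arr E.F" "Cod E.F A = Cod E.F B" and f: "f \<in> E.T (s_obj (E.W A) B)"
 shows "sfun_eq E (Dom E.F B) (hs \<star> E.pbf A B f) (E'.pbf (ho A) (ho B) (eh_tm H (s_obj (E.W A) B) f) \<star> hs)"
proof -
 have V: "s_obj (E.W A) B \<in> Arr E.F" using AB by auto
 have W: "sfun_eq E (Dom E.F B) (hs \<star> E.sl B (E.W A)) (E'.sl (ho B) (E'.W (ho A)) \<star> hs)"
  by (rule int_slice[OF h_W[OF AB(1,3)] AB(2) refl])
 have "E.hm (Cod E.F B) (Dom E.F A) (E.W A)" using E.W_hm[OF AB(1)] AB(3) by simp
 note sl = E.hm_sfun[OF E.hm_slice[OF this AB(2) refl]]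
 show ?thesis
  using int_comp[OF h_S[OF V f] W sl] AB by (simp add: thom_pb_def h_W_obj)
qed

definition harr :: "'a univ \<Rightarrow> 'a univ" where
 "harr a = \<langle>ho (ufst a), \<langle>eh_tm H (s_obj (E.W (ufst a)) (tgt a)) (ufst (usnd a)), ho (tgt a)\<rangle>\<rangle>"

lemma harr_simps [simp]: "ufst (harr a) = ho (ufst a)" "usnd (usnd (harr a)) = ho (tgt a)"
 by (auto simp: harr_def)

lemma harr:
 assumes "a \<in> Arr (thom_cat E \<Gamma>)"
 shows "harr a \<in> Arr (thom_cat E' (onObj (eh_fun H) \<Gamma>))"
  "sfun_eq E (Dom E.F (tgt a)) (hs \<star> E.afun a) (E'.afun (harr a) \<star> hs)"
proof -
 obtain A f B where a: "a = \<langle>A, \<langle>f, B\<rangle>\<rangle>" "A \<in> Arr E.F" "Cod E.F A = \<Gamma>" "B \<in> Arr E.F" "Cod E.F B = \<Gamma>"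
   "f \<in> E.T (s_obj (E.W A) B)"
  using assms by (auto simp: E.thom_arr)
 have V: "s_obj (E.W A) B \<in> Arr E.F" using a by auto
 show "harr a \<in> Arr (thom_cat E' (onObj (eh_fun H) \<Gamma>))"
  using a h_tm[OF V a(6)] by (simp add: E'.thom_arr harr_def h_W_obj)
 show "sfun_eq E (Dom E.F (tgt a)) (hs \<star> E.afun a) (E'.afun (harr a) \<star> hs)"
  using int_pbf[of A B f] a by (simp add: E.afun_def E'.afun_def harr_def)
qed

text \<open>The image of an arrow given by a functor is computed from any functor that
  \<open>H\<close> intertwines with it. Preservation of composites, of the arrows
  \<open>I(Q)\<close> and of connecting arrows are instances.\<close>

lemma harr_arr_of:
 assumes "E.rel A B G" "B \<in> Arr E.F" "sfun_eq E (Dom E.F B) (hs \<star> G) (G' \<star> hs)"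
 shows "harr (E.arr_of A B G) = E'.arr_of (ho A) (ho B) G'"
 using int_point[of B "Dom E.F A" G G'] assms E.rel_obj[OF assms(1,2,2)]
 by (simp add: harr_def E.arr_of_def E'.arr_of_def E.rel_def)

lemma harr_comp:
 assumes a: "a \<in> Arr (thom_cat E \<Gamma>)" and b: "b \<in> Arr (thom_cat E \<Gamma>)" and ab: "ufst b = tgt a"
 shows "harr (b \<cdot>\<^bsub>thom_cat E \<Gamma>\<^esub> a) = harr b \<cdot>\<^bsub>thom_cat E' (onObj (eh_fun H) \<Gamma>)\<^esub> harr a"
proof -
 note A = E.thom_arrD[OF a] and B = E.thom_arrD[OF b]
 have r: "E.rel (tgt a) (tgt b) (E.afun b)" using B(5) ab by simp
 have c: "Cod E.F (tgt a) = Cod E.F (tgt b)" using A B by simp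
 have s: "E.sfn (Dom E.F (tgt b)) (Dom E.F (tgt a)) (E.afun b)"
  using E.afun_sfun[OF b] ab by simp
 have e: "ufst (harr b) = usnd (usnd (harr a))" using ab by simp
 show ?thesis
  unfolding E.thom_comp(1)[OF a b ab] E'.thom_comp(1)[OF harr(1)[OF a] harr(1)[OF b] e] harr_simps
  by (rule harr_arr_of[OF E.rel_comp[OF r A(5) A(3) B(3) c] B(3) int_comp[OF harr(2)[OF a] harr(2)[OF b] s]])
qed

lemma harr_ident:
 assumes "A \<in> Arr E.F"
 shows "harr \<langle>A, \<langle>E.idtm A, A\<rangle>\<rangle> = \<langle>ho A, \<langle>E'.idtm (ho A), ho A\<rangle>\<rangle>"
 using assms by (simp add: harr_def h_idtm)

end

locale strat_esys_hom = esys_hom E E' H + E: strat_esys E + E': strat_esys E' for E E' :: "'a esys" and H :: "'a ehom" +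
 assumes is_strat_hom: "is_stratified_ehom E E' H"
begin

lemma h_lev: "X \<in> Obj E.F \<Longrightarrow> e_lev E' (onObj (eh_fun H) X) = e_lev E X"
 using is_strat_hom by (simp add: is_stratified_ehom_def)

lemma h_indec:
 assumes "X \<in> Obj E.F" "0 < e_lev E X"
 shows "ho (e_indec E X) = e_indec E' (onObj (eh_fun H) X)"
 using E'.T.indec_eq[of "ho (e_indec E X)"] assms by (simp add: h_lev)

lemma E2CE_hom_simps:
 "ceh_fam (E2CE_hom E H) = fmap_restrict (slice_cat E.F (e_root E))
   \<lparr>onObj = ho, onArr = (\<lambda>a. \<langle>ho (ufst a), ho (usnd a)\<rangle>)\<rparr>"
 "ceh_cat (E2CE_hom E H) = fmap_restrict (thom_cat E (e_root E)) \<lparr>onObj = ho, onArr = harr\<rparr>"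
proof -
 have "(\<lambda>a. \<langle>ho (ufst a), \<langle>eh_tm H (s_obj (E.W (ufst a)) (tgt a)) (ufst (usnd a)), ho (tgt a)\<rangle>\<rangle>) = harr"
  by (simp add: fun_eq_iff harr_def)
 then show "ceh_fam (E2CE_hom E H) = fmap_restrict (slice_cat E.F (e_root E))
   \<lparr>onObj = ho, onArr = (\<lambda>a. \<langle>ho (ufst a), ho (usnd a)\<rangle>)\<rparr>"
  "ceh_cat (E2CE_hom E H) = fmap_restrict (thom_cat E (e_root E)) \<lparr>onObj = ho, onArr = harr\<rparr>"
  by (simp_all add: E2CE_hom_def Let_def)
qed

lemma is_cehom_E2CE: "is_cehom (E2CE_obj E) (E2CE_obj E') (E2CE_hom E H)"
proof -
 let ?K = "\<lparr>ceh_fam = \<lparr>onObj = ho, onArr = (\<lambda>a. \<langle>ho (ufst a), ho (usnd a)\<rangle>)\<rparr>,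
  ceh_cat = \<lparr>onObj = ho, onArr = harr\<rparr>\<rparr>"
 have "is_cehom (E2CE_obj E) (E2CE_obj E') ?K"
  unfolding is_cehom_def E.E2CE_simps(1-3) E'.E2CE_simps(1-3) cehom.select_convs fmap.select_convs
 proof (intro conjI ballI, goal_cases)
  case 1
  show ?case unfolding is_functor_def fmap.select_convs
   by (auto elim!: slice_arrE simp: hom_def over_def h_comp h_id h_root)
 next
  case 2
  show ?case unfolding is_functor_def fmap.select_convs
  proof (intro conjI ballI impI, goal_cases)
   case (2 f)
   then show ?case using harr(1)[OF 2] by (simp add: hom_def h_root)
  next
   case (3 A)
   then show ?case using harr_ident by (simp add: over_def)
  next
   case (4 f g)
   then show ?case using harr_comp[of f "e_root E" g] by (simp add: h_root)
  qed (simp add: over_def h_root)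
 next
  case (3 X)
  show ?case by simp
 next
  case (4 a)
  then obtain A Q where a: "a = \<langle>A, Q\<rangle>" "A \<in> Arr E.F" "Cod E.F A = e_root E" "Q \<in> Arr E.F" "Cod E.F Q = Dom E.F A"
   by (rule slice_arrE)
  show ?case using harr_arr_of[OF E.rel_W[OF a(2,4,5)] a(2) h_W[OF a(4,5)]] a by (simp add: h_comp)
 next
  case 5
  show ?case using h_root by (simp add: h_id)
 next
  case (6 f r)
  then obtain R where r: "r = \<langle>tgt f, R\<rangle>" "R \<in> Arr E.F" "Cod E.F R = Dom E.F (tgt f)"
   by (auto elim: slice_overE)
  show ?case using seqD(1)[OF harr(2)[OF 6(1)] r(2,3)]
   by (simp add: r(1) E.E2CE_pb[OF 6(1)] E'.E2CE_pb[OF harr(1)[OF 6(1)]] del: E.E2CE_simps(5) E'.E2CE_simps(5))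
 next
  case (7 f r)
  then obtain R where r: "r = \<langle>tgt f, R\<rangle>" "R \<in> Arr E.F" "Cod E.F R = Dom E.F (tgt f)"
   by (auto elim: slice_overE)
  note A = E.thom_arrD[OF 7(1)]
  have c: "Cod E.F (ufst f) = Cod E.F (tgt f)" using A by simp
  note p = E.pi2_arr[OF 7(1) r(2,3)]
  have BR: "tgt f \<cdot>\<^bsub>E.F\<^esub> R \<in> Arr E.F" "Dom E.F (tgt f \<cdot>\<^bsub>E.F\<^esub> R) = Dom E.F R" using A r by auto
  have i: "sfun_eq E (Dom E.F (tgt f \<cdot>\<^bsub>E.F\<^esub> R)) (hs \<star> E.sl R (E.afun f)) (E'.sl (ho R) (E'.afun (harr f)) \<star> hs)"
   using int_slice[OF harr(2)[OF 7(1)] r(2,3)] BR by simp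
  have o: "ho (s_obj (E.afun f) R) = s_obj (E'.afun (harr f)) (ho R)"
   using seqD(1)[OF harr(2)[OF 7(1)] r(2,3)] by simp
  have hR: "ho R \<in> Arr E'.F" "Cod E'.F (ho R) = Dom E'.F (usnd (usnd (harr f)))" using r A by auto
  show ?case
   using harr_arr_of[OF E.rel_slice[OF A(5) A(1,3) c r(2,3)] BR(1) i] A r p
    E.E2CE_pi2[OF 7(1) r(2,3)] E'.E2CE_pi2[OF harr(1)[OF 7(1)] hR]
   by (simp add: h_comp o)
 qed
 then have "is_cehom (E2CE_obj E) (E2CE_obj E') (cehom_restrict (E2CE_obj E) ?K)"
  by (simp add: cehom_restrict E.is_cesys_E2CE)
 moreover have "cehom_restrict (E2CE_obj E) ?K = E2CE_hom E H"
  by (rule cehom_eqI) (simp_all add: E2CE_hom_simps)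
 ultimately show ?thesis by simp
qed

lemma is_stratified_cehom_E2CE: "is_stratified_cehom (E2CE_obj E) (E2CE_obj E') (E2CE_hom E H)"
 unfolding is_stratified_cehom_def
 using E.E2CE_lev E'.E2CE_lev h_lev h_root by (auto simp: E2CE_hom_simps over_def)

end

lemma strat_esysI: "is_esys E \<Longrightarrow> is_stratified_esys E \<Longrightarrow> strat_esys E"
 by (simp add: strat_esys_def strat_esys_axioms_def esys_def esys_axioms_def pre_esys_def is_esys_def)

lemma strat_esys_homI: "is_esys E \<Longrightarrow> is_stratified_esys E \<Longrightarrow> is_esys E' \<Longrightarrow> is_stratified_esys E' \<Longrightarrow>
  is_pre_ehom E E' H \<Longrightarrow> is_stratified_ehom E E' H \<Longrightarrow> strat_esys_hom E E' H"
 using strat_esysI[of E] strat_esysI[of E']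
 by (simp add: strat_esys_hom_def strat_esys_hom_axioms_def esys_hom_def esys_hom_axioms_def strat_esys_def)

lemma ehom_restrict_simps [simp]:
 "eh_fun (ehom_restrict E H) = fmap_restrict (e_cat E) (eh_fun H)"
 "A \<in> e_arr E \<Longrightarrow> t \<in> e_T E A \<Longrightarrow> eh_tm (ehom_restrict E H) A t = eh_tm H A t"
 by (auto simp: ehom_restrict_def)

lemma ehom_extensional_restrict [simp]: "ehom_extensional E (ehom_restrict E H)"
 by (auto simp: ehom_extensional_def ehom_restrict_def)

lemma ehom_eqI:
 assumes "ehom_extensional E H" "ehom_extensional E K"
  and "\<And>X. X \<in> Obj (e_cat E) \<Longrightarrow> onObj (eh_fun H) X = onObj (eh_fun K) X"
  and "\<And>A. A \<in> e_arr E \<Longrightarrow> onArr (eh_fun H) A = onArr (eh_fun K) A"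
  and tm: "\<And>A t. A \<in> e_arr E \<Longrightarrow> t \<in> e_T E A \<Longrightarrow> eh_tm H A t = eh_tm K A t"
 shows "H = K"
proof (rule ehom.equality)
 show "eh_fun H = eh_fun K" using assms(1-4) by (intro fmap_eqI[of "e_cat E"]) (auto simp: ehom_extensional_def)
 show "eh_tm H = eh_tm K"
 proof (rule extensionalityI[of _ "e_arr E"])
  show "eh_tm H A = eh_tm K A" if "A \<in> e_arr E" for A
   by (rule extensionalityI[of _ "e_T E A"]) (use assms(1,2) tm that in \<open>auto simp: ehom_extensional_def\<close>)
 qed (use assms(1,2) in \<open>auto simp: ehom_extensional_def\<close>)
qed simp

lemma ehom_restrict:
 assumes "pre_esys E" and H: "is_pre_ehom E E' H"
 shows "is_pre_ehom E E' (ehom_restrict E H)"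
proof -
 interpret pre_esys E by fact
 have h: "is_functor (e_cat E) (e_cat E') (eh_fun H)"
  "\<And>A t. A \<in> e_arr E \<Longrightarrow> t \<in> e_T E A \<Longrightarrow> eh_tm H A t \<in> e_T E' (onArr (eh_fun H) A)"
  "onObj (eh_fun H) (e_root E) = e_root E'"
  "\<And>\<Gamma>. \<Gamma> \<in> Obj (e_cat E) \<Longrightarrow> preserves_at E E' \<Gamma> (ehom_slice H)"
  using H unfolding is_pre_ehom_def by blast+
 have root: "e_root E \<in> Obj F" using e_terminal unfolding is_terminal_def by blast
 have "preserves_at E E' \<Gamma> (ehom_slice (ehom_restrict E H))" if "\<Gamma> \<in> Obj F" for \<Gamma>
  by (rule preserves_at_cong[OF h(4)[OF that]], rule seqI) simp_all
 then show ?thesis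
  unfolding is_pre_ehom_def using h root by (simp add: functor_restrict)
qed

lemma is_functor_E2CE: "is_functor Esys\<^sub>s rCEsys\<^sub>s E2CE"
 unfolding Esys\<^sub>s_def rCEsys\<^sub>s_def E2CE_def
proof (rule is_functor_mk_category, goal_cases)
 case (1 E)
 then interpret strat_esys E by (simp add: strat_esysI)
 show ?case by (simp add: is_cesys_E2CE is_rooted_E2CE is_stratified_E2CE)
next
 case (2 E E' H)
 then interpret strat_esys_hom E E' H by (simp add: strat_esys_homI)
 show ?case using is_cehom_E2CE is_stratified_cehom_E2CE by (simp add: E2CE_hom_def Let_def)
next
 case (3 E)
 then interpret strat_esys E by (simp add: strat_esysI)
 show ?case
  by (rule cehom_eqI; rule fmap_eqI[of "slice_cat F (e_root E)"] fmap_eqI[of "thom_cat E (e_root E)"])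
   (auto elim!: slice_arrE simp: E2CE_hom_def Let_def over_def thom_arr)
next
 case (4 E E' E'' H K)
 interpret H: strat_esys_hom E E' H using 4 by (simp add: strat_esys_homI)
 interpret K: strat_esys_hom E' E'' K using 4 by (simp add: strat_esys_homI)
 have root: "onObj (eh_fun H) (e_root E) = e_root E'" by (rule H.h_root)
 show ?case
  by (rule cehom_eqI; rule fmap_eqI[of "slice_cat H.E.F (e_root E)"] fmap_eqI[of "thom_cat E (e_root E)"])
   (auto elim!: slice_arrE simp: E2CE_hom_def Let_def over_def H.E.thom_arr H.E'.thom_arr root H.h_W_obj H.h_tm
    simp flip: H.h_W_obj)
qed

section \<open>From CE-systems to E-systems\<close>

context cesys
begin

abbreviation "EE \<equiv> CE2E_obj S"
abbreviation "TT \<equiv> CE2E_T S"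
abbreviation "pf \<equiv> CE2E_pb S"

lemma CE2E_simps [simp]:
 "e_cat EE = FF" "e_T EE = TT" "e_root EE = ce_one S" "e_S EE A x = pf x" "e_W EE A = pf (ce_I S A)"
 by (auto simp: CE2E_obj_def)

lemma TT_iff:
 "A \<in> Arr FF \<Longrightarrow> x \<in> TT A \<longleftrightarrow> x \<in> Arr CC \<and> Dom CC x = Cod FF A \<and> Cod CC x = Dom FF A \<and>
  ce_I S A \<odot> x = Ident CC (Cod FF A)"
 by (auto simp: CE2E_T_def hom_def)

text \<open>The pulled back section \<open>f^* y\<close>, for a section \<open>y\<close> of
  \<open>I(Q)\<close> with \<open>Q\<close> over the codomain of \<open>f\<close>. The action of the
  functor \<open>pf f\<close> on the terms of an arrow \<open>Q\<close> over \<open>A\<close> is the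
  case of the connecting arrow \<open>ce_pi2 S f A\<close>.\<close>

definition sec :: "'a univ \<Rightarrow> 'a univ \<Rightarrow> 'a univ \<Rightarrow> 'a univ" where
 "sec f Q y = (THE z. z \<in> TT (ce_pb S f Q) \<and> ce_pi2 S f Q \<odot> z = y \<odot> f)"

text \<open>The section is the arrow into the pullback induced by \<open>y \<odot> f\<close> and the
  identity.\<close>

lemma sec_ex1:
 assumes f: "f \<in> Arr CC" and Q: "Q \<in> Arr FF" "Cod FF Q = Cod CC f" and y: "y \<in> TT Q"
 shows "\<exists>!z. z \<in> TT (ce_pb S f Q) \<and> ce_pi2 S f Q \<odot> z = y \<odot> f"
proof -
 note pb = pb_arr[OF f Q]
 have y': "y \<in> Arr CC" "Dom CC y = Cod CC f" "Cod CC y = Dom FF Q" "ce_I S Q \<odot> y = Ident CC (Cod CC f)"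
  using y Q by (auto simp: TT_iff)
 have "ce_I S Q \<odot> (y \<odot> f) = (ce_I S Q \<odot> y) \<odot> f"
  using y'(1-3) f Q by (subst C.assoc) auto
 also have "... = f \<odot> Ident CC (Dom CC f)" using f y' by simp
 finally obtain z where z: "z \<in> Arr CC" "Dom CC z = Dom CC (y \<odot> f)" "Cod CC z = Dom CC (ce_pi2 S f Q)"
   "ce_pi2 S f Q \<odot> z = y \<odot> f" "ce_I S (ce_pb S f Q) \<odot> z = Ident CC (Dom CC f)"
  using C.pullback_ex[OF pb_pullback[OF f Q], of "y \<odot> f" "Ident CC (Dom CC f)"] f Q y' by auto
 show ?thesis
 proof (rule ex1I[of _ z])
  show "z \<in> TT (ce_pb S f Q) \<and> ce_pi2 S f Q \<odot> z = y \<odot> f"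
   using z f Q y' by (simp add: TT_iff)
  show "w = z" if w: "w \<in> TT (ce_pb S f Q) \<and> ce_pi2 S f Q \<odot> w = y \<odot> f" for w
   by (rule C.pullback_eqI[OF pb_pullback[OF f Q]]) (use w z f Q y' pb in \<open>simp_all add: TT_iff\<close>)
 qed
qed

lemma sec:
 assumes f: "f \<in> Arr CC" and Q: "Q \<in> Arr FF" "Cod FF Q = Cod CC f" and y: "y \<in> TT Q"
 shows "sec f Q y \<in> TT (ce_pb S f Q)" "ce_pi2 S f Q \<odot> sec f Q y = y \<odot> f"
  "z \<in> TT (ce_pb S f Q) \<Longrightarrow> ce_pi2 S f Q \<odot> z = y \<odot> f \<Longrightarrow> sec f Q y = z"
proof -
 show "sec f Q y \<in> TT (ce_pb S f Q)" "ce_pi2 S f Q \<odot> sec f Q y = y \<odot> f"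
  using theI'[OF sec_ex1[OF assms]] unfolding sec_def by blast+
 show "sec f Q y = z" if "z \<in> TT (ce_pb S f Q)" "ce_pi2 S f Q \<odot> z = y \<odot> f"
  unfolding sec_def by (rule the1_equality[OF sec_ex1[OF assms] conjI[OF that]])
qed

lemma sec_id:
 assumes Q: "Q \<in> Arr FF" "Cod FF Q = X" and y: "y \<in> TT Q"
 shows "sec (Ident CC X) Q y = y"
proof (rule sec(3))
 show "Ident CC X \<in> Arr CC" "Q \<in> Arr FF" "y \<in> TT Q" "Cod FF Q = Cod CC (Ident CC X)" using assms by auto
 show "y \<in> TT (ce_pb S (Ident CC X) Q)" using assms by simp
 show "ce_pi2 S (Ident CC X) Q \<odot> y = y \<odot> Ident CC X" using assms by (simp add: TT_iff)
qed

lemma sec_comp: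
 assumes f: "f \<in> Arr CC" and g: "g \<in> Arr CC" "Cod CC g = Dom CC f" and Q: "Q \<in> Arr FF" "Cod FF Q = Cod CC f"
  and y: "y \<in> TT Q"
 shows "sec (f \<odot> g) Q y = sec g (ce_pb S f Q) (sec f Q y)"
proof (rule sec(3))
 note pb = pb_arr[OF f Q]
 note s = sec[OF f Q y]
 have t: "sec f Q y \<in> Arr CC" "Dom CC (sec f Q y) = Dom CC f" "Cod CC (sec f Q y) = Dom FF (ce_pb S f Q)"
  using s(1) pb by (auto simp: TT_iff)
 have c: "Cod FF (ce_pb S f Q) = Cod CC g" using pb g by simp
 note pb' = pb_arr[OF g(1) pb(1) c]
 note s' = sec[OF g(1) pb(1) c s(1)]
 show "f \<odot> g \<in> Arr CC" "Q \<in> Arr FF" "Cod FF Q = Cod CC (f \<odot> g)" "y \<in> TT Q"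
  using f g Q y by auto
 show "sec g (ce_pb S f Q) (sec f Q y) \<in> TT (ce_pb S (f \<odot> g) Q)"
  using s'(1) comp_pb[OF f g Q] by simp
 let ?z = "sec g (ce_pb S f Q) (sec f Q y)"
 have z: "?z \<in> Arr CC" "Dom CC ?z = Dom CC g" "Cod CC ?z = Dom FF (ce_pb S g (ce_pb S f Q))"
  using s'(1) pb' by (auto simp: TT_iff)
 have y': "y \<in> Arr CC" "Dom CC y = Cod CC f" "Cod CC y = Dom FF Q" using y Q by (auto simp: TT_iff)
 have "ce_pi2 S (f \<odot> g) Q \<odot> ?z = ce_pi2 S f Q \<odot> (ce_pi2 S g (ce_pb S f Q) \<odot> ?z)"
  using comp_pb(2)[OF f g Q] pb pb' z by (simp add: C.assoc)
 also have "... = (ce_pi2 S f Q \<odot> sec f Q y) \<odot> g"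
  using s'(2) pb t g by (simp add: C.assoc)
 also have "... = y \<odot> (f \<odot> g)" using s(2) y' f g by (simp add: C.assoc)
 finally show "ce_pi2 S (f \<odot> g) Q \<odot> ?z = y \<odot> (f \<odot> g)" .
qed

lemma pf_simps [simp]:
 "s_obj (pf f) A = ce_pb S f A" "s_arr (pf f) A P = ce_pb S (ce_pi2 S f A) P"
 by (auto simp: CE2E_pb_def)

lemma pf_tm:
 assumes "f \<in> Arr CC" "A \<in> Arr FF" "Cod FF A = Cod CC f" "Q \<in> Arr FF" "Cod FF Q = Dom FF A"
 shows "s_tm (pf f) A Q y = sec (ce_pi2 S f A) Q y"
 using pb_comp(2)[OF assms] by (simp add: CE2E_pb_def sec_def)

interpretation EC: esys_cat EE
 by unfold_locales (simp add: F.is_cat)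

lemma pf_sfun:
 assumes f: "f \<in> Arr CC"
 shows "is_sfun EE (Cod CC f) EE (Dom CC f) (pf f)"
proof (rule is_sfunI, goal_cases)
 case (2 A P)
 then show ?case using f by (simp add: pb_comp)
next
 case (4 A P Q)
 then show ?case using f by (simp add: pb_comp)
next
 case (5 A P t)
 then show ?case using f sec(1)[of "ce_pi2 S f A" P t] by (simp add: pf_tm)
qed (use f in simp_all)

lemma pf_eq_comp:
 assumes "f \<in> Arr CC" "g \<in> Arr CC" "Cod CC g = Dom CC f"
 shows "sfun_eq EE (Cod CC f) (pf (f \<odot> g)) (pf g \<star> pf f)"
 by (rule seqI) (use assms in \<open>simp_all add: comp_pb pf_tm sec_comp\<close>)

lemma pf_eq_id: "X \<in> Obj FF \<Longrightarrow> sfun_eq EE X (pf (Ident CC X)) sfun_id"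
 by (rule seqI) (simp_all add: pf_tm sec_id)

lemma pf_eq_slice:
 assumes "f \<in> Arr CC" "A \<in> Arr FF" "Cod FF A = Cod CC f"
 shows "sfun_eq EE (Dom FF A) (sfun_slice FF A (pf f)) (pf (ce_pi2 S f A))"
 by (rule seqI) (use assms in \<open>simp_all add: pb_comp pf_tm\<close>)

lemma pf_sfun_tm:
 assumes "f \<in> Arr CC" "A \<in> Arr FF" "Cod FF A = Cod CC f"
 shows "sfun_tm EE (pf f) A y = sec f A y"
 using assms by (simp add: sfun_tm_def pf_tm)

text \<open>The generic term is the diagonal of the pullback of \<open>I(A)\<close> along itself,
  induced by two identities.\<close>

lemma CE2E_idtm_ex1:
 assumes A: "A \<in> Arr FF"
 shows "\<exists>!z. z \<in> TT (ce_pb S (ce_I S A) A) \<and> ce_pi2 S (ce_I S A) A \<odot> z = Ident CC (Dom FF A)"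
proof -
 have I: "ce_I S A \<in> Arr CC" "Cod FF A = Cod CC (ce_I S A)" using A by auto
 note pb = pb_arr[OF I(1) A I(2)]
 obtain z where z: "z \<in> Arr CC" "Dom CC z = Dom FF A" "Cod CC z = Dom CC (ce_pi2 S (ce_I S A) A)"
   "ce_pi2 S (ce_I S A) A \<odot> z = Ident CC (Dom FF A)" "ce_I S (ce_pb S (ce_I S A) A) \<odot> z = Ident CC (Dom FF A)"
  using C.pullback_ex[OF pb_pullback[OF I(1) A I(2)], of "Ident CC (Dom FF A)" "Ident CC (Dom FF A)"] A by auto
 show ?thesis
 proof (rule ex1I[of _ z])
  show "z \<in> TT (ce_pb S (ce_I S A) A) \<and> ce_pi2 S (ce_I S A) A \<odot> z = Ident CC (Dom FF A)"
   using z pb A by (simp add: TT_iff)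
  show "w = z" if w: "w \<in> TT (ce_pb S (ce_I S A) A) \<and> ce_pi2 S (ce_I S A) A \<odot> w = Ident CC (Dom FF A)" for w
   by (rule C.pullback_eqI[OF pb_pullback[OF I(1) A I(2)]]) (use w z A pb in \<open>simp_all add: TT_iff\<close>)
 qed
qed

lemma CE2E_idtm:
 assumes A: "A \<in> Arr FF"
 shows "e_idtm EE A \<in> TT (ce_pb S (ce_I S A) A)" "ce_pi2 S (ce_I S A) A \<odot> e_idtm EE A = Ident CC (Dom FF A)"
  "z \<in> TT (ce_pb S (ce_I S A) A) \<Longrightarrow> ce_pi2 S (ce_I S A) A \<odot> z = Ident CC (Dom FF A) \<Longrightarrow> e_idtm EE A = z"
proof -
 have e: "e_idtm EE A = (THE z. z \<in> TT (ce_pb S (ce_I S A) A) \<and> ce_pi2 S (ce_I S A) A \<odot> z = Ident CC (Dom FF A))"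
  by (simp add: CE2E_obj_def)
 show "e_idtm EE A \<in> TT (ce_pb S (ce_I S A) A)" "ce_pi2 S (ce_I S A) A \<odot> e_idtm EE A = Ident CC (Dom FF A)"
  using theI'[OF CE2E_idtm_ex1[OF A]] unfolding e by blast+
 show "e_idtm EE A = z" if "z \<in> TT (ce_pb S (ce_I S A) A)" "ce_pi2 S (ce_I S A) A \<odot> z = Ident CC (Dom FF A)"
  unfolding e by (rule the1_equality[OF CE2E_idtm_ex1[OF A] conjI[OF that]])
qed

lemma is_pre_esys_CE2E: "is_pre_esys EE"
 unfolding is_pre_esys_def Let_def CE2E_simps
proof (intro conjI ballI, goal_cases)
 case 1
 show ?case by (rule F.is_cat)
next
 case 2
 show ?case by (rule one_terminal)
next
 case (3 X A x)
 then have "x \<in> Arr CC" "Dom CC x = X" "Cod CC x = Dom FF A" by (auto simp: TT_iff over_def)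
 then show ?case using pf_sfun[of x] by simp
next
 case (4 X A x)
 then have "x \<in> Arr CC" "Dom CC x = X" "Cod CC x = Dom FF A" by (auto simp: TT_iff over_def)
 then show ?case by simp
next
 case (5 X A)
 then show ?case using pf_sfun[of "ce_I S A"] by (simp add: over_def)
next
 case (6 X A)
 then show ?case by (auto simp: over_def)
next
 case (7 X)
 then show ?case by (simp add: pf_eq_id)
next
 case (8 X A P)
 then show ?case using pf_eq_comp[of "ce_I S A" "ce_I S P"] by (simp add: over_def I_comp)
next
 case (9 A)
 then show ?case using CE2E_idtm(1)[of A] by simp
qed

interpretation PE: pre_esys EE
 by unfold_locales (rule is_pre_esys_CE2E)

text \<open>Substitutions and weakenings are themselves pullback functors, so each compatibility of
  \<open>pf g\<close> with them follows from functoriality of pullback and a commuting square: the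
  defining equation of \<open>sec\<close> for substitution and \<open>pb_square\<close> for
  weakening. The clause on \<open>idtm\<close> follows from the uniqueness of the diagonal.\<close>

lemma pf_preserves:
 assumes g: "g \<in> Arr CC"
 shows "preserves_at EE EE (Cod CC g) (pf g)"
proof (rule PE.preserves_atI, unfold CE2E_simps)
 fix A assume A: "A \<in> Arr FF" "Cod FF A = Cod CC g"
 note pb = pb_arr[OF g A]
 note sl = pf_eq_slice[OF g A]
 { fix x assume x: "x \<in> TT A"
  have x': "x \<in> Arr CC" "Dom CC x = Cod CC g" "Cod CC x = Dom FF A" using x A by (auto simp: TT_iff)
  note s = sec[OF g A x]
  have s': "sec g A x \<in> Arr CC" "Dom CC (sec g A x) = Dom CC g" "Cod CC (sec g A x) = Dom CC (ce_pi2 S g A)"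
   using s(1) pb by (auto simp: TT_iff)
  have "sfun_eq EE (Dom FF A) (pf g \<star> pf x) (pf (x \<odot> g))"
   using seq_sym[OF pf_eq_comp[of x g]] x' g by simp
  also have "sfun_eq EE (Dom FF A) ... (pf (sec g A x) \<star> pf (ce_pi2 S g A))"
   unfolding s(2)[symmetric] using pf_eq_comp[of "ce_pi2 S g A" "sec g A x"] s' pb by simp
  also have "sfun_eq EE (Dom FF A) ... (pf (sec g A x) \<star> sfun_slice FF A (pf g))"
   by (rule seq_right[OF seq_sym[OF sl]])
  finally show "sfun_eq EE (Dom FF A) (pf g \<star> pf x) (pf (sfun_tm EE (pf g) A x) \<star> sfun_slice FF A (pf g))"
   by (simp add: pf_sfun_tm[OF g A]) }
 have "sfun_eq EE (Cod CC g) (sfun_slice FF A (pf g) \<star> pf (ce_I S A)) (pf (ce_pi2 S g A) \<star> pf (ce_I S A))"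
  using pf_sfun[of "ce_I S A"] A by (intro seq_left[OF sl]) simp
 also have "sfun_eq EE (Cod CC g) ... (pf (g \<odot> ce_I S (ce_pb S g A)))"
  unfolding pb_square[OF g A, symmetric] using seq_sym[OF pf_eq_comp[of "ce_I S A" "ce_pi2 S g A"]] A pb by simp
 also have "sfun_eq EE (Cod CC g) ... (pf (ce_I S (ce_pb S g A)) \<star> pf g)"
  using pf_eq_comp[of g "ce_I S (ce_pb S g A)"] g pb by simp
 finally show "sfun_eq EE (Cod CC g) (sfun_slice FF A (pf g) \<star> pf (ce_I S A)) (pf (ce_I S (s_obj (pf g) A)) \<star> pf g)"
  by simp
 let ?A = "ce_pb S g A" and ?V = "ce_pb S (ce_I S A) A"
 have I: "ce_I S A \<in> Arr CC" "Cod FF A = Cod CC (ce_I S A)" using A by auto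
 note pbI = pb_arr[OF I(1) A(1) I(2)]
 have V: "?V \<in> Arr FF" "Cod FF ?V = Dom FF A" using pbI A by auto
 have c: "Cod FF ?V = Cod CC (ce_pi2 S g A)" using V pb by simp
 note i = CE2E_idtm[OF A(1)]
 let ?z = "sec (ce_pi2 S g A) ?V (e_idtm EE A)"
 note z = sec[OF pb(3) V(1) c i(1)]
 \<comment> \<open>Both sides pull \<open>A\<close> back along the diagonal of
   \<open>pb_square\<close>, factored in its two ways.\<close>
 have e: "ce_pb S (ce_pi2 S g A) ?V = ce_pb S (ce_I S ?A) ?A"
  using comp_pb(1)[of "ce_I S A" "ce_pi2 S g A" A] comp_pb(1)[of g "ce_I S ?A" A] pb_square[OF g A] pb g A by simp
 have IA: "ce_I S ?A \<in> Arr CC" "Cod FF ?A = Cod CC (ce_I S ?A)" using pb by auto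
 note pbA = pb_arr[OF IA(1) pb(1) IA(2)]
 have zT: "?z \<in> TT (ce_pb S (ce_I S ?A) ?A)" using z(1) e by simp
 have za: "?z \<in> Arr CC" "Dom CC ?z = Dom FF ?A" "Cod CC ?z = Dom FF (ce_pb S (ce_I S ?A) ?A)"
   "ce_I S (ce_pb S (ce_I S ?A) ?A) \<odot> ?z = Ident CC (Dom FF ?A)"
  using zT pbA pb by (auto simp: TT_iff)
 \<comment> \<open>The equation that characterizes \<open>idtm\<close> of the pulled back arrow. It
   is tested on the two projections of the pullback of \<open>A\<close> along
   \<open>g\<close>.\<close>
 have "ce_pi2 S (ce_I S ?A) ?A \<odot> ?z = Ident CC (Dom FF ?A)"
 proof (rule C.pullback_eqI[OF pb_pullback[OF g A]])
  show "ce_pi2 S (ce_I S ?A) ?A \<odot> ?z \<in> Arr CC" "Cod CC (ce_pi2 S (ce_I S ?A) ?A \<odot> ?z) = Dom CC (ce_pi2 S g A)"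
   "Ident CC (Dom FF ?A) \<in> Arr CC" "Cod CC (Ident CC (Dom FF ?A)) = Dom CC (ce_pi2 S g A)"
   "Dom CC (ce_pi2 S (ce_I S ?A) ?A \<odot> ?z) = Dom CC (Ident CC (Dom FF ?A))"
   using za pbA pb by auto
  have ii: "e_idtm EE A \<in> Arr CC" "Dom CC (e_idtm EE A) = Dom FF A" "Cod CC (e_idtm EE A) = Dom FF ?V"
   using i(1) V by (auto simp: TT_iff)
  have "ce_pi2 S g A \<odot> (ce_pi2 S (ce_I S ?A) ?A \<odot> ?z) = (ce_pi2 S g A \<odot> ce_pi2 S (ce_I S ?A) ?A) \<odot> ?z"
   using za pbA pb by (simp add: C.assoc)
  also have "ce_pi2 S g A \<odot> ce_pi2 S (ce_I S ?A) ?A = ce_pi2 S (ce_I S A) A \<odot> ce_pi2 S (ce_pi2 S g A) ?V"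
   using comp_pb(2)[of "ce_I S A" "ce_pi2 S g A" A] comp_pb(2)[of g "ce_I S ?A" A] pb_square[OF g A] pb g A by simp
  also have "... \<odot> ?z = ce_pi2 S (ce_I S A) A \<odot> (ce_pi2 S (ce_pi2 S g A) ?V \<odot> ?z)"
   using za pb_arr[OF pb(3) V(1) c] pbI e by (simp add: C.assoc)
  also have "... = (ce_pi2 S (ce_I S A) A \<odot> e_idtm EE A) \<odot> ce_pi2 S g A"
   using z(2) ii pb pbI by (simp add: C.assoc)
  also have "... = ce_pi2 S g A" using i(2) pb by simp
  finally show "ce_pi2 S g A \<odot> (ce_pi2 S (ce_I S ?A) ?A \<odot> ?z) = ce_pi2 S g A \<odot> Ident CC (Dom FF ?A)"
   using pb by simp
  have "ce_I S ?A \<odot> (ce_pi2 S (ce_I S ?A) ?A \<odot> ?z) = (ce_I S ?A \<odot> ce_pi2 S (ce_I S ?A) ?A) \<odot> ?z"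
   using za pbA pb by (simp add: C.assoc)
  also have "... = ce_I S ?A \<odot> (ce_I S (ce_pb S (ce_I S ?A) ?A) \<odot> ?z)"
   using pb_square[OF IA(1) pb(1) IA(2)] za(1-3) pbA pb by (simp add: C.assoc)
  finally show "ce_I S ?A \<odot> (ce_pi2 S (ce_I S ?A) ?A \<odot> ?z) = ce_I S ?A \<odot> Ident CC (Dom FF ?A)"
   using za(4) by simp
 qed
 then have "e_idtm EE ?A = ?z" by (intro CE2E_idtm(3)[OF pb(1) zT])
 moreover have "sfun_tm EE (sfun_slice FF A (pf g)) ?V (e_idtm EE A) = ?z"
  using A V g by (simp add: sfun_tm_def pf_tm)
 ultimately show "sfun_tm EE (sfun_slice FF A (pf g)) (s_obj (pf (ce_I S A)) A) (e_idtm EE A) = e_idtm EE (s_obj (pf g) A)"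
  by simp
qed

text \<open>A slice of a pullback functor is the pullback functor of the connecting arrow, so
  \<open>pf_preserves\<close> covers all slices.\<close>

lemma pf_hm:
 assumes g: "g \<in> Arr CC"
 shows "is_slice_pre_ehom EE (Cod CC g) (Dom CC g) (pf g)"
proof (rule PE.hmI)
 show "is_sfun EE (Cod CC g) EE (Dom CC g) (pf g)" by (rule pf_sfun[OF g])
 show "s_obj (pf g) (Ident PE.F (Cod CC g)) = Ident PE.F (Dom CC g)" using g by simp
 fix A assume "A \<in> Arr PE.F" "Cod PE.F A = Cod CC g"
 then have A: "A \<in> Arr FF" "Cod FF A = Cod CC g" by auto
 show "preserves_at EE EE (Dom PE.F A) (PE.sl A (pf g))"
  using PE.preserves_at_cong[OF _ seq_sym[OF pf_eq_slice[OF g A]]] pf_preserves[OF pb_arr(3)[OF g A]]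
   pb_arr(5)[OF g A] by simp
qed

text \<open>All functors involved are pullback functors. Cancellation of weakening by substitution
  is pullback along a section followed by its projection, and cancellation by \<open>idtm\<close> is
  pullback along the diagonal followed by a projection; both composites are identities.\<close>

lemma is_esys_CE2E: "is_esys EE"
 unfolding is_esys_def Let_def CE2E_simps
proof (intro conjI ballI, goal_cases)
 case 1
 show ?case by (rule is_pre_esys_CE2E)
next
 case (2 X A x)
 then have "x \<in> Arr CC" "Dom CC x = X" "Cod CC x = Dom FF A" by (auto simp: TT_iff over_def)
 then show ?case using pf_hm[of x] by simp
next
 case (3 X A)
 then show ?case using pf_hm[of "ce_I S A"] by (simp add: over_def)
next
 case (4 X A x)
 then have A: "A \<in> Arr FF" "Cod FF A = X" by (auto simp: over_def)
 then have x: "x \<in> Arr CC" "Dom CC x = X" "Cod CC x = Dom FF A" "ce_I S A \<odot> x = Ident CC X"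
  using 4 by (auto simp: TT_iff)
 show ?case using seq_trans[OF seq_sym[OF pf_eq_comp[of "ce_I S A" x, unfolded x(4)]]] pf_eq_id[OF 4(1)] A x(1-3)
  by simp
next
 case (5 X A x)
 then have A: "A \<in> Arr FF" "Cod FF A = X" by (auto simp: over_def)
 then have x: "x \<in> Arr CC" "Dom CC x = X" "Cod CC x = Dom FF A" "ce_I S A \<odot> x = Ident CC X"
  using 5 by (auto simp: TT_iff)
 let ?V = "ce_pb S (ce_I S A) A"
 have pbI: "?V \<in> Arr FF" "Cod FF ?V = Cod CC x" "ce_pi2 S (ce_I S A) A \<in> Arr CC" "Dom CC (ce_pi2 S (ce_I S A) A) = Dom FF ?V"
  using A x by auto
 note i = CE2E_idtm[OF A(1)]
 have ii: "e_idtm EE A \<in> Arr CC" "Dom CC (e_idtm EE A) = Dom FF A" "Cod CC (e_idtm EE A) = Dom FF ?V"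
  using i(1) pbI(1,2) x by (auto simp: TT_iff)
 \<comment> \<open>By uniqueness this amounts to
   \<open>ce_pi2 S x ?V \<odot> x = e_idtm EE A \<odot> x\<close>. Both sides become
   \<open>x\<close> under each of the two projections of the pullback of \<open>A\<close> along
   \<open>I(A)\<close>.\<close>
 have "sec x ?V (e_idtm EE A) = x"
 proof (rule sec(3)[OF x(1) pbI(1,2) i(1)])
  have e: "ce_pb S x ?V = A" "ce_pi2 S (ce_I S A) A \<odot> ce_pi2 S x ?V = Ident CC (Dom FF A)"
   using comp_pb[of "ce_I S A" x A] A x by simp_all
  show "x \<in> TT (ce_pb S x ?V)" using 5 e by simp
  have px: "ce_pi2 S x ?V \<in> Arr CC" "Dom CC (ce_pi2 S x ?V) = Dom FF A" "Cod CC (ce_pi2 S x ?V) = Dom FF ?V"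
   using pb_arr[OF x(1) pbI(1,2)] e by simp_all
  have I: "ce_I S A \<in> Arr CC" "Cod FF A = Cod CC (ce_I S A)" using A by auto
  show "ce_pi2 S x ?V \<odot> x = e_idtm EE A \<odot> x"
  proof (rule C.pullback_eqI[OF pb_pullback[OF I(1) A(1) I(2)]])
   show "ce_pi2 S (ce_I S A) A \<odot> (ce_pi2 S x ?V \<odot> x) = ce_pi2 S (ce_I S A) A \<odot> (e_idtm EE A \<odot> x)"
    using e(2) i(2) px pbI ii x A by (simp add: C.assoc[symmetric])
   have "ce_I S ?V \<odot> ce_pi2 S x ?V = x \<odot> ce_I S A"
    using pb_square[OF x(1) pbI(1,2)] e by simp
   then have "ce_I S ?V \<odot> (ce_pi2 S x ?V \<odot> x) = x \<odot> (ce_I S A \<odot> x)"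
    using px pbI x(1-3) A by (simp add: C.assoc[symmetric])
   also have "... = x" using x by simp
   finally have l: "ce_I S ?V \<odot> (ce_pi2 S x ?V \<odot> x) = x" .
   have "ce_I S ?V \<odot> (e_idtm EE A \<odot> x) = x"
    using i(1) pbI ii x by (simp add: C.assoc[symmetric] TT_iff)
   with l show "ce_I S ?V \<odot> (ce_pi2 S x ?V \<odot> x) = ce_I S ?V \<odot> (e_idtm EE A \<odot> x)"
    by (simp only:)
  qed (use px pbI ii x A in simp_all)
 qed
 then show ?case using pf_sfun_tm[OF x(1) pbI(1,2)] by simp
next
 case (6 X A)
 then have A: "A \<in> Arr FF" "Cod FF A = X" by (auto simp: over_def)
 let ?V = "ce_pb S (ce_I S A) A"
 have I: "ce_I S A \<in> Arr CC" "Cod FF A = Cod CC (ce_I S A)" using A by auto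
 note pbI = pb_arr[OF I(1) A(1) I(2)]
 note i = CE2E_idtm[OF A(1)]
 have ii: "e_idtm EE A \<in> Arr CC" "Dom CC (e_idtm EE A) = Dom FF A" "Cod CC (e_idtm EE A) = Dom CC (ce_pi2 S (ce_I S A) A)"
  using i(1) pbI A by (auto simp: TT_iff)
 have "sfun_eq EE (Dom FF A) (pf (e_idtm EE A) \<star> sfun_slice FF A (pf (ce_I S A))) (pf (e_idtm EE A) \<star> pf (ce_pi2 S (ce_I S A) A))"
  by (rule seq_right[OF pf_eq_slice[OF I(1) A(1) I(2)]])
 also have "sfun_eq EE (Dom FF A) ... (pf (Ident CC (Dom FF A)))"
  unfolding i(2)[symmetric] using seq_sym[OF pf_eq_comp[OF pbI(3) ii(1,3)]] pbI by simp
 also have "sfun_eq EE (Dom FF A) ... sfun_id" using A by (simp add: pf_eq_id)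
 finally show ?case .
qed

end

context strat_cesys
begin

lemma is_stratified_CE2E: "is_stratified_esys EE"
 unfolding is_stratified_esys_def is_stratified_sfun_def CE2E_simps
proof (intro conjI ballI)
 show "is_stratified FF (ce_one S)" using is_strat by (simp add: is_stratified_cesys_def)
 show "ce_lev S (Dom FF B) - ce_lev S X = ce_lev S (Dom FF (s_obj (pf (ce_I S A)) B)) - ce_lev S (Dom FF A)"
  if "X \<in> Obj FF" "A \<in> over FF X" "B \<in> over FF X" for X A B
  using lev_pb[of "ce_I S A" B] that by (simp add: over_def)
 show "ce_lev S (Dom FF B) - ce_lev S (Dom FF A) = ce_lev S (Dom FF (s_obj (pf x) B)) - ce_lev S X"
  if "X \<in> Obj FF" "A \<in> over FF X" "x \<in> TT A" "B \<in> over FF (Dom FF A)" for X A x B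
  using lev_pb[of x B] that by (simp add: over_def TT_iff)
qed

end

context strat_cehom
begin

lemma hom_T:
 assumes "A \<in> Arr (ce_fam S)" "x \<in> CE2E_T S A"
 shows "onArr (ceh_cat H) x \<in> CE2E_T S' (onArr (ceh_fam H) A)"
proof -
 have x: "x \<in> Arr (ce_cat S)" "Dom (ce_cat S) x = Cod (ce_fam S) A" "Cod (ce_cat S) x = Dom (ce_fam S) A"
   "ce_I S A \<cdot>\<^bsub>ce_cat S\<^esub> x = Ident (ce_cat S) (Cod (ce_fam S) A)"
  using assms by (auto simp: S.TT_iff)
 note a = functor_arr[OF cat_functor x(1)] functor_arr[OF fam_functor assms(1)]
 have "ce_I S' (onArr (ceh_fam H) A) \<cdot>\<^bsub>ce_cat S'\<^esub> onArr (ceh_cat H) x = onArr (ceh_cat H) (ce_I S A \<cdot>\<^bsub>ce_cat S\<^esub> x)"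
  using functor_comp[OF cat_functor x(1), of "ce_I S A"] assms x hom_I by simp
 also have "... = Ident (ce_cat S') (onObj (ceh_fam H) (Cod (ce_fam S) A))"
  using x(4) functor_id[OF cat_functor] assms(1) by (simp add: obj_agree)
 finally show ?thesis
  using a assms x by (simp add: S'.TT_iff obj_agree)
qed

text \<open>The image of the pulled back section satisfies the equation that characterizes the
  pullback of the image.\<close>

lemma hom_sec:
 assumes f: "f \<in> Arr (ce_cat S)" and Q: "Q \<in> Arr (ce_fam S)" "Cod (ce_fam S) Q = Cod (ce_cat S) f" and y: "y \<in> CE2E_T S Q"
 shows "S'.sec (onArr (ceh_cat H) f) (onArr (ceh_fam H) Q) (onArr (ceh_cat H) y) = onArr (ceh_cat H) (S.sec f Q y)"
proof (rule S'.sec(3))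
 note s = S.sec[OF f Q y]
 note pb = S.pb_arr[OF f Q]
 note h = hom_pb[OF f Q]
 show "onArr (ceh_cat H) f \<in> Arr (ce_cat S')" "onArr (ceh_fam H) Q \<in> Arr (ce_fam S')"
  "Cod (ce_fam S') (onArr (ceh_fam H) Q) = Cod (ce_cat S') (onArr (ceh_cat H) f)"
  using functor_arr[OF cat_functor f] functor_arr[OF fam_functor Q(1)] f Q by (simp_all add: obj_agree)
 show "onArr (ceh_cat H) y \<in> CE2E_T S' (onArr (ceh_fam H) Q)" by (rule hom_T[OF Q(1) y])
 show "onArr (ceh_cat H) (S.sec f Q y) \<in> CE2E_T S' (ce_pb S' (onArr (ceh_cat H) f) (onArr (ceh_fam H) Q))"
  using hom_T[OF pb(1) s(1)] h by simp
 have sy: "S.sec f Q y \<in> Arr (ce_cat S)" "Cod (ce_cat S) (S.sec f Q y) = Dom (ce_cat S) (ce_pi2 S f Q)"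
  "y \<in> Arr (ce_cat S)" "Dom (ce_cat S) y = Cod (ce_cat S) f"
  using s(1) y Q pb by (auto simp: S.TT_iff)
 have "onArr (ceh_cat H) (ce_pi2 S f Q \<cdot>\<^bsub>ce_cat S\<^esub> S.sec f Q y) = onArr (ceh_cat H) (y \<cdot>\<^bsub>ce_cat S\<^esub> f)" using s(2) by simp
 then show "ce_pi2 S' (onArr (ceh_cat H) f) (onArr (ceh_fam H) Q) \<cdot>\<^bsub>ce_cat S'\<^esub> onArr (ceh_cat H) (S.sec f Q y) =
   onArr (ceh_cat H) y \<cdot>\<^bsub>ce_cat S'\<^esub> onArr (ceh_cat H) f"
  using h sy f pb functor_comp[OF cat_functor] by simp
qed

lemma hom_idtm:
 assumes A: "A \<in> Arr (ce_fam S)"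
 shows "e_idtm (CE2E_obj S') (onArr (ceh_fam H) A) = onArr (ceh_cat H) (e_idtm (CE2E_obj S) A)"
proof (rule S'.CE2E_idtm(3))
 note i = S.CE2E_idtm[OF A]
 have I: "ce_I S A \<in> Arr (ce_cat S)" "Cod (ce_fam S) A = Cod (ce_cat S) (ce_I S A)" using A by auto
 note pb = S.pb_arr[OF I(1) A I(2)] and h = hom_pb[OF I(1) A I(2)]
 show "onArr (ceh_fam H) A \<in> Arr (ce_fam S')" using functor_arr[OF fam_functor A] by simp
 show "onArr (ceh_cat H) (e_idtm (CE2E_obj S) A) \<in> CE2E_T S' (ce_pb S' (ce_I S' (onArr (ceh_fam H) A)) (onArr (ceh_fam H) A))"
  using hom_T[OF pb(1) i(1)] h hom_I[OF A] by simp
 have ia: "e_idtm (CE2E_obj S) A \<in> Arr (ce_cat S)" "Cod (ce_cat S) (e_idtm (CE2E_obj S) A) = Dom (ce_cat S) (ce_pi2 S (ce_I S A) A)"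
  using i(1) pb by (auto simp: S.TT_iff)
 have "onArr (ceh_cat H) (ce_pi2 S (ce_I S A) A \<cdot>\<^bsub>ce_cat S\<^esub> e_idtm (CE2E_obj S) A) = onArr (ceh_cat H) (Ident (ce_cat S) (Dom (ce_fam S) A))"
  using i(2) by simp
 then show "ce_pi2 S' (ce_I S' (onArr (ceh_fam H) A)) (onArr (ceh_fam H) A) \<cdot>\<^bsub>ce_cat S'\<^esub> onArr (ceh_cat H) (e_idtm (CE2E_obj S) A) =
   Ident (ce_cat S') (Dom (ce_fam S') (onArr (ceh_fam H) A))"
  using h hom_I[OF A] ia pb A functor_comp[OF cat_functor] functor_id[OF cat_functor] functor_arr[OF fam_functor A]
  by (simp add: obj_agree)
qed

text \<open>Weakenings and substitutions are both pullback functors, so this one square yields the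
  compatibility of a CE-homomorphism with either of them.\<close>

lemma hom_pf:
 assumes f: "f \<in> Arr (ce_cat S)" and H': "ehom_slice K = \<lparr>s_obj = onArr (ceh_fam H), s_arr = (\<lambda>A P. onArr (ceh_fam H) P),
  s_tm = (\<lambda>A P t. onArr (ceh_cat H) t)\<rparr>"
 shows "sfun_eq (CE2E_obj S) (Cod (ce_cat S) f) (ehom_slice K \<star> CE2E_pb S f) (CE2E_pb S' (onArr (ceh_cat H) f) \<star> ehom_slice K)"
proof (rule seqI, unfold H' S.CE2E_simps, goal_cases)
 case (1 A)
 then show ?case using f hom_pb by simp
next
 case (2 A P)
 then show ?case using f hom_pb[of f A] hom_pb[of "ce_pi2 S f A" P] by simp
next
 case (3 A P t)
 note F = functor_arr[OF fam_functor] functor_arr[OF cat_functor]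
 have "onArr (ceh_fam H) A \<in> Arr (ce_fam S')" "onArr (ceh_fam H) P \<in> Arr (ce_fam S')" "onArr (ceh_cat H) f \<in> Arr (ce_cat S')"
  "Cod (ce_fam S') (onArr (ceh_fam H) A) = Cod (ce_cat S') (onArr (ceh_cat H) f)"
  "Cod (ce_fam S') (onArr (ceh_fam H) P) = Dom (ce_fam S') (onArr (ceh_fam H) A)"
  using 3 f F by (simp_all add: obj_agree)
 then show ?case using 3 f hom_pb[of f A] hom_sec[of "ce_pi2 S f A" P t] by (simp add: S.pf_tm S'.pf_tm)
qed

lemma is_pre_ehom_CE2E: "is_pre_ehom (CE2E_obj S) (CE2E_obj S') (CE2E_hom S H)"
proof -
 let ?K = "\<lparr>eh_fun = ceh_fam H, eh_tm = (\<lambda>A x. onArr (ceh_cat H) x)\<rparr>"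
 have K: "ehom_slice ?K = \<lparr>s_obj = onArr (ceh_fam H), s_arr = (\<lambda>A P. onArr (ceh_fam H) P), s_tm = (\<lambda>A P t. onArr (ceh_cat H) t)\<rparr>"
  by (simp add: ehom_slice_def)
 interpret P: pre_esys "CE2E_obj S" by (rule pre_esys.intro[OF S.is_pre_esys_CE2E])
 have "preserves_at (CE2E_obj S) (CE2E_obj S') \<Gamma> (ehom_slice ?K)" for \<Gamma>
 proof (rule P.preserves_atI)
  fix A assume "A \<in> Arr P.F" "Cod P.F A = \<Gamma>"
  then have A: "A \<in> Arr (ce_fam S)" "Cod (ce_fam S) A = \<Gamma>" by auto
  { fix x assume "x \<in> P.T A"
   then have "x \<in> Arr (ce_cat S)" "Cod (ce_cat S) x = Dom (ce_fam S) A" using A by (auto simp: S.TT_iff)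
   then show "P.eqv (Dom P.F A) (ehom_slice ?K \<star> P.S A x)
    (e_S (CE2E_obj S') (s_obj (ehom_slice ?K) A) (P.tm (ehom_slice ?K) A x) \<star> P.sl A (ehom_slice ?K))"
    using hom_pf[OF _ K, of x] by simp }
  show "P.eqv \<Gamma> (P.sl A (ehom_slice ?K) \<star> P.W A) (e_W (CE2E_obj S') (s_obj (ehom_slice ?K) A) \<star> ehom_slice ?K)"
   using hom_pf[OF _ K, of "ce_I S A"] A hom_I by simp
  show "P.tm (P.sl A (ehom_slice ?K)) (s_obj (P.W A) A) (P.idtm A) = e_idtm (CE2E_obj S') (s_obj (ehom_slice ?K) A)"
   using hom_idtm[OF A(1)] by simp
 qed
 then have "is_pre_ehom (CE2E_obj S) (CE2E_obj S') ?K"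
  unfolding is_pre_ehom_def using fam_functor hom_T hom_one by simp
 then show ?thesis unfolding CE2E_hom_def by (rule ehom_restrict[OF P.pre_esys_axioms])
qed

lemma is_stratified_ehom_CE2E: "is_stratified_ehom (CE2E_obj S) (CE2E_obj S') (CE2E_hom S H)"
 using hom_lev by (simp add: is_stratified_ehom_def CE2E_hom_def)

end

lemma is_functor_CE2E: "is_functor rCEsys\<^sub>s Esys\<^sub>s CE2E"
 unfolding Esys\<^sub>s_def rCEsys\<^sub>s_def CE2E_def
proof (rule is_functor_mk_category, goal_cases)
 case (1 S)
 then interpret strat_cesys S by (simp add: strat_cesysI)
 show ?case by (simp add: is_esys_CE2E is_stratified_CE2E)
next
 case (2 S S' H)
 then interpret strat_cehom S S' H by (simp add: strat_cehomI)
 show ?case using is_pre_ehom_CE2E is_stratified_ehom_CE2E by (simp add: CE2E_hom_def)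
next
 case (3 S)
 then interpret strat_cesys S by (simp add: strat_cesysI)
 show ?case by (rule ehom_eqI[of EE]) (auto simp: CE2E_hom_def TT_iff)
next
 case (4 S S' S'' H K)
 interpret H: strat_cehom S S' H using 4 by (simp add: strat_cehomI)
 interpret K: strat_cehom S' S'' K using 4 by (simp add: strat_cehomI)
 show ?case
  by (rule ehom_eqI[of H.S.EE])
   (auto simp: CE2E_hom_def H.S.TT_iff functor_obj[OF H.fam_functor] functor_arr[OF H.fam_functor] H.hom_T)
qed

section \<open>Comparison of a CE-system with the CE-system of its C-system\<close>

context strat_cesys
begin

interpretation C2: csys "CE2C_obj S"
 by (rule csys.intro[OF is_csys_CE2C])

abbreviation "cft \<equiv> c_ft (CE2C_obj S)"

text \<open>The evaluation in the given family category of the formal path of length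
  \<open>k\<close> out of \<open>X\<close>, where formal paths belong to the free category built
  from the associated C-system.\<close>

fun pth :: "'a univ \<Rightarrow> nat \<Rightarrow> 'a univ" where
 "pth X 0 = Ident FF X"
| "pth X (Suc k) = pth (cft X) k \<cdot>\<^bsub>FF\<^esub> ce_indec S X"

lemma pth_facts:
 "X \<in> Obj FF \<Longrightarrow> k \<le> ce_lev S X \<Longrightarrow>
  pth X k \<in> Arr FF \<and> Dom FF (pth X k) = X \<and> Cod FF (pth X k) = (cft ^^ k) X \<and> CE_I (CE2C_obj S) X k = ce_I S (pth X k)"
proof (induction k arbitrary: X)
 case (Suc k)
 have X: "0 < ce_lev S X" using Suc.prems by simp
 have c: "cft X = Cod FF (ce_indec S X)" by (rule CE2C_ft[OF Suc.prems(1) X])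
 have "cft X \<in> Obj FF" "k \<le> ce_lev S (cft X)" using Suc.prems X by (simp_all add: c)
 note IH = Suc.IH[OF this]
 then show ?case using Suc.prems X c by (simp add: funpow_swap1 I_comp)
qed simp

lemmas pth = pth_facts[THEN conjunct1] pth_facts[THEN conjunct2, THEN conjunct1]
 pth_facts[THEN conjunct2, THEN conjunct2, THEN conjunct1]
 pth_facts[THEN conjunct2, THEN conjunct2, THEN conjunct2]

text \<open>Pullback along a path was defined edge by edge. Clause (d) shows that the chosen
  pullback of a composite is computed in the same way, and \<open>indec_pb\<close> shows that
  pulling back an edge gives an edge.\<close>

lemma pth_pb:
 "X \<in> Obj FF \<Longrightarrow> k \<le> ce_lev S X \<Longrightarrow> f \<in> Arr CC \<Longrightarrow> Cod CC f = (cft ^^ k) X \<Longrightarrow>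
  pth (C2.ppb f X k) k = ce_pb S f (pth X k) \<and> CE_pi2 (CE2C_obj S) f X k = ce_pi2 S f (pth X k)"
proof (induction k arbitrary: X)
 case (Suc k)
 have X: "0 < ce_lev S X" using Suc.prems by simp
 have c: "cft X = Cod FF (ce_indec S X)" by (rule CE2C_ft[OF Suc.prems(1) X])
 have Y: "cft X \<in> Obj FF" "k \<le> ce_lev S (cft X)" "Cod CC f = (cft ^^ k) (cft X)"
  using Suc.prems X by (simp_all add: c funpow_swap1)
 note IH = Suc.IH[OF Y(1,2) Suc.prems(3) Y(3)]
 let ?g = "CE_pi2 (CE2C_obj S) f (cft X) k"
 have "?g \<in> Arr CC \<and> Cod CC ?g = cft X \<and> Dom CC ?g = C2.ppb f (cft X) k"
  using C2.CE_pi2_facts[of "cft X" k f] Y Suc.prems by simp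
 then have g: "?g \<in> Arr CC" "Cod CC ?g = Cod FF (ce_indec S X)" "Dom CC ?g = C2.ppb f (cft X) k" by (simp_all add: c)
 note i = indec_pb[OF Suc.prems(1) X g(1,2)]
 let ?Z = "Dom FF (ce_pb S ?g (ce_indec S X))"
 have ii: "ce_indec S X \<in> Arr FF" using Suc.prems(1) X by simp
 note pb = pb_arr[OF g(1) ii g(2)[symmetric]]
 have cz: "cft ?Z = C2.ppb f (cft X) k"
  using CE2C_ft[of ?Z] i pb g by simp
 have "pth (cft X) k \<in> Arr FF" "Cod FF (pth (cft X) k) = Cod CC f" "Cod FF (ce_indec S X) = Dom FF (pth (cft X) k)"
  using pth[OF Y(1,2)] Y c by simp_all
 note d = pb_comp[OF Suc.prems(3) this(1,2) ii this(3)]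
 show ?case using IH d i(2) cz by simp
qed (simp)

text \<open>The identity on the second category; only the families change, from formal paths to
  actual composites.\<close>

definition theta :: "'a cehom" where
 "theta = cehom_restrict (CE_obj (CE2C_obj S))
   \<lparr>ceh_fam = \<lparr>onObj = (\<lambda>X. X), onArr = (\<lambda>p. pth (ufst p) (unum (usnd p)))\<rparr>, ceh_cat = fmap_id\<rparr>"

lemma theta_hom: "is_cehom (CE_obj (CE2C_obj S)) S theta"
proof -
 let ?H = "\<lparr>ceh_fam = \<lparr>onObj = (\<lambda>X. X), onArr = (\<lambda>p. pth (ufst p) (unum (usnd p)))\<rparr>, ceh_cat = fmap_id\<rparr> :: 'a cehom"
 have "is_cehom (CE_obj (CE2C_obj S)) S ?H"
  unfolding is_cehom_def C2.CE_obj_simps CE2C_simps cehom.select_convs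
 proof (intro conjI ballI, goal_cases)
  case 1
  show ?case
   unfolding is_functor_def fmap.select_convs hom_def
  proof (intro conjI ballI impI CollectI, goal_cases)
   case (1 X)
   then show ?case by simp
  next
   case (6 f g)
   obtain X k where f: "f = \<langle>X, Num k\<rangle>" "X \<in> Obj FF" "k \<le> ce_lev S X" using 6(1) by (auto elim: C2.CE_arrE)
   obtain Y j where g: "g = \<langle>Y, Num j\<rangle>" "Y \<in> Obj FF" "j \<le> ce_lev S Y" using 6(2) by (auto elim: C2.CE_arrE)
   have Y: "Y = (cft ^^ k) X" using 6(3) f g by simp
   have le: "k + j \<le> ce_lev S X" using g(3) C2.len_fts[of X k] f by (simp add: Y)
   \<comment> \<open>Composites are compared by thinness: the evaluations of both sides are parallel
     arrows of a stratified category.\<close>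
   show ?case
    using f g pth[OF f(2,3)] pth[OF g(2,3)] pth[OF f(2) le] Y
    by (simp add: funpow_add add.commute[of k j]) (rule T.thin, simp_all add: funpow_add)
  qed (auto elim!: C2.CE_arrE simp: pth)
 next
  case 2
  show ?case using is_functor_id .
 next
  case (4 A)
  then show ?case by (auto elim!: C2.CE_arrE simp: pth)
 next
  case (6 f A)
  then show ?case by (auto simp: C2.CE_over pth_pb)
 next
  case (7 f A)
  then show ?case by (auto simp: C2.CE_over pth_pb)
 qed simp_all
 then show ?thesis unfolding theta_def by (simp add: cehom_restrict C2.is_cesys_CE)
qed

lemma theta_strat: "is_stratified_cehom (CE_obj (CE2C_obj S)) S theta"
 using C2.CE_lev by (simp add: is_stratified_cehom_def theta_def)

end

context strat_cehom
begin

lemma hom_cft: "X \<in> Obj (ce_fam S) \<Longrightarrow> onObj (ceh_fam H) (S.cft X) = S'.cft (onObj (ceh_fam H) X)"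
 using is_csys_hom_CE2C obj_agree functor_obj[OF fam_functor] csys.ft_obj[OF csys.intro[OF S.is_csys_CE2C]]
 unfolding is_csys_hom_def by simp

lemma hom_pth: "X \<in> Obj (ce_fam S) \<Longrightarrow> k \<le> ce_lev S X \<Longrightarrow>
  onArr (ceh_fam H) (S.pth X k) = S'.pth (onObj (ceh_fam H) X) k"
proof (induction k arbitrary: X)
 case 0
 then show ?case using functor_id[OF fam_functor] by simp
next
 case (Suc k)
 have X: "0 < ce_lev S X" using Suc.prems by simp
 have c: "S.cft X = Cod (ce_fam S) (ce_indec S X)" by (rule S.CE2C_ft[OF Suc.prems(1) X])
 have "S.cft X \<in> Obj (ce_fam S)" "k \<le> ce_lev S (S.cft X)" using Suc.prems X by (simp_all add: c)
 then show ?case using Suc.IH[of "S.cft X"] S.pth[of "S.cft X" k] Suc.prems X c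
  using hom_cft[OF Suc.prems(1)] by (simp add: functor_comp[OF fam_functor] hom_indec)
qed

lemma theta_natural:
 "cehom_restrict (CE_obj (CE2C_obj S))
   \<lparr>ceh_fam = ceh_fam S'.theta \<circ>\<^sub>F ceh_fam (CE_hom (CE2C_obj S) (ceh_cat H)),
   ceh_cat = ceh_cat S'.theta \<circ>\<^sub>F ceh_cat (CE_hom (CE2C_obj S) (ceh_cat H))\<rparr> =
  cehom_restrict (CE_obj (CE2C_obj S))
   \<lparr>ceh_fam = ceh_fam H \<circ>\<^sub>F ceh_fam S.theta, ceh_cat = ceh_cat H \<circ>\<^sub>F ceh_cat S.theta\<rparr>"
proof -
 interpret C2: csys "CE2C_obj S" by (rule csys.intro[OF S.is_csys_CE2C])
 interpret C2': csys "CE2C_obj S'" by (rule csys.intro[OF S'.is_csys_CE2C])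
 show ?thesis
  by (rule cehom_eqI; rule fmap_eqI[of "CE_fam (CE2C_obj S)"] fmap_eqI[of "ce_cat S"])
   (auto elim!: C2.CE_arrE simp: CE_hom_def S.theta_def S'.theta_def obj_agree functor_obj[OF fam_functor]
    functor_arr[OF cat_functor] hom_pth hom_lev)
qed

end

section \<open>Comparison of an E-system with the E-system of its CE-system\<close>

lemma (in strat_esys) strat_cesys_E2CE: "strat_cesys (E2CE_obj E)"
 by (rule strat_cesysI[OF is_cesys_E2CE is_rooted_E2CE is_stratified_E2CE])

context strat_esys
begin

interpretation C: strat_cesys "E2CE_obj E"
 by (rule strat_cesys_E2CE)

abbreviation "bang \<equiv> T.bang"
abbreviation "thC \<equiv> thom_cat E (e_root E)"

text \<open>A term of \<open>A\<close> becomes a section, that is an arrow of the category of terms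
  over the root. It is specified by the functor it has to induce, substitution of \<open>t\<close>;
  objects are represented by their arrows to the root.\<close>

definition eta_tm :: "'a univ \<Rightarrow> 'a univ \<Rightarrow> 'a univ" where
 "eta_tm A t = arr_of (bang (Cod F A)) (bang (Dom F A)) (S A t)"

definition eta0 :: "'a ehom" where
 "eta0 = \<lparr>eh_fun = \<lparr>onObj = bang, onArr = (\<lambda>A. \<langle>bang (Cod F A), A\<rangle>)\<rparr>, eh_tm = eta_tm\<rparr>"

definition eta :: "'a ehom" where
 "eta = ehom_restrict E eta0"

text \<open>Weakening from the root to the domain of \<open>A\<close> ends with weakening by
  \<open>A\<close>, which the substitution cancels.\<close>

lemma rel_S:
 assumes A: "A \<in> Arr F" and t: "t \<in> T A"
 shows "rel (bang (Cod F A)) (bang (Dom F A)) (S A t)"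
 unfolding rel_def
proof
 have b: "bang (Cod F A) \<in> Arr F" "bang (Cod F A) \<odot> A = bang (Dom F A)" using A by (auto simp: T.bang_comp)
 show "hm (Dom F (bang (Dom F A))) (Dom F (bang (Cod F A))) (S A t)" using S_hm[OF A t] A by simp
 have "eqv (e_root E) (S A t \<star> W (bang (Dom F A))) (S A t \<star> (W A \<star> W (bang (Cod F A))))"
  using seq_right[OF W_comp[OF b(1) A]] b A by simp
 also have "eqv (e_root E) ... (sfun_id \<star> W (bang (Cod F A)))"
  unfolding sassoc[symmetric]
  by (rule seq_left[OF S_W[OF A t]]) (use W_sfun[OF b(1)] A in simp)
 finally show "eqv (Cod F (bang (Dom F A))) (S A t \<star> W (bang (Dom F A))) (W (bang (Cod F A)))"
  using A by simp
qed

lemma eta_tm: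
 assumes A: "A \<in> Arr F" and t: "t \<in> T A"
 shows "eta_tm A t \<in> Arr thC" "ufst (eta_tm A t) = bang (Cod F A)" "usnd (usnd (eta_tm A t)) = bang (Dom F A)"
  "eqv (Dom F A) (afun (eta_tm A t)) (S A t)"
 using arr_of[OF rel_S[OF A t]] A by (auto simp: eta_tm_def)

lemma I_eta:
 assumes A: "A \<in> Arr F"
 shows "ce_I (E2CE_obj E) \<langle>bang (Cod F A), A\<rangle> \<in> Arr thC" "ufst (ce_I (E2CE_obj E) \<langle>bang (Cod F A), A\<rangle>) = bang (Dom F A)"
  "usnd (usnd (ce_I (E2CE_obj E) \<langle>bang (Cod F A), A\<rangle>)) = bang (Cod F A)"
  "eqv (Cod F A) (afun (ce_I (E2CE_obj E) \<langle>bang (Cod F A), A\<rangle>)) (W A)"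
 using thom_I[of "bang (Cod F A)" "e_root E" A] A T.bang_comp[OF A] by auto

lemma eta_slice_arr: "A \<in> Arr F \<Longrightarrow> \<langle>bang (Cod F A), A\<rangle> \<in> Arr (slice_cat F (e_root E))"
 by (simp add: over_def)

lemma comp_eqv:
 assumes "a \<in> Arr thC" "b \<in> Arr thC" "ufst b = tgt a" "eqv (Dom F (tgt a)) (afun a) G"
  "eqv (Dom F (tgt b)) (afun b) K"
 shows "eqv (Dom F (tgt b)) (afun (b \<cdot>\<^bsub>thC\<^esub> a)) (G \<star> K)"
 using seq_trans[OF thom_comp(5)[OF assms(1-3)] sfun_eq_comp[OF assms(5) afun_sfun[OF assms(2)] assms(4)[folded assms(3)]]] .

text \<open>On functors, the section equation reads \<open>S A t \<star> W A\<close> equals the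
  identity, which is an axiom of E-systems.\<close>

lemma eta_T:
 assumes A: "A \<in> Arr F" and t: "t \<in> T A"
 shows "eta_tm A t \<in> CE2E_T (E2CE_obj E) \<langle>bang (Cod F A), A\<rangle>"
proof -
 let ?I = "ce_I (E2CE_obj E) \<langle>bang (Cod F A), A\<rangle>"
 note e = eta_tm[OF A t] and I = I_eta[OF A]
 have "eqv (Cod F A) (afun (?I \<cdot>\<^bsub>thC\<^esub> eta_tm A t)) (S A t \<star> W A)"
  using comp_eqv[OF e(1) I(1), of "S A t" "W A"] e I A by simp
 also have "eqv (Cod F A) ... sfun_id" by (rule S_W[OF A t])
 finally have 1: "eqv (Cod F A) (afun (?I \<cdot>\<^bsub>thC\<^esub> eta_tm A t)) sfun_id" .
 have b: "bang (Cod F A) \<in> Arr F" "Cod F (bang (Cod F A)) = e_root E" "Dom F (bang (Cod F A)) = Cod F A" using A by auto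
 note i = thom_ident[OF b(1,2)]
 have "?I \<cdot>\<^bsub>thC\<^esub> eta_tm A t = Ident thC (bang (Cod F A))"
  using thom_comp(2-4)[OF e(1) I(1)] e I i 1 A seq_trans[OF 1 seq_sym[OF i(2)[unfolded b(3)]]]
  by - (rule thom_eqI[of _ "e_root E"], simp_all)
 then show ?thesis using e eta_slice_arr[OF A] A T.bang_comp[OF A] by (simp add: C.TT_iff)
qed

text \<open>The image of the substituted term satisfies the equation that defines the pulled back
  section; on functors, this equation says that \<open>afun a\<close> commutes with
  substitution.\<close>

lemma eta_sec:
 assumes a: "a \<in> Arr thC" and P: "P \<in> Arr F" "Cod F P = Dom F (tgt a)" and t: "t \<in> T P"
 shows "eta_tm (s_obj (afun a) P) (tm (afun a) P t) = C.sec a \<langle>tgt a, P\<rangle> (eta_tm P t)"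
proof -
 note A = thom_arrD[OF a]
 note p = pi2_arr[OF a P]
 have ha: "hm (Dom F (tgt a)) (Dom F (ufst a)) (afun a)" using A(5) by (simp add: rel_def)
 have bP: "bang (Cod F P) = tgt a" using T.bang_eq[OF A(3)] A P by simp
 have bA: "bang (Dom F (ufst a)) = ufst a" using T.bang_eq[OF A(1)] A by simp
 let ?aP = "s_obj (afun a) P"
 let ?u = "tm (afun a) P t"
 have u: "?u \<in> T ?aP" by (rule hm_tm_in[OF ha P t])
 note e = eta_tm[OF P(1) t] and eu = eta_tm[OF p(3) u]
 have bD: "bang (Dom F ?aP) = ufst a \<odot> ?aP" using T.bang_comp[OF p(3)] p(4) bA by simp
 have bDP: "bang (Dom F P) = tgt a \<odot> P" using T.bang_comp[OF P(1)] bP by simp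
 let ?pi = "arr_of (ufst a \<odot> ?aP) (tgt a \<odot> P) (sl P (afun a))"
 have c1: "ufst ?pi = usnd (usnd (eta_tm ?aP ?u))" using eu bD by simp
 have c2: "ufst (eta_tm P t) = tgt a" using e bP by simp
 have d: "Dom F (tgt a \<odot> P) = Dom F P" using A P by simp
 have dd: "Dom F (usnd (usnd (eta_tm ?aP ?u))) = Dom F ?aP" using eu p(3) by simp
 have "eqv (Dom F P) (afun (?pi \<cdot>\<^bsub>thC\<^esub> eta_tm ?aP ?u)) (S ?aP ?u \<star> sl P (afun a))"
  using comp_eqv[OF eu(1) p(1) c1, of "S ?aP ?u" "sl P (afun a)"] eu(4) p(2) dd d by simp
 also have "eqv (Dom F P) ... (afun a \<star> S P t)"
  using seq_sym[OF presD(1)[OF hm_pres[OF ha dom_obj[OF A(3)]] P t]] .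
 also have "eqv (Dom F P) ... (afun (eta_tm P t \<cdot>\<^bsub>thC\<^esub> a))"
  using seq_sym[OF comp_eqv[OF a e(1) c2 sfun_eq_refl, of "S P t"]] e(3,4) P by simp
 finally have "?pi \<cdot>\<^bsub>thC\<^esub> eta_tm ?aP ?u = eta_tm P t \<cdot>\<^bsub>thC\<^esub> a"
  using thom_comp(2-4)[OF eu(1) p(1) c1] thom_comp(2-4)[OF a e(1) c2] eu e p(4) bA bDP d
  by - (rule thom_eqI[of _ "e_root E"], simp_all)
 moreover have "eta_tm ?aP ?u \<in> CE2E_T (E2CE_obj E) (ce_pb (E2CE_obj E) a \<langle>tgt a, P\<rangle>)"
  using eta_T[OF p(3) u] p(4) bA by (simp add: E2CE_pb[OF a] del: E2CE_simps(5))
 moreover have "eta_tm P t \<in> CE2E_T (E2CE_obj E) \<langle>tgt a, P\<rangle>" using eta_T[OF P(1) t] bP by simp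
 moreover have "\<langle>tgt a, P\<rangle> \<in> Arr (slice_cat F (e_root E))" using A P by (simp add: over_def)
 ultimately show ?thesis
  using E2CE_pi2[OF a P] a by (intro C.sec(3)[symmetric]) simp_all
qed

text \<open>The comparison intertwines the action of \<open>a\<close> in the E-system with pullback
  along \<open>a\<close> in the new CE-system. Compatibility with substitution and weakening are
  both obtained from this square.\<close>

lemma eta_pf:
 assumes a: "a \<in> Arr thC"
 shows "eqv (Dom F (tgt a)) (ehom_slice eta0 \<star> afun a) (CE2E_pb (E2CE_obj E) a \<star> ehom_slice eta0)"
proof -
 note A = thom_arrD[OF a]
 have bA: "bang (Dom F (ufst a)) = ufst a" using T.bang_eq[OF A(1)] A by simp
 have bB: "bang (Dom F (tgt a)) = tgt a" using T.bang_eq[OF A(3)] A by simp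
 show ?thesis
 proof (rule seqI, goal_cases)
  case (1 B)
  note p = pi2_arr[OF a 1]
  show ?case using 1 p bA bB by (simp add: eta0_def E2CE_pb[OF a] del: E2CE_simps(5))
 next
  case (2 B P)
  note p = pi2_arr[OF a 2(1,2)]
  note s = sfun_arr[OF afun_sfun[OF a] 2]
  have o: "s_obj (afun (arr_of (ufst a \<odot> s_obj (afun a) B) (tgt a \<odot> B) (sl B (afun a)))) P = s_arr (afun a) B P"
   using seqD(1)[OF p(2) 2(3,4)] by simp
  have b1: "bang (Dom F (s_obj (afun a) B)) = ufst a \<odot> s_obj (afun a) B" using T.bang_comp[OF p(3)] p(4) bA by simp
  show ?case using 2 s bA bB o b1
   by (simp add: eta0_def E2CE_pi2[OF a 2(1,2)] E2CE_pb[OF p(1)] del: E2CE_simps(5))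
 next
  case (3 B P t)
  note p = pi2_arr[OF a 3(1,2)]
  let ?pi = "arr_of (ufst a \<odot> s_obj (afun a) B) (tgt a \<odot> B) (sl B (afun a))"
  note s = sfun_arr[OF afun_sfun[OF a] 3(1-4)]
  have bB': "bang (Cod F B) = tgt a" using bB 3 by simp
  have bDB: "bang (Cod F P) = tgt a \<odot> B" using T.bang_comp[OF 3(1)] bB' 3 by simp
  have d: "Dom F (usnd (usnd ?pi)) = Dom F B" using A 3 by simp
  have "eta_tm (s_arr (afun a) B P) (s_tm (afun a) B P t) = eta_tm (s_obj (afun ?pi) P) (tm (afun ?pi) P t)"
   using seqD(1)[OF p(2) 3(3,4)] sfun_tm_eq[OF p(2) 3(3,4,5)] sfun_tm_slice[OF 3(1,4)] by simp
  also have "... = C.sec ?pi \<langle>usnd (usnd ?pi), P\<rangle> (eta_tm P t)"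
   by (rule eta_sec[OF p(1) 3(3) _ 3(5)]) (use 3 d in simp)
  also have "... = s_tm (CE2E_pb (E2CE_obj E) a) \<langle>tgt a, B\<rangle> \<langle>tgt a \<odot> B, P\<rangle> (eta_tm P t)"
   using E2CE_pi2[OF a 3(1,2)] a A 3 by (subst C.pf_tm) (simp_all add: over_def)
  finally show ?case by (simp add: eta0_def bB' bDB)
 qed
qed

text \<open>Substitution by \<open>x\<close> and weakening by \<open>A\<close> are the functors of
  the arrows \<open>eta_tm A x\<close> and \<open>I(A)\<close>, so \<open>eta_pf\<close> applies to
  both. That \<open>idtm\<close> is preserved follows from the uniqueness of the diagonal, whose
  equation becomes \<open>S_idtm_W\<close>.\<close>

lemma eta0_hom: "is_pre_ehom E (CE2E_obj (E2CE_obj E)) eta0"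
 unfolding is_pre_ehom_def
proof (intro conjI ballI)
 show "is_functor F (e_cat (CE2E_obj (E2CE_obj E))) (eh_fun eta0)"
  unfolding is_functor_def by (auto simp: eta0_def hom_def over_def T.bang_comp)
 show "eh_tm eta0 A t \<in> e_T (CE2E_obj (E2CE_obj E)) (onArr (eh_fun eta0) A)" if "A \<in> Arr F" "t \<in> T A" for A t
  using eta_T[OF that] by (simp add: eta0_def)
 show "onObj (eh_fun eta0) (e_root E) = e_root (CE2E_obj (E2CE_obj E))"
  by (simp add: eta0_def T.bang_base)
 fix \<Gamma> assume "\<Gamma> \<in> Obj F"
 let ?R = "ehom_slice eta0"
 show "preserves_at E (CE2E_obj (E2CE_obj E)) \<Gamma> ?R"
 proof (rule preserves_atI)
  fix A assume A: "A \<in> Arr F" "Cod F A = \<Gamma>"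
  { fix x assume x: "x \<in> T A"
   note e = eta_tm[OF A(1) x]
   have "eqv (Dom F A) (?R \<star> S A x) (?R \<star> afun (eta_tm A x))"
    by (rule seq_right[OF seq_sym[OF e(4)]])
   also have "eqv (Dom F A) ... (CE2E_pb (E2CE_obj E) (eta_tm A x) \<star> ?R)"
    using eta_pf[OF e(1)] e A by simp
   finally show "eqv (Dom F A) (?R \<star> S A x)
    (e_S (CE2E_obj (E2CE_obj E)) (s_obj ?R A) (tm ?R A x) \<star> sl A ?R)"
    by (simp add: eta0_def) }
  note I = I_eta[OF A(1)]
  let ?I = "ce_I (E2CE_obj E) \<langle>bang (Cod F A), A\<rangle>"
  have "eqv \<Gamma> (?R \<star> W A) (?R \<star> afun ?I)" using seq_right[OF seq_sym[OF I(4)]] A(2) by (simp del: E2CE_simps)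
  also have "eqv \<Gamma> ... (CE2E_pb (E2CE_obj E) ?I \<star> ?R)" using eta_pf[OF I(1)] I(3) A(1) A(2)[symmetric] by (simp del: E2CE_simps)
  finally show "eqv \<Gamma> (sl A ?R \<star> W A) (e_W (CE2E_obj (E2CE_obj E)) (s_obj ?R A) \<star> ?R)"
   by (simp add: eta0_def del: E2CE_simps)
  let ?V = "s_obj (W A) A"
  have V: "?V \<in> Arr F" "Cod F ?V = Dom F A" using A by auto
  note e = eta_tm[OF V(1) idtm_in[OF A(1)]]
  have b: "bang (Cod F A) \<in> Arr F" "Cod F (bang (Cod F A)) = e_root E" using A by auto
  have Ar: "A \<in> Arr F" "Cod F A = Dom F (usnd (usnd ?I))" using A(1) by (simp_all add: I(3) del: E2CE_simps)
  note p = pi2_arr[OF I(1) Ar]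
  have o: "s_obj (afun ?I) A = ?V" using seqD(1)[OF I(4) A(1) refl] by simp
  let ?pi = "arr_of (ufst ?I \<odot> s_obj (afun ?I) A) (usnd (usnd ?I) \<odot> A) (sl A (afun ?I))"
  have c: "ufst ?pi = usnd (usnd (eta_tm ?V (idtm A)))"
   using e(3) I(2) o T.bang_comp[OF V(1)] V by simp
  have d: "Dom F (usnd (usnd ?pi)) = Dom F A" using Ar A b I(3) by simp
  have dd: "Dom F (usnd (usnd (eta_tm ?V (idtm A)))) = Dom F ?V" using e V by simp
  have slA: "eqv (Dom F A) (sl A (afun ?I)) (sl A (W A))" by (rule seq_slice[OF I(4) A(1) refl])
  have "eqv (Dom F A) (afun (?pi \<cdot>\<^bsub>thC\<^esub> eta_tm ?V (idtm A))) (S ?V (idtm A) \<star> sl A (W A))"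
   using comp_eqv[OF e(1) p(1) c, of "S ?V (idtm A)" "sl A (W A)"] e(4) seq_trans[OF p(2) slA] d dd by simp
  also have "eqv (Dom F A) ... sfun_id" by (rule S_idtm_W[OF A(1)])
  finally have 1: "eqv (Dom F A) (afun (?pi \<cdot>\<^bsub>thC\<^esub> eta_tm ?V (idtm A))) sfun_id" .
  have bd: "bang (Dom F A) \<in> Arr F" "Cod F (bang (Dom F A)) = e_root E" "Dom F (bang (Dom F A)) = Dom F A" using A by auto
  note i = thom_ident[OF bd(1,2)]
  have "?pi \<cdot>\<^bsub>thC\<^esub> eta_tm ?V (idtm A) = \<langle>bang (Dom F A), \<langle>idtm (bang (Dom F A)), bang (Dom F A)\<rangle>\<rangle>"
   using thom_comp(2-4)[OF e(1) p(1) c] i(1) d seq_trans[OF 1 seq_sym[OF i(2)[unfolded bd(3)]]]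
    e(2) V I(3) T.bang_comp[OF A(1)] bd
   by - (rule thom_eqI[of _ "e_root E"], simp_all)
  moreover have "ce_pi2 (E2CE_obj E) ?I \<langle>bang (Cod F A), A\<rangle> = ?pi"
   using E2CE_pi2[OF I(1) Ar] I(3) by (simp del: E2CE_simps)
  moreover have "eta_tm ?V (idtm A) \<in> CE2E_T (E2CE_obj E) (ce_pb (E2CE_obj E) ?I \<langle>bang (Cod F A), A\<rangle>)"
   using eta_T[OF V(1) idtm_in[OF A(1)]] V o I(2) A(1) by (simp add: E2CE_pb[OF I(1)] del: E2CE_simps)
  moreover have "\<langle>bang (Cod F A), A\<rangle> \<in> Arr C.FF" using eta_slice_arr[OF A(1)] by simp
  ultimately have "e_idtm (CE2E_obj (E2CE_obj E)) \<langle>bang (Cod F A), A\<rangle> = eta_tm ?V (idtm A)"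
   using A T.bang_comp[OF A(1)] by (intro C.CE2E_idtm(3)) (simp_all del: E2CE_simps(4-5))
  then show "tm (sl A ?R) (s_obj (W A) A) (idtm A) = e_idtm (CE2E_obj (E2CE_obj E)) (s_obj ?R A)"
   by (simp add: eta0_def)
 qed
qed

lemma eta_hom: "is_pre_ehom E (CE2E_obj (E2CE_obj E)) eta"
 unfolding eta_def by (rule ehom_restrict[OF pre_esys_axioms eta0_hom])

lemma eta_strat: "is_stratified_ehom E (CE2E_obj (E2CE_obj E)) eta"
 using E2CE_lev by (simp add: is_stratified_ehom_def eta_def eta0_def)

text \<open>The functor of the image is substitution by \<open>t\<close>, and its value at the
  generic term is \<open>t\<close>.\<close>

lemma eta_inj:
 assumes A: "A \<in> Arr F" and t: "t \<in> T A" "u \<in> T A" "eta_tm A t = eta_tm A u"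
 shows "t = u"
proof -
 have "eqv (Dom F A) (S A t) (S A u)"
  using seq_trans[OF seq_sym[OF eta_tm(4)[OF A t(1)]] eta_tm(4)[OF A t(2), folded t(3)]] .
 then have "point A (S A t) = point A (S A u)" using A by (rule point_eq)
 then show ?thesis using S_idtm[OF A] t by simp
qed

text \<open>The preimage of a section \<open>s\<close> is the value of its functor at the generic
  term of \<open>A\<close>. The section equation says that this functor cancels weakening by
  \<open>A\<close>; with \<open>S_idtm_W\<close> this forces it to be the substitution of that
  value.\<close>

lemma eta_surj:
 assumes A: "A \<in> Arr F" and s: "s \<in> CE2E_T (E2CE_obj E) \<langle>bang (Cod F A), A\<rangle>"
 shows "\<exists>t \<in> T A. eta_tm A t = s"
proof -
 let ?I = "ce_I (E2CE_obj E) \<langle>bang (Cod F A), A\<rangle>"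
 note I = I_eta[OF A]
 have s': "s \<in> Arr thC" "ufst s = bang (Cod F A)" "tgt s = bang (Dom F A)"
   "?I \<cdot>\<^bsub>thC\<^esub> s = Ident thC (bang (Cod F A))"
  using s eta_slice_arr[OF A] T.bang_comp[OF A] A by (auto simp: C.TT_iff)
 have b: "bang (Cod F A) \<in> Arr F" "Cod F (bang (Cod F A)) = e_root E" "Dom F (bang (Cod F A)) = Cod F A" using A by auto
 note D = thom_arrD[OF s'(1)]
 have hs: "hm (Dom F A) (Cod F A) (afun s)" using D(5) A by (simp add: rel_def s'(2,3))
 have "eqv (Cod F A) (afun s \<star> W A) (afun (?I \<cdot>\<^bsub>thC\<^esub> s))"
  using seq_sym[OF comp_eqv[OF s'(1) I(1) _ sfun_eq_refl, of "W A"]] I s' A by simp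
 also have "eqv (Cod F A) ... sfun_id" using thom_ident(2)[OF b(1,2)] b(3) by (simp add: s'(4) del: E2CE_simps)
 finally have 1: "eqv (Cod F A) (afun s \<star> W A) sfun_id" .
 let ?V = "s_obj (W A) A" and ?t = "point A (afun s)"
 have V: "?V \<in> Arr F" "Cod F ?V = Dom F A" using A by auto
 have sV: "s_obj (afun s) ?V = A" using seqD(1)[OF 1 A refl] by simp
 have t: "?t \<in> T A" using hm_tm_in[OF hs V idtm_in[OF A]] sV by simp
 have slW: "sfn (Dom F A) (Dom F ?V) (sl A (W A))" by (rule hm_sfun[OF hm_slice[OF W_hm[OF A] A refl]])
 have "eqv (Dom F A) (afun s \<star> sfun_id) (afun s \<star> (S ?V (idtm A) \<star> sl A (W A)))"
  by (rule seq_right[OF seq_sym[OF S_idtm_W[OF A]]])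
 also have "eqv (Dom F A) ... ((S (s_obj (afun s) ?V) ?t \<star> sl ?V (afun s)) \<star> sl A (W A))"
  unfolding sassoc[symmetric]
  by (rule seq_left[OF presD(1)[OF hm_pres[OF hs dom_obj[OF A]] V idtm_in[OF A]] slW])
 also have "eqv (Dom F A) ... (S A ?t \<star> sl A (afun s \<star> W A))"
  unfolding sV sassoc by (rule seq_right[OF seq_sym[OF slice_comp[OF W_sfun[OF A] A refl]]])
 also have "eqv (Dom F A) ... (S A ?t \<star> sl A sfun_id)"
  by (rule seq_right[OF seq_slice[OF 1 A refl]])
 also have "eqv (Dom F A) ... (S A ?t \<star> sfun_id)"
  by (rule seq_right, rule seqI) (use A in simp_all)
 finally have 2: "eqv (Dom F A) (afun s) (S A ?t)" by simp
 note e = eta_tm[OF A t]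
 have "eta_tm A ?t = s"
  using e s' seq_trans[OF e(4) seq_sym[OF 2]] A by - (rule thom_eqI[of _ "e_root E"], simp_all)
 with t show ?thesis by blast
qed

end

context strat_esys_hom
begin

lemma h_bang: "X \<in> Obj E.F \<Longrightarrow> ho (E.bang X) = E'.bang (onObj (eh_fun H) X)"
 using E'.T.bang_eq[of "ho (E.bang X)"] h_root by simp

text \<open>On terms, \<open>H\<close> intertwines substitution of \<open>t\<close> with
  substitution of its image, and \<open>harr_arr_of\<close> turns this into the equality of the two
  arrows.\<close>

lemma eta_natural:
 "ehom_restrict E
   \<lparr>eh_fun = eh_fun E'.eta \<circ>\<^sub>F eh_fun H, eh_tm = (\<lambda>A t. eh_tm E'.eta (ho A) (eh_tm H A t))\<rparr> =
  ehom_restrict E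
   \<lparr>eh_fun = eh_fun (CE2E_hom (E2CE_obj E) (E2CE_hom E H)) \<circ>\<^sub>F eh_fun E.eta,
   eh_tm = (\<lambda>A t. eh_tm (CE2E_hom (E2CE_obj E) (E2CE_hom E H)) (onArr (eh_fun E.eta) A) (eh_tm E.eta A t))\<rparr>"
proof (rule ehom_eqI[of E])
 interpret C: strat_cesys "E2CE_obj E" by (rule E.strat_cesys_E2CE)
 fix A assume A: "A \<in> Arr E.F"
 have sa: "\<langle>E.bang (Cod E.F A), A\<rangle> \<in> Arr C.FF" using E.eta_slice_arr[OF A] by simp
 show "onArr (eh_fun (ehom_restrict E \<lparr>eh_fun = eh_fun E'.eta \<circ>\<^sub>F eh_fun H, eh_tm = (\<lambda>A t. eh_tm E'.eta (ho A) (eh_tm H A t))\<rparr>)) A =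
  onArr (eh_fun (ehom_restrict E
   \<lparr>eh_fun = eh_fun (CE2E_hom (E2CE_obj E) (E2CE_hom E H)) \<circ>\<^sub>F eh_fun E.eta,
   eh_tm = (\<lambda>A t. eh_tm (CE2E_hom (E2CE_obj E) (E2CE_hom E H)) (onArr (eh_fun E.eta) A) (eh_tm E.eta A t))\<rparr>)) A"
  using A E.eta_slice_arr[OF A] by (simp add: E.eta_def E'.eta_def E.eta0_def E'.eta0_def CE2E_hom_def E2CE_hom_simps h_bang)
 fix t assume t: "t \<in> E.T A"
 have "E'.eta_tm (ho A) (eh_tm H A t) = harr (E.eta_tm A t)"
  unfolding E.eta_tm_def E'.eta_tm_def
  using harr_arr_of[OF E.rel_S[OF A t], of "E'.S (ho A) (eh_tm H A t)"] h_S[OF A t] A by (simp add: h_bang)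
 then show "eh_tm (ehom_restrict E \<lparr>eh_fun = eh_fun E'.eta \<circ>\<^sub>F eh_fun H, eh_tm = (\<lambda>A t. eh_tm E'.eta (ho A) (eh_tm H A t))\<rparr>) A t =
  eh_tm (ehom_restrict E
   \<lparr>eh_fun = eh_fun (CE2E_hom (E2CE_obj E) (E2CE_hom E H)) \<circ>\<^sub>F eh_fun E.eta,
   eh_tm = (\<lambda>A t. eh_tm (CE2E_hom (E2CE_obj E) (E2CE_hom E H)) (onArr (eh_fun E.eta) A) (eh_tm E.eta A t))\<rparr>) A t"
  using A t h_tm[OF A t] E.eta_T[OF A t] E.eta_tm(1)[OF A t] sa
  by (simp add: E.eta_def E'.eta_def E.eta0_def E'.eta0_def CE2E_hom_def E2CE_hom_simps)
next
 interpret C: strat_cesys "E2CE_obj E" by (rule E.strat_cesys_E2CE)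
 fix X assume "X \<in> Obj E.F"
 then show "onObj (eh_fun (ehom_restrict E \<lparr>eh_fun = eh_fun E'.eta \<circ>\<^sub>F eh_fun H, eh_tm = (\<lambda>A t. eh_tm E'.eta (ho A) (eh_tm H A t))\<rparr>)) X =
  onObj (eh_fun (ehom_restrict E
   \<lparr>eh_fun = eh_fun (CE2E_hom (E2CE_obj E) (E2CE_hom E H)) \<circ>\<^sub>F eh_fun E.eta,
   eh_tm = (\<lambda>A t. eh_tm (CE2E_hom (E2CE_obj E) (E2CE_hom E H)) (onArr (eh_fun E.eta) A) (eh_tm E.eta A t))\<rparr>)) X"
  using functor_obj[OF hfun]
  by (simp add: E.eta_def E'.eta_def E.eta0_def E'.eta0_def CE2E_hom_def E2CE_hom_simps h_bang over_def)
qed simp_all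

end

section \<open>B-frames and B-systems\<close>

lemma bhom_comp_simps [simp]:
 "bh_ty (K \<ast> H) n X = bh_ty K n (bh_ty H n X)" "bh_tm (K \<ast> H) n x = bh_tm K n (bh_tm H n x)"
 "bh_ty bhom_id n X = X" "bh_tm bhom_id n x = x"
 "bh_ty (bhom_slice m H) n = bh_ty H (m + n)" "bh_tm (bhom_slice m H) n = bh_tm H (m + n)"
 by (auto simp: bhom_comp_def bhom_id_def bhom_slice_def)

lemma bassoc: "(K \<ast> H) \<ast> G = K \<ast> (H \<ast> G)"
 by (simp add: bhom_comp_def)

lemma bhom_comp_id [simp]: "H \<ast> bhom_id = H" "bhom_id \<ast> H = H"
 by (auto simp: bhom_comp_def bhom_id_def)

lemma bslice_comp: "bhom_slice n (K \<ast> H) = bhom_slice n K \<ast> bhom_slice n H"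
 by (simp add: bhom_comp_def bhom_slice_def)

lemma bslice_slice: "bhom_slice n (bhom_slice m H) = bhom_slice (m + n) H"
 by (simp add: bhom_slice_def add.assoc)

lemma bhom_slice_0 [simp]: "bhom_slice 0 H = H"
 by (simp add: bhom_slice_def)

lemma bhom_slice_id [simp]: "bhom_slice n bhom_id = bhom_id"
 by (simp add: bhom_slice_def bhom_id_def)

lemma bhom_eq_refl [simp]: "bhom_eq B H H"
 by (simp add: bhom_eq_def)

lemma beq_sym: "bhom_eq B H K \<Longrightarrow> bhom_eq B K H"
 by (simp add: bhom_eq_def)

lemma beq_trans [trans]: "bhom_eq B H K \<Longrightarrow> bhom_eq B K L \<Longrightarrow> bhom_eq B H L"
 by (simp add: bhom_eq_def)

lemma beqD:
 assumes "bhom_eq B H K"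
 shows "X \<in> b_ty B n \<Longrightarrow> bh_ty H n X = bh_ty K n X" "x \<in> b_tm B n \<Longrightarrow> bh_tm H n x = bh_tm K n x"
 using assms by (auto simp: bhom_eq_def)

lemma beq_right: "bhom_eq B H K \<Longrightarrow> bhom_eq B (G \<ast> H) (G \<ast> K)"
 by (simp add: bhom_eq_def)

lemma frameD:
 assumes "is_bframe_hom B A H"
 shows "X \<in> b_ty B n \<Longrightarrow> bh_ty H n X \<in> b_ty A n"
  "x \<in> b_tm B (Suc n) \<Longrightarrow> bh_tm H (Suc n) x \<in> b_tm A (Suc n)"
  "X \<in> b_ty B (Suc n) \<Longrightarrow> bh_ty H n (b_ft B (Suc n) X) = b_ft A (Suc n) (bh_ty H (Suc n) X)"
  "x \<in> b_tm B (Suc n) \<Longrightarrow> bh_ty H (Suc n) (b_bd B (Suc n) x) = b_bd A (Suc n) (bh_tm H (Suc n) x)"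
 using assms unfolding is_bframe_hom_def by blast+

text \<open>\<open>H\<close> has to map into the carriers of \<open>A\<close>, where
  \<open>G\<close> and \<open>K\<close> agree. Frame homomorphisms control terms of positive index,
  and the frame \<open>B\<close> has no terms of index 0.\<close>

lemma beq_left:
 assumes "is_bframe B" "bhom_eq A G K" "is_bframe_hom B A H"
 shows "bhom_eq B (G \<ast> H) (K \<ast> H)"
 unfolding bhom_eq_def
proof (intro conjI allI ballI)
 show "bh_ty (G \<ast> H) n X = bh_ty (K \<ast> H) n X" if "X \<in> b_ty B n" for n X
  using beqD(1)[OF assms(2)] frameD(1)[OF assms(3) that] by simp
 show "bh_tm (G \<ast> H) n x = bh_tm (K \<ast> H) n x" if "x \<in> b_tm B n" for n x
 proof (cases n)
  case 0
  then show ?thesis using assms(1) that by (simp add: is_bframe_def)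
 next
  case (Suc k)
  then show ?thesis using beqD(2)[OF assms(2)] frameD(2)[OF assms(3), of x k] that by simp
 qed
qed

lemma beq_slice: "bhom_eq B H K \<Longrightarrow> bhom_eq (b_slice B n X) (bhom_slice n H) (bhom_slice n K)"
 by (simp add: bhom_eq_def b_slice_def)

lemma is_bframe_hom_comp:
 assumes "is_bframe_hom B A H" "is_bframe_hom A D K"
 shows "is_bframe_hom B D (K \<ast> H)"
 unfolding is_bframe_hom_def using frameD[OF assms(1)] frameD[OF assms(2)] by simp

lemma b_slice_simps [simp]:
 "Y \<in> b_ty (b_slice B n X) m \<longleftrightarrow> Y \<in> b_ty B (n + m) \<and> b_ftm B n m Y = X"
 "y \<in> b_tm (b_slice B n X) m \<longleftrightarrow> y \<in> b_tm B (n + m) \<and> m > 0 \<and> b_ftm B n m (b_bd B (n + m) y) = X"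
 "b_ft (b_slice B n X) m = b_ft B (n + m)" "b_bd (b_slice B n X) m = b_bd B (n + m)"
 "b_S (b_slice B n X) m = b_S B (n + m)" "b_W (b_slice B n X) m = b_W B (n + m)"
 "b_delta (b_slice B n X) m = b_delta B (n + m)"
 by (auto simp: b_slice_def)

lemma b_ftm_slice: "b_ftm (b_slice B n X) m k Z = b_ftm B (n + m) k Z"
 by (induction k arbitrary: Z) (auto simp: add.assoc)

lemma b_ftm_add: "b_ftm B n (m + k) Z = b_ftm B n m (b_ftm B (n + m) k Z)"
 by (induction k arbitrary: Z) (auto simp: add.assoc)

text \<open>The identification of an iterated slice with a single one is an equality of records,
  because slicing keeps the underlying elements and only shifts indices.\<close>

lemma b_slice_slice:
 assumes "Y \<in> b_ty B (n + m)" "b_ftm B n m Y = X"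
 shows "b_slice (b_slice B n X) m Y = b_slice B (n + m) Y"
proof (rule bsys.equality)
 have e: "b_ftm B n (m + k) Z = X" if "b_ftm B (n + m) k Z = Y" for k Z
  using assms(2) that by (simp add: b_ftm_add)
 show "b_ty (b_slice (b_slice B n X) m Y) = b_ty (b_slice B (n + m) Y)"
 proof (rule ext, rule set_eqI)
  show "Z \<in> b_ty (b_slice (b_slice B n X) m Y) k \<longleftrightarrow> Z \<in> b_ty (b_slice B (n + m) Y) k" for Z k
   using e[of k Z] by (auto simp: b_ftm_slice add.assoc)
 qed
 show "b_tm (b_slice (b_slice B n X) m Y) = b_tm (b_slice B (n + m) Y)"
 proof (rule ext, rule set_eqI)
  show "Z \<in> b_tm (b_slice (b_slice B n X) m Y) k \<longleftrightarrow> Z \<in> b_tm (b_slice B (n + m) Y) k" for Z k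
   using e[of k "b_bd B (n + (m + k)) Z"] by (auto simp: b_ftm_slice add.assoc)
 qed
qed (auto simp: b_slice_def add.assoc)

locale bframe =
 fixes B :: "'a bsys"
 assumes is_bframe: "is_bframe B"
begin

lemma ft_in [simp]: "X \<in> b_ty B (Suc n) \<Longrightarrow> b_ft B (Suc n) X \<in> b_ty B n"
 and bd_in [simp]: "x \<in> b_tm B (Suc n) \<Longrightarrow> b_bd B (Suc n) x \<in> b_ty B (Suc n)"
 and tm_0 [simp]: "b_tm B 0 = {}"
 using is_bframe by (auto simp: is_bframe_def)

lemma ftm_in [simp]: "X \<in> b_ty B (n + m) \<Longrightarrow> b_ftm B n m X \<in> b_ty B n"
 by (induction m arbitrary: X) auto

lemma is_bframe_slice:
 assumes "X \<in> b_ty B n"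
 shows "is_bframe (b_slice B n X)"
 unfolding is_bframe_def
proof (intro conjI allI ballI)
 show "\<exists>x. b_ty (b_slice B n X) 0 = {x}" using assms by (intro exI[of _ X]) (auto simp: b_slice_def)
qed (auto simp: b_slice_def)

lemma ty_0: "X \<in> b_ty B 0 \<Longrightarrow> Y \<in> b_ty B 0 \<Longrightarrow> X = Y"
 using is_bframe by (auto simp: is_bframe_def)

lemma hom_ftm:
 assumes "is_bframe_hom B A H"
 shows "X \<in> b_ty B (n + m) \<Longrightarrow> bh_ty H n (b_ftm B n m X) = b_ftm A n m (bh_ty H (n + m) X)"
proof (induction m arbitrary: X)
 case (Suc m)
 then show ?case using frameD(3)[OF assms, of X "n + m"] by simp
qed simp

lemma is_bframe_hom_slice:
 assumes H: "is_bframe_hom B A H" and X: "X \<in> b_ty B n"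
 shows "is_bframe_hom (b_slice B n X) (b_slice A n (bh_ty H n X)) (bhom_slice n H)"
 unfolding is_bframe_hom_def
proof (intro conjI allI ballI, goal_cases)
 case (1 m Y)
 then show ?case using frameD(1)[OF H, of Y "n + m"] hom_ftm[OF H, of Y n m] by simp
next
 case (2 m y)
 then have y: "y \<in> b_tm B (Suc (n + m))" "b_ftm B n (Suc m) (b_bd B (Suc (n + m)) y) = X" by auto
 then show ?case using frameD(2,4)[OF H y(1)] hom_ftm[OF H, of "b_bd B (Suc (n + m)) y" n "Suc m"] bd_in[OF y(1)] by simp
next
 case (3 m Y)
 then show ?case using frameD(3)[OF H, of Y "n + m"] by simp
next
 case (4 m y)
 then show ?case using frameD(4)[OF H, of y "n + m"] by simp
qed

lemma pre_bhom_frame: "is_pre_bhom B A H \<Longrightarrow> is_bframe_hom B A H"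
 by (simp add: is_pre_bhom_def)

lemma pre_bhomD:
 assumes "is_pre_bhom B A H"
 shows "x \<in> b_tm B (Suc n) \<Longrightarrow> bhom_eq (b_slice B (Suc n) (b_bd B (Suc n) x))
    (bhom_slice n H \<ast> b_S B (Suc n) x)
    (b_S A (Suc n) (bh_tm H (Suc n) x) \<ast> bhom_slice (Suc n) H)"
  "X \<in> b_ty B (Suc n) \<Longrightarrow> bhom_eq (b_slice B n (b_ft B (Suc n) X))
    (bhom_slice (Suc n) H \<ast> b_W B (Suc n) X)
    (b_W A (Suc n) (bh_ty H (Suc n) X) \<ast> bhom_slice n H)"
  "X \<in> b_ty B (Suc n) \<Longrightarrow> bh_tm H (Suc (Suc n)) (b_delta B (Suc n) X) = b_delta A (Suc n) (bh_ty H (Suc n) X)"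
 using assms unfolding is_pre_bhom_def by blast+

lemma pre_bhomI:
 assumes "is_bframe_hom B A H"
  "\<And>n x. x \<in> b_tm B (Suc n) \<Longrightarrow> bhom_eq (b_slice B (Suc n) (b_bd B (Suc n) x))
    (bhom_slice n H \<ast> b_S B (Suc n) x)
    (b_S A (Suc n) (bh_tm H (Suc n) x) \<ast> bhom_slice (Suc n) H)"
  "\<And>n X. X \<in> b_ty B (Suc n) \<Longrightarrow> bhom_eq (b_slice B n (b_ft B (Suc n) X))
    (bhom_slice (Suc n) H \<ast> b_W B (Suc n) X)
    (b_W A (Suc n) (bh_ty H (Suc n) X) \<ast> bhom_slice n H)"
  "\<And>n X. X \<in> b_ty B (Suc n) \<Longrightarrow> bh_tm H (Suc (Suc n)) (b_delta B (Suc n) X) = b_delta A (Suc n) (bh_ty H (Suc n) X)"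
 shows "is_pre_bhom B A H"
 using assms unfolding is_pre_bhom_def by blast

lemma pre_bhom_id: "is_pre_bhom B B bhom_id"
 by (rule pre_bhomI) (auto simp: is_bframe_hom_def)

lemma pre_bhom_comp:
 assumes "is_bframe A" and H: "is_pre_bhom B A H" and K: "is_pre_bhom A D K"
  and delta: "\<And>n X. X \<in> b_ty B (Suc n) \<Longrightarrow> b_delta B (Suc n) X \<in> b_tm B (Suc (Suc n))"
 shows "is_pre_bhom B D (K \<ast> H)"
proof (rule pre_bhomI)
 interpret A: bframe A by unfold_locales fact
 note h = pre_bhom_frame[OF H] and k = A.pre_bhom_frame[OF K]
 show "is_bframe_hom B D (K \<ast> H)" by (rule is_bframe_hom_comp[OF h k])
 { fix n x assume x: "x \<in> b_tm B (Suc n)"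
  note hx = frameD[OF h]
  let ?X = "b_bd B (Suc n) x"
  have hs: "is_bframe_hom (b_slice B (Suc n) ?X) (b_slice A (Suc n) (b_bd A (Suc n) (bh_tm H (Suc n) x))) (bhom_slice (Suc n) H)"
   using is_bframe_hom_slice[OF h bd_in[OF x]] hx(4)[OF x] by simp
  have "bhom_eq (b_slice B (Suc n) ?X) (bhom_slice n (K \<ast> H) \<ast> b_S B (Suc n) x)
    (bhom_slice n K \<ast> (b_S A (Suc n) (bh_tm H (Suc n) x) \<ast> bhom_slice (Suc n) H))"
   unfolding bslice_comp bassoc by (rule beq_right[OF pre_bhomD(1)[OF H x]])
  also have "bhom_eq (b_slice B (Suc n) ?X) ...
    ((b_S D (Suc n) (bh_tm K (Suc n) (bh_tm H (Suc n) x)) \<ast> bhom_slice (Suc n) K) \<ast> bhom_slice (Suc n) H)"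
   unfolding bassoc[symmetric]
   by (rule beq_left[OF is_bframe_slice[OF bd_in[OF x]] A.pre_bhomD(1)[OF K hx(2)[OF x]] hs])
  finally show "bhom_eq (b_slice B (Suc n) ?X) (bhom_slice n (K \<ast> H) \<ast> b_S B (Suc n) x)
    (b_S D (Suc n) (bh_tm (K \<ast> H) (Suc n) x) \<ast> bhom_slice (Suc n) (K \<ast> H))"
   by (simp add: bslice_comp bassoc) }
 { fix n X assume X: "X \<in> b_ty B (Suc n)"
  note hx = frameD[OF h]
  let ?Y = "b_ft B (Suc n) X"
  have hs: "is_bframe_hom (b_slice B n ?Y) (b_slice A n (b_ft A (Suc n) (bh_ty H (Suc n) X))) (bhom_slice n H)"
   using is_bframe_hom_slice[OF h ft_in[OF X]] hx(3)[OF X] by simp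
  have "bhom_eq (b_slice B n ?Y) (bhom_slice (Suc n) (K \<ast> H) \<ast> b_W B (Suc n) X)
    (bhom_slice (Suc n) K \<ast> (b_W A (Suc n) (bh_ty H (Suc n) X) \<ast> bhom_slice n H))"
   unfolding bslice_comp bassoc by (rule beq_right[OF pre_bhomD(2)[OF H X]])
  also have "bhom_eq (b_slice B n ?Y) ...
    ((b_W D (Suc n) (bh_ty K (Suc n) (bh_ty H (Suc n) X)) \<ast> bhom_slice n K) \<ast> bhom_slice n H)"
   unfolding bassoc[symmetric]
   by (rule beq_left[OF is_bframe_slice[OF ft_in[OF X]] A.pre_bhomD(2)[OF K hx(1)[OF X]] hs])
  finally show "bhom_eq (b_slice B n ?Y) (bhom_slice (Suc n) (K \<ast> H) \<ast> b_W B (Suc n) X)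
    (b_W D (Suc n) (bh_ty (K \<ast> H) (Suc n) X) \<ast> bhom_slice n (K \<ast> H))"
   by (simp add: bslice_comp bassoc)
  show "bh_tm (K \<ast> H) (Suc (Suc n)) (b_delta B (Suc n) X) = b_delta D (Suc n) (bh_ty (K \<ast> H) (Suc n) X)"
   using pre_bhomD(3)[OF H X] A.pre_bhomD(3)[OF K hx(1)[OF X]] by simp }
qed

lemma pre_bhom_slice:
 assumes H: "is_pre_bhom B A H" and X: "X \<in> b_ty B n"
 shows "is_pre_bhom (b_slice B n X) (b_slice A n (bh_ty H n X)) (bhom_slice n H)"
proof -
 interpret S: bframe "b_slice B n X" by unfold_locales (rule is_bframe_slice[OF X])
 note h = pre_bhom_frame[OF H]
 show ?thesis
 proof (rule S.pre_bhomI)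
  show "is_bframe_hom (b_slice B n X) (b_slice A n (bh_ty H n X)) (bhom_slice n H)"
   by (rule is_bframe_hom_slice[OF h X])
  fix m x assume x: "x \<in> b_tm (b_slice B n X) (Suc m)"
  then have x': "x \<in> b_tm B (Suc (n + m))" "b_ftm B n (Suc m) (b_bd B (Suc (n + m)) x) = X" by auto
  have e: "b_slice (b_slice B n X) (Suc m) (b_bd B (Suc (n + m)) x) = b_slice B (Suc (n + m)) (b_bd B (Suc (n + m)) x)"
   using b_slice_slice[of "b_bd B (Suc (n + m)) x" B n "Suc m" X] x' bd_in[OF x'(1)] by simp
  show "bhom_eq (b_slice (b_slice B n X) (Suc m) (b_bd (b_slice B n X) (Suc m) x))
    (bhom_slice m (bhom_slice n H) \<ast> b_S (b_slice B n X) (Suc m) x)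
    (b_S (b_slice A n (bh_ty H n X)) (Suc m) (bh_tm (bhom_slice n H) (Suc m) x) \<ast> bhom_slice (Suc m) (bhom_slice n H))"
   using pre_bhomD(1)[OF H x'(1)] by (simp add: e bslice_slice)
 next
  fix m Y assume Y: "Y \<in> b_ty (b_slice B n X) (Suc m)"
  then have Y': "Y \<in> b_ty B (Suc (n + m))" "b_ftm B n m (b_ft B (Suc (n + m)) Y) = X" by auto
  have e: "b_slice (b_slice B n X) m (b_ft B (Suc (n + m)) Y) = b_slice B (n + m) (b_ft B (Suc (n + m)) Y)"
   using b_slice_slice[of "b_ft B (Suc (n + m)) Y" B n m X] Y' ft_in[OF Y'(1)] by simp
  show "bhom_eq (b_slice (b_slice B n X) m (b_ft (b_slice B n X) (Suc m) Y))
    (bhom_slice (Suc m) (bhom_slice n H) \<ast> b_W (b_slice B n X) (Suc m) Y)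
    (b_W (b_slice A n (bh_ty H n X)) (Suc m) (bh_ty (bhom_slice n H) (Suc m) Y) \<ast> bhom_slice m (bhom_slice n H))"
   using pre_bhomD(2)[OF H Y'(1)] by (simp add: e bslice_slice)
  show "bh_tm (bhom_slice n H) (Suc (Suc m)) (b_delta (b_slice B n X) (Suc m) Y) =
    b_delta (b_slice A n (bh_ty H n X)) (Suc m) (bh_ty (bhom_slice n H) (Suc m) Y)"
   using pre_bhomD(3)[OF H Y'(1)] by simp
 qed
qed

lemma is_bframe_hom_cong:
 assumes h: "is_bframe_hom B A H" and eq: "bhom_eq B H K"
 shows "is_bframe_hom B A K"
 unfolding is_bframe_hom_def using frameD[OF h] beqD[OF eq] bd_in ft_in by metis

lemma pre_bhom_cong:
 assumes pre: "is_pre_bsys B" and H: "is_pre_bhom B A H" and eq: "bhom_eq B H K"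
 shows "is_pre_bhom B A K"
proof (rule pre_bhomI)
 note h = pre_bhom_frame[OF H]
 show "is_bframe_hom B A K" by (rule is_bframe_hom_cong[OF h eq])
 have S: "is_bframe_hom (b_slice B (Suc n) (b_bd B (Suc n) x)) (b_slice B n (b_ft B (Suc n) (b_bd B (Suc n) x))) (b_S B (Suc n) x)"
  if "x \<in> b_tm B (Suc n)" for n x
  using pre that unfolding is_pre_bsys_def Let_def by blast
 have W: "is_bframe_hom (b_slice B n (b_ft B (Suc n) X)) (b_slice B (Suc n) X) (b_W B (Suc n) X)"
  "b_delta B (Suc n) X \<in> b_tm B (Suc (Suc n))" if "X \<in> b_ty B (Suc n)" for n X
  using pre that unfolding is_pre_bsys_def by blast+
 { fix n x assume x: "x \<in> b_tm B (Suc n)"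
  let ?B = "b_slice B (Suc n) (b_bd B (Suc n) x)"
  have "bhom_eq ?B (bhom_slice n K \<ast> b_S B (Suc n) x) (bhom_slice n H \<ast> b_S B (Suc n) x)"
   by (rule beq_left[OF is_bframe_slice[OF bd_in[OF x]] beq_slice[OF beq_sym[OF eq]] S[OF x]])
  also have "bhom_eq ?B ... (b_S A (Suc n) (bh_tm H (Suc n) x) \<ast> bhom_slice (Suc n) H)" by (rule pre_bhomD(1)[OF H x])
  also have "bhom_eq ?B ... (b_S A (Suc n) (bh_tm H (Suc n) x) \<ast> bhom_slice (Suc n) K)"
   by (rule beq_right[OF beq_slice[OF eq]])
  finally show "bhom_eq ?B (bhom_slice n K \<ast> b_S B (Suc n) x) (b_S A (Suc n) (bh_tm K (Suc n) x) \<ast> bhom_slice (Suc n) K)"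
   using beqD(2)[OF eq x] by simp }
 { fix n X assume X: "X \<in> b_ty B (Suc n)"
  let ?B = "b_slice B n (b_ft B (Suc n) X)"
  have "bhom_eq ?B (bhom_slice (Suc n) K \<ast> b_W B (Suc n) X) (bhom_slice (Suc n) H \<ast> b_W B (Suc n) X)"
   by (rule beq_left[OF is_bframe_slice[OF ft_in[OF X]] beq_slice[OF beq_sym[OF eq]] W(1)[OF X]])
  also have "bhom_eq ?B ... (b_W A (Suc n) (bh_ty H (Suc n) X) \<ast> bhom_slice n H)" by (rule pre_bhomD(2)[OF H X])
  also have "bhom_eq ?B ... (b_W A (Suc n) (bh_ty H (Suc n) X) \<ast> bhom_slice n K)"
   by (rule beq_right[OF beq_slice[OF eq]])
  finally show "bhom_eq ?B (bhom_slice (Suc n) K \<ast> b_W B (Suc n) X) (b_W A (Suc n) (bh_ty K (Suc n) X) \<ast> bhom_slice n K)"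
   using beqD(1)[OF eq X] by simp
  show "bh_tm K (Suc (Suc n)) (b_delta B (Suc n) X) = b_delta A (Suc n) (bh_ty K (Suc n) X)"
   using pre_bhomD(3)[OF H X] beqD(1)[OF eq X] beqD(2)[OF eq W(2)[OF X]] by simp }
qed

end

locale pre_bsys =
 fixes B :: "'a bsys"
 assumes is_pre_bsys: "is_pre_bsys B"

sublocale pre_bsys \<subseteq> bframe B
 using is_pre_bsys by (simp add: is_pre_bsys_def bframe_def)

locale bsys = pre_bsys +
 assumes is_bsys: "is_bsys B"
begin

lemma delta_in [simp]: "X \<in> b_ty B (Suc n) \<Longrightarrow> b_delta B (Suc n) X \<in> b_tm B (Suc (Suc n))"
 and bd_delta [simp]: "X \<in> b_ty B (Suc n) \<Longrightarrow> b_bd B (Suc (Suc n)) (b_delta B (Suc n) X) = bh_ty (b_W B (Suc n) X) 1 X"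
 using is_pre_bsys unfolding is_pre_bsys_def by blast+

lemma
 assumes x: "x \<in> b_tm B (Suc n)"
 shows S_hom: "is_pre_bhom (b_slice B (Suc n) (b_bd B (Suc n) x)) (b_slice B n (b_ft B (Suc n) (b_bd B (Suc n) x))) (b_S B (Suc n) x)"
  and S_W: "bhom_eq (b_slice B n (b_ft B (Suc n) (b_bd B (Suc n) x))) (b_S B (Suc n) x \<ast> b_W B (Suc n) (b_bd B (Suc n) x)) bhom_id"
  and S_delta: "bh_tm (b_S B (Suc n) x) 1 (b_delta B (Suc n) (b_bd B (Suc n) x)) = x"
 using is_bsys x unfolding is_bsys_def Let_def by blast+

lemma
 assumes X: "X \<in> b_ty B (Suc n)"
 shows W_hom: "is_pre_bhom (b_slice B n (b_ft B (Suc n) X)) (b_slice B (Suc n) X) (b_W B (Suc n) X)"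
  and S_delta_W: "bhom_eq (b_slice B (Suc n) X) (b_S B (Suc (Suc n)) (b_delta B (Suc n) X) \<ast> bhom_slice 1 (b_W B (Suc n) X)) bhom_id"
 using is_bsys X unfolding is_bsys_def by blast+

lemma slice_frame: "X \<in> b_ty B n \<Longrightarrow> bframe (b_slice B n X)"
 using is_bframe_slice by (simp add: bframe_def)

text \<open>The boundary of \<open>delta\<close> is the weakening of \<open>Y\<close> by itself;
  weakening commutes with \<open>ft\<close>, so one application of \<open>ft\<close> returns
  \<open>Y\<close>, which lies in the slice.\<close>

lemma slice_delta:
 assumes X: "X \<in> b_ty B n" and Y: "Y \<in> b_ty (b_slice B n X) (Suc m)"
 shows "b_delta (b_slice B n X) (Suc m) Y \<in> b_tm (b_slice B n X) (Suc (Suc m))"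
proof -
 have Y': "Y \<in> b_ty B (Suc (n + m))" "b_ftm B n m (b_ft B (Suc (n + m)) Y) = X" using Y by auto
 interpret S: bframe "b_slice B (n + m) (b_ft B (Suc (n + m)) Y)" by (rule slice_frame[OF ft_in[OF Y'(1)]])
 note w = S.pre_bhom_frame[OF W_hom[OF Y'(1)]]
 have "Y \<in> b_ty (b_slice B (n + m) (b_ft B (Suc (n + m)) Y)) 1" using Y' by simp
 from frameD(1)[OF w this] have "b_ft B (Suc (Suc (n + m))) (bh_ty (b_W B (Suc (n + m)) Y) 1 Y) = Y" by simp
 then show ?thesis using Y' delta_in[OF Y'(1)] by simp
qed

lemma slice_comp:
 assumes X: "X \<in> b_ty B n" and "is_bframe A" "is_pre_bhom (b_slice B n X) A H" "is_pre_bhom A D K"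
 shows "is_pre_bhom (b_slice B n X) D (K \<ast> H)"
proof -
 interpret S: bframe "b_slice B n X" by (rule slice_frame[OF X])
 show ?thesis by (rule S.pre_bhom_comp[OF assms(2-4)]) (rule slice_delta[OF X])
qed

end

lemma bsysI: "is_bsys B \<Longrightarrow> bsys B"
 by (simp add: bsys_def pre_bsys_def bsys_axioms_def is_bsys_def)

lemma bhom_restrict_simps [simp]:
 "X \<in> b_ty B n \<Longrightarrow> bh_ty (bhom_restrict B H) n X = bh_ty H n X"
 "x \<in> b_tm B n \<Longrightarrow> bh_tm (bhom_restrict B H) n x = bh_tm H n x"
 by (auto simp: bhom_restrict_def)

lemma bhom_extensional_restrict [simp]: "bhom_extensional B (bhom_restrict B H)"
 by (auto simp: bhom_extensional_def bhom_restrict_def)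

lemma bhom_eqI:
 assumes "bhom_extensional B H" "bhom_extensional B K" "bhom_eq B H K"
 shows "H = K"
proof (rule bhom.equality)
 show "bh_ty H = bh_ty K"
  using assms by (intro ext[of "bh_ty H"] extensionalityI[of _ "b_ty B _"]) (auto simp: bhom_extensional_def bhom_eq_def)
 show "bh_tm H = bh_tm K"
  using assms by (intro ext[of "bh_tm H"] extensionalityI[of _ "b_tm B _"]) (auto simp: bhom_extensional_def bhom_eq_def)
qed simp

lemma pre_bhom_restrict:
 assumes "is_pre_bsys B" "is_pre_bhom B A H"
 shows "is_pre_bhom B A (bhom_restrict B H)"
proof -
 interpret pre_bsys B by (rule pre_bsys.intro[OF assms(1)])
 show ?thesis by (rule pre_bhom_cong[OF assms]) (auto simp: bhom_eq_def)
qed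

lemma is_category_Bsys: "is_category Bsys"
 unfolding Bsys_def
proof (rule is_category_mk_category, goal_cases)
 case (1 B)
 then interpret bsys B by (simp add: bsysI)
 show ?case using pre_bhom_restrict[OF is_pre_bsys pre_bhom_id] by simp
next
 case (2 B A D H K)
 interpret B: bsys B using 2 by (simp add: bsysI)
 interpret A: bsys A using 2 by (simp add: bsysI)
 show ?case using pre_bhom_restrict[OF B.is_pre_bsys B.pre_bhom_comp[OF A.is_bframe, of H D K]] 2 by simp
next
 case (3 B A H)
 interpret B: bsys B using 3 by (simp add: bsysI)
 note h = frameD[OF B.pre_bhom_frame, of A H]
 have m: "bh_tm H n x \<in> b_tm A n" if "x \<in> b_tm B n" for n x
  using h(2)[of x "n - 1"] that 3 by (cases n) auto
 show ?case
  using 3 h(1) m by (auto intro!: bhom_eqI[of B] simp: bhom_eq_def)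
next
 case (4 B A D E H K L)
 interpret B: bsys B using 4 by (simp add: bsysI)
 note h = frameD[OF B.pre_bhom_frame, of A H]
 have m: "bh_tm H n x \<in> b_tm A n" if "x \<in> b_tm B n" for n x
  using h(2)[of x "n - 1"] that 4 by (cases n) auto
 show ?case
  using 4 h(1) m by (auto intro!: bhom_eqI[of B] simp: bhom_eq_def)
qed

section \<open>From B-systems to E-systems\<close>

text \<open>The recursions defining \<open>T(X, k)\<close>, \<open>S\<^sup>k\<close> and \<open>idtm\<close> treat \<open>k = 1\<close> separately; with \<open>tm_cons\<close> the
 steps from \<open>0\<close> to \<open>1\<close> and from \<open>k\<close> to \<open>k + 1\<close> take the same form.\<close>

definition tm_cons :: "nat \<Rightarrow> 'a univ \<Rightarrow> 'a univ \<Rightarrow> 'a univ" where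
 "tm_cons k t x = (if k = 0 then x else \<langle>t, x\<rangle>)"

lemma B2E_T_Suc: "B2E_T B n X (Suc k) = {tm_cons k t x |t x. t \<in> B2E_T B (n - 1) (b_ft B n X) k \<and>
  x \<in> b_tm B (n - k) \<and> b_bd B (n - k) x = bh_ty (B2E_sub B (n - 1) k t) 1 X}"
 by (cases k) (auto simp: tm_cons_def)

lemma B2E_sub_Suc: "B2E_sub B n (Suc k) (tm_cons k t x) = b_S B (n - k) x \<ast> bhom_slice 1 (B2E_sub B (n - 1) k t)"
 by (cases k) (auto simp: tm_cons_def)

lemma map_tms_Suc: "map_tms h (Suc k) (tm_cons k t x) = tm_cons k (map_tms h k t) (h x)"
 by (cases k) (auto simp: tm_cons_def)

lemma B2E_idtm_Suc: "B2E_idtm B n X (Suc k) =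
  tm_cons k (map_tms (bh_tm (b_W B n X) 1) k (B2E_idtm B (n - 1) (b_ft B n X) k)) (b_delta B n X)"
 by (cases k) (auto simp: tm_cons_def)

declare B2E_T.simps(2,3) [simp del] B2E_sub.simps(2,3) [simp del] map_tms.simps(2,3) [simp del]
 B2E_idtm.simps(2,3) [simp del]

lemma B2E_T_SucE:
 assumes "t \<in> B2E_T B (m + Suc k) X (Suc k)"
 obtains u x where "t = tm_cons k u x" "u \<in> B2E_T B (m + k) (b_ft B (Suc (m + k)) X) k" "x \<in> b_tm B (Suc m)"
  "b_bd B (Suc m) x = bh_ty (B2E_sub B (m + k) k u) 1 X"
 using assms unfolding B2E_T_Suc by auto

lemma B2E_T_SucI:
 assumes "u \<in> B2E_T B (m + k) (b_ft B (Suc (m + k)) X) k" "x \<in> b_tm B (Suc m)"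
  "b_bd B (Suc m) x = bh_ty (B2E_sub B (m + k) k u) 1 X"
 shows "tm_cons k u x \<in> B2E_T B (Suc (m + k)) X (Suc k)"
 using assms unfolding B2E_T_Suc by auto

lemma map_tms_map: "map_tms g k (map_tms h k t) = map_tms (\<lambda>x. g (h x)) k t"
 by (induction g k t rule: map_tms.induct) (auto simp: map_tms.simps)

locale bsys2 = B: bsys B + A: bsys A for B A :: "'a bsys"
begin

text \<open>The slices may belong to different B-systems, so that the same facts serve the
  operations \<open>S\<close> and \<open>W\<close> inside one system and the slices of homomorphisms
  between two systems.\<close>

definition bmap :: "nat \<Rightarrow> 'a univ \<Rightarrow> nat \<Rightarrow> 'a univ \<Rightarrow> 'a bhom \<Rightarrow> bool" where
 "bmap p X q Y H \<longleftrightarrow> X \<in> b_ty B p \<and> Y \<in> b_ty A q \<and> is_pre_bhom (b_slice B p X) (b_slice A q Y) H"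

lemma bmap_frame: "bmap p X q Y H \<Longrightarrow> is_bframe_hom (b_slice B p X) (b_slice A q Y) H"
 unfolding bmap_def using bframe.pre_bhom_frame[OF B.slice_frame] by blast

lemma
 assumes H: "bmap p X q Y H"
 shows bmap_ty: "Z \<in> b_ty B (p + k) \<Longrightarrow> b_ftm B p k Z = X \<Longrightarrow> bh_ty H k Z \<in> b_ty A (q + k) \<and> b_ftm A q k (bh_ty H k Z) = Y"
  and bmap_tm: "x \<in> b_tm B (Suc (p + k)) \<Longrightarrow> b_ftm B p k (b_ft B (Suc (p + k)) (b_bd B (Suc (p + k)) x)) = X \<Longrightarrow>
   bh_tm H (Suc k) x \<in> b_tm A (Suc (q + k)) \<and>
   b_ftm A q k (b_ft A (Suc (q + k)) (b_bd A (Suc (q + k)) (bh_tm H (Suc k) x))) = Y \<and>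
   b_bd A (Suc (q + k)) (bh_tm H (Suc k) x) = bh_ty H (Suc k) (b_bd B (Suc (p + k)) x)"
  and bmap_ft: "Z \<in> b_ty B (Suc (p + k)) \<Longrightarrow> b_ftm B p k (b_ft B (Suc (p + k)) Z) = X \<Longrightarrow>
   bh_ty H k (b_ft B (Suc (p + k)) Z) = b_ft A (Suc (q + k)) (bh_ty H (Suc k) Z)"
 using frameD(1)[OF bmap_frame[OF H], of Z k] frameD(2,4)[OF bmap_frame[OF H], of x k]
  frameD(3)[OF bmap_frame[OF H], of Z k] by auto

lemma bmap_slice:
 assumes H: "bmap p X q Y H" and Z: "Z \<in> b_ty B (p + k)" "b_ftm B p k Z = X"
 shows "bmap (p + k) Z (q + k) (bh_ty H k Z) (bhom_slice k H)"
proof -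
 note z = bmap_ty[OF H Z]
 interpret S: bframe "b_slice B p X" using H B.slice_frame by (simp add: bmap_def)
 have "is_pre_bhom (b_slice (b_slice B p X) k Z) (b_slice (b_slice A q Y) k (bh_ty H k Z)) (bhom_slice k H)"
  using S.pre_bhom_slice[of "b_slice A q Y" H Z k] H Z by (simp add: bmap_def)
 then show ?thesis using Z z b_slice_slice[of Z B p k X] b_slice_slice[of "bh_ty H k Z" A q k Y] by (simp add: bmap_def)
qed

lemma bmap_S:
 assumes H: "bmap p X q Y H" and x: "x \<in> b_tm B (Suc p)" "b_ft B (Suc p) (b_bd B (Suc p) x) = X"
 shows "bhom_eq (b_slice B (Suc p) (b_bd B (Suc p) x)) (H \<ast> b_S B (Suc p) x)
  (b_S A (Suc q) (bh_tm H 1 x) \<ast> bhom_slice 1 H)"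
proof -
 interpret S: bframe "b_slice B p X" using H B.slice_frame by (simp add: bmap_def)
 show ?thesis
  using S.pre_bhomD(1)[of "b_slice A q Y" H x 0] H x b_slice_slice[of "b_bd B (Suc p) x" B p 1 X]
  by (simp add: bmap_def)
qed

lemma bmap_W:
 assumes H: "bmap p X q Y H" and Z: "Z \<in> b_ty B (Suc (p + k))" "b_ftm B p k (b_ft B (Suc (p + k)) Z) = X"
 shows "bhom_eq (b_slice B (p + k) (b_ft B (Suc (p + k)) Z)) (bhom_slice (Suc k) H \<ast> b_W B (Suc (p + k)) Z)
  (b_W A (Suc (q + k)) (bh_ty H (Suc k) Z) \<ast> bhom_slice k H)"
  "bh_tm H (Suc (Suc k)) (b_delta B (Suc (p + k)) Z) = b_delta A (Suc (q + k)) (bh_ty H (Suc k) Z)"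
proof -
 interpret S: bframe "b_slice B p X" using H B.slice_frame by (simp add: bmap_def)
 show "bhom_eq (b_slice B (p + k) (b_ft B (Suc (p + k)) Z)) (bhom_slice (Suc k) H \<ast> b_W B (Suc (p + k)) Z)
  (b_W A (Suc (q + k)) (bh_ty H (Suc k) Z) \<ast> bhom_slice k H)"
  using S.pre_bhomD(2)[of "b_slice A q Y" H Z k] H Z b_slice_slice[of "b_ft B (Suc (p + k)) Z" B p k X]
  by (simp add: bmap_def)
 show "bh_tm H (Suc (Suc k)) (b_delta B (Suc (p + k)) Z) = b_delta A (Suc (q + k)) (bh_ty H (Suc k) Z)"
  using S.pre_bhomD(3)[of "b_slice A q Y" H Z k] H Z by (simp add: bmap_def)
qed

lemma bmap_eq_left:
 assumes "bmap p X q Y H" "bhom_eq (b_slice A q Y) G K"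
 shows "bhom_eq (b_slice B p X) (G \<ast> H) (K \<ast> H)"
 using assms(1) by (intro beq_left[OF B.is_bframe_slice assms(2) bmap_frame[OF assms(1)]]) (simp add: bmap_def)

end

lemma bmap_comp:
 assumes "bsys B" "bsys A" "bsys D" "bsys2.bmap B A p X q Y H" "bsys2.bmap A D q Y r Z K"
 shows "bsys2.bmap B D p X r Z (K \<ast> H)"
proof -
 interpret BA: bsys2 B A by (rule bsys2.intro[OF assms(1,2)])
 interpret AD: bsys2 A D by (rule bsys2.intro[OF assms(2,3)])
 interpret BD: bsys2 B D by (rule bsys2.intro[OF assms(1,3)])
 show ?thesis
  using assms(4,5) BA.B.slice_comp[OF _ BA.A.is_bframe_slice, of X p Y q H "b_slice D r Z" K]
  unfolding BA.bmap_def AD.bmap_def BD.bmap_def by blast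
qed

sublocale bsys \<subseteq> self: bsys2 B B
 by unfold_locales

context bsys
begin

abbreviation "TT \<equiv> B2E_T B"
abbreviation "sub \<equiv> B2E_sub B"
abbreviation "wk \<equiv> B2E_wk B"
abbreviation "idt \<equiv> B2E_idtm B"
abbreviation "bmap \<equiv> self.bmap"

lemmas self_comp = bmap_comp[OF bsys_axioms bsys_axioms bsys_axioms]

lemma bmap_id: "X \<in> b_ty B n \<Longrightarrow> bmap n X n X bhom_id"
 unfolding self.bmap_def using bframe.pre_bhom_id[OF slice_frame] by blast

lemma S_map: "x \<in> b_tm B (Suc n) \<Longrightarrow>
  bmap (Suc n) (b_bd B (Suc n) x) n (b_ft B (Suc n) (b_bd B (Suc n) x)) (b_S B (Suc n) x)"
 unfolding self.bmap_def using S_hom by auto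

lemma W_map: "X \<in> b_ty B (Suc n) \<Longrightarrow> bmap n (b_ft B (Suc n) X) (Suc n) X (b_W B (Suc n) X)"
 unfolding self.bmap_def using W_hom by auto

text \<open>Each additional component contributes one substitution operation, composed with a slice
  of the homomorphism built so far. Writing the index as \<open>m + k\<close> keeps the truncated
  subtractions of the recursion out of the statement.\<close>

lemma sub_map:
 "X \<in> b_ty B (m + k) \<Longrightarrow> t \<in> TT (m + k) X k \<Longrightarrow> bmap (m + k) X m (b_ftm B m k X) (sub (m + k) k t)"
proof (induction k arbitrary: X t)
 case 0
 then show ?case by (simp add: bmap_id)
next
 case (Suc k)
 obtain u x where t: "t = tm_cons k u x" "u \<in> TT (m + k) (b_ft B (Suc (m + k)) X) k" "x \<in> b_tm B (Suc m)"
  "b_bd B (Suc m) x = bh_ty (sub (m + k) k u) 1 X"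
  using Suc.prems(2) by (rule B2E_T_SucE)
 have Z: "b_ft B (Suc (m + k)) X \<in> b_ty B (m + k)" using Suc.prems by simp
 note IH = Suc.IH[OF Z t(2)]
 have X: "X \<in> b_ty B (m + k + 1)" "b_ftm B (m + k) 1 X = b_ft B (Suc (m + k)) X" using Suc.prems by simp_all
 have 1: "bmap (m + k + 1) X (m + 1) (b_bd B (Suc m) x) (bhom_slice 1 (sub (m + k) k u))"
  unfolding t(4) using self.bmap_slice[OF IH X] .
 have ftx: "b_ft B (Suc m) (b_bd B (Suc m) x) = b_ftm B m k (b_ft B (Suc (m + k)) X)"
  unfolding t(4) using self.bmap_ty[OF IH X] by simp
 show ?case
  using self_comp[OF 1, of m "b_ftm B m k (b_ft B (Suc (m + k)) X)" "b_S B (Suc m) x"] S_map[OF t(3)] ftx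
  by (simp add: t(1) B2E_sub_Suc)
qed

lemma wk_map:
 "X \<in> b_ty B (m + k) \<Longrightarrow> bmap m (b_ftm B m k X) (m + k) X (wk (m + k) X k)"
proof (induction k arbitrary: X)
 case 0
 then show ?case by (simp add: bmap_id)
next
 case (Suc k)
 have Z: "b_ft B (Suc (m + k)) X \<in> b_ty B (m + k)" using Suc.prems by simp
 show ?case using self_comp[OF Suc.IH[OF Z] W_map] Suc.prems by simp
qed

text \<open>The boundary of the new component is the image of \<open>X\<close> under the
  substitution of the other components, and that homomorphism commutes with \<open>ft\<close>. Hence
  all components of a term lie over the same base, and a componentwise map depends only on its
  values there, as \<open>map_tms_cong\<close> records.\<close>

lemma T_last:
 assumes "X \<in> b_ty B (Suc (m + k))" "u \<in> TT (m + k) (b_ft B (Suc (m + k)) X) k" "x \<in> b_tm B (Suc m)"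
  "b_bd B (Suc m) x = bh_ty (sub (m + k) k u) 1 X"
 shows "b_ft B (Suc m) (b_bd B (Suc m) x) = b_ftm B m k (b_ft B (Suc (m + k)) X)"
 unfolding assms(4) using self.bmap_ty[OF sub_map[OF ft_in[OF assms(1)] assms(2)], of X 1] assms(1) by simp

lemma map_tms_cong:
 assumes "\<And>x. x \<in> b_tm B (Suc m) \<Longrightarrow> b_ft B (Suc m) (b_bd B (Suc m) x) = b_ftm B m k X \<Longrightarrow> h x = g x"
 shows "X \<in> b_ty B (m + k) \<Longrightarrow> t \<in> TT (m + k) X k \<Longrightarrow> map_tms h k t = map_tms g k t"
 using assms
proof (induction k arbitrary: X t)
 case (Suc k)
 obtain u x where t: "t = tm_cons k u x" "u \<in> TT (m + k) (b_ft B (Suc (m + k)) X) k" "x \<in> b_tm B (Suc m)"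
  "b_bd B (Suc m) x = bh_ty (sub (m + k) k u) 1 X"
  using Suc.prems(2) by (rule B2E_T_SucE)
 have X: "X \<in> b_ty B (Suc (m + k))" using Suc.prems by simp
 have "map_tms h k u = map_tms g k u" using Suc.IH[OF ft_in[OF X] t(2)] Suc.prems(3) by simp
 moreover have "h x = g x" using Suc.prems(3)[OF t(3)] T_last[OF X t(2-4)] by simp
 ultimately show ?case by (simp add: t(1) map_tms_Suc)
qed simp

lemma map_tms_id: "X \<in> b_ty B (m + k) \<Longrightarrow> t \<in> TT (m + k) X k \<Longrightarrow> map_tms (\<lambda>x. x) k t = t"
proof (induction k arbitrary: X t)
 case (Suc k)
 obtain u x where t: "t = tm_cons k u x" "u \<in> TT (m + k) (b_ft B (Suc (m + k)) X) k"
  using Suc.prems(2) by (rule B2E_T_SucE)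
 have X: "X \<in> b_ty B (Suc (m + k))" using Suc.prems by simp
 show ?case using Suc.IH[OF ft_in[OF X] t(2)] by (simp add: t(1) map_tms_Suc)
qed simp

end

context bsys2
begin

text \<open>The two claims are proved together: the equation for the shorter term shows that the
  image of the new component has the required boundary, and compatibility of \<open>H\<close> with
  the last substitution extends the equation.\<close>

lemma bmap_sub:
 assumes H: "bmap p X0 q Y0 H"
 shows "X \<in> b_ty B (p + k) \<Longrightarrow> b_ftm B p k X = X0 \<Longrightarrow> t \<in> B.TT (p + k) X k \<Longrightarrow>
  map_tms (bh_tm H 1) k t \<in> A.TT (q + k) (bh_ty H k X) k \<and>
  bhom_eq (b_slice B (p + k) X) (H \<ast> B.sub (p + k) k t)
   (A.sub (q + k) k (map_tms (bh_tm H 1) k t) \<ast> bhom_slice k H)"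
proof (induction k arbitrary: X t)
 case 0
 then show ?case by simp
next
 case (Suc k)
 obtain u x where t: "t = tm_cons k u x" "u \<in> B.TT (p + k) (b_ft B (Suc (p + k)) X) k" "x \<in> b_tm B (Suc p)"
  "b_bd B (Suc p) x = bh_ty (B.sub (p + k) k u) 1 X"
  using Suc.prems(3) by (rule B2E_T_SucE)
 let ?Z = "b_ft B (Suc (p + k)) X" and ?u = "map_tms (bh_tm H 1) k u"
 have X: "X \<in> b_ty B (Suc (p + k))" "b_ftm B p k ?Z = X0" using Suc.prems by auto
 have Z: "?Z \<in> b_ty B (p + k)" using X by simp
 note IH = Suc.IH[OF Z X(2) t(2)]
 have ftx: "b_ft B (Suc p) (b_bd B (Suc p) x) = X0" using B.T_last[OF X(1) t(2-4)] X(2) by simp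
 note Hx = bmap_tm[OF H, of x 0, simplified, OF t(3) ftx]
 have sX: "X \<in> b_ty (b_slice B (p + k) ?Z) 1" using X by simp
 have bdHx: "b_bd A (Suc q) (bh_tm H 1 x) = bh_ty (A.sub (q + k) k ?u) 1 (bh_ty H (Suc k) X)"
  using Hx beqD(1)[OF IH[THEN conjunct2] sX] t(4) by simp
 have ftH: "b_ft A (Suc (q + k)) (bh_ty H (Suc k) X) = bh_ty H k ?Z" using bmap_ft[OF H X] by simp
 have in_T: "map_tms (bh_tm H 1) (Suc k) t \<in> A.TT (q + Suc k) (bh_ty H (Suc k) X) (Suc k)"
  using B2E_T_SucI[of ?u A q k "bh_ty H (Suc k) X" "bh_tm H 1 x"] IH Hx bdHx by (simp add: t(1) map_tms_Suc ftH)
 note su = B.sub_map[OF Z t(2)]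
 have X1: "X \<in> b_ty B (p + k + 1)" "b_ftm B (p + k) 1 X = ?Z" using X by simp_all
 have su1: "B.bmap (Suc (p + k)) X (Suc p) (b_bd B (Suc p) x) (bhom_slice 1 (B.sub (p + k) k u))"
  using B.self.bmap_slice[OF su X1] t(4) by simp
 have sl: "b_slice (b_slice B (p + k) ?Z) 1 X = b_slice B (Suc (p + k)) X"
  using b_slice_slice[OF X1] by simp
 let ?B = "b_slice B (Suc (p + k)) X"
 have "bhom_eq ?B ((H \<ast> b_S B (Suc p) x) \<ast> bhom_slice 1 (B.sub (p + k) k u))
   ((b_S A (Suc q) (bh_tm H 1 x) \<ast> bhom_slice 1 H) \<ast> bhom_slice 1 (B.sub (p + k) k u))"
  by (rule B.self.bmap_eq_left[OF su1 bmap_S[OF H t(3) ftx]])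
 also have "bhom_eq ?B ... (b_S A (Suc q) (bh_tm H 1 x) \<ast> bhom_slice 1 (A.sub (q + k) k ?u \<ast> bhom_slice k H))"
  unfolding bassoc bslice_comp[symmetric]
  by (rule beq_right[OF beq_slice[OF IH[THEN conjunct2], of 1 X, unfolded sl]])
 finally show ?case
  using in_T by (simp add: t(1) B2E_sub_Suc map_tms_Suc bassoc bslice_comp bslice_slice)
qed

lemma bmap_wk:
 assumes H: "bmap p X0 q Y0 H"
 shows "X \<in> b_ty B (p + k) \<Longrightarrow> b_ftm B p k X = X0 \<Longrightarrow>
  bhom_eq (b_slice B p X0) (bhom_slice k H \<ast> B.wk (p + k) X k) (A.wk (q + k) (bh_ty H k X) k \<ast> H)"
proof (induction k arbitrary: X)
 case (Suc k)
 let ?Z = "b_ft B (Suc (p + k)) X"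
 have X: "X \<in> b_ty B (Suc (p + k))" "b_ftm B p k ?Z = X0" using Suc.prems by auto
 have Z: "?Z \<in> b_ty B (p + k)" using X by simp
 have wm: "B.bmap p X0 (p + k) ?Z (B.wk (p + k) ?Z k)" using B.wk_map[OF Z] X(2) by simp
 have "bhom_eq (b_slice B p X0) ((bhom_slice (Suc k) H \<ast> b_W B (Suc (p + k)) X) \<ast> B.wk (p + k) ?Z k)
   ((b_W A (Suc (q + k)) (bh_ty H (Suc k) X) \<ast> bhom_slice k H) \<ast> B.wk (p + k) ?Z k)"
  by (rule B.self.bmap_eq_left[OF wm bmap_W(1)[OF H X]])
 also have "bhom_eq (b_slice B p X0) ... (b_W A (Suc (q + k)) (bh_ty H (Suc k) X) \<ast> (A.wk (q + k) (bh_ty H k ?Z) k \<ast> H))"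
  unfolding bassoc by (rule beq_right[OF Suc.IH[OF Z X(2)]])
 finally show ?case using bmap_ft[OF H X] by (simp add: bassoc)
qed simp

end

context bsys
begin

text \<open>The two claims support each other. The new component \<open>delta\<close> is well typed
  over the previous ones only because these already cancel the previous weakenings.\<close>

lemma idt_in:
 "X \<in> b_ty B (m + k) \<Longrightarrow> idt (m + k) X k \<in> TT (m + k + k) (bh_ty (wk (m + k) X k) k X) k \<and>
  bhom_eq (b_slice B (m + k) X) (sub (m + k + k) k (idt (m + k) X k) \<ast> bhom_slice k (wk (m + k) X k)) bhom_id"
proof (induction k arbitrary: X)
 case 0
 then show ?case by simp
next
 case (Suc k)
 let ?n = "m + k"
 let ?Z = "b_ft B (Suc ?n) X" and ?W = "b_W B (Suc ?n) X"
 let ?u = "idt ?n ?Z k" and ?w = "wk ?n ?Z k"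
 let ?u' = "map_tms (bh_tm ?W 1) k ?u" and ?d = "b_delta B (Suc ?n) X"
 have X: "X \<in> b_ty B (Suc ?n)" using Suc.prems by simp
 have Z: "?Z \<in> b_ty B ?n" using X by simp
 note IH = Suc.IH[OF Z]
 note Wm = W_map[OF X]
 note wm = wk_map[OF Z]
 let ?V = "bh_ty ?w k ?Z"
 have V: "?V \<in> b_ty B (?n + k)" "b_ftm B ?n k ?V = ?Z" using self.bmap_ty[OF wm Z] by simp_all
 note N = self.bmap_sub[OF Wm V IH[THEN conjunct1]]
 have U: "bh_ty ?w (Suc k) X \<in> b_ty B (Suc (?n + k))" "b_ft B (Suc (?n + k)) (bh_ty ?w (Suc k) X) = ?V"
  using self.bmap_ty[OF wm, of X "Suc k"] self.bmap_ft[OF wm, of X k] X by simp_all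
 have X1: "X \<in> b_ty (b_slice B ?n ?Z) 1" using X by simp
 have "bh_ty (sub (?n + k) k ?u) 1 (bh_ty ?w (Suc k) X) = X"
  using beqD(1)[OF IH[THEN conjunct2] X1] by simp
 moreover have "bh_ty ?W 1 (bh_ty (sub (?n + k) k ?u) 1 (bh_ty ?w (Suc k) X)) =
   bh_ty (sub (Suc ?n + k) k ?u') 1 (bh_ty ?W (Suc k) (bh_ty ?w (Suc k) X))"
  using beqD(1)[OF N[THEN conjunct2], of "bh_ty ?w (Suc k) X" 1] U by simp
 \<comment> \<open>The boundary of \<open>delta\<close>, the weakening of \<open>X\<close> by
   itself, is brought into the form required of a last component: \<open>X\<close> is replaced by
   the substituted weakening of \<open>X\<close> from the induction hypothesis, and
   \<open>?W\<close> is moved past that substitution.\<close>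
 ultimately have bd: "b_bd B (Suc (Suc ?n)) ?d = bh_ty (sub (Suc ?n + k) k ?u') 1 (bh_ty ?W (Suc k) (bh_ty ?w (Suc k) X))"
  using bd_delta[OF X] by simp
 have ftW: "b_ft B (Suc (Suc ?n + k)) (bh_ty ?W (Suc k) (bh_ty ?w (Suc k) X)) = bh_ty ?W k ?V"
  using self.bmap_ft[OF Wm U(1)] U V by simp
 have in_T: "idt (m + Suc k) X (Suc k) \<in> TT (m + Suc k + Suc k) (bh_ty (wk (m + Suc k) X (Suc k)) (Suc k) X) (Suc k)"
  using B2E_T_SucI[of ?u' B "Suc ?n" k "bh_ty ?W (Suc k) (bh_ty ?w (Suc k) X)" ?d] N delta_in[OF X] bd ftW
  by (simp add: B2E_idtm_Suc)
 let ?B = "b_slice B (Suc ?n) X"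
 have wk1: "bmap ?n ?Z (?n + k) ?V (bhom_slice k ?w)"
  using self.bmap_slice[OF wm Z refl] by simp
 have X2: "X \<in> b_ty B (?n + 1)" "b_ftm B ?n 1 X = ?Z" using X by simp_all
 have sl: "b_slice (b_slice B ?n ?Z) 1 X = ?B" using b_slice_slice[OF X2] by simp
 \<comment> \<open>The substitution of all components but the last cancels all weakenings but the
   last, leaving \<open>?W\<close>; \<open>S_delta_W\<close> then removes what remains.\<close>
 have "bhom_eq (b_slice B ?n ?Z) ((sub (Suc ?n + k) k ?u' \<ast> bhom_slice k ?W) \<ast> bhom_slice k ?w)
   ((?W \<ast> sub (?n + k) k ?u) \<ast> bhom_slice k ?w)"
  by (rule self.bmap_eq_left[OF wk1 beq_sym[OF N[THEN conjunct2]]])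
 also have "bhom_eq (b_slice B ?n ?Z) ... (?W \<ast> bhom_id)"
  unfolding bassoc by (rule beq_right[OF IH[THEN conjunct2]])
 finally have e: "bhom_eq (b_slice B ?n ?Z) (sub (Suc ?n + k) k ?u' \<ast> (bhom_slice k ?W \<ast> bhom_slice k ?w)) ?W"
  by (simp add: bassoc)
 have "bhom_eq ?B (b_S B (Suc (Suc ?n)) ?d \<ast> bhom_slice 1 (sub (Suc ?n + k) k ?u' \<ast> (bhom_slice k ?W \<ast> bhom_slice k ?w)))
   (b_S B (Suc (Suc ?n)) ?d \<ast> bhom_slice 1 ?W)"
  by (rule beq_right[OF beq_slice[OF e, of 1 X, unfolded sl]])
 also have "bhom_eq ?B ... bhom_id" by (rule S_delta_W[OF X])
 finally show ?case
  using in_T by (simp add: B2E_idtm_Suc B2E_sub_Suc bslice_comp bslice_slice bassoc)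
qed

text \<open>The last weakening is moved outward past the substitution of the earlier components,
  where it becomes weakening by the boundary of the last component and is cancelled by its
  substitution. The earlier operations cancel by induction.\<close>

lemma sub_wk:
 "X \<in> b_ty B (m + k) \<Longrightarrow> t \<in> TT (m + k) X k \<Longrightarrow>
  bhom_eq (b_slice B m (b_ftm B m k X)) (sub (m + k) k t \<ast> wk (m + k) X k) bhom_id"
proof (induction k arbitrary: X t)
 case (Suc k)
 obtain u x where t: "t = tm_cons k u x" "u \<in> TT (m + k) (b_ft B (Suc (m + k)) X) k" "x \<in> b_tm B (Suc m)"
  "b_bd B (Suc m) x = bh_ty (sub (m + k) k u) 1 X"
  using Suc.prems(2) by (rule B2E_T_SucE)
 let ?Z = "b_ft B (Suc (m + k)) X"
 have X: "X \<in> b_ty B (Suc (m + k))" using Suc.prems by simp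
 have Z: "?Z \<in> b_ty B (m + k)" using X by simp
 let ?Y = "b_ftm B m k ?Z"
 note su = sub_map[OF Z t(2)] and wm = wk_map[OF Z]
 have ftx: "b_ft B (Suc m) (b_bd B (Suc m) x) = ?Y" using T_last[OF X t(2-4)] .
 have "bhom_eq (b_slice B (m + k) ?Z) (bhom_slice (Suc 0) (sub (m + k) k u) \<ast> b_W B (Suc (m + k)) X)
   (b_W B (Suc m) (b_bd B (Suc m) x) \<ast> sub (m + k) k u)"
  using self.bmap_W(1)[OF su, of X 0] X t(4) by simp
 from self.bmap_eq_left[OF wm this]
 have "bhom_eq (b_slice B m ?Y) (b_S B (Suc m) x \<ast> ((bhom_slice (Suc 0) (sub (m + k) k u) \<ast> b_W B (Suc (m + k)) X) \<ast> wk (m + k) ?Z k))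
   (b_S B (Suc m) x \<ast> ((b_W B (Suc m) (b_bd B (Suc m) x) \<ast> sub (m + k) k u) \<ast> wk (m + k) ?Z k))"
  by (rule beq_right)
 also have "bhom_eq (b_slice B m ?Y) ... ((b_S B (Suc m) x \<ast> b_W B (Suc m) (b_bd B (Suc m) x)) \<ast> bhom_id)"
  unfolding bassoc by (intro beq_right Suc.IH[OF Z t(2)])
 also have "bhom_eq (b_slice B m ?Y) ... bhom_id" using S_W[OF t(3)] ftx by simp
 finally show ?case by (simp add: t(1) B2E_sub_Suc bassoc)
qed simp

lemma wk_T_cong:
 assumes X: "X \<in> b_ty B (m + k)"
  and "\<And>x. x \<in> b_tm B (Suc (m + k)) \<Longrightarrow> b_ft B (Suc (m + k)) (b_bd B (Suc (m + k)) x) = X \<Longrightarrow> h x = g x"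
 shows "map_tms h k (idt (m + k) X k) = map_tms g k (idt (m + k) X k)"
proof (rule map_tms_cong)
 have V: "bh_ty (wk (m + k) X k) k X \<in> b_ty B (m + k + k) \<and> b_ftm B (m + k) k (bh_ty (wk (m + k) X k) k X) = X"
  using self.bmap_ty[OF wk_map[OF X] X refl] .
 show "bh_ty (wk (m + k) X k) k X \<in> b_ty B (m + k + k)" using V by simp
 show "idt (m + k) X k \<in> TT (m + k + k) (bh_ty (wk (m + k) X k) k X) k" using idt_in[OF X] by simp
qed (use assms(2) self.bmap_ty[OF wk_map[OF X] X refl] in auto)

text \<open>The last component is \<open>S_delta\<close> after transporting \<open>delta\<close>.
  For the earlier components, the last weakening and the last substitution cancel as in
  \<open>sub_wk\<close>, and the induction hypothesis applies.\<close>

lemma sub_idt: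
 "X \<in> b_ty B (m + k) \<Longrightarrow> t \<in> TT (m + k) X k \<Longrightarrow> map_tms (bh_tm (sub (m + k) k t) 1) k (idt (m + k) X k) = t"
proof (induction k arbitrary: X t)
 case (Suc k)
 obtain u x where t: "t = tm_cons k u x" "u \<in> TT (m + k) (b_ft B (Suc (m + k)) X) k" "x \<in> b_tm B (Suc m)"
  "b_bd B (Suc m) x = bh_ty (sub (m + k) k u) 1 X"
  using Suc.prems(2) by (rule B2E_T_SucE)
 let ?Z = "b_ft B (Suc (m + k)) X" and ?W = "b_W B (Suc (m + k)) X"
 have X: "X \<in> b_ty B (Suc (m + k))" using Suc.prems by simp
 have Z: "?Z \<in> b_ty B (m + k)" using X by simp
 note su = sub_map[OF Z t(2)]
 have ftx: "b_ft B (Suc m) (b_bd B (Suc m) x) = b_ftm B m k ?Z" using T_last[OF X t(2-4)] .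
 have W: "bhom_eq (b_slice B (m + k) ?Z) (bhom_slice (Suc 0) (sub (m + k) k u) \<ast> ?W)
   (b_W B (Suc m) (b_bd B (Suc m) x) \<ast> sub (m + k) k u)"
  using self.bmap_W(1)[OF su, of X 0] X t(4) by simp
 have d: "bh_tm (sub (m + k) k u) 2 (b_delta B (Suc (m + k)) X) = b_delta B (Suc m) (b_bd B (Suc m) x)"
  using self.bmap_W(2)[OF su, of X 0] X t(4) by (simp add: numeral_2_eq_2)
 have "bh_tm (b_S B (Suc m) x) 1 (bh_tm (sub (m + k) k u) 2 (bh_tm ?W 1 y)) = bh_tm (sub (m + k) k u) 1 y"
  if y: "y \<in> b_tm B (Suc (m + k))" "b_ft B (Suc (m + k)) (b_bd B (Suc (m + k)) y) = ?Z" for y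
 proof -
  have y': "y \<in> b_tm (b_slice B (m + k) ?Z) 1" using y by simp
  have sy: "bh_tm (sub (m + k) k u) 1 y \<in> b_tm (b_slice B m (b_ft B (Suc m) (b_bd B (Suc m) x))) 1"
   using self.bmap_tm[OF su, of y 0, simplified, OF y, THEN conjunct1]
    self.bmap_tm[OF su, of y 0, simplified, OF y, THEN conjunct2, THEN conjunct1] ftx by simp
  have "bh_tm (sub (m + k) k u) 2 (bh_tm ?W 1 y) = bh_tm (b_W B (Suc m) (b_bd B (Suc m) x)) 1 (bh_tm (sub (m + k) k u) 1 y)"
   using beqD(2)[OF W y'] by (simp add: numeral_2_eq_2)
  then show ?thesis using beqD(2)[OF S_W[OF t(3)] sy] by simp
 qed
 then have "map_tms (\<lambda>y. bh_tm (b_S B (Suc m) x) 1 (bh_tm (sub (m + k) k u) 2 (bh_tm ?W 1 y))) k (idt (m + k) ?Z k) =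
   map_tms (bh_tm (sub (m + k) k u) 1) k (idt (m + k) ?Z k)"
  by (rule wk_T_cong[OF Z])
 also have "... = u" by (rule Suc.IH[OF Z t(2)])
 finally show ?case
  using S_delta[OF t(3)] d
  by (simp add: t(1) B2E_idtm_Suc map_tms_Suc B2E_sub_Suc map_tms_map numeral_2_eq_2)
qed simp

lemma wk_add: "wk (n + i + j) U (j + i) = wk (n + i + j) U j \<ast> wk (n + i) (b_ftm B (n + i) j U) i"
 by (induction j arbitrary: U) (auto simp: bassoc)

end

context bsys2
begin

text \<open>\<open>H\<close> commutes with the weakening that is applied to the earlier components,
  and its compatibility with \<open>delta\<close> gives the last one.\<close>

lemma bmap_idt:
 assumes H: "bmap p X0 q Y0 H"
 shows "X \<in> b_ty B (p + k) \<Longrightarrow> b_ftm B p k X = X0 \<Longrightarrow>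
  map_tms (bh_tm H (Suc k)) k (B.idt (p + k) X k) = A.idt (q + k) (bh_ty H k X) k"
proof (induction k arbitrary: X)
 case (Suc k)
 let ?Z = "b_ft B (Suc (p + k)) X" and ?W = "b_W B (Suc (p + k)) X"
 have X: "X \<in> b_ty B (Suc (p + k))" "b_ftm B p k ?Z = X0" using Suc.prems by auto
 have Z: "?Z \<in> b_ty B (p + k)" using X by simp
 let ?W' = "b_W A (Suc (q + k)) (bh_ty H (Suc k) X)"
 have "bh_tm H (Suc (Suc k)) (bh_tm ?W 1 y) = bh_tm ?W' 1 (bh_tm H (Suc k) y)"
  if y: "y \<in> b_tm B (Suc (p + k))" "b_ft B (Suc (p + k)) (b_bd B (Suc (p + k)) y) = ?Z" for y
  using beqD(2)[OF bmap_W(1)[OF H X], of y 1] y by simp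
 then have "map_tms (\<lambda>y. bh_tm H (Suc (Suc k)) (bh_tm ?W 1 y)) k (B.idt (p + k) ?Z k) =
   map_tms (\<lambda>y. bh_tm ?W' 1 (bh_tm H (Suc k) y)) k (B.idt (p + k) ?Z k)"
  by (rule B.wk_T_cong[OF Z])
 also have "... = map_tms (bh_tm ?W' 1) k (A.idt (q + k) (bh_ty H k ?Z) k)"
  using Suc.IH[OF Z X(2)] by (simp add: map_tms_map[symmetric])
 finally show ?case
  using bmap_W(2)[OF H X] bmap_ft[OF H X] by (simp add: B2E_idtm_Suc map_tms_Suc map_tms_map)
qed simp

end

section \<open>Functors between slices induced by homomorphisms of B-systems\<close>

abbreviation pt :: "nat \<Rightarrow> nat \<Rightarrow> 'a univ \<Rightarrow> 'a univ" where
 "pt n k Z \<equiv> \<langle>\<langle>Num (n + k), Z\<rangle>, Num k\<rangle>"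

definition vft :: "'a bsys \<Rightarrow> 'a univ \<Rightarrow> 'a univ" where
 "vft B v = \<langle>Num (unum (ufst v) - 1), b_ft B (unum (ufst v)) (usnd v)\<rangle>"

lemma B2E_cat_path: "B2E_cat B = path_cat {\<langle>Num n, X\<rangle> |n X. X \<in> b_ty B n} (\<lambda>v. unum (ufst v)) (vft B)"
 by (simp add: B2E_cat_def vft_def[abs_def] Let_def)

lemma vft_pow: "(vft B ^^ k) \<langle>Num (m + k), X\<rangle> = \<langle>Num m, b_ftm B m k X\<rangle>"
proof (induction k arbitrary: X)
 case (Suc k)
 have "(vft B ^^ Suc k) \<langle>Num (m + Suc k), X\<rangle> = (vft B ^^ k) (vft B \<langle>Num (m + Suc k), X\<rangle>)"
  by (simp add: funpow_swap1)
 also have "vft B \<langle>Num (m + Suc k), X\<rangle> = \<langle>Num (m + k), b_ft B (m + Suc k) X\<rangle>" by (simp add: vft_def)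
 finally show ?case using Suc by simp
qed simp

lemma B2E_sfun_simps [simp]:
 "s_obj (B2E_sfun n m H) \<langle>\<langle>Num p, Z\<rangle>, Num k\<rangle> = \<langle>\<langle>Num (m + (p - n)), bh_ty H (p - n) Z\<rangle>, Num k\<rangle>"
 "s_arr (B2E_sfun n m H) A \<langle>\<langle>Num p, Z\<rangle>, Num k\<rangle> = \<langle>\<langle>Num (m + (p - n)), bh_ty H (p - n) Z\<rangle>, Num k\<rangle>"
 "s_tm (B2E_sfun n m H) A \<langle>\<langle>Num p, Z\<rangle>, Num k\<rangle> t = map_tms (bh_tm H (Suc (p - n - k))) k t"
 by (auto simp: B2E_sfun_def Let_def)

context bsys
begin

abbreviation "EB \<equiv> B2E_obj B"
abbreviation "FB \<equiv> B2E_cat B"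

definition base :: "'a univ" where
 "base = \<langle>Num 0, the_elem (b_ty B 0)\<rangle>"

lemma the_elem_0: "X \<in> b_ty B 0 \<longleftrightarrow> X = the_elem (b_ty B 0)"
 using is_bframe unfolding is_bframe_def by (metis singleton_iff the_elem_eq)

sublocale PT: path_tree "{\<langle>Num n, X\<rangle> |n X. X \<in> b_ty B n}" "\<lambda>v. unum (ufst v)" "vft B" base
proof (unfold_locales, goal_cases)
 case 1
 show ?case using the_elem_0 by (simp add: base_def)
next
 case (2 v)
 then obtain n X where v: "v = \<langle>Num n, X\<rangle>" "X \<in> b_ty B n" by blast
 show ?case using v(2) iffD1[OF the_elem_0, of X] by (cases n) (simp_all add: v(1) base_def)
next
 case (3 v)
 then obtain n X where v: "v = \<langle>Num (Suc n), X\<rangle>" "X \<in> b_ty B (Suc n)" by (auto simp: gr0_conv_Suc)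
 then show ?case by (auto simp: vft_def)
next
 case (4 v)
 then show ?case by (auto simp: vft_def)
qed

lemma EB_simps [simp]:
 "e_cat EB = FB" "e_root EB = base"
 "e_T EB \<langle>\<langle>Num p, Z\<rangle>, Num k\<rangle> = TT p Z k"
 "e_S EB \<langle>\<langle>Num p, Z\<rangle>, Num k\<rangle> t = B2E_sfun p (p - k) (sub p k t)"
 "e_W EB \<langle>\<langle>Num p, Z\<rangle>, Num k\<rangle> = B2E_sfun (p - k) p (wk p Z k)"
 "e_idtm EB \<langle>\<langle>Num p, Z\<rangle>, Num k\<rangle> = idt p Z k"
 by (auto simp: B2E_obj_def Let_def base_def)

lemma FB_simps [simp]:
 "\<langle>Num n, X\<rangle> \<in> Obj FB \<longleftrightarrow> X \<in> b_ty B n"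
 "Dom FB \<langle>v, kk\<rangle> = v" "Ident FB X = \<langle>X, Num 0\<rangle>"
 "\<langle>w, Num j\<rangle> \<cdot>\<^bsub>FB\<^esub> \<langle>v, Num k\<rangle> = \<langle>v, Num (k + j)\<rangle>"
 "\<langle>\<langle>Num p, Z\<rangle>, Num k\<rangle> \<in> Arr FB \<longleftrightarrow> Z \<in> b_ty B p \<and> k \<le> p"
 "Cod FB (pt n k Z) = \<langle>Num n, b_ftm B n k Z\<rangle>"
 by (auto simp: B2E_cat_path vft_pow)

lemma FB_objE:
 assumes "v \<in> Obj FB"
 obtains n X where "v = \<langle>Num n, X\<rangle>" "X \<in> b_ty B n"
 using assms by (auto simp: B2E_cat_path)

text \<open>Writing the index of the domain as \<open>n + k\<close> turns the truncated subtractions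
  in the definitions of the operations into sums that simplify away.\<close>

lemma FB_arrE:
 assumes "a \<in> Arr FB"
 obtains n k Z where "a = pt n k Z" "Z \<in> b_ty B (n + k)" "Cod FB a = \<langle>Num n, b_ftm B n k Z\<rangle>"
proof -
 obtain v k where a: "a = \<langle>v, Num k\<rangle>" "v \<in> {\<langle>Num n, X\<rangle> |n X. X \<in> b_ty B n}" "k \<le> unum (ufst v)"
  using assms unfolding B2E_cat_path by (rule PT.path_arrE)
 then obtain p X where v: "v = \<langle>Num p, X\<rangle>" "X \<in> b_ty B p" by blast
 then have "p = (p - k) + k" using a by simp
 then obtain n where "p = n + k" by blast
 then show ?thesis using that[of n k X] a v by simp
qed

lemma FB_overE:
 assumes "a \<in> Arr FB" "Cod FB a = \<langle>Num n, X\<rangle>"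
 obtains k Z where "a = pt n k Z" "Z \<in> b_ty B (n + k)" "b_ftm B n k Z = X"
 using assms by (elim FB_arrE) auto

lemma FB_over2E:
 assumes "a \<in> Arr FB" "Cod FB a = \<langle>Num n, X\<rangle>" "p \<in> Arr FB" "Cod FB p = Dom FB a"
 obtains i Z j U where "a = pt n i Z" "Z \<in> b_ty B (n + i)" "b_ftm B n i Z = X"
  "p = pt (n + i) j U" "U \<in> b_ty B (n + i + j)" "b_ftm B (n + i) j U = Z"
proof -
 obtain i Z where a: "a = pt n i Z" "Z \<in> b_ty B (n + i)" "b_ftm B n i Z = X" using assms(1,2) by (rule FB_overE)
 have "Cod FB p = \<langle>Num (n + i), Z\<rangle>" using assms(4) a by simp
 from FB_overE[OF assms(3) this] show ?thesis using that a by metis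
qed

lemma FB_cat: "is_category FB"
 unfolding B2E_cat_path by (rule PT.is_category_path)

lemma FB_tree: "rooted_tree FB base (\<lambda>v. unum (ufst v)) (\<lambda>X. \<langle>X, Num 1\<rangle>)"
 unfolding B2E_cat_path by (rule PT.path_rooted_tree)

lemma FB_terminal: "is_terminal FB base"
 using rooted_tree.terminal[OF FB_tree] .

lemma FB_lev: "X \<in> b_ty B n \<Longrightarrow> e_lev EB \<langle>Num n, X\<rangle> = n"
 using rooted_tree_lev(2)[OF FB_tree, of "\<langle>Num n, X\<rangle>"] by simp

lemma FB_indec: "X \<in> b_ty B (Suc n) \<Longrightarrow> e_indec EB \<langle>Num (Suc n), X\<rangle> = \<langle>\<langle>Num (Suc n), X\<rangle>, Num 1\<rangle>"
 using rooted_tree_lev(3)[OF FB_tree, of "\<langle>Num (Suc n), X\<rangle>"] by simp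

sublocale EC: esys_cat EB
 by unfold_locales (simp add: FB_cat)

end

context bsys2
begin

abbreviation "EB \<equiv> B2E_obj B"
abbreviation "EA \<equiv> B2E_obj A"

lemma bmap_ty2:
 assumes H: "bmap n X m Y H" and Z: "Z \<in> b_ty B (n + i)" "b_ftm B n i Z = X" and U: "U \<in> b_ty B (n + i + j)" "b_ftm B (n + i) j U = Z"
 shows "bh_ty H (i + j) U \<in> b_ty A (m + i + j)" "b_ftm A (m + i) j (bh_ty H (i + j) U) = bh_ty H i Z"
 using bmap_ty[OF bmap_slice[OF H Z] U] by simp_all

lemma sfun_B2E:
 assumes H: "bmap n X m Y H"
 shows "is_sfun EB \<langle>Num n, X\<rangle> EA \<langle>Num m, Y\<rangle> (B2E_sfun n m H)"
proof (rule is_sfunI, unfold B.EB_simps(1) A.EB_simps(1), goal_cases)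
 case (1 a)
 then obtain i Z where a: "a = pt n i Z" "Z \<in> b_ty B (n + i)" "b_ftm B n i Z = X" by (rule B.FB_overE)
 then show ?case using bmap_ty[OF H a(2,3)] by simp
next
 case (2 a p)
 from this(1-4) show ?case
 proof (rule B.FB_over2E, goal_cases)
  case (1 i Z j U)
  show ?case using bmap_ty2[OF H 1(2,3,5,6)] 1 by (simp add: add.assoc[symmetric])
 qed
next
 case (3 a)
 then show ?case by (auto elim: B.FB_overE)
next
 case (4 a p q)
 from 4(1-4) show ?case
 proof (rule B.FB_over2E, goal_cases)
  case (1 i Z j U)
  have "Cod B.FB q = \<langle>Num (n + i + j), U\<rangle>" using 4 1 by simp
  with 4(5) obtain l V where q: "q = pt (n + i + j) l V" by (rule B.FB_overE)
  show ?case using 1 q by simp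
 qed
next
 case (5 a p t)
 from 5(1-4) show ?case
 proof (rule B.FB_over2E, goal_cases)
  case (1 i Z j U)
  have t: "t \<in> B.TT (n + i + j) U j" using 5(5) 1 by simp
  show ?case using bmap_sub[OF bmap_slice[OF H 1(2,3)] 1(5,6) t] 1 by (simp add: add.assoc)
 qed
qed

lemma sfun_eq_B2E:
 assumes X: "X \<in> b_ty B n" and eq: "bhom_eq (b_slice B n X) H K"
 shows "sfun_eq EB \<langle>Num n, X\<rangle> (B2E_sfun n m H) (B2E_sfun n m K)"
proof (rule seqI, unfold B.EB_simps(1), goal_cases)
 case (1 a)
 then obtain i Z where a: "a = pt n i Z" "Z \<in> b_ty B (n + i)" "b_ftm B n i Z = X" by (rule B.FB_overE)
 then show ?case using beqD(1)[OF eq, of Z i] by simp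
next
 case (2 a p)
 then show ?case
 proof (rule B.FB_over2E, goal_cases)
  case (1 i Z j U)
  then show ?case using beqD(1)[OF eq, of U "i + j"] by (simp add: b_ftm_add add.assoc)
 qed
next
 case (3 a p t)
 from 3(1-4) show ?case
 proof (rule B.FB_over2E, goal_cases)
  case (1 i Z j U)
  have t: "t \<in> B.TT (n + i + j) U j" using 3(5) 1 by simp
  have "map_tms (bh_tm H (Suc i)) j t = map_tms (bh_tm K (Suc i)) j t"
   by (rule B.map_tms_cong[OF _ 1(5) t]) (use beqD(2)[OF eq, of _ "Suc i"] 1(3,6) in simp)
  then show ?case using 1 by simp
 qed
qed

text \<open>Together with \<open>B2E_slice\<close> and \<open>B2E_id\<close> this makes the passage
  from homomorphisms of slices to functors compatible with composition, slicing and identities, so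
  that equations between homomorphisms carry over to functors.\<close>

lemma B2E_comp:
 "sfun_eq EB \<langle>Num n, X\<rangle> (B2E_sfun m l K \<star> B2E_sfun n m H) (B2E_sfun n l (K \<ast> H))"
 by (rule seqI, unfold B.EB_simps(1))
  (erule (1) B.FB_overE, simp, erule (3) B.FB_over2E, simp, erule (3) B.FB_over2E, simp add: map_tms_map bhom_comp_def)

lemma B2E_slice:
 "sfun_eq EB \<langle>Num (n + i), Z\<rangle> (sfun_slice B.FB (pt n i Z) (B2E_sfun n m H))
  (B2E_sfun (n + i) (m + i) (bhom_slice i H))"
 by (rule seqI, unfold B.EB_simps(1))
  (erule (1) B.FB_overE, simp add: add.assoc, erule (3) B.FB_over2E, simp add: add.assoc, erule (3) B.FB_over2E,
   simp add: bhom_slice_def add.assoc)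

end

context bsys
begin

lemma B2E_id: "X \<in> b_ty B n \<Longrightarrow> sfun_eq EB \<langle>Num n, X\<rangle> (B2E_sfun n n bhom_id) sfun_id"
proof (rule seqI, unfold EB_simps(1), goal_cases)
 case (3 a p t)
 from 3(2-5) show ?case
 proof (rule FB_over2E, goal_cases)
  case (1 i Z j U)
  then show ?case using map_tms_id[OF 1(5), of t] 3 by (simp add: bhom_id_def)
 qed
next
 case (1 a)
 from 1(2,3) show ?case by (rule FB_overE) simp
next
 case (2 a p)
 from 2(2-5) show ?case by (rule FB_over2E) simp
qed

lemma is_pre_esys_B2E: "is_pre_esys EB"
 unfolding is_pre_esys_def Let_def EB_simps(1,2)
proof (intro conjI ballI, goal_cases)
 case 1
 show ?case by (rule FB_cat)
next
 case 2
 show ?case by (rule FB_terminal)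
next
 case (3 X a t)
 then obtain n k Z where a: "a = pt n k Z" "Z \<in> b_ty B (n + k)" "X = \<langle>Num n, b_ftm B n k Z\<rangle>"
  by (auto simp: over_iff elim: FB_arrE)
 show ?case using self.sfun_B2E[OF sub_map[OF a(2), of t]] 3 a by simp
next
 case (4 X a t)
 then obtain n k Z where a: "a = pt n k Z" "Z \<in> b_ty B (n + k)" "X = \<langle>Num n, b_ftm B n k Z\<rangle>"
  by (auto simp: over_iff elim: FB_arrE)
 show ?case using self.bmap_ty[OF sub_map[OF a(2), of t], of Z 0] 4 a by simp
next
 case (5 X a)
 then obtain n k Z where a: "a = pt n k Z" "Z \<in> b_ty B (n + k)" "X = \<langle>Num n, b_ftm B n k Z\<rangle>"
  by (auto simp: over_iff elim: FB_arrE)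
 show ?case using self.sfun_B2E[OF wk_map[OF a(2)]] a by simp
next
 case (6 X a)
 then obtain n k Z where a: "a = pt n k Z" "Z \<in> b_ty B (n + k)" "X = \<langle>Num n, b_ftm B n k Z\<rangle>"
  by (auto simp: over_iff elim: FB_arrE)
 show ?case using self.bmap_ty[OF wk_map[OF a(2)], of "b_ftm B n k Z" 0] a by simp
next
 case (7 X)
 then obtain n Z where X: "X = \<langle>Num n, Z\<rangle>" "Z \<in> b_ty B n" by (rule FB_objE)
 show ?case using B2E_id[OF X(2)] by (simp add: X(1))
next
 case (8 X a p)
 then obtain n i Z where a: "a = pt n i Z" "Z \<in> b_ty B (n + i)" "X = \<langle>Num n, b_ftm B n i Z\<rangle>"
  by (auto simp: over_iff elim: FB_arrE)
 have "p \<in> Arr FB" "Cod FB p = \<langle>Num (n + i), Z\<rangle>" using 8 a by (auto simp: over_iff)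
 then obtain j U where p: "p = pt (n + i) j U" "U \<in> b_ty B (n + i + j)" "b_ftm B (n + i) j U = Z"
  by (rule FB_overE)
 show ?case using seq_sym[OF self.B2E_comp[of n _ "n + i" "n + i + j" "wk (n + i + j) U j" "wk (n + i) Z i"]] wk_add[of n i j U] p a
  by simp
next
 case (9 a)
 then obtain n k Z where a: "a = pt n k Z" "Z \<in> b_ty B (n + k)" by (rule FB_arrE)
 show ?case using idt_in[OF a(2)] a by simp
qed

end

sublocale bsys \<subseteq> PE: pre_esys EB
 by unfold_locales (rule is_pre_esys_B2E)

context bsys2
begin

text \<open>The three compatibilities are the images of \<open>bmap_sub\<close>,
  \<open>bmap_wk\<close> and \<open>bmap_idt\<close> under the passage to functors.\<close>

lemma B2E_preserves:
 assumes H: "bmap n X m Y H"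
 shows "preserves_at EB EA \<langle>Num n, X\<rangle> (B2E_sfun n m H)"
proof (rule B.PE.preserves_atI)
 interpret BA: bsys2 B A ..
 let ?R = "B2E_sfun n m H"
 have X: "X \<in> b_ty B n" using H by (simp add: bmap_def)
 fix a assume "a \<in> Arr B.PE.F" "Cod B.PE.F a = \<langle>Num n, X\<rangle>"
 then have a': "a \<in> Arr B.FB" "Cod B.FB a = \<langle>Num n, X\<rangle>" by simp_all
 then obtain k Z where a: "a = pt n k Z" "Z \<in> b_ty B (n + k)" "b_ftm B n k Z = X" by (rule B.FB_overE)
 let ?D = "\<langle>Num (n + k), Z\<rangle>"
 note sl = B2E_slice[of n k Z m H, folded a(1)]
 { fix t assume "t \<in> B.PE.T a"
  then have t: "t \<in> B.TT (n + k) Z k" by (simp add: a(1))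
  let ?t = "map_tms (bh_tm H 1) k t"
  note N = bmap_sub[OF H a(2,3) t]
  have "sfun_eq EB ?D (?R \<star> B2E_sfun (n + k) n (B.sub (n + k) k t)) (B2E_sfun (n + k) m (H \<ast> B.sub (n + k) k t))"
   by (rule B2E_comp)
  also have "sfun_eq EB ?D ... (B2E_sfun (n + k) m (A.sub (m + k) k ?t \<ast> bhom_slice k H))"
   by (rule sfun_eq_B2E[OF a(2) N[THEN conjunct2]])
  also have "sfun_eq EB ?D ... (B2E_sfun (m + k) m (A.sub (m + k) k ?t) \<star> B2E_sfun (n + k) (m + k) (bhom_slice k H))"
   by (rule seq_sym[OF B2E_comp])
  also have "sfun_eq EB ?D ... (B2E_sfun (m + k) m (A.sub (m + k) k ?t) \<star> sfun_slice B.FB a ?R)"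
   by (rule seq_right[OF seq_sym[OF sl]])
  finally show "B.PE.eqv (Dom B.PE.F a) (?R \<star> B.PE.S a t) (e_S EA (s_obj ?R a) (B.PE.tm ?R a t) \<star> B.PE.sl a ?R)"
   using a'(2) by (simp add: a(1) sfun_tm_def) }
 have "sfun_eq EB \<langle>Num n, X\<rangle> (sfun_slice B.FB a ?R \<star> B2E_sfun n (n + k) (B.wk (n + k) Z k))
   (B2E_sfun (n + k) (m + k) (bhom_slice k H) \<star> B2E_sfun n (n + k) (B.wk (n + k) Z k))"
  using B.self.sfun_B2E[OF B.wk_map[OF a(2)]] a(3) by (intro seq_left[OF sl]) simp
 also have "sfun_eq EB \<langle>Num n, X\<rangle> ... (B2E_sfun n (m + k) (bhom_slice k H \<ast> B.wk (n + k) Z k))" by (rule B2E_comp)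
 also have "sfun_eq EB \<langle>Num n, X\<rangle> ... (B2E_sfun n (m + k) (A.wk (m + k) (bh_ty H k Z) k \<ast> H))"
  by (rule sfun_eq_B2E[OF X bmap_wk[OF H a(2,3)]])
 also have "sfun_eq EB \<langle>Num n, X\<rangle> ... (B2E_sfun m (m + k) (A.wk (m + k) (bh_ty H k Z) k) \<star> ?R)"
  by (rule seq_sym[OF B2E_comp])
 finally show "B.PE.eqv \<langle>Num n, X\<rangle> (B.PE.sl a ?R \<star> B.PE.W a) (e_W EA (s_obj ?R a) \<star> ?R)"
  by (simp add: a(1))
 let ?V = "bh_ty (B.wk (n + k) Z k) k Z"
 have V: "?V \<in> b_ty B (n + k + k)" "b_ftm B (n + k) k ?V = Z"
  using B.self.bmap_ty[OF B.wk_map[OF a(2)] a(2) refl] by auto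
 show "B.PE.tm (B.PE.sl a ?R) (s_obj (B.PE.W a) a) (B.PE.idtm a) = e_idtm EA (s_obj ?R a)"
  using bmap_idt[OF H a(2,3)] V by (simp add: a(1) sfun_tm_def)
qed

end

context bsys
begin

lemma B2E_hm:
 assumes H: "bmap n X m Y H"
 shows "PE.hm \<langle>Num n, X\<rangle> \<langle>Num m, Y\<rangle> (B2E_sfun n m H)"
proof (rule PE.hmI)
 show "PE.sfn \<langle>Num n, X\<rangle> \<langle>Num m, Y\<rangle> (B2E_sfun n m H)" by (rule self.sfun_B2E[OF H])
 have "X \<in> b_ty B n" using H by (simp add: self.bmap_def)
 then show "s_obj (B2E_sfun n m H) (Ident PE.F \<langle>Num n, X\<rangle>) = Ident PE.F \<langle>Num m, Y\<rangle>"
  using self.bmap_ty[OF H, of X 0] by simp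
 fix a assume "a \<in> Arr PE.F" "Cod PE.F a = \<langle>Num n, X\<rangle>"
 then have a': "a \<in> Arr FB" "Cod FB a = \<langle>Num n, X\<rangle>" by simp_all
 then obtain k Z where a: "a = pt n k Z" "Z \<in> b_ty B (n + k)" "b_ftm B n k Z = X" by (rule FB_overE)
 show "preserves_at EB EB (Dom PE.F a) (PE.sl a (B2E_sfun n m H))"
  using PE.preserves_at_cong[OF self.B2E_preserves[OF self.bmap_slice[OF H a(2,3)]] seq_sym[OF self.B2E_slice]]
  by (simp add: a(1))
qed

text \<open>The cancellation laws for paths of arbitrary length come from \<open>sub_wk\<close>,
  \<open>sub_idt\<close> and the second claim of \<open>idt_in\<close>.\<close>

lemma is_esys_B2E: "is_esys EB"
 unfolding is_esys_def Let_def
proof (intro conjI ballI, goal_cases)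
 case 1
 show ?case by (rule is_pre_esys_B2E)
next
 case (2 X a t)
 then obtain n k Z where a: "a = pt n k Z" "Z \<in> b_ty B (n + k)" "X = \<langle>Num n, b_ftm B n k Z\<rangle>"
  by (auto simp: over_iff elim: FB_arrE)
 show ?case using B2E_hm[OF sub_map[OF a(2), of t]] 2 a by simp
next
 case (3 X a)
 then obtain n k Z where a: "a = pt n k Z" "Z \<in> b_ty B (n + k)" "X = \<langle>Num n, b_ftm B n k Z\<rangle>"
  by (auto simp: over_iff elim: FB_arrE)
 show ?case using B2E_hm[OF wk_map[OF a(2)]] a by simp
next
 case (4 X a t)
 then obtain n k Z where a: "a = pt n k Z" "Z \<in> b_ty B (n + k)" "X = \<langle>Num n, b_ftm B n k Z\<rangle>"
  by (auto simp: over_iff elim: FB_arrE)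
 have t: "t \<in> TT (n + k) Z k" using 4 a by simp
 have Y: "b_ftm B n k Z \<in> b_ty B n" using a by simp
 show ?case
  using seq_trans[OF self.B2E_comp[of n _ "n + k" n] seq_trans[OF self.sfun_eq_B2E[OF Y sub_wk[OF a(2) t]] B2E_id[OF Y]]] a
  by simp
next
 case (5 X a t)
 then obtain n k Z where a: "a = pt n k Z" "Z \<in> b_ty B (n + k)" "X = \<langle>Num n, b_ftm B n k Z\<rangle>"
  by (auto simp: over_iff elim: FB_arrE)
 have t: "t \<in> TT (n + k) Z k" using 5 a by simp
 have V: "bh_ty (wk (n + k) Z k) k Z \<in> b_ty B (n + k + k)" "b_ftm B (n + k) k (bh_ty (wk (n + k) Z k) k Z) = Z"
  using self.bmap_ty[OF wk_map[OF a(2)] a(2) refl] by auto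
 show ?case using sub_idt[OF a(2) t] V a by (simp add: sfun_tm_def)
next
 case (6 X a)
 then obtain n k Z where a: "a = pt n k Z" "Z \<in> b_ty B (n + k)" "X = \<langle>Num n, b_ftm B n k Z\<rangle>"
  by (auto simp: over_iff elim: FB_arrE)
 let ?i = "idt (n + k) Z k"
 note I = idt_in[OF a(2)]
 have sl: "sfun_eq EB \<langle>Num (n + k), Z\<rangle> (sfun_slice FB a (B2E_sfun n (n + k) (wk (n + k) Z k)))
   (B2E_sfun (n + k) (n + k + k) (bhom_slice k (wk (n + k) Z k)))"
  unfolding a(1) by (rule self.B2E_slice)
 have "sfun_eq EB \<langle>Num (n + k), Z\<rangle> (B2E_sfun (n + k + k) (n + k) (sub (n + k + k) k ?i) \<star>
   sfun_slice FB a (B2E_sfun n (n + k) (wk (n + k) Z k)))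
   (B2E_sfun (n + k + k) (n + k) (sub (n + k + k) k ?i) \<star> B2E_sfun (n + k) (n + k + k) (bhom_slice k (wk (n + k) Z k)))"
  by (rule seq_right[OF sl])
 also have "sfun_eq EB \<langle>Num (n + k), Z\<rangle> ... (B2E_sfun (n + k) (n + k) (sub (n + k + k) k ?i \<ast> bhom_slice k (wk (n + k) Z k)))"
  by (rule self.B2E_comp)
 also have "sfun_eq EB \<langle>Num (n + k), Z\<rangle> ... (B2E_sfun (n + k) (n + k) bhom_id)"
  by (rule self.sfun_eq_B2E[OF a(2) I[THEN conjunct2]])
 also have "sfun_eq EB \<langle>Num (n + k), Z\<rangle> ... sfun_id" by (rule B2E_id[OF a(2)])
 finally show ?case by (simp add: a(1))
qed

lemma is_stratified_B2E: "is_stratified_esys EB"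
 unfolding is_stratified_esys_def is_stratified_sfun_def
proof (intro conjI ballI)
 show "is_stratified (e_cat EB) (e_root EB)" using rooted_tree_lev(1)[OF FB_tree] by simp
 fix X a assume "X \<in> Obj (e_cat EB)" and a0: "a \<in> over (e_cat EB) X"
 then obtain n k Z where a: "a = pt n k Z" "Z \<in> b_ty B (n + k)" "X = \<langle>Num n, b_ftm B n k Z\<rangle>"
  by (auto simp: over_iff elim: FB_arrE)
 note lv = FB_lev[simplified]
 have Y: "b_ftm B n k Z \<in> b_ty B n" using a by simp
 { fix b assume "b \<in> over (e_cat EB) X"
  then have "b \<in> Arr FB" "Cod FB b = \<langle>Num n, b_ftm B n k Z\<rangle>" using a by (auto simp: over_iff)
  then obtain i U where b: "b = pt n i U" "U \<in> b_ty B (n + i)" "b_ftm B n i U = b_ftm B n k Z" by (rule FB_overE)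
  show "e_lev EB (e_ext EB b) - e_lev EB X = e_lev EB (e_ext EB (s_obj (e_W EB a) b)) - e_lev EB (e_ext EB a)"
   using self.bmap_ty[OF wk_map[OF a(2)] b(2,3)] Y a b by (simp add: lv) }
 fix t b assume t0: "t \<in> e_T EB a" and "b \<in> over (e_cat EB) (e_ext EB a)"
 then have "b \<in> Arr FB" "Cod FB b = \<langle>Num (n + k), Z\<rangle>" using a by (auto simp: over_iff)
 then obtain i U where b: "b = pt (n + k) i U" "U \<in> b_ty B (n + k + i)" "b_ftm B (n + k) i U = Z" by (rule FB_overE)
 have t: "t \<in> TT (n + k) Z k" using t0 a by simp
 show "e_lev EB (e_ext EB b) - e_lev EB (e_ext EB a) = e_lev EB (e_ext EB (s_obj (e_S EB a t) b)) - e_lev EB X"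
  using self.bmap_ty[OF sub_map[OF a(2) t] b(2,3)] Y a b by (simp add: lv)
qed

end

context bsys2
begin

text \<open>Over an object \<open>\<langle>Num n, X\<rangle>\<close> the constructed homomorphism
  agrees with the functor induced by the slice \<open>bhom_slice n H\<close>, and
  \<open>B2E_preserves\<close> applies to that functor.\<close>

lemma is_pre_ehom_B2E:
 assumes H: "is_pre_bhom B A H"
 shows "is_pre_ehom EB EA (B2E_hom B H)" "is_stratified_ehom EB EA (B2E_hom B H)"
proof -
 note h = frameD[OF B.pre_bhom_frame[OF H]]
 have Hs: "bmap n X n (bh_ty H n X) (bhom_slice n H)" if "X \<in> b_ty B n" for n X
  using that B.pre_bhom_slice[OF H that] h(1)[OF that] by (simp add: bmap_def)
 define ob where "ob = (\<lambda>v. \<langle>ufst v, bh_ty H (unum (ufst v)) (usnd v)\<rangle>)"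
 let ?K = "\<lparr>eh_fun = \<lparr>onObj = ob, onArr = (\<lambda>a. \<langle>ob (ufst a), usnd a\<rangle>)\<rparr>,
    eh_tm = (\<lambda>a t. let n = unum (ufst (ufst a)); k = unum (usnd a) in map_tms (bh_tm H (n - k + 1)) k t)\<rparr>"
 have K: "B2E_hom B H = ehom_restrict EB ?K" by (simp add: B2E_hom_def ob_def Let_def)
 have ftm: "bh_ty H n (b_ftm B n k Z) = b_ftm A n k (bh_ty H (n + k) Z)" if "Z \<in> b_ty B (n + k)" for n k Z
  using B.hom_ftm[OF B.pre_bhom_frame[OF H] that] .
 have eq: "sfun_eq EB \<langle>Num n, X\<rangle> (B2E_sfun n n (bhom_slice n H)) (ehom_slice ?K)" for n X
  by (rule seqI, unfold B.EB_simps(1))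
   (erule (1) B.FB_overE, simp add: ob_def, erule (3) B.FB_over2E, simp add: ob_def add.assoc, erule (3) B.FB_over2E, simp add: bhom_slice_def)
 have "is_pre_ehom EB EA ?K"
  unfolding is_pre_ehom_def
 proof (intro conjI ballI)
  show "is_functor (e_cat EB) (e_cat EA) (eh_fun ?K)"
   unfolding is_functor_def B.EB_simps(1) A.EB_simps(1) hom_def ehom.select_convs fmap.select_convs
  proof (intro conjI ballI impI CollectI, goal_cases)
   case (1 X)
   then show ?case by (auto elim!: B.FB_objE simp: ob_def h)
  next
   case (2 a)
   then show ?case by (auto elim!: B.FB_arrE simp: ob_def h)
  next
   case (3 a)
   then show ?case by (auto elim!: B.FB_arrE simp: ob_def)
  next
   case (4 a)
   then show ?case by (auto elim!: B.FB_arrE simp: ob_def ftm)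
  next
   case (5 X)
   then show ?case by (auto elim!: B.FB_objE simp: ob_def)
  next
   case (6 f g)
   obtain n k Z where f: "f = pt n k Z" using 6(1) by (rule B.FB_arrE)
   obtain m j U where g: "g = pt m j U" using 6(2) by (rule B.FB_arrE)
   show ?case by (simp add: f g)
  qed
  show "eh_tm ?K a t \<in> e_T EA (onArr (eh_fun ?K) a)" if h: "a \<in> Arr (e_cat EB)" "t \<in> e_T EB a" for a t
  proof -
   obtain n k Z where a: "a = pt n k Z" "Z \<in> b_ty B (n + k)"
    using h(1) by (auto elim: B.FB_arrE)
   have t: "t \<in> B.TT (n + k) Z k" using h(2) a by simp
   show ?thesis using bmap_sub[OF Hs[of "b_ftm B n k Z" n] a(2) refl t] a by (simp add: ob_def)
  qed
  show "onObj (eh_fun ?K) (e_root EB) = e_root EA"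
   using h(1)[of "the_elem (b_ty B 0)" 0] B.the_elem_0 A.the_elem_0 by (simp add: ob_def B.base_def A.base_def)
  fix X assume "X \<in> Obj (e_cat EB)"
  then obtain n Z where X: "X = \<langle>Num n, Z\<rangle>" "Z \<in> b_ty B n" by (auto elim: B.FB_objE)
  show "preserves_at EB EA X (ehom_slice ?K)"
   unfolding X(1) by (rule B.PE.preserves_at_cong[OF B2E_preserves[OF Hs[OF X(2)]] eq])
 qed
 then show "is_pre_ehom EB EA (B2E_hom B H)" unfolding K by (rule ehom_restrict[OF B.PE.pre_esys_axioms])
 show "is_stratified_ehom EB EA (B2E_hom B H)"
  unfolding is_stratified_ehom_def K
  using B.FB_lev A.FB_lev h(1) by (auto elim!: B.FB_objE simp: ob_def)
qed

lemma B2E_hom_simps: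
 "v \<in> Obj B.FB \<Longrightarrow> onObj (eh_fun (B2E_hom B H)) v = \<langle>ufst v, bh_ty H (unum (ufst v)) (usnd v)\<rangle>"
 "a \<in> Arr B.FB \<Longrightarrow> onArr (eh_fun (B2E_hom B H)) a = \<langle>\<langle>ufst (ufst a), bh_ty H (unum (ufst (ufst a))) (usnd (ufst a))\<rangle>, usnd a\<rangle>"
 "a \<in> Arr B.FB \<Longrightarrow> t \<in> e_T EB a \<Longrightarrow> eh_tm (B2E_hom B H) a t = map_tms (bh_tm H (unum (ufst (ufst a)) - unum (usnd a) + 1)) (unum (usnd a)) t"
 by (simp_all add: B2E_hom_def Let_def)

lemma B2E_hom_ext: "ehom_extensional EB (B2E_hom B H)"
 by (simp add: B2E_hom_def Let_def)

end

lemma is_functor_B2E: "is_functor Bsys Esys\<^sub>s B2E"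
 unfolding Esys\<^sub>s_def Bsys_def B2E_def
proof (rule is_functor_mk_category, goal_cases)
 case (1 B)
 then interpret bsys B by (simp add: bsysI)
 show ?case by (simp add: is_esys_B2E is_stratified_B2E)
next
 case (2 B A H)
 then interpret bsys2 B A by (simp add: bsysI bsys2_def)
 show ?case using 2 is_pre_ehom_B2E B2E_hom_ext by simp
next
 case (3 B)
 then interpret bsys B by (simp add: bsysI)
 show ?case
 proof (rule ehom_eqI[of EB], goal_cases)
  case (5 a t)
  then obtain n k Z where a: "a = pt n k Z" "Z \<in> b_ty B (n + k)" by (auto elim: FB_arrE)
  have t: "t \<in> TT (n + k) Z k" using 5 a by simp
  have "map_tms (bh_tm (bhom_restrict B bhom_id) (Suc n)) k t = map_tms (\<lambda>x. x) k t"
   by (rule map_tms_cong[OF _ a(2) t]) simp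
  then show ?case using 5 a map_tms_id[OF a(2) t] by (simp add: self.B2E_hom_simps)
 qed (auto simp: self.B2E_hom_simps self.B2E_hom_ext elim!: FB_objE FB_arrE)
next
 case (4 B A D H K)
 interpret BA: bsys2 B A using 4 by (simp add: bsysI bsys2_def)
 interpret AD: bsys2 A D using 4 by (simp add: bsysI bsys2_def)
 interpret BD: bsys2 B D using 4 by (simp add: bsysI bsys2_def)
 have H: "is_pre_bhom B A H" using 4 by simp
 note h = frameD[OF BA.B.pre_bhom_frame[OF H]]
 interpret E: strat_esys_hom "B2E_obj B" "B2E_obj A" "B2E_hom B H"
  by (rule strat_esys_homI)
   (simp_all add: BA.B.is_esys_B2E BA.B.is_stratified_B2E BA.A.is_esys_B2E BA.A.is_stratified_B2E BA.is_pre_ehom_B2E[OF H])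
 show ?case
 proof (rule ehom_eqI[of "B2E_obj B"], goal_cases)
  case (5 a t)
  then obtain n k Z where a: "a = pt n k Z" "Z \<in> b_ty B (n + k)" by (auto elim: BA.B.FB_arrE)
  have t: "t \<in> BA.B.TT (n + k) Z k" using 5 a by simp
  have "map_tms (bh_tm (bhom_restrict B (K \<ast> H)) (Suc n)) k t = map_tms (\<lambda>x. bh_tm K (Suc n) (bh_tm H (Suc n) x)) k t"
   by (rule BA.B.map_tms_cong[OF _ a(2) t]) simp
  moreover have "eh_tm (B2E_hom B H) a t \<in> e_T (B2E_obj A) (onArr (eh_fun (B2E_hom B H)) a)"
   using E.h_tm[of a t] 5 by simp
  ultimately show ?case using 5 a h(1)[OF a(2)] by (simp add: BA.B2E_hom_simps AD.B2E_hom_simps BD.B2E_hom_simps map_tms_map)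
 qed (auto simp: BA.B2E_hom_simps AD.B2E_hom_simps BD.B2E_hom_simps BD.B2E_hom_ext h elim!: BA.B.FB_objE BA.B.FB_arrE)
qed

section \<open>From stratified E-systems to B-systems\<close>

text \<open>The construction \<open>E2B_bhom\<close> with target in a second E-system. In this form
  it also covers the functors that a homomorphism of E-systems induces on slices.\<close>

definition ebm :: "'a esys \<Rightarrow> 'a esys \<Rightarrow> 'a univ \<Rightarrow> 'a sfun \<Rightarrow> 'a bhom" where
 "ebm E E' X G = (let arr = (\<lambda>Y. THE a. a \<in> hom (e_cat E) Y X); ty = (\<lambda>Y. e_ext E' (s_obj G (arr Y)))
   in \<lparr>bh_ty = (\<lambda>m. ty), bh_tm = (\<lambda>m y. let P = e_indec E (ufst y) in
      \<langle>ty (ufst y), s_tm G (arr (e_cod E P)) P (usnd y)\<rangle>)\<rparr>)"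

lemma E2B_bhom_ebm: "E2B_bhom E = ebm E E"
 by (simp add: fun_eq_iff E2B_bhom_def ebm_def Let_def)

context strat_esys
begin

abbreviation "BB \<equiv> E2B_obj E"
abbreviation "L \<equiv> e_lev E"
abbreviation "slB X \<equiv> b_slice BB (L X) X"

lemma BB_simps [simp]:
 "X \<in> b_ty BB n \<longleftrightarrow> X \<in> Obj F \<and> L X = n" "b_ft BB n X = Cod F (e_indec E X)" "b_bd BB n y = ufst y"
 "y \<in> b_tm BB n \<longleftrightarrow> (\<exists>X x. y = \<langle>X, x\<rangle> \<and> X \<in> Obj F \<and> L X = n \<and> n > 0 \<and> x \<in> T (e_indec E X))"
 "b_S BB n y = ebm E E (ufst y) (S (e_indec E (ufst y)) (usnd y))"
 "b_W BB n X = ebm E E (Cod F (e_indec E X)) (W (e_indec E X))"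
 "b_delta BB n X = \<langle>Dom F (s_obj (W (e_indec E X)) (e_indec E X)), idtm (e_indec E X)\<rangle>"
 by (auto simp: E2B_obj_def E2B_bhom_ebm)

lemma is_bframe_E2B: "is_bframe BB"
 unfolding is_bframe_def
proof (intro conjI allI ballI exI[of _ "e_root E"])
 show "b_ty BB 0 = {e_root E}" using T.level_0 T.base_obj by (auto simp: set_eq_iff)
 show "b_tm BB 0 = {}" by (auto simp: set_eq_iff)
qed auto

sublocale Fr: bframe BB
 by unfold_locales (rule is_bframe_E2B)

text \<open>One application of \<open>ft\<close> removes the indecomposable arrow out of
  \<open>Y\<close>, so iterating it reaches precisely the objects of the given level to which
  \<open>Y\<close> has an arrow. This identifies slices of the frame with slices of the
  category.\<close>

lemma BB_ftm:
 assumes "Y \<in> Obj F" "L Y = n + i"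
 shows "b_ftm BB n i Y = X \<longleftrightarrow> L X = n \<and> (\<exists>A \<in> Arr F. Dom F A = Y \<and> Cod F A = X)"
 using assms
proof (induction i arbitrary: Y)
 case 0
 show ?case
 proof
  assume "b_ftm BB n 0 Y = X"
  then show "L X = n \<and> (\<exists>A \<in> Arr F. Dom F A = Y \<and> Cod F A = X)" using 0 by (auto intro: bexI[of _ "Ident F Y"])
 next
  assume "L X = n \<and> (\<exists>A \<in> Arr F. Dom F A = Y \<and> Cod F A = X)"
  then obtain A where A: "L X = n" "A \<in> Arr F" "Dom F A = Y" "Cod F A = X" by blast
  then have "Ident F Y = A" using T.level_eq[of A] 0 by simp
  then have "Cod F A = Y" using cod_id[OF 0(1)] by simp
  then show "b_ftm BB n 0 Y = X" using A by simp
 qed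
next
 case (Suc i)
 let ?P = "e_indec E Y"
 have P: "?P \<in> Arr F" "Dom F ?P = Y" "L (Cod F ?P) = n + i" using Suc.prems by auto
 have "(\<exists>A \<in> Arr F. Dom F A = Y \<and> Cod F A = X) \<longleftrightarrow> (\<exists>A \<in> Arr F. Dom F A = Cod F ?P \<and> Cod F A = X)" if "L X = n"
 proof
  assume "\<exists>A \<in> Arr F. Dom F A = Y \<and> Cod F A = X"
  then show "\<exists>A \<in> Arr F. Dom F A = Cod F ?P \<and> Cod F A = X" using T.factor Suc.prems \<open>L X = n\<close> by fastforce
 next
  assume "\<exists>A \<in> Arr F. Dom F A = Cod F ?P \<and> Cod F A = X"
  then obtain A where "A \<in> Arr F" "Dom F A = Cod F ?P" "Cod F A = X" by blast
  then show "\<exists>A \<in> Arr F. Dom F A = Y \<and> Cod F A = X" using P by (intro bexI[of _ "A \<odot> ?P"]) simp_all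
 qed
 then show ?case using Suc.IH[of "Cod F ?P"] P by auto
qed

text \<open>The data behind a type of index \<open>Suc i\<close> over \<open>X\<close>: the
  indecomposable arrow \<open>P\<close>, which carries the terms, and the rest \<open>A\<close> of
  the path to \<open>X\<close>.\<close>

definition stp :: "'a univ \<Rightarrow> nat \<Rightarrow> 'a univ \<Rightarrow> 'a univ \<Rightarrow> bool" where
 "stp X i A P \<longleftrightarrow> A \<in> Arr F \<and> Cod F A = X \<and> P \<in> Arr F \<and> Cod F P = Dom F A \<and> L (Dom F A) = L X + i \<and> L (Dom F P) = Suc (L X + i)"

lemma stpD:
 assumes "stp X i A P"
 shows "A \<in> Arr F" "Cod F A = X" "P \<in> Arr F" "Cod F P = Dom F A" "L (Dom F A) = L X + i" "L (Dom F P) = Suc (L X + i)"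
  "e_indec E (Dom F P) = P" "X \<in> Obj F"
 using assms T.indec_eq[of P] by (auto simp: stp_def)

lemma slty: "Y \<in> b_ty (slB X) i \<longleftrightarrow> (\<exists>A \<in> Arr F. Dom F A = Y \<and> Cod F A = X \<and> L Y = L X + i)"
 using BB_ftm[of Y "L X" i X] by auto

lemma slty_Suc:
 assumes "Y \<in> b_ty (slB X) (Suc i)"
 obtains A P where "stp X i A P" "Y = Dom F P"
proof -
 obtain Q where Q: "Q \<in> Arr F" "Dom F Q = Y" "Cod F Q = X" "L Y = Suc (L X + i)" using iffD1[OF slty assms] by auto
 then have P: "e_indec E Y \<in> Arr F" "Dom F (e_indec E Y) = Y" "L (Cod F (e_indec E Y)) = L X + i" by auto
 obtain A where "A \<in> Arr F" "Dom F A = Cod F (e_indec E Y)" "Cod F A = X" using T.factor[of Q] Q by auto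
 then show ?thesis using that[of A "e_indec E Y"] P Q by (simp add: stp_def)
qed

lemma stp_ty: "stp X i A P \<Longrightarrow> Dom F P \<in> b_ty (slB X) (Suc i)"
 unfolding slty using stpD[of X i A P] by (intro bexI[of _ "A \<odot> P"]) simp_all

lemma sltm: "y \<in> b_tm (slB X) (Suc i) \<longleftrightarrow> (\<exists>A P t. stp X i A P \<and> t \<in> T P \<and> y = \<langle>Dom F P, t\<rangle>)"
proof
 assume y: "y \<in> b_tm (slB X) (Suc i)"
 then have "ufst y \<in> b_ty (slB X) (Suc i)" by auto
 then obtain A P where s: "stp X i A P" "ufst y = Dom F P" by (rule slty_Suc)
 then have "usnd y \<in> T P \<and> y = \<langle>Dom F P, usnd y\<rangle>" using y stpD(7)[of X i A P] by auto
 then show "\<exists>A P t. stp X i A P \<and> t \<in> T P \<and> y = \<langle>Dom F P, t\<rangle>" using s by blast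
next
 assume "\<exists>A P t. stp X i A P \<and> t \<in> T P \<and> y = \<langle>Dom F P, t\<rangle>"
 then obtain A P t where "stp X i A P" "t \<in> T P" "y = \<langle>Dom F P, t\<rangle>" by blast
 then show "y \<in> b_tm (slB X) (Suc i)" using stp_ty[of X i A P] stpD[of X i A P] by simp
qed

lemma sl_eqI:
 assumes "\<And>A i. A \<in> Arr F \<Longrightarrow> Cod F A = X \<Longrightarrow> L (Dom F A) = L X + i \<Longrightarrow> bh_ty H i (Dom F A) = bh_ty K i (Dom F A)"
  and "\<And>A P t i. stp X i A P \<Longrightarrow> t \<in> T P \<Longrightarrow> bh_tm H (Suc i) \<langle>Dom F P, t\<rangle> = bh_tm K (Suc i) \<langle>Dom F P, t\<rangle>"
 shows "bhom_eq (slB X) H K"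
 unfolding bhom_eq_def
proof (intro conjI allI ballI)
 show "bh_ty H i Y = bh_ty K i Y" if h: "Y \<in> b_ty (slB X) i" for i Y
  using h[unfolded slty] assms(1) by auto
 show "bh_tm H i y = bh_tm K i y" if h: "y \<in> b_tm (slB X) i" for i y
 proof (cases i)
  case (Suc j)
  then show ?thesis using h sltm[of y X j] assms(2) by auto
 qed (use h in simp)
qed

lemma ebm_ty: "A \<in> Arr F \<Longrightarrow> Cod F A = X \<Longrightarrow> bh_ty (ebm E E' X G) i (Dom F A) = e_ext E' (s_obj G A)"
 by (simp add: ebm_def Let_def T.the_arr)

lemma ebm_tm:
 assumes "stp X i A P"
 shows "bh_tm (ebm E E' X G) j \<langle>Dom F P, t\<rangle> = \<langle>e_ext E' (s_obj G (A \<odot> P)), s_tm G A P t\<rangle>"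
proof -
 note D = stpD[OF assms]
 have "(THE a. a \<in> hom F (Dom F P) X) = A \<odot> P" "(THE a. a \<in> hom F (Dom F A) X) = A"
  by (rule T.the_arr; use D in simp)+
 then show ?thesis using D by (simp add: ebm_def Let_def)
qed

lemma ebm_eq:
 assumes "eqv X G K"
 shows "bhom_eq (slB X) (ebm E E' X G) (ebm E E' X K)"
proof (rule sl_eqI)
 fix A P t i assume "stp X i A P" "t \<in> T P"
 then show "bh_tm (ebm E E' X G) (Suc i) \<langle>Dom F P, t\<rangle> = bh_tm (ebm E E' X K) (Suc i) \<langle>Dom F P, t\<rangle>"
  using stpD[of X i A P] seqD[OF assms, of A] seqD(1)[OF assms, of "A \<odot> P"] by (simp add: ebm_tm)
qed (simp add: ebm_ty seqD[OF assms])

lemma ebm_id: "bhom_eq (slB X) (ebm E E X sfun_id) bhom_id"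
proof (rule sl_eqI)
 fix A P t i assume "stp X i A P" "t \<in> T P"
 then show "bh_tm (ebm E E X sfun_id) (Suc i) \<langle>Dom F P, t\<rangle> = bh_tm bhom_id (Suc i) \<langle>Dom F P, t\<rangle>"
  using stpD[of X i A P] by (simp add: ebm_tm)
qed (simp add: ebm_ty)

end

locale eb2 = E: strat_esys E + E': strat_esys E' for E E' :: "'a esys"
begin

text \<open>A stratified functor with term structure between slices of two E-systems. The level
  condition is solved for the level of the value, which is the form needed to place the value in a
  component of the target frame.\<close>

definition gd :: "'a univ \<Rightarrow> 'a univ \<Rightarrow> 'a sfun \<Rightarrow> bool" where
 "gd X Z G \<longleftrightarrow> X \<in> Obj E.F \<and> Z \<in> Obj E'.F \<and> is_sfun E X E' Z G \<and>
  (\<forall>A \<in> Arr E.F. Cod E.F A = X \<longrightarrow> E'.L (Dom E'.F (s_obj G A)) = E.L (Dom E.F A) - E.L X + E'.L Z)"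

lemma gdD:
 assumes "gd X Z G"
 shows "X \<in> Obj E.F" "Z \<in> Obj E'.F" "is_sfun E X E' Z G"
  "A \<in> Arr E.F \<Longrightarrow> Cod E.F A = X \<Longrightarrow> E'.L (Dom E'.F (s_obj G A)) = E.L (Dom E.F A) - E.L X + E'.L Z"
 using assms by (auto simp: gd_def)

lemma gd_slice:
 assumes G: "gd X Z G" and A: "A \<in> Arr E.F" "Cod E.F A = X"
 shows "gd (Dom E.F A) (Dom E'.F (s_obj G A)) (E.sl A G)"
proof -
 note s = gdD(3)[OF G]
 have "E'.L (Dom E'.F (s_arr G A P)) = E.L (Dom E.F P) - E.L (Dom E.F A) + E'.L (Dom E'.F (s_obj G A))"
  if P: "P \<in> Arr E.F" "Cod E.F P = Dom E.F A" for P
  using gdD(4)[OF G, of "A \<cdot>\<^bsub>E.F\<^esub> P"] gdD(4)[OF G A] A P sfun_obj[OF s A] sfun_arr[OF s A P] E.T.level_mono[of A] E.T.level_mono[of P] by simp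
 then show ?thesis using A sfun_obj[OF s A] E.sfun_slice[OF E'.cat_axioms s A] by (simp add: gd_def)
qed

lemma stp_G:
 assumes G: "gd X Z G" and st: "E.stp X i A P"
 shows "E'.stp Z i (s_obj G A) (s_arr G A P)" "s_obj G (A \<cdot>\<^bsub>E.F\<^esub> P) = s_obj G A \<cdot>\<^bsub>E'.F\<^esub> s_arr G A P"
  "Dom E'.F (s_obj G (A \<cdot>\<^bsub>E.F\<^esub> P)) = Dom E'.F (s_arr G A P)"
proof -
 note s = gdD(3)[OF G] and D = E.stpD[OF st]
 note a = sfun_arr[OF s D(1-4)] and o = sfun_obj[OF s D(1,2)]
 show "s_obj G (A \<cdot>\<^bsub>E.F\<^esub> P) = s_obj G A \<cdot>\<^bsub>E'.F\<^esub> s_arr G A P" by (rule a(3))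
 then show d: "Dom E'.F (s_obj G (A \<cdot>\<^bsub>E.F\<^esub> P)) = Dom E'.F (s_arr G A P)" using a o by simp
 show "E'.stp Z i (s_obj G A) (s_arr G A P)"
  using gdD(4)[OF G, of A] gdD(4)[OF G, of "A \<cdot>\<^bsub>E.F\<^esub> P"] D a o d by (simp add: E'.stp_def)
qed

lemma ebm_frame:
 assumes G: "gd X Z G"
 shows "is_bframe_hom (E.slB X) (E'.slB Z) (ebm E E' X G)"
 unfolding is_bframe_hom_def
proof (intro conjI allI ballI)
 note s = gdD(3)[OF G]
 { fix i Y assume "Y \<in> b_ty (E.slB X) i"
  then obtain A where A: "A \<in> Arr E.F" "Dom E.F A = Y" "Cod E.F A = X" "E.L Y = E.L X + i" using E.slty by auto
  then show "bh_ty (ebm E E' X G) i Y \<in> b_ty (E'.slB Z) i"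
   unfolding E'.slty using E.ebm_ty[OF A(1,3)] gdD(4)[OF G A(1,3)] sfun_obj[OF s A(1,3)] by (auto simp: A(2)) }
 { fix i y assume y: "y \<in> b_tm (E.slB X) (Suc i)"
  then obtain A P t where *: "E.stp X i A P" "t \<in> E.T P" "y = \<langle>Dom E.F P, t\<rangle>" using E.sltm by blast
  then show "bh_tm (ebm E E' X G) (Suc i) y \<in> b_tm (E'.slB Z) (Suc i)"
   unfolding E'.sltm using stp_G[OF G *(1)] sfun_arr(4)[OF s E.stpD(1-4)[OF *(1)] *(2)] E.ebm_tm[OF *(1)] by metis
  show "bh_ty (ebm E E' X G) (Suc i) (b_bd (E.slB X) (Suc i) y) = b_bd (E'.slB Z) (Suc i) (bh_tm (ebm E E' X G) (Suc i) y)"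
   using E.ebm_ty[of "A \<cdot>\<^bsub>E.F\<^esub> P" X] E.stpD[OF *(1)] E.ebm_tm[OF *(1)] *(3) by simp }
 { fix i Y assume "Y \<in> b_ty (E.slB X) (Suc i)"
  then obtain A P where *: "E.stp X i A P" "Y = Dom E.F P" by (rule E.slty_Suc)
  note D = E.stpD[OF *(1)] and D' = E'.stpD[OF stp_G(1)[OF G *(1)]]
  show "bh_ty (ebm E E' X G) i (b_ft (E.slB X) (Suc i) Y) = b_ft (E'.slB Z) (Suc i) (bh_ty (ebm E E' X G) (Suc i) Y)"
   using E.ebm_ty[of "A \<cdot>\<^bsub>E.F\<^esub> P" X E' G] E.ebm_ty[OF D(1,2), of E' G] D D' *(2) stp_G(3)[OF G *(1)] by simp }
qed

lemma ebm_comp: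
 assumes G: "gd X Z G"
 shows "bhom_eq (E.slB X) (ebm E' E'' Z K \<ast> ebm E E' X G) (ebm E E'' X (K \<star> G))"
proof (rule E.sl_eqI)
 note s = gdD(3)[OF G]
 show "bh_ty (ebm E' E'' Z K \<ast> ebm E E' X G) i (Dom E.F A) = bh_ty (ebm E E'' X (K \<star> G)) i (Dom E.F A)"
  if A: "A \<in> Arr E.F" "Cod E.F A = X" for A i
  using E.ebm_ty[OF A] sfun_obj[OF s A] by (simp add: E'.ebm_ty)
 fix A P t i assume st: "E.stp X i A P" "t \<in> E.T P"
 show "bh_tm (ebm E' E'' Z K \<ast> ebm E E' X G) (Suc i) \<langle>Dom E.F P, t\<rangle> = bh_tm (ebm E E'' X (K \<star> G)) (Suc i) \<langle>Dom E.F P, t\<rangle>"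
  using E.ebm_tm[OF st(1)] E'.ebm_tm[OF stp_G(1)[OF G st(1)]] stp_G(2,3)[OF G st(1)] by simp
qed

text \<open>\<open>ebm\<close> finds the arrow of an object by its domain and codomain and ignores
  the index, so slicing it amounts to composing this arrow with \<open>A\<close>; the index
  \<open>i\<close> can be any number.\<close>

lemma ebm_slice:
 assumes G: "gd X Z G" and A: "A \<in> Arr E.F" "Cod E.F A = X"
 shows "bhom_eq (E.slB (Dom E.F A)) (bhom_slice i (ebm E E' X G)) (ebm E E' (Dom E.F A) (E.sl A G))"
proof (rule E.sl_eqI)
 note s = gdD(3)[OF G]
 have d: "Dom E'.F (s_obj G (A \<cdot>\<^bsub>E.F\<^esub> P)) = Dom E'.F (s_arr G A P)" if "P \<in> Arr E.F" "Cod E.F P = Dom E.F A" for P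
  using sfun_arr[OF s A that] sfun_obj[OF s A] by simp
 show "bh_ty (bhom_slice i (ebm E E' X G)) j (Dom E.F P) = bh_ty (ebm E E' (Dom E.F A) (E.sl A G)) j (Dom E.F P)"
  if P: "P \<in> Arr E.F" "Cod E.F P = Dom E.F A" for P j
  using E.ebm_ty[of "A \<cdot>\<^bsub>E.F\<^esub> P" X E' G] A P E.ebm_ty[OF P] by (simp add: d)
 fix P Q t j assume st: "E.stp (Dom E.F A) j P Q" "t \<in> E.T Q"
 note D = E.stpD[OF st(1)]
 have "E.stp X (E.L (Dom E.F P) - E.L X) (A \<cdot>\<^bsub>E.F\<^esub> P) Q" using D A E.T.level_mono[of A] E.T.level_mono[of P] by (simp add: E.stp_def)
 from E.ebm_tm[OF this, of E' G] E.ebm_tm[OF st(1), of E' "E.sl A G"]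
 show "bh_tm (bhom_slice i (ebm E E' X G)) (Suc j) \<langle>Dom E.F Q, t\<rangle> = bh_tm (ebm E E' (Dom E.F A) (E.sl A G)) (Suc j) \<langle>Dom E.F Q, t\<rangle>"
  using D A d[of "P \<cdot>\<^bsub>E.F\<^esub> Q"] by (simp add: E.assoc)
qed

end

sublocale strat_esys \<subseteq> self: eb2 E E ..

context strat_esys
begin

lemma gd_S: "A \<in> Arr F \<Longrightarrow> x \<in> T A \<Longrightarrow> self.gd (Dom F A) (Cod F A) (S A x)"
 unfolding self.gd_def using S_sfun lev_S by simp

lemma gd_W: "A \<in> Arr F \<Longrightarrow> self.gd (Cod F A) (Dom F A) (W A)"
 unfolding self.gd_def using W_sfun lev_W by simp

lemma stp_W:
 assumes "stp X i A P"
 shows "stp X (Suc i) (A \<odot> P) (s_obj (W P) P)"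
 using stpD[OF assms] lev_W[of P P] by (simp add: stp_def)

end

context eb2
begin

text \<open>\<open>ebm\<close> respects composition and slicing by \<open>ebm_comp\<close> and
  \<open>ebm_slice\<close>. The compatibilities of the slices of \<open>G\<close> with substitution
  and weakening are equations between functors, which are thereby carried over to homomorphisms of
  frames; the clause on \<open>idtm\<close> becomes the one on \<open>delta\<close>.\<close>

lemma ebm_pre:
 assumes G: "gd X Z G" and pr: "\<And>A. A \<in> Arr E.F \<Longrightarrow> Cod E.F A = X \<Longrightarrow> preserves_at E E' (Dom E.F A) (E.sl A G)"
 shows "is_pre_bhom (E.slB X) (E'.slB Z) (ebm E E' X G)"
proof -
 interpret Sl: bframe "E.slB X" using E.Fr.is_bframe_slice[of X] gdD(1)[OF G] by (simp add: bframe_def)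
 let ?e = "ebm E E'"
 show ?thesis
 proof (rule Sl.pre_bhomI)
  show "is_bframe_hom (E.slB X) (E'.slB Z) (?e X G)" by (rule ebm_frame[OF G])
 next
  fix i y assume "y \<in> b_tm (E.slB X) (Suc i)"
  then obtain A P t where st: "E.stp X i A P" and t: "t \<in> E.T P" "y = \<langle>Dom E.F P, t\<rangle>" using E.sltm by blast
  note D = E.stpD[OF st] and D' = E'.stpD[OF stp_G(1)[OF G st]]
  let ?R = "E.sl A G" and ?P = "Dom E.F P"
  note R = gd_slice[OF G D(1,2)]
  have S: "E.self.gd ?P (Dom E.F A) (E.S P t)" using E.gd_S[OF D(3) t(1)] D(4) by simp
  have AP: "A \<cdot>\<^bsub>E.F\<^esub> P \<in> Arr E.F" "Cod E.F (A \<cdot>\<^bsub>E.F\<^esub> P) = X" "Dom E.F (A \<cdot>\<^bsub>E.F\<^esub> P) = ?P" using D by simp_all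
  let ?S = "E'.S (s_arr G A P) (s_tm G A P t)"
  have e: "E.eqv ?P (?R \<star> E.S P t) (?S \<star> E.sl (A \<cdot>\<^bsub>E.F\<^esub> P) G)"
   using seq_trans[OF E.presD(1)[OF pr[OF D(1,2)] D(3,4) t(1)] seq_right[OF E.slice_slice[OF D(1,3,4)]]]
    E.sfun_tm_slice[OF D(1,4)] by simp
  have "bhom_eq (E.slB ?P) (bhom_slice i (?e X G) \<ast> ebm E E ?P (E.S P t)) (?e (Dom E.F A) ?R \<ast> ebm E E ?P (E.S P t))"
   by (rule beq_left[OF _ ebm_slice[OF G D(1,2)] E.self.ebm_frame[OF S]]) (use E.Fr.is_bframe_slice[of ?P] D in simp)
  also have "bhom_eq (E.slB ?P) ... (?e ?P (?R \<star> E.S P t))" by (rule E.self.ebm_comp[OF S])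
  also have "bhom_eq (E.slB ?P) ... (?e ?P (?S \<star> E.sl (A \<cdot>\<^bsub>E.F\<^esub> P) G))" by (rule E.ebm_eq[OF e])
  also have "bhom_eq (E.slB ?P) ... (ebm E' E' (Dom E'.F (s_arr G A P)) ?S \<ast> ?e ?P (E.sl (A \<cdot>\<^bsub>E.F\<^esub> P) G))"
   using beq_sym[OF ebm_comp[OF gd_slice[OF G AP(1,2)]]] AP(3) stp_G(3)[OF G st] by simp
  also have "bhom_eq (E.slB ?P) ... (ebm E' E' (Dom E'.F (s_arr G A P)) ?S \<ast> bhom_slice (Suc i) (?e X G))"
   using beq_right[OF beq_sym[OF ebm_slice[OF G AP(1,2)]]] AP(3) by simp
  finally show "bhom_eq (b_slice (E.slB X) (Suc i) (b_bd (E.slB X) (Suc i) y)) (bhom_slice i (?e X G) \<ast> b_S (E.slB X) (Suc i) y)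
    (b_S (E'.slB Z) (Suc i) (bh_tm (?e X G) (Suc i) y) \<ast> bhom_slice (Suc i) (?e X G))"
   using b_slice_slice[of ?P E.BB "E.L X" "Suc i" X] E.stp_ty[OF st] D D' E.ebm_tm[OF st] stp_G(3)[OF G st] t(2) by simp
 next
  fix i Y assume "Y \<in> b_ty (E.slB X) (Suc i)"
  then obtain A P where st: "E.stp X i A P" and Y: "Y = Dom E.F P" by (rule E.slty_Suc)
  note D = E.stpD[OF st] and D' = E'.stpD[OF stp_G(1)[OF G st]]
  let ?R = "E.sl A G" and ?D = "Dom E.F A" and ?P = "s_arr G A P"
  note R = gd_slice[OF G D(1,2)]
  have W: "E.self.gd ?D Y (E.W P)" using E.gd_W[OF D(3)] D(4) Y by simp
  have AP: "A \<cdot>\<^bsub>E.F\<^esub> P \<in> Arr E.F" "Cod E.F (A \<cdot>\<^bsub>E.F\<^esub> P) = X" "Dom E.F (A \<cdot>\<^bsub>E.F\<^esub> P) = Y" using D Y by simp_all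
  have sW: "is_sfun E ?D E (Dom E.F P) (E.W P)" using W Y E.self.gdD(3) by simp
  note e0 = E.presD(2)[OF pr[OF D(1,2)] D(3,4)]
  have e: "E.eqv ?D (E.sl (A \<cdot>\<^bsub>E.F\<^esub> P) G \<star> E.W P) (E'.W ?P \<star> ?R)"
   using seq_trans[OF seq_left[OF seq_sym[OF E.slice_slice[OF D(1,3,4)]] sW] e0] by simp
  have Dt: "?D \<in> b_ty E.BB (E.L X + i)" "b_ftm E.BB (E.L X) i ?D = X" using D E.slty[of ?D X i] by auto
  have "bhom_eq (E.slB ?D) (bhom_slice (Suc i) (?e X G) \<ast> ebm E E ?D (E.W P)) (?e Y (E.sl (A \<cdot>\<^bsub>E.F\<^esub> P) G) \<ast> ebm E E ?D (E.W P))"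
   using ebm_slice[OF G AP(1,2), of "Suc i"] AP(3) D Y E.Fr.is_bframe_slice[of ?D]
   by (intro beq_left[OF _ _ E.self.ebm_frame[OF W]]) simp_all
  also have "bhom_eq (E.slB ?D) ... (?e ?D (E.sl (A \<cdot>\<^bsub>E.F\<^esub> P) G \<star> E.W P))" by (rule E.self.ebm_comp[OF W])
  also have "bhom_eq (E.slB ?D) ... (?e ?D (E'.W ?P \<star> ?R))" by (rule E.ebm_eq[OF e])
  also have "bhom_eq (E.slB ?D) ... (ebm E' E' (Dom E'.F (s_obj G A)) (E'.W ?P) \<ast> ?e ?D ?R)" by (rule beq_sym[OF ebm_comp[OF R]])
  also have "bhom_eq (E.slB ?D) ... (ebm E' E' (Dom E'.F (s_obj G A)) (E'.W ?P) \<ast> bhom_slice i (?e X G))"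
   by (rule beq_right[OF beq_sym[OF ebm_slice[OF G D(1,2)]]])
  finally show "bhom_eq (b_slice (E.slB X) i (b_ft (E.slB X) (Suc i) Y)) (bhom_slice (Suc i) (?e X G) \<ast> b_W (E.slB X) (Suc i) Y)
    (b_W (E'.slB Z) (Suc i) (bh_ty (?e X G) (Suc i) Y) \<ast> bhom_slice i (?e X G))"
   using b_slice_slice[OF Dt] D D' E.ebm_ty[OF AP(1,2), of E' G] AP(3) stp_G(3)[OF G st] Y by simp
  have t: "s_tm G (A \<cdot>\<^bsub>E.F\<^esub> P) (s_obj (E.W P) P) (E.idtm P) = E'.idtm ?P"
   using E.presD(3)[OF pr[OF D(1,2)] D(3,4)] E.sfun_tm_slice[of P "s_obj (E.W P) P"] D by simp
  have o: "s_arr G (A \<cdot>\<^bsub>E.F\<^esub> P) (s_obj (E.W P) P) = s_obj (E'.W ?P) ?P" using seqD(1)[OF e D(3,4)] by simp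
  show "bh_tm (?e X G) (Suc (Suc i)) (b_delta (E.slB X) (Suc i) Y) = b_delta (E'.slB Z) (Suc i) (bh_ty (?e X G) (Suc i) Y)"
   using E.ebm_tm[OF E.stp_W[OF st], of E' G] stp_G(3)[OF G E.stp_W[OF st]] t o E.ebm_ty[OF AP(1,2), of E' G] AP(3) stp_G(3)[OF G st] D D' Y
   by simp
 qed
qed

end

context strat_esys
begin

lemma ebm_hm: "hm X Z G \<Longrightarrow> self.gd X Z G \<Longrightarrow> is_pre_bhom (slB X) (slB Z) (ebm E E X G)"
 using self.ebm_pre hm_preserves_slice by blast

text \<open>Every law is the image under \<open>ebm\<close> of the corresponding law of E-systems at
  an indecomposable arrow.\<close>

lemma is_bsys_E2B: "is_bsys BB"
proof -
 have P: "e_indec E X \<in> Arr F" "Dom F (e_indec E X) = X" "L (Cod F (e_indec E X)) = n" "X \<in> Obj F" "L X = Suc n"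
  if "X \<in> b_ty BB (Suc n)" for X n using that by auto
 have S: "is_pre_bhom (b_slice BB (Suc n) X) (b_slice BB n (Cod F (e_indec E X))) (ebm E E X (S (e_indec E X) t))"
  if h: "X \<in> b_ty BB (Suc n)" "t \<in> T (e_indec E X)" for X n t
  using ebm_hm[OF S_hm[OF P(1)[OF h(1)] h(2)]] gd_S[OF P(1)[OF h(1)] h(2)] P[OF h(1)] by simp
 have W: "is_pre_bhom (b_slice BB n (Cod F (e_indec E X))) (b_slice BB (Suc n) X) (ebm E E (Cod F (e_indec E X)) (W (e_indec E X)))"
  if h: "X \<in> b_ty BB (Suc n)" for X n
  using ebm_hm[OF W_hm[OF P(1)[OF h]]] gd_W[OF P(1)[OF h]] P[OF h] by simp
 \<comment> \<open>The weakening of \<open>X\<close> by itself lies one step above \<open>X\<close>,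
   and its indecomposable arrow is \<open>V\<close>. This is what evaluates boundaries and
   operations at \<open>delta\<close>.\<close>
 have st: "stp X 0 (Ident F X) V" "e_indec E (Dom F V) = V" "L (Dom F V) = Suc (Suc n)" "V \<in> Arr F" "Cod F V = X"
  if h: "X \<in> b_ty BB (Suc n)" "V = s_obj (W (e_indec E X)) (e_indec E X)" for X n V
 proof -
  show s: "stp X 0 (Ident F X) V" "V \<in> Arr F" "Cod F V = X" using P[OF h(1)] lev_W[of "e_indec E X" "e_indec E X"] by (simp_all add: stp_def h(2))
  show "e_indec E (Dom F V) = V" "L (Dom F V) = Suc (Suc n)" using stpD[OF s(1)] P[OF h(1)] by simp_all
 qed
 note fr = Fr.is_bframe_slice
 show ?thesis
  unfolding is_bsys_def is_pre_bsys_def Let_def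
 proof (intro conjI allI ballI, goal_cases)
  case 1
  show ?case by (rule is_bframe_E2B)
 next
  case (2 n y)
  then obtain X t where y: "y = \<langle>X, t\<rangle>" "X \<in> b_ty BB (Suc n)" "t \<in> T (e_indec E X)" by auto
  interpret bframe "b_slice BB (Suc n) X" using fr[OF y(2)] by (simp add: bframe_def)
  show ?case using pre_bhom_frame[OF S[OF y(2,3)]] by (simp add: y(1))
 next
  case (3 n X)
  have "Cod F (e_indec E X) \<in> b_ty BB n" using P[OF 3] by simp
  from fr[OF this] interpret bframe "b_slice BB n (Cod F (e_indec E X))" by (simp add: bframe_def)
  show ?case using pre_bhom_frame[OF W[OF 3]] by simp
 next
  case (4 n X)
  show ?case using st[OF 4 refl] P[OF 4] by auto
 next
  case (5 n X)
  show ?case using P[OF 5] ebm_ty[of "e_indec E X" "Cod F (e_indec E X)" E "W (e_indec E X)"] by simp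
 next
  case (6 n y)
  then obtain X t where y: "y = \<langle>X, t\<rangle>" "X \<in> b_ty BB (Suc n)" "t \<in> T (e_indec E X)" by auto
  show ?case using S[OF y(2,3)] by (simp add: y(1))
 next
  case (7 n y)
  then obtain X t where y: "y = \<langle>X, t\<rangle>" "X \<in> b_ty BB (Suc n)" "t \<in> T (e_indec E X)" by auto
  note P = P[OF y(2)]
  show ?case
   using beq_trans[OF self.ebm_comp[OF gd_W[OF P(1)]] beq_trans[OF ebm_eq[OF S_W[OF P(1) y(3)]] ebm_id]] P by (simp add: y(1))
 next
  case (8 n y)
  then obtain X t where y: "y = \<langle>X, t\<rangle>" "X \<in> b_ty BB (Suc n)" "t \<in> T (e_indec E X)" by auto
  note P = P[OF y(2)] and st = st[OF y(2) refl]
  show ?case using ebm_tm[OF st(1)] st S_idtm[OF P(1) y(3)] seqD(1)[OF S_W[OF P(1) y(3)] P(1)] P by (simp add: y(1) sfun_tm_def)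
 next
  case (9 n X)
  show ?case using W[OF 9] by simp
 next
  case (10 n X)
  note P = P[OF 10] and st = st[OF 10 refl]
  let ?P = "e_indec E X"
  let ?V = "s_obj (W ?P) ?P"
  have t: "idtm ?P \<in> T ?V" using P by simp
  have g: "self.gd X (Dom F ?V) (sl ?P (W ?P))" using self.gd_slice[OF gd_W[OF P(1)] P(1)] P by simp
  have "bhom_eq (slB X) (ebm E E (Dom F ?V) (S ?V (idtm ?P)) \<ast> bhom_slice 1 (ebm E E (Cod F ?P) (W ?P)))
    (ebm E E (Dom F ?V) (S ?V (idtm ?P)) \<ast> ebm E E X (sl ?P (W ?P)))"
   using beq_right[OF self.ebm_slice[OF gd_W[OF P(1)] P(1)]] P by simp
  also have "bhom_eq (slB X) ... (ebm E E X (S ?V (idtm ?P) \<star> sl ?P (W ?P)))" by (rule self.ebm_comp[OF g])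
  also have "bhom_eq (slB X) ... (ebm E E X sfun_id)" using ebm_eq[OF S_idtm_W[OF P(1)]] P by simp
  also have "bhom_eq (slB X) ... bhom_id" by (rule ebm_id)
  finally show ?case using P st by simp
 qed
qed

end

text \<open>Every type lies over the only type of level 0. Statements about slices therefore
  specialize to whole systems.\<close>

lemma b_slice_0:
 assumes "is_bframe B" "X \<in> b_ty B 0"
 shows "b_slice B 0 X = B"
proof -
 interpret bframe B by unfold_locales fact
 have e: "b_ftm B 0 n Y = X" if "Y \<in> b_ty B n" for n Y
  using ftm_in[of Y 0 n] that ty_0 assms(2) by simp
 have t: "n > 0 \<and> b_ftm B 0 n (b_bd B n y) = X" if "y \<in> b_tm B n" for n y
  using that e bd_in by (cases n) auto
 show ?thesis by (rule bsys.equality) (auto simp: b_slice_def e t fun_eq_iff)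
qed

context strat_esys_hom
begin

sublocale eb: eb2 E E' ..

lemma E2B_hom_simps:
 "X \<in> Obj E.F \<Longrightarrow> E.L X = n \<Longrightarrow> bh_ty (E2B_hom E H) n X = onObj (eh_fun H) X"
 "X \<in> Obj E.F \<Longrightarrow> E.L X = Suc n \<Longrightarrow> x \<in> E.T (e_indec E X) \<Longrightarrow>
  bh_tm (E2B_hom E H) (Suc n) \<langle>X, x\<rangle> = \<langle>onObj (eh_fun H) X, eh_tm H (e_indec E X) x\<rangle>"
 by (simp_all add: E2B_hom_def)

lemma gd_H: "X \<in> Obj E.F \<Longrightarrow> eb.gd X (onObj (eh_fun H) X) hs"
 unfolding eb.gd_def using hs_sfun h_lev functor_obj[OF hfun] E.T.level_mono by auto

lemma E2B_hom_ebm: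
 assumes X: "X \<in> Obj E.F"
 shows "bhom_eq (E.slB X) (bhom_slice (E.L X) (E2B_hom E H)) (ebm E E' X hs)"
proof (rule E.sl_eqI)
 fix A P t i assume st: "E.stp X i A P" "t \<in> E.T P"
 then show "bh_tm (bhom_slice (E.L X) (E2B_hom E H)) (Suc i) \<langle>Dom E.F P, t\<rangle> = bh_tm (ebm E E' X hs) (Suc i) \<langle>Dom E.F P, t\<rangle>"
  using E.stpD[OF st(1)] E.ebm_tm[OF st(1), of E' hs] by (simp add: E2B_hom_simps h_comp)
qed (simp add: E.ebm_ty E2B_hom_simps)

text \<open>The homomorphism is treated as the functor it induces on the slice over the root, to
  which \<open>ebm_pre\<close> applies; the slices of the frames over the roots are the frames
  themselves.\<close>

lemma is_pre_bhom_E2B: "is_pre_bhom E.BB E'.BB (E2B_hom E H)"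
proof -
 let ?r = "e_root E"
 interpret B: bsys E.BB using E.is_bsys_E2B by (rule bsysI)
 have r: "E.slB ?r = E.BB" "E'.slB (e_root E') = E'.BB"
  using b_slice_0[OF E.is_bframe_E2B] b_slice_0[OF E'.is_bframe_E2B] by simp_all
 have "is_pre_bhom E.BB E'.BB (ebm E E' ?r hs)"
  using eb.ebm_pre[OF gd_H[of ?r]] h_pres r by (simp add: h_root)
 then show ?thesis
  using E.Fr.pre_bhom_cong[OF B.is_pre_bsys _ beq_sym] E2B_hom_ebm[of ?r] r by simp
qed

lemma E2B_hom_ext: "bhom_extensional E.BB (E2B_hom E H)"
 by (simp add: E2B_hom_def)

end

lemma is_functor_E2B: "is_functor Esys\<^sub>s Bsys E2B"
 unfolding Esys\<^sub>s_def Bsys_def E2B_def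
proof (rule is_functor_mk_category, goal_cases)
 case (1 E)
 then interpret strat_esys E by (simp add: strat_esysI)
 show ?case using is_bsys_E2B by simp
next
 case (2 E E' H)
 then interpret strat_esys_hom E E' H by (simp add: strat_esys_homI)
 show ?case using is_pre_bhom_E2B E2B_hom_ext by simp
next
 case (3 E)
 then interpret strat_esys E by (simp add: strat_esysI)
 show ?case by (rule bhom_eqI[of BB]) (auto simp: E2B_hom_def bhom_eq_def)
next
 case (4 E E' E'' H K)
 interpret H: strat_esys_hom E E' H using 4 by (simp add: strat_esys_homI)
 interpret K: strat_esys_hom E' E'' K using 4 by (simp add: strat_esys_homI)
 show ?case
  using H.h_lev functor_obj[OF H.hfun] H.h_tm
  by (intro bhom_eqI[of "E2B_obj E"]) (auto simp: E2B_hom_def bhom_eq_def H.h_indec[symmetric])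
qed

section \<open>The composite on B-systems\<close>

lemma fmap_comp_simps2 [simp]: "F \<circ>\<^sub>F fmap_id = F" "fmap_id \<circ>\<^sub>F F = F" "(H \<circ>\<^sub>F G) \<circ>\<^sub>F F = H \<circ>\<^sub>F (G \<circ>\<^sub>F F)"
 by (simp_all add: fmap_comp_def fmap_id_def comp_def)

text \<open>Isomorphism is asked of the images under \<open>K\<close>. Comparisons between E-systems
  or CE-systems enter as natural transformations and are inverted after passing to
  B-systems.\<close>

lemma nat_iso_image:
 assumes F: "is_functor C D F" and G: "is_functor C D G" and K: "is_functor D E K"
  and h: "\<And>X. X \<in> Obj C \<Longrightarrow> \<eta> X \<in> hom D (onObj F X) (onObj G X)"
  and nat: "\<And>f. f \<in> Arr C \<Longrightarrow> \<eta> (Cod C f) \<cdot>\<^bsub>D\<^esub> onArr F f = onArr G f \<cdot>\<^bsub>D\<^esub> \<eta> (Dom C f)"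
  and C: "\<forall>f \<in> Arr C. Dom C f \<in> Obj C \<and> Cod C f \<in> Obj C" and iso: "\<And>X. X \<in> Obj C \<Longrightarrow> is_iso E (onArr K (\<eta> X))"
 shows "is_nat_iso C E (K \<circ>\<^sub>F F) (K \<circ>\<^sub>F G) (\<lambda>X. onArr K (\<eta> X))"
 unfolding is_nat_iso_def
proof (intro conjI ballI)
 note h' = h[unfolded hom_def]
 show "onArr K (\<eta> X) \<in> hom E (onObj (K \<circ>\<^sub>F F) X) (onObj (K \<circ>\<^sub>F G) X)" if "X \<in> Obj C" for X
  using h'[OF that] functor_arr[OF K, of "\<eta> X"] by (simp add: hom_def fmap_comp_def)
 fix f assume f: "f \<in> Arr C"
 note a = functor_arr[OF F f] functor_arr[OF G f] h'[OF C[THEN bspec, OF f, THEN conjunct1]] h'[OF C[THEN bspec, OF f, THEN conjunct2]]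
 show "onArr K (\<eta> (Cod C f)) \<cdot>\<^bsub>E\<^esub> onArr (K \<circ>\<^sub>F F) f = onArr (K \<circ>\<^sub>F G) f \<cdot>\<^bsub>E\<^esub> onArr K (\<eta> (Dom C f))"
  using functor_comp[OF K, of "onArr F f" "\<eta> (Cod C f)"] functor_comp[OF K, of "\<eta> (Dom C f)" "onArr G f"] nat[OF f] a
  by (simp add: fmap_comp_def)
qed (rule iso)

lemma nat_iso_whisker:
 assumes "is_nat_iso C E F G \<eta>" "is_functor D C H"
 shows "is_nat_iso D E (F \<circ>\<^sub>F H) (G \<circ>\<^sub>F H) (\<lambda>X. \<eta> (onObj H X))"
 using assms(1) functor_obj[OF assms(2)] functor_arr[OF assms(2)] unfolding is_nat_iso_def
 by (metis (no_types, lifting) comp_apply fmap.select_convs fmap_comp_def)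

text \<open>Inserting the inverses on both sides of a commuting square turns it into the square for
  the inverses.\<close>

lemma bhom_conj:
 assumes sq: "bhom_eq B (h' \<ast> s) (s' \<ast> h)" and k: "is_bframe_hom A B k" and s: "is_bframe_hom B B' s"
  and hk: "bhom_eq A (h \<ast> k) bhom_id" and kh: "bhom_eq B' (k' \<ast> h') bhom_id" and A: "b_tm A 0 = {}"
 shows "bhom_eq A (k' \<ast> s') (s \<ast> k)"
 unfolding bhom_eq_def
proof (intro conjI allI ballI)
 fix n X assume X: "X \<in> b_ty A n"
 note kX = frameD(1)[OF k X]
 show "bh_ty (k' \<ast> s') n X = bh_ty (s \<ast> k) n X"
  using beqD(1)[OF sq kX] beqD(1)[OF kh frameD(1)[OF s kX]] beqD(1)[OF hk X] by simp
next
 fix n x assume x: "x \<in> b_tm A n"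
 then obtain m where n: "n = Suc m" using A by (cases n) auto
 note kx = frameD(2)[OF k x[unfolded n]]
 show "bh_tm (k' \<ast> s') n x = bh_tm (s \<ast> k) n x"
  using beqD(2)[OF sq kx] beqD(2)[OF kh frameD(2)[OF s kx]] beqD(2)[OF hk x] by (simp add: n)
qed

text \<open>The inverse functions commute with \<open>ft\<close> and the boundary by cancelling
  \<open>H\<close>, and with substitution and weakening by applying \<open>bhom_conj\<close> to the
  slices of \<open>H\<close>.\<close>

lemma bij_bhom_iso:
 assumes B: "is_bsys B" and A: "is_bsys A" and H: "is_pre_bhom B A H" "bhom_extensional B H"
  and ty: "\<And>n. bij_betw (bh_ty H n) (b_ty B n) (b_ty A n)" and tm: "\<And>n. bij_betw (bh_tm H n) (b_tm B n) (b_tm A n)"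
 shows "is_iso Bsys (B, H, A)"
proof -
 interpret B: bsys B by (rule bsysI[OF B])
 interpret A: bsys A by (rule bsysI[OF A])
 \<comment> \<open>Arrows of \<open>Bsys\<close> are extensional, hence the restriction of the
   inverse functions to the carriers.\<close>
 define K where "K = bhom_restrict A \<lparr>bh_ty = (\<lambda>n. inv_into (b_ty B n) (bh_ty H n)), bh_tm = (\<lambda>n. inv_into (b_tm B n) (bh_tm H n))\<rparr>"
 note h = frameD[OF B.pre_bhom_frame[OF H(1)]]
 have kh: "bhom_eq B (K \<ast> H) bhom_id" and hk: "bhom_eq A (H \<ast> K) bhom_id"
  and kt: "\<And>n Y. Y \<in> b_ty A n \<Longrightarrow> bh_ty K n Y \<in> b_ty B n" and ku: "\<And>n y. y \<in> b_tm A n \<Longrightarrow> bh_tm K n y \<in> b_tm B n"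
  using bij_betw_inv_into_left[OF ty] bij_betw_inv_into_left[OF tm] bij_betw_inv_into_right[OF ty] bij_betw_inv_into_right[OF tm]
   bij_betw_apply[OF ty] bij_betw_apply[OF tm] bij_betw_apply[OF bij_betw_inv_into[OF ty]] bij_betw_apply[OF bij_betw_inv_into[OF tm]]
  by (auto simp: K_def bhom_eq_def)
 note hk' = beqD[OF hk, simplified] and kh' = beqD[OF kh, simplified]
 have K: "is_bframe_hom A B K"
  unfolding is_bframe_hom_def
 proof (intro conjI allI ballI)
  show "bh_ty K n (b_ft A (Suc n) Y) = b_ft B (Suc n) (bh_ty K (Suc n) Y)" if "Y \<in> b_ty A (Suc n)" for n Y
   using kh'(1)[OF B.ft_in[OF kt[OF that]]] h(3)[OF kt[OF that]] hk'(1)[OF that] by simp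
  show "bh_ty K (Suc n) (b_bd A (Suc n) y) = b_bd B (Suc n) (bh_tm K (Suc n) y)" if "y \<in> b_tm A (Suc n)" for n y
   using kh'(1)[OF B.bd_in[OF ku[OF that]]] h(4)[OF ku[OF that]] hk'(2)[OF that] by simp
 qed (simp_all add: kt ku)
 have sl: "is_bframe_hom (b_slice A n Y) (b_slice B n (bh_ty K n Y)) (bhom_slice n K)"
  "bhom_eq (b_slice A n Y) (bhom_slice n H \<ast> bhom_slice n K) bhom_id" if "Y \<in> b_ty A n" for n Y
  using A.is_bframe_hom_slice[OF K that] beq_slice[OF hk, of n] by (simp_all add: bslice_comp)
 have sl': "bhom_eq (b_slice B n X) (bhom_slice n K \<ast> bhom_slice n H) bhom_id" for n X
  using beq_slice[OF kh, of n] by (simp add: bslice_comp)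
 note frame = is_pre_bhom_def[THEN iffD1, THEN conjunct1]
 have pre: "is_pre_bhom A B K"
 proof (rule A.pre_bhomI[OF K])
  fix n y assume y: "y \<in> b_tm A (Suc n)"
  note x = ku[OF y]
  note e = frameD(4)[OF K y]
  show "bhom_eq (b_slice A (Suc n) (b_bd A (Suc n) y)) (bhom_slice n K \<ast> b_S A (Suc n) y)
    (b_S B (Suc n) (bh_tm K (Suc n) y) \<ast> bhom_slice (Suc n) K)"
   by (rule bhom_conj[OF B.pre_bhomD(1)[OF H(1) x, unfolded hk'(2)[OF y]] _ frame[OF B.S_hom[OF x]] sl(2)[OF A.bd_in[OF y]] sl'])
    (use sl(1)[OF A.bd_in[OF y]] e in \<open>simp_all add: b_slice_def\<close>)
 next
  fix n Y assume Y: "Y \<in> b_ty A (Suc n)"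
  note X = kt[OF Y]
  note e = frameD(3)[OF K Y]
  show "bhom_eq (b_slice A n (b_ft A (Suc n) Y)) (bhom_slice (Suc n) K \<ast> b_W A (Suc n) Y)
    (b_W B (Suc n) (bh_ty K (Suc n) Y) \<ast> bhom_slice n K)"
   by (rule bhom_conj[OF B.pre_bhomD(2)[OF H(1) X, unfolded hk'(1)[OF Y]] _ frame[OF B.W_hom[OF X]] sl(2)[OF A.ft_in[OF Y]] sl'])
    (use sl(1)[OF A.ft_in[OF Y]] e in \<open>simp_all add: b_slice_def\<close>)
  show "bh_tm K (Suc (Suc n)) (b_delta A (Suc n) Y) = b_delta B (Suc n) (bh_ty K (Suc n) Y)"
   using kh'(2)[OF B.delta_in[OF X]] B.pre_bhomD(3)[OF H(1) X] hk'(1)[OF Y] by simp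
 qed
 have e: "bhom_restrict B (K \<ast> H) = bhom_restrict B bhom_id" "bhom_restrict A (H \<ast> K) = bhom_restrict A bhom_id"
  using kh hk by (intro bhom_eqI[of B] bhom_eqI[of A]; simp add: bhom_eq_def)+
 have Ke: "bhom_extensional A K" by (simp add: K_def)
 show ?thesis
  unfolding is_iso_def Bsys_def
  by (rule conjI, use assms in simp, rule bexI[of _ "(A, K, B)"], use e in simp, use assms pre Ke in \<open>simp add: mk_category_hom\<close>)
qed

context bsys
begin

lemmas B2E_lev [simp] = FB_lev[simplified] and B2E_indec [simp] = FB_indec[simplified]

lemma B2E_one [simp]:
 "TT n X (Suc 0) = {x \<in> b_tm B n. b_bd B n x = X}" "sub n (Suc 0) x = b_S B n x" "wk n X (Suc 0) = b_W B n X"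
 "idt n X (Suc 0) = b_delta B n X" "map_tms h (Suc 0) x = h x" "Cod FB \<langle>\<langle>Num (Suc n), X\<rangle>, Num (Suc 0)\<rangle> = \<langle>Num n, b_ft B (Suc n) X\<rangle>"
 using FB_simps(6)[of n 1 X]
 by (simp_all add: B2E_T.simps B2E_sub.simps B2E_wk.simps B2E_idtm.simps map_tms.simps)

text \<open>A term is paired with its boundary because the terms of the B-system of an E-system are
  pairs of an object and a term of its indecomposable arrow. Types are tagged with their index,
  since the sets \<open>b_ty B n\<close> may overlap.\<close>

definition psi :: "'a bhom" where
 "psi = bhom_restrict B \<lparr>bh_ty = (\<lambda>n X. \<langle>Num n, X\<rangle>), bh_tm = (\<lambda>n x. \<langle>\<langle>Num n, b_bd B n x\<rangle>, x\<rangle>)\<rparr>"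

interpretation E: strat_esys EB
 by (rule strat_esysI[OF is_esys_B2E is_stratified_B2E])

lemma psi_simps [simp]:
 "X \<in> b_ty B n \<Longrightarrow> bh_ty psi n X = \<langle>Num n, X\<rangle>" "x \<in> b_tm B n \<Longrightarrow> bh_tm psi n x = \<langle>\<langle>Num n, b_bd B n x\<rangle>, x\<rangle>"
 by (simp_all add: psi_def)

text \<open>\<open>psi\<close> intertwines a homomorphism of slices with the functor it induces. For
  \<open>S\<close> and \<open>W\<close> this functor is the operation of the E-system at an edge, so
  both compatibilities of \<open>psi\<close> are instances.\<close>

lemma psi_bmap:
 assumes H: "self.bmap n X m Y H"
 shows "bhom_eq (b_slice B n X) (bhom_slice m psi \<ast> H) (ebm EB EB \<langle>Num n, X\<rangle> (B2E_sfun n m H) \<ast> bhom_slice n psi)"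
proof -
 have h: "is_bframe_hom (b_slice B n X) (b_slice B m Y) H" "X \<in> b_ty B n" using H by (simp_all add: self.bmap_def is_pre_bhom_def)
 note h' = frameD[OF h(1)]
 show ?thesis
  unfolding bhom_eq_def
 proof (intro conjI allI ballI)
  fix i Z assume Z: "Z \<in> b_ty (b_slice B n X) i"
  have "bh_ty (ebm EB EB \<langle>Num n, X\<rangle> (B2E_sfun n m H)) i \<langle>Num (n + i), Z\<rangle> = \<langle>Num (m + i), bh_ty H i Z\<rangle>"
   using E.ebm_ty[of "\<langle>\<langle>Num (n + i), Z\<rangle>, Num i\<rangle>" "\<langle>Num n, X\<rangle>" EB "B2E_sfun n m H" i] Z by simp
  then show "bh_ty (bhom_slice m psi \<ast> H) i Z = bh_ty (ebm EB EB \<langle>Num n, X\<rangle> (B2E_sfun n m H) \<ast> bhom_slice n psi) i Z"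
   using Z h'(1)[OF Z] by simp
 next
  fix j z assume z0: "z \<in> b_tm (b_slice B n X) j"
  then obtain i where j: "j = Suc i" by (cases j) simp_all
  have z: "z \<in> b_tm B (Suc (n + i))" "b_ftm B n i (b_ft B (Suc (n + i)) (b_bd B (Suc (n + i)) z)) = X" using z0 j by simp_all
  let ?b = "b_bd B (Suc (n + i)) z"
  \<comment> \<open>The path from the boundary of \<open>z\<close> down to \<open>X\<close> is split
    into its first edge \<open>?P\<close>, which carries the term, and the remaining path
    \<open>?A\<close>.\<close>
  let ?A = "\<langle>\<langle>Num (n + i), b_ft B (Suc (n + i)) ?b\<rangle>, Num i\<rangle>" and ?P = "\<langle>\<langle>Num (Suc (n + i)), ?b\<rangle>, Num (Suc 0)\<rangle>"
  have b: "?b \<in> b_ty B (Suc (n + i))" using z by simp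
  have st: "E.stp \<langle>Num n, X\<rangle> i ?A ?P" using b z(2) h(2) unfolding E.stp_def by simp
  note w = h'(2)[OF z0[unfolded j]]
  note w' = h'(4)[OF z0[unfolded j]]
  show "bh_tm (bhom_slice m psi \<ast> H) j z = bh_tm (ebm EB EB \<langle>Num n, X\<rangle> (B2E_sfun n m H) \<ast> bhom_slice n psi) j z"
   using E.ebm_tm[OF st, of EB "B2E_sfun n m H" "Suc i" z] w w' z by (simp add: j)
 qed
qed

lemma psi_hom: "is_pre_bhom B (E2B_obj EB) psi"
proof (rule pre_bhomI)
 show "is_bframe_hom B (E2B_obj EB) psi"
  unfolding is_bframe_hom_def by simp
 fix n X assume X: "X \<in> b_ty B (Suc n)"
 show "bhom_eq (b_slice B n (b_ft B (Suc n) X)) (bhom_slice (Suc n) psi \<ast> b_W B (Suc n) X)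
    (b_W (E2B_obj EB) (Suc n) (bh_ty psi (Suc n) X) \<ast> bhom_slice n psi)"
  using psi_bmap[OF W_map[OF X]] X by simp
 show "bh_tm psi (Suc (Suc n)) (b_delta B (Suc n) X) = b_delta (E2B_obj EB) (Suc n) (bh_ty psi (Suc n) X)"
  using X by simp
next
 fix n x assume x: "x \<in> b_tm B (Suc n)"
 then show "bhom_eq (b_slice B (Suc n) (b_bd B (Suc n) x)) (bhom_slice n psi \<ast> b_S B (Suc n) x)
    (b_S (E2B_obj EB) (Suc n) (bh_tm psi (Suc n) x) \<ast> bhom_slice (Suc n) psi)"
  using psi_bmap[OF S_map[OF x]] by simp
qed

lemma psi_iso: "is_iso Bsys (B, psi, E2B_obj EB)"
proof (rule bij_bhom_iso[OF is_bsys E.is_bsys_E2B psi_hom])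
 show "bhom_extensional B psi" by (simp add: psi_def)
 show "bij_betw (bh_ty psi n) (b_ty B n) (b_ty (E2B_obj EB) n)" for n
  by (rule bij_betw_byWitness[where f' = usnd]) (auto elim!: FB_objE)
 show "bij_betw (bh_tm psi n) (b_tm B n) (b_tm (E2B_obj EB) n)" for n
 proof (cases n)
  case (Suc m)
  have "y \<in> bh_tm psi n ` b_tm B n" if y: "y \<in> b_tm (E2B_obj EB) n" for y
  proof -
   obtain v x where v: "y = \<langle>v, x\<rangle>" "v \<in> Obj FB" "E.L v = n" "x \<in> e_T EB (e_indec EB v)" using y by auto
   obtain X where X: "v = \<langle>Num n, X\<rangle>" "X \<in> b_ty B n" using v(2,3) by (auto elim!: FB_objE)
   then have "x \<in> b_tm B n" "b_bd B n x = X" using v(4) Suc by simp_all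
   then show ?thesis using v X by (intro image_eqI[of _ _ x]) simp_all
  qed
  moreover have "bh_tm psi n x \<in> b_tm (E2B_obj EB) n" if "x \<in> b_tm B n" for x
   using frameD(2)[OF pre_bhom_frame[OF psi_hom]] that Suc by blast
  moreover have "inj_on (bh_tm psi n) (b_tm B n)" by (auto simp: inj_on_def)
  ultimately show ?thesis unfolding bij_betw_def by blast
 qed (auto simp: bij_betw_def)
qed

end

section \<open>The natural comparisons in the category of B-systems\<close>

lemma cat_dom_cod:
 "\<forall>f \<in> Arr Bsys. Dom Bsys f \<in> Obj Bsys \<and> Cod Bsys f \<in> Obj Bsys"
 "\<forall>f \<in> Arr Esys\<^sub>s. Dom Esys\<^sub>s f \<in> Obj Esys\<^sub>s \<and> Cod Esys\<^sub>s f \<in> Obj Esys\<^sub>s"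
 "\<forall>f \<in> Arr rCEsys\<^sub>s. Dom rCEsys\<^sub>s f \<in> Obj rCEsys\<^sub>s \<and> Cod rCEsys\<^sub>s f \<in> Obj rCEsys\<^sub>s"
 by (auto simp: Bsys_def Esys\<^sub>s_def rCEsys\<^sub>s_def mk_category_def)

lemma psi_nat: "is_nat_iso Bsys Bsys fmap_id (E2B \<circ>\<^sub>F B2E) (\<lambda>B. (B, bsys.psi B, E2B_obj (B2E_obj B)))"
 unfolding is_nat_iso_def
proof (intro conjI ballI)
 fix B :: "'a bsys" assume "B \<in> Obj Bsys"
 then have B: "is_bsys B" by (simp add: Bsys_def)
 interpret bsys B by (rule bsysI[OF B])
 show "is_iso Bsys (B, psi, E2B_obj (B2E_obj B))" by (rule psi_iso)
 then show "(B, psi, E2B_obj (B2E_obj B)) \<in> hom Bsys (onObj fmap_id B) (onObj (E2B \<circ>\<^sub>F B2E) B)"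
  by (simp add: is_iso_def hom_def Bsys_def fmap_id_def fmap_comp_def E2B_def B2E_def)
next
 fix f :: "'a bsys \<times> 'a bhom \<times> 'a bsys" assume "f \<in> Arr Bsys"
 then obtain B H A where f: "f = (B, H, A)" "is_bsys B" "is_bsys A" "is_pre_bhom B A H"
  by (cases f) (auto simp: Bsys_def)
 interpret bsys2 B A using f by (simp add: bsysI bsys2_def)
 note h = frameD[OF B.pre_bhom_frame[OF f(4)]]
 interpret E: strat_esys EB by (rule strat_esysI[OF B.is_esys_B2E B.is_stratified_B2E])
 have "bhom_restrict B (A.psi \<ast> H) = bhom_restrict B (E2B_hom EB (B2E_hom B H) \<ast> B.psi)"
 proof (rule bhom_eqI[of B], simp, simp, unfold bhom_eq_def, intro conjI allI ballI)
  show "bh_ty (bhom_restrict B (A.psi \<ast> H)) n X = bh_ty (bhom_restrict B (E2B_hom EB (B2E_hom B H) \<ast> B.psi)) n X"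
   if "X \<in> b_ty B n" for n X using that h(1) by (simp add: E2B_hom_def B2E_hom_simps)
  fix n x assume x: "x \<in> b_tm B n"
  then obtain m where n: "n = Suc m" by (cases n) simp_all
  have b: "b_bd B (Suc m) x \<in> b_ty B (Suc m)" using x n by simp
  show "bh_tm (bhom_restrict B (A.psi \<ast> H)) n x = bh_tm (bhom_restrict B (E2B_hom EB (B2E_hom B H) \<ast> B.psi)) n x"
   using x n b h(2)[of x m] h(4)[of x m] by (simp add: E2B_hom_def B2E_hom_simps)
 qed
 then show "(Cod Bsys f, bsys.psi (Cod Bsys f), E2B_obj (B2E_obj (Cod Bsys f))) \<cdot>\<^bsub>Bsys\<^esub> onArr fmap_id f =
   onArr (E2B \<circ>\<^sub>F B2E) f \<cdot>\<^bsub>Bsys\<^esub> (Dom Bsys f, bsys.psi (Dom Bsys f), E2B_obj (B2E_obj (Dom Bsys f)))"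
  by (simp add: f(1) Bsys_def fmap_id_def fmap_comp_def E2B_def B2E_def)
qed

text \<open>On types the map sends an object to its arrow to the root and is inverted by taking
  domains. On terms, bijectivity is \<open>eta_inj\<close> and \<open>eta_surj\<close> at the
  indecomposable arrows.\<close>

lemma eta_nat: "is_nat_iso Esys\<^sub>s Bsys E2B (E2B \<circ>\<^sub>F (CE2E \<circ>\<^sub>F E2CE))
  (\<lambda>E :: 'a esys. onArr E2B (E, strat_esys.eta E, CE2E_obj (E2CE_obj E)))"
proof -
 note fn = is_functor_comp[OF is_functor_E2CE is_functor_CE2E]
 have "is_nat_iso Esys\<^sub>s Bsys (E2B \<circ>\<^sub>F fmap_id) (E2B \<circ>\<^sub>F (CE2E \<circ>\<^sub>F E2CE))
  (\<lambda>E :: 'a esys. onArr E2B (E, strat_esys.eta E, CE2E_obj (E2CE_obj E)))"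
 proof (rule nat_iso_image[OF is_functor_id fn is_functor_E2B _ _ cat_dom_cod(2)])
  fix E :: "'a esys" assume "E \<in> Obj Esys\<^sub>s"
  then have E: "is_esys E" "is_stratified_esys E" by (simp_all add: Esys\<^sub>s_def)
  interpret strat_esys E by (rule strat_esysI[OF E])
  interpret C: strat_cesys "E2CE_obj E" by (rule strat_cesys_E2CE)
  interpret H: strat_esys_hom E "CE2E_obj (E2CE_obj E)" eta
   using E C.is_esys_CE2E C.is_stratified_CE2E eta_hom eta_strat by (simp add: strat_esys_homI)
  show "(E, eta, CE2E_obj (E2CE_obj E)) \<in> hom Esys\<^sub>s (onObj fmap_id E) (onObj (CE2E \<circ>\<^sub>F E2CE) E)"
   using E C.is_esys_CE2E C.is_stratified_CE2E eta_hom eta_strat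
   by (simp add: Esys\<^sub>s_def mk_category_hom fmap_id_def fmap_comp_def CE2E_def E2CE_def eta_def)
  let ?h = "E2B_hom E eta"
  have et: "onObj (eh_fun eta) X = bang X" if "X \<in> Obj F" for X using that by (simp add: eta_def eta0_def)
  have ind: "e_indec (CE2E_obj (E2CE_obj E)) (bang X) = \<langle>bang (Cod F (e_indec E X)), e_indec E X\<rangle>" if "X \<in> Obj F" "0 < L X" for X
   using H.h_indec[OF that] that by (simp add: et eta_def eta0_def)
  have tm: "eh_tm eta A t = eta_tm A t" if "A \<in> Arr F" "t \<in> T A" for A t using that by (simp add: eta_def eta0_def)
  have "is_iso Bsys (E2B_obj E, ?h, E2B_obj (CE2E_obj (E2CE_obj E)))"
  proof (rule bij_bhom_iso[OF is_bsys_E2B H.E'.is_bsys_E2B H.is_pre_bhom_E2B H.E2B_hom_ext])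
   show "bij_betw (bh_ty ?h n) (b_ty BB n) (b_ty H.E'.BB n)" for n
    by (rule bij_betw_byWitness[where f' = "Dom F"])
     (use H.h_lev in \<open>auto simp: E2B_hom_def et T.over_base\<close>)
   show "bij_betw (bh_tm ?h n) (b_tm BB n) (b_tm H.E'.BB n)" for n
   proof (cases n)
    case (Suc m)
    have f: "bh_tm ?h n \<langle>X, t\<rangle> = \<langle>bang X, eta_tm (e_indec E X) t\<rangle>" if "X \<in> Obj F" "L X = n" "t \<in> T (e_indec E X)" for X t
     using that Suc by (simp add: E2B_hom_def et tm)
    have "inj_on (bh_tm ?h n) (b_tm BB n)"
    proof (rule inj_onI)
     fix x y assume "x \<in> b_tm BB n" "y \<in> b_tm BB n" and e: "bh_tm ?h n x = bh_tm ?h n y"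
     then obtain X t Y u where x: "x = \<langle>X, t\<rangle>" "X \<in> Obj F" "L X = n" "t \<in> T (e_indec E X)"
      and y: "y = \<langle>Y, u\<rangle>" "Y \<in> Obj F" "L Y = n" "u \<in> T (e_indec E Y)" by auto
     have "X = Y" using e f x y by (metis T.bang(2) univ.inject(3))
     then show "x = y" using e f x y eta_inj[of "e_indec E X" t u] Suc by simp
    qed
    moreover have "y \<in> bh_tm ?h n ` b_tm BB n" if h: "y \<in> b_tm H.E'.BB n" for y
    proof -
     obtain v x where v: "y = \<langle>v, x\<rangle>" "v \<in> over F (e_root E)" "H.E'.L v = n" "x \<in> CE2E_T (E2CE_obj E) (e_indec (CE2E_obj (E2CE_obj E)) v)"
      using h by auto
     then obtain X where X: "X \<in> Obj F" "v = bang X" using T.over_base by auto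
     have l: "L X = n" using H.h_lev[OF X(1)] v(3) by (simp add: et X)
     obtain t where t: "t \<in> T (e_indec E X)" "eta_tm (e_indec E X) t = x"
      using eta_surj[of "e_indec E X" x] v(4) ind[OF X(1)] X l Suc by auto
     then show ?thesis using X l v f by (intro image_eqI[of _ _ "\<langle>X, t\<rangle>"]) (simp_all add: Suc)
    qed
    moreover have "bh_tm ?h n x \<in> b_tm H.E'.BB n" if "x \<in> b_tm BB n" for x
     using frameD(2)[OF Fr.pre_bhom_frame[OF H.is_pre_bhom_E2B]] that Suc by blast
    ultimately show ?thesis unfolding bij_betw_def by blast
   qed (auto simp: bij_betw_def)
  qed
  then show "is_iso Bsys (onArr E2B (E, eta, CE2E_obj (E2CE_obj E)))" by (simp add: E2B_def)
 next
  fix f :: "'a esys \<times> 'a ehom \<times> 'a esys" assume "f \<in> Arr Esys\<^sub>s"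
  then obtain E H E' where f: "f = (E, H, E')" "is_esys E" "is_stratified_esys E" "is_esys E'" "is_stratified_esys E'"
   "is_pre_ehom E E' H" "is_stratified_ehom E E' H" by (cases f) (auto simp: Esys\<^sub>s_def)
  interpret strat_esys_hom E E' H using f by (simp add: strat_esys_homI)
  show "(Cod Esys\<^sub>s f, strat_esys.eta (Cod Esys\<^sub>s f), CE2E_obj (E2CE_obj (Cod Esys\<^sub>s f))) \<cdot>\<^bsub>Esys\<^sub>s\<^esub> onArr fmap_id f =
    onArr (CE2E \<circ>\<^sub>F E2CE) f \<cdot>\<^bsub>Esys\<^sub>s\<^esub> (Dom Esys\<^sub>s f, strat_esys.eta (Dom Esys\<^sub>s f), CE2E_obj (E2CE_obj (Dom Esys\<^sub>s f)))"
   using eta_natural by (simp add: f(1) Esys\<^sub>s_def fmap_id_def fmap_comp_def CE2E_def E2CE_def)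
 qed
 then show ?thesis by simp
qed

text \<open>\<open>theta\<close> is the identity on objects and on the second category, so after
  passing to B-systems it acts as the identity on types and on terms.\<close>

lemma theta_nat: "is_nat_iso rCEsys\<^sub>s Bsys (E2B \<circ>\<^sub>F (CE2E \<circ>\<^sub>F (CE \<circ>\<^sub>F CE2C))) (E2B \<circ>\<^sub>F CE2E)
  (\<lambda>S :: 'a cesys. onArr (E2B \<circ>\<^sub>F CE2E) (CE_obj (CE2C_obj S), strat_cesys.theta S, S))"
proof -
 note fn = is_functor_comp[OF is_functor_CE2C is_functor_CE]
 have "is_nat_iso rCEsys\<^sub>s Bsys ((E2B \<circ>\<^sub>F CE2E) \<circ>\<^sub>F (CE \<circ>\<^sub>F CE2C)) ((E2B \<circ>\<^sub>F CE2E) \<circ>\<^sub>F fmap_id)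
  (\<lambda>S :: 'a cesys. onArr (E2B \<circ>\<^sub>F CE2E) (CE_obj (CE2C_obj S), strat_cesys.theta S, S))"
 proof (rule nat_iso_image[OF fn is_functor_id is_functor_comp[OF is_functor_CE2E is_functor_E2B] _ _ cat_dom_cod(3)])
  fix S :: "'a cesys" assume "S \<in> Obj rCEsys\<^sub>s"
  then have S: "is_cesys S" "is_rooted_cesys S" "is_stratified_cesys S" by (simp_all add: rCEsys\<^sub>s_def)
  interpret strat_cesys S by (rule strat_cesysI[OF S])
  interpret C: csys "CE2C_obj S" by (rule csys.intro[OF is_csys_CE2C])
  let ?S = "CE_obj (CE2C_obj S)"
  interpret Q: strat_cehom ?S S theta
   using S C.is_cesys_CE C.is_rooted_CE C.is_stratified_CE theta_hom theta_strat by (simp add: strat_cehomI)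
  show "(?S, theta, S) \<in> hom rCEsys\<^sub>s (onObj (CE \<circ>\<^sub>F CE2C) S) (onObj fmap_id S)"
   using S C.is_cesys_CE C.is_rooted_CE C.is_stratified_CE theta_hom theta_strat
   by (simp add: rCEsys\<^sub>s_def mk_category_hom fmap_id_def fmap_comp_def CE_def CE2C_def theta_def)
  let ?t = "CE2E_hom ?S theta"
   interpret H: strat_esys_hom "CE2E_obj ?S" "CE2E_obj S" ?t
   by (rule strat_esys_homI)
    (simp_all add: Q.S.is_esys_CE2E Q.S.is_stratified_CE2E is_esys_CE2E is_stratified_CE2E Q.is_pre_ehom_CE2E Q.is_stratified_ehom_CE2E)
  have ob: "onObj (eh_fun ?t) X = X" if "X \<in> Obj FF" for X
   using that by (simp add: CE2E_hom_def theta_def)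
  \<comment> \<open>The formal path of length 1 evaluates to the indecomposable arrow, so both have
    the same image in the second category and hence the same sections.\<close>
  have Tm: "CE2E_T ?S (ce_indec ?S X) = CE2E_T S (ce_indec S X)" if X: "X \<in> Obj FF" "0 < ce_lev S X" for X
   using C.CE_indec[of X] pth[of X 1] X C.CE_over CE2C_ft[OF X] by (simp add: CE2E_T_def)
  have tm: "eh_tm ?t A x = x" if "A \<in> Arr (ce_fam ?S)" "x \<in> CE2E_T ?S A" for A x
   using that by (simp add: CE2E_hom_def theta_def CE2E_T_def hom_def)
  have lv: "H.E.L X = ce_lev S X" if "X \<in> Obj FF" for X using H.h_lev[of X] that by (simp add: ob)
  have ti: "eh_tm ?t (ce_indec ?S X) x = x" if "X \<in> Obj FF" "0 < ce_lev S X" "x \<in> CE2E_T S (ce_indec S X)" for X x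
   using tm[of "ce_indec ?S X" x] H.E.T.indec(1)[of X] that Tm[of X] lv[of X] by simp
  note lv = lv[simplified] and Tm = Tm[simplified] and ti = ti[simplified]
  have "is_iso Bsys (E2B_obj (CE2E_obj ?S), E2B_hom (CE2E_obj ?S) ?t, E2B_obj (CE2E_obj S))"
  proof (rule bij_bhom_iso[OF H.E.is_bsys_E2B H.E'.is_bsys_E2B H.is_pre_bhom_E2B H.E2B_hom_ext])
   show "bij_betw (bh_ty (E2B_hom (CE2E_obj ?S) ?t) n) (b_ty H.E.BB n) (b_ty H.E'.BB n)" for n
    by (rule bij_betw_byWitness[where f' = "\<lambda>X. X"]) (auto simp: E2B_hom_def ob lv)
   show "bij_betw (bh_tm (E2B_hom (CE2E_obj ?S) ?t) n) (b_tm H.E.BB n) (b_tm H.E'.BB n)" for n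
    by (rule bij_betw_byWitness[where f' = "\<lambda>X. X"]) (auto simp: E2B_hom_def ob lv ti Tm)
  qed
  then show "is_iso Bsys (onArr (E2B \<circ>\<^sub>F CE2E) (?S, theta, S))" by (simp add: E2B_def CE2E_def fmap_comp_def)
 next
  fix f :: "'a cesys \<times> 'a cehom \<times> 'a cesys" assume "f \<in> Arr rCEsys\<^sub>s"
  then obtain S H S' where f: "f = (S, H, S')" "is_cesys S" "is_rooted_cesys S" "is_stratified_cesys S"
   "is_cesys S'" "is_rooted_cesys S'" "is_stratified_cesys S'" "is_cehom S S' H" "is_stratified_cehom S S' H"
   by (cases f) (auto simp: rCEsys\<^sub>s_def)
  interpret strat_cehom S S' H using f by (simp add: strat_cehomI)
  show "(CE_obj (CE2C_obj (Cod rCEsys\<^sub>s f)), strat_cesys.theta (Cod rCEsys\<^sub>s f), Cod rCEsys\<^sub>s f) \<cdot>\<^bsub>rCEsys\<^sub>s\<^esub> onArr (CE \<circ>\<^sub>F CE2C) f =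
    onArr fmap_id f \<cdot>\<^bsub>rCEsys\<^sub>s\<^esub> (CE_obj (CE2C_obj (Dom rCEsys\<^sub>s f)), strat_cesys.theta (Dom rCEsys\<^sub>s f), Dom rCEsys\<^sub>s f)"
   using theta_natural by (simp add: f(1) rCEsys\<^sub>s_def fmap_id_def fmap_comp_def CE_def CE2C_def)
 qed
 then show ?thesis by simp
qed

text \<open>The comparison passes through \<open>?G2\<close> and \<open>?G1\<close> to the identity.
  \<open>theta\<close> points in this direction; \<open>eta\<close> and \<open>psi\<close> point the
  other way and are inverted by \<open>ns\<close>.\<close>

lemma C2B_B2C_nat: "\<exists>\<epsilon>. is_nat_iso Bsys Bsys ((C2B :: ('a csys, _, 'a bsys, _) fmap) \<circ>\<^sub>F B2C) fmap_id \<epsilon>"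
proof -
 note gE = is_functor_comp[OF is_functor_B2E is_functor_E2CE]
 note gB = is_functor_comp[OF is_functor_CE2E is_functor_E2B]
 let ?G1 = "E2B \<circ>\<^sub>F B2E" and ?G2 = "E2B \<circ>\<^sub>F (CE2E \<circ>\<^sub>F (E2CE \<circ>\<^sub>F B2E))"
 have f1: "is_functor Bsys Bsys ?G1" by (rule is_functor_comp[OF is_functor_B2E is_functor_E2B])
 have f2: "is_functor Bsys Bsys ?G2" using is_functor_comp[OF gE gB] by simp
 have f3: "is_functor Bsys Bsys (C2B \<circ>\<^sub>F B2C)"
  using is_functor_comp[OF is_functor_comp[OF gE is_functor_CE2C] is_functor_comp[OF is_functor_CE gB]] by (simp add: C2B_def B2C_def)
 have nt: "is_nat_iso Bsys Bsys F H (\<lambda>X. \<beta> X \<cdot>\<^bsub>Bsys\<^esub> \<alpha> X)"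
  if "is_functor Bsys Bsys F" "is_functor Bsys Bsys H" "is_functor Bsys Bsys G" "is_nat_iso Bsys Bsys F G \<alpha>" "is_nat_iso Bsys Bsys G H \<beta>"
  for F G H :: "('a bsys, 'a bsys \<times> 'a bhom \<times> 'a bsys, 'a bsys, 'a bsys \<times> 'a bhom \<times> 'a bsys) fmap" and \<alpha> \<beta>
  by (rule nat_iso_trans[OF is_category_Bsys bspec[OF cat_dom_cod(1)] that])
 have ns: "is_nat_iso Bsys Bsys G F (\<lambda>X. iso_inv Bsys (\<alpha> X))"
  if "is_functor Bsys Bsys F" "is_functor Bsys Bsys G" "is_nat_iso Bsys Bsys F G \<alpha>"
  for F G :: "('a bsys, 'a bsys \<times> 'a bhom \<times> 'a bsys, 'a bsys, 'a bsys \<times> 'a bhom \<times> 'a bsys) fmap" and \<alpha>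
  by (rule nat_iso_sym[OF is_category_Bsys bspec[OF cat_dom_cod(1)] that])
 note fi = is_functor_id[of Bsys]
 note a = ns[OF fi f1 psi_nat]
 have b0: "is_nat_iso Bsys Bsys ?G1 ?G2 (\<lambda>B. onArr E2B (B2E_obj B, strat_esys.eta (B2E_obj B), CE2E_obj (E2CE_obj (B2E_obj B))))"
  using nat_iso_whisker[OF eta_nat is_functor_B2E] by (simp add: B2E_def)
 have "is_nat_iso Bsys Bsys (C2B \<circ>\<^sub>F B2C) ?G2 (\<lambda>B. onArr (E2B \<circ>\<^sub>F CE2E) (CE_obj (CE2C_obj (onObj (E2CE \<circ>\<^sub>F B2E) B)),
   strat_cesys.theta (onObj (E2CE \<circ>\<^sub>F B2E) B), onObj (E2CE \<circ>\<^sub>F B2E) B))"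
  using nat_iso_whisker[OF theta_nat gE] by (simp add: C2B_def B2C_def)
 from nt[OF f3 f1 f2 this ns[OF f1 f2 b0]] show ?thesis using nt[OF f3 fi f1 _ a] by blast
qed

section \<open>Reconstructing morphisms from their values on types and terms\<close>

sublocale strat_cesys \<subseteq> E: strat_esys EE
 by (rule strat_esysI[OF is_esys_CE2E is_stratified_CE2E])

section \<open>The action of arrows on types and terms by pullback\<close>

context strat_cesys
begin

abbreviation "em f \<equiv> ebm EE EE (Cod CC f) (pf f)"
abbreviation "BS \<equiv> E2B_obj EE"
abbreviation "sB X \<equiv> b_slice BS (ce_lev S X) X"
abbreviation "ind \<equiv> ce_indec S"

lemma BS_simps [simp]:
 "X \<in> b_ty BS n \<longleftrightarrow> X \<in> Obj FF \<and> ce_lev S X = n" "b_ft BS n X = Cod FF (ind X)" "b_bd BS n y = ufst y"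
 "y \<in> b_tm BS n \<longleftrightarrow> (\<exists>X x. y = \<langle>X, x\<rangle> \<and> X \<in> Obj FF \<and> ce_lev S X = n \<and> n > 0 \<and> x \<in> TT (ind X))"
 by simp_all

lemma gd_pf: "f \<in> Arr CC \<Longrightarrow> E.self.gd (Cod CC f) (Dom CC f) (pf f)"
 unfolding E.self.gd_def using pf_sfun[of f] lev_pb[of f] by simp

lemma em_frame: "f \<in> Arr CC \<Longrightarrow> is_bframe_hom (sB (Cod CC f)) (sB (Dom CC f)) (em f)"
 using E.self.ebm_frame[OF gd_pf] by simp

lemma em_comp:
 assumes "f \<in> Arr CC" "g \<in> Arr CC" "Cod CC g = Dom CC f"
 shows "bhom_eq (sB (Cod CC f)) (em (f \<odot> g)) (em g \<ast> em f)"
 using beq_trans[OF E.ebm_eq[OF pf_eq_comp[OF assms]] beq_sym[OF E.self.ebm_comp[OF gd_pf[OF assms(1)]]]] assms by simp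

lemma em_id: "X \<in> Obj FF \<Longrightarrow> bhom_eq (sB X) (em (Ident CC X)) bhom_id"
 using beq_trans[OF E.ebm_eq[OF pf_eq_id] E.ebm_id, of X] by simp

lemma em_slice:
 assumes "f \<in> Arr CC" "A \<in> Arr FF" "Cod FF A = Cod CC f"
 shows "bhom_eq (sB (Dom FF A)) (bhom_slice i (em f)) (em (ce_pi2 S f A))"
proof -
 have "bhom_eq (sB (Dom FF A)) (bhom_slice i (em f)) (ebm EE EE (Dom FF A) (sfun_slice FF A (pf f)))"
  using E.self.ebm_slice[OF gd_pf[OF assms(1)], of A i] assms by simp
 also have "bhom_eq (sB (Dom FF A)) ... (em (ce_pi2 S f A))" using E.ebm_eq[OF pf_eq_slice[OF assms]] assms by simp
 finally show ?thesis .
qed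

text \<open>One level above the codomain of \<open>f\<close>, the action is pullback of an
  indecomposable arrow and of its sections. These are the values from which arrows are
  recovered.\<close>

lemma em_ind:
 assumes f: "f \<in> Arr CC" and X: "X \<in> Obj FF" "0 < ce_lev S X" "Cod CC f = Cod FF (ind X)"
 shows "bh_ty (em f) i X = Dom FF (ce_pb S f (ind X))"
  "bh_tm (em f) j \<langle>X, t\<rangle> = \<langle>Dom FF (ce_pb S f (ind X)), sec f (ind X) t\<rangle>"
proof -
 show "bh_ty (em f) i X = Dom FF (ce_pb S f (ind X))" using E.ebm_ty[of "ind X" "Cod CC f" EE "pf f" i] assms by simp
 have "E.stp (Cod CC f) 0 (Ident FF (Cod CC f)) (ind X)" using assms f by (simp add: E.stp_def)
 from E.ebm_tm[OF this, of EE "pf f" j t] show "bh_tm (em f) j \<langle>X, t\<rangle> = \<langle>Dom FF (ce_pb S f (ind X)), sec f (ind X) t\<rangle>"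
  using assms f by (simp add: pf_tm)
qed

text \<open>Rootedness enters here, as the base of the inductions on the level of the
  codomain.\<close>

lemma one_arr:
 assumes "f \<in> Arr CC" "g \<in> Arr CC" "Dom CC f = Dom CC g" "Cod CC f = ce_one S" "Cod CC g = ce_one S"
 shows "f = g"
proof -
 have "\<exists>!h. h \<in> hom CC (Dom CC g) (ce_one S)" using is_rooted assms(2) unfolding is_rooted_cesys_def is_terminal_def by simp
 then show ?thesis using assms by (auto simp: hom_def)
qed

text \<open>The section is induced by \<open>f\<close> and the identity of its domain, by the
  universal property of the pullback of \<open>A\<close> along
  \<open>ce_I S A \<odot> f\<close>.\<close>

lemma split_arr:
 assumes f: "f \<in> Arr CC" and A: "A \<in> Arr FF" "Dom FF A = Cod CC f"
 shows "\<exists>s \<in> TT (ce_pb S (ce_I S A \<odot> f) A). ce_pi2 S (ce_I S A \<odot> f) A \<odot> s = f"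
proof -
 let ?g = "ce_I S A \<odot> f"
 have g: "?g \<in> Arr CC" "Dom CC ?g = Dom CC f" "Cod FF A = Cod CC ?g" using assms by simp_all
 note pb = pb_arr[OF g(1) A(1) g(3)]
 have "\<exists>w. w \<in> Arr CC \<and> Dom CC w = Dom CC f \<and> Cod CC w = Dom CC (ce_pi2 S ?g A) \<and> ce_pi2 S ?g A \<odot> w = f \<and>
   ce_I S (ce_pb S ?g A) \<odot> w = Ident CC (Dom CC f)"
  by (rule C.pullback_ex[OF pb_pullback[OF g(1) A(1) g(3)]]) (use assms g in simp_all)
 then show ?thesis using pb g by (auto simp: TT_iff)
qed

end

section \<open>Arrows corresponding under a homomorphism of B-systems\<close>

locale ce2 = A: strat_cesys S + B: strat_cesys S' for S S' :: "'a cesys" +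
 fixes K :: "'a bhom"
 assumes K: "is_pre_bhom A.BS B.BS K"
begin

definition kp :: "'a univ \<Rightarrow> 'a univ" where
 "kp X = bh_ty K (ce_lev S X) X"

definition kt :: "'a univ \<Rightarrow> 'a univ \<Rightarrow> 'a univ" where
 "kt X x = usnd (bh_tm K (ce_lev S X) \<langle>X, x\<rangle>)"

lemma frK: "is_bframe_hom A.BS B.BS K"
 using K by (simp add: is_pre_bhom_def)

lemma kp [simp]:
 assumes "X \<in> Obj A.FF"
 shows "kp X \<in> Obj B.FF" "ce_lev S' (kp X) = ce_lev S X"
  "0 < ce_lev S X \<Longrightarrow> Cod B.FF (B.ind (kp X)) = kp (Cod A.FF (A.ind X))"
 using frameD(1)[OF frK, of X "ce_lev S X"] frameD(3)[OF frK, of X "ce_lev S X - 1"] assms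
 by (auto simp: kp_def)

lemma kt:
 assumes "X \<in> Obj A.FF" "0 < ce_lev S X" "x \<in> A.TT (A.ind X)"
 shows "kt X x \<in> B.TT (B.ind (kp X))" "ce_lev S X = n \<Longrightarrow> bh_tm K n \<langle>X, x\<rangle> = \<langle>kp X, kt X x\<rangle>"
proof -
 let ?n = "ce_lev S X - 1"
 have x: "\<langle>X, x\<rangle> \<in> b_tm A.BS (Suc ?n)" using assms by simp
 show "kt X x \<in> B.TT (B.ind (kp X))" "ce_lev S X = n \<Longrightarrow> bh_tm K n \<langle>X, x\<rangle> = \<langle>kp X, kt X x\<rangle>"
  using frameD(2,4)[OF frK x] assms by (auto simp: kt_def kp_def)
qed

text \<open>\<open>f'\<close> acts on the images under \<open>K\<close> as \<open>f\<close> acts on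
  the originals. A relation is used because existence and uniqueness of the counterpart are shown by
  separate inductions.\<close>

definition compat :: "'a univ \<Rightarrow> 'a univ \<Rightarrow> bool" where
 "compat f f' \<longleftrightarrow> f \<in> Arr A.CC \<and> f' \<in> Arr B.CC \<and> Dom B.CC f' = kp (Dom A.CC f) \<and> Cod B.CC f' = kp (Cod A.CC f) \<and>
  bhom_eq (A.sB (Cod A.CC f)) (bhom_slice (ce_lev S (Dom A.CC f)) K \<ast> A.em f)
   (B.em f' \<ast> bhom_slice (ce_lev S (Cod A.CC f)) K)"

lemma compatD:
 assumes "compat f f'"
 shows "f \<in> Arr A.CC" "f' \<in> Arr B.CC" "Dom B.CC f' = kp (Dom A.CC f)" "Cod B.CC f' = kp (Cod A.CC f)"
  "bhom_eq (A.sB (Cod A.CC f)) (bhom_slice (ce_lev S (Dom A.CC f)) K \<ast> A.em f) (B.em f' \<ast> bhom_slice (ce_lev S (Cod A.CC f)) K)"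
 using assms by (auto simp: compat_def)

lemma frK_slice:
 assumes "X \<in> Obj A.FF"
 shows "is_bframe_hom (A.sB X) (B.sB (kp X)) (bhom_slice (ce_lev S X) K)"
 using A.E.Fr.is_bframe_hom_slice[OF frK, of X "ce_lev S X"] assms by (simp add: kp_def[symmetric])

lemma fr: "X \<in> Obj A.FF \<Longrightarrow> is_bframe (A.sB X)"
 using A.E.Fr.is_bframe_slice[of X "ce_lev S X"] by simp

lemma compat_comp:
 assumes f: "compat f f'" and g: "compat g g'" and gf: "Cod A.CC g = Dom A.CC f"
 shows "compat (f \<cdot>\<^bsub>A.CC\<^esub> g) (f' \<cdot>\<^bsub>B.CC\<^esub> g')"
proof -
 note F = compatD[OF f] and G = compatD[OF g]
 let ?X = "Cod A.CC f"
 let ?k = "\<lambda>X. bhom_slice (ce_lev S X) K"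
 have X: "?X \<in> Obj A.FF" using F by simp
 have gf': "Cod B.CC g' = Dom B.CC f'" using F G gf by simp
 have "bhom_eq (A.sB ?X) (?k (Dom A.CC g) \<ast> A.em (f \<cdot>\<^bsub>A.CC\<^esub> g)) (?k (Dom A.CC g) \<ast> (A.em g \<ast> A.em f))"
  by (rule beq_right[OF A.em_comp[OF F(1) G(1) gf]])
 also have "bhom_eq (A.sB ?X) ... ((B.em g' \<ast> ?k (Dom A.CC f)) \<ast> A.em f)"
  using beq_left[OF fr[OF X] G(5)[unfolded gf] A.em_frame[OF F(1)]] by (simp add: gf bassoc)
 also have "bhom_eq (A.sB ?X) ... ((B.em g' \<ast> B.em f') \<ast> ?k ?X)"
  unfolding bassoc by (rule beq_right[OF F(5)])
 also have "bhom_eq (A.sB ?X) ... (B.em (f' \<cdot>\<^bsub>B.CC\<^esub> g') \<ast> ?k ?X)"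
  using beq_sym[OF B.em_comp[OF F(2) G(2) gf']] F(4)
  by (intro beq_left[OF fr[OF X] _ frK_slice[OF X]]) simp
 finally show ?thesis using F G gf gf' by (simp add: compat_def)
qed

lemma compat_id:
 assumes X: "X \<in> Obj A.FF"
 shows "compat (Ident A.CC X) (Ident B.CC (kp X))"
proof -
 let ?k = "bhom_slice (ce_lev S X) K"
 have "bhom_eq (A.sB X) (?k \<ast> A.em (Ident A.CC X)) (?k \<ast> bhom_id)"
  by (rule beq_right[OF A.em_id[OF X]])
 also have "bhom_eq (A.sB X) (?k \<ast> bhom_id) (B.em (Ident B.CC (kp X)) \<ast> ?k)"
  using beq_left[OF fr[OF X] beq_sym[OF B.em_id[OF kp(1)[OF X]]], of ?k] frK_slice[OF X] X by simp
 finally show ?thesis using X by (simp add: compat_def)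
qed

text \<open>Pullback along a projection is weakening, so this is the clause of \<open>K\<close> on
  \<open>W\<close>.\<close>

lemma compat_I:
 assumes X: "X \<in> Obj A.FF" "0 < ce_lev S X"
 shows "compat (ce_I S (A.ind X)) (ce_I S' (B.ind (kp X)))"
 using A.E.Fr.pre_bhomD(2)[OF K, of X "ce_lev S X - 1"] X kp[OF X(1)] by (simp add: compat_def kp_def)

text \<open>Pullback along a section is substitution, so this is the clause of \<open>K\<close> on
  \<open>S\<close>.\<close>

lemma compat_S:
 assumes X: "X \<in> Obj A.FF" "0 < ce_lev S X" and x: "x \<in> A.TT (A.ind X)"
 shows "compat x (kt X x)"
proof -
 have x': "x \<in> Arr A.CC" "Dom A.CC x = Cod A.FF (A.ind X)" "Cod A.CC x = X" using x X by (simp_all add: A.TT_iff)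
 have "B.ind (kp X) \<in> Arr B.FF" using X by simp
 then have k': "kt X x \<in> Arr B.CC" "Dom B.CC (kt X x) = kp (Cod A.FF (A.ind X))" "Cod B.CC (kt X x) = kp X"
  using kt(1)[OF X x] X by (simp_all add: B.TT_iff)
 show ?thesis
  using A.E.Fr.pre_bhomD(1)[OF K, of "\<langle>X, x\<rangle>" "ce_lev S X - 1"] X x x' k' kt(2)[OF X x refl] by (simp add: compat_def)
qed

text \<open>The equation in \<open>compat f f'\<close> is used in three ways: evaluated at the type
  \<open>X\<close>, sliced at \<open>X\<close>, where actions become those of connecting arrows, and
  evaluated at a term of \<open>X\<close>.\<close>

lemma compat_pb:
 assumes f: "compat f f'" and X: "X \<in> Obj A.FF" "0 < ce_lev S X" "Cod A.CC f = Cod A.FF (A.ind X)"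
 shows "kp (Dom A.FF (ce_pb S f (A.ind X))) = Dom B.FF (ce_pb S' f' (B.ind (kp X)))"
  "compat (ce_pi2 S f (A.ind X)) (ce_pi2 S' f' (B.ind (kp X)))"
  "y \<in> A.TT (A.ind X) \<Longrightarrow> kt (Dom A.FF (ce_pb S f (A.ind X))) (A.sec f (A.ind X) y) = B.sec f' (B.ind (kp X)) (kt X y)"
proof -
 note F = compatD[OF f]
 let ?A = "A.ind X" and ?B = "B.ind (kp X)"
 let ?Z = "Dom A.FF (ce_pb S f ?A)"
 have A: "?A \<in> Arr A.FF" "Dom A.FF ?A = X" "Cod A.FF ?A = Cod A.CC f" using X by simp_all
 have B: "?B \<in> Arr B.FF" "Dom B.FF ?B = kp X" "Cod B.FF ?B = Cod B.CC f'" using X F by simp_all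
 have l: "ce_lev S X = Suc (ce_lev S (Cod A.CC f))" using X by simp
 have Z: "?Z \<in> Obj A.FF" "ce_lev S ?Z = Suc (ce_lev S (Dom A.CC f))" "A.ind ?Z = ce_pb S f ?A"
  using A.lev_pb[OF F(1) A(1,3)] A.indec_pb[OF X(1,2) F(1) X(3)] A.pb_arr[OF F(1) A(1,3)] A X(1,2) l by simp_all
 have Xs: "X \<in> b_ty (A.sB (Cod A.CC f)) 1" using X by simp
 note eA = A.em_ind[OF F(1) X]
 have eB: "bh_ty (B.em f') i (kp X) = Dom B.FF (ce_pb S' f' ?B)"
   "bh_tm (B.em f') i \<langle>kp X, t\<rangle> = \<langle>Dom B.FF (ce_pb S' f' ?B), B.sec f' ?B t\<rangle>" for i t
  using B.em_ind[OF F(2), of "kp X"] X B by simp_all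
 show k: "kp ?Z = Dom B.FF (ce_pb S' f' ?B)"
  using beqD(1)[OF F(5) Xs] eA(1) eB(1) Z l by (simp add: kp_def)
 have sl: "b_slice (A.sB (Cod A.CC f)) 1 X = A.sB X" using b_slice_slice[of X A.BS "ce_lev S (Cod A.CC f)" 1] X(1) A(3) l by simp
 have "bhom_eq (A.sB X) (bhom_slice (ce_lev S ?Z) K \<ast> A.em (ce_pi2 S f ?A)) (bhom_slice (ce_lev S ?Z) K \<ast> bhom_slice 1 (A.em f))"
  using beq_right[OF beq_sym[OF A.em_slice[OF F(1) A(1,3)]]] A by simp
 also have "bhom_eq (A.sB X) ... (bhom_slice 1 (B.em f') \<ast> bhom_slice (ce_lev S X) K)"
  using beq_slice[OF F(5), of 1 X] unfolding sl bslice_comp bslice_slice by (simp add: l Z)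
 also have "bhom_eq (A.sB X) ... (B.em (ce_pi2 S' f' ?B) \<ast> bhom_slice (ce_lev S X) K)"
  using B.em_slice[OF F(2) B(1,3), of 1] B(2) X by (intro beq_left[OF fr _ frK_slice]) simp_all
 finally show "compat (ce_pi2 S f ?A) (ce_pi2 S' f' ?B)"
  using F A B k Z X(1,2) by (simp add: compat_def)
 assume y: "y \<in> A.TT ?A"
 have s: "A.sec f ?A y \<in> A.TT (A.ind ?Z)" using A.sec(1)[OF F(1) A(1,3) y] Z by simp
 have "\<langle>X, y\<rangle> \<in> b_tm (A.sB (Cod A.CC f)) 1" using X y by simp
 from beqD(2)[OF F(5) this] show "kt ?Z (A.sec f ?A y) = B.sec f' ?B (kt X y)"
  using eA(2) eB(2) kt(2)[OF X(1,2) y] kt(2)[OF Z(1) _ s] Z l by simp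
qed

text \<open>This is the clause of \<open>K\<close> on \<open>delta\<close>, whose second component
  is the generic term.\<close>

lemma kt_idtm:
 assumes X: "X \<in> Obj A.FF" "0 < ce_lev S X"
 shows "kt (Dom A.FF (ce_pb S (ce_I S (A.ind X)) (A.ind X))) (e_idtm A.EE (A.ind X)) = e_idtm B.EE (B.ind (kp X))"
proof -
 let ?A = "A.ind X"
 have A: "?A \<in> Arr A.FF" "Dom A.FF ?A = X" "ce_I S ?A \<in> Arr A.CC" "Cod A.FF ?A = Cod A.CC (ce_I S ?A)" using X by simp_all
 let ?Z = "Dom A.FF (ce_pb S (ce_I S ?A) ?A)"
 have Z: "?Z \<in> Obj A.FF" "ce_lev S ?Z = Suc (ce_lev S X)" "A.ind ?Z = ce_pb S (ce_I S ?A) ?A"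
  using A.lev_pb[OF A(3,1,4)] A.indec_pb[OF X A(3)] A.pb_arr[OF A(3,1,4)] A(1-3) X by simp_all
 have "e_idtm A.EE ?A \<in> A.TT (A.ind ?Z)" using A.CE2E_idtm(1)[OF A(1)] Z by simp
 then show ?thesis
  using A.E.Fr.pre_bhomD(3)[OF K, of X "ce_lev S X - 1"] X kt(2)[OF Z(1), of "e_idtm A.EE ?A" "Suc (ce_lev S X)"] Z by (simp add: kp_def)
qed

text \<open>An arrow into an object of positive level is the connecting arrow over its projection
  composed with the section it induces, and this section is its action on the generic term. By
  compatibility that action is the image under \<open>K\<close> of the action of \<open>f\<close>,
  so the right side depends on \<open>f'\<close> only through its projection.\<close>

lemma compat_eq:
 assumes f: "compat f f'" and X: "X = Cod A.CC f" "0 < ce_lev S X"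
 defines "V \<equiv> ce_pb S (ce_I S (A.ind X)) (A.ind X)"
 shows "f' = ce_pi2 S' (ce_I S' (B.ind (kp X)) \<cdot>\<^bsub>B.CC\<^esub> f') (B.ind (kp X)) \<cdot>\<^bsub>B.CC\<^esub>
  kt (Dom A.FF (ce_pb S f V)) (A.sec f V (e_idtm A.EE (A.ind X)))"
proof -
 note F = compatD[OF f]
 have X': "X \<in> Obj A.FF" using F X by simp
 let ?A = "A.ind X" and ?B = "B.ind (kp X)"
 have A: "?A \<in> Arr A.FF" "Dom A.FF ?A = X" "ce_I S ?A \<in> Arr A.CC" "Cod A.FF ?A = Cod A.CC (ce_I S ?A)" using X X' by simp_all
 have B: "?B \<in> Arr B.FF" "Dom B.FF ?B = kp X" "ce_I S' ?B \<in> Arr B.CC" "Cod B.FF ?B = Cod B.CC (ce_I S' ?B)" using X X' by simp_all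
 let ?V = "ce_pb S' (ce_I S' ?B) ?B"
 let ?Z = "Dom A.FF V"
 note pA = A.pb_arr[OF A(3,1,4)] and pB = B.pb_arr[OF B(3,1,4)]
 have Z: "?Z \<in> Obj A.FF" "0 < ce_lev S ?Z" "A.ind ?Z = V" "Cod A.CC f = Cod A.FF (A.ind ?Z)"
  using A.indec_pb[OF X' X(2) A(3)] pA A(1-3) X by (simp_all add: V_def)
 have kZ: "kp ?Z = Dom B.FF ?V" using compat_pb(1)[OF compat_I[OF X' X(2)] X' X(2)] A(1-3) by (simp add: V_def)
 have iZ: "B.ind (kp ?Z) = ?V" unfolding kZ using B.indec_pb(2)[of "kp X" "ce_I S' ?B"] B(1-3) X X' by simp
 have i: "e_idtm A.EE ?A \<in> A.TT (A.ind ?Z)" using A.CE2E_idtm(1)[OF A(1)] Z by (simp add: V_def)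
 have "kt (Dom A.FF (ce_pb S f V)) (A.sec f V (e_idtm A.EE ?A)) = B.sec f' ?V (e_idtm B.EE ?B)"
  using compat_pb(3)[OF f Z(1,2,4) i] kt_idtm[OF X' X(2)] iZ Z by (simp add: V_def)
 \<comment> \<open>This holds for every arrow: the connecting arrow of the composite splits as the
   one of the projection after the one of \<open>f'\<close>, the pulled back section moves
   \<open>f'\<close> behind the diagonal, and the diagonal followed by the projection is the
   identity.\<close>
 moreover have "ce_pi2 S' (ce_I S' ?B \<cdot>\<^bsub>B.CC\<^esub> f') ?B \<cdot>\<^bsub>B.CC\<^esub> B.sec f' ?V (e_idtm B.EE ?B) = f'"
 proof -
  note j = B.CE2E_idtm(1,2)[OF B(1)]
  have V: "?V \<in> Arr B.FF" "Cod B.FF ?V = Cod B.CC f'" using pB F X B(1-3) by simp_all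
  note s = B.sec[OF F(2) V j(1)] and pV = B.pb_arr[OF F(2) V]
  have f': "Cod B.CC f' = Dom B.CC (ce_I S' ?B)" using F X B(1-3) by simp
  have j': "e_idtm B.EE ?B \<in> Arr B.CC" "Dom B.CC (e_idtm B.EE ?B) = Cod B.CC f'" "Cod B.CC (e_idtm B.EE ?B) = Dom B.FF ?V"
   using j(1) V by (simp_all add: B.TT_iff)
  have s': "B.sec f' ?V (e_idtm B.EE ?B) \<in> Arr B.CC" "Cod B.CC (B.sec f' ?V (e_idtm B.EE ?B)) = Dom B.FF (ce_pb S' f' ?V)"
   using s(1) pV by (simp_all add: B.TT_iff)
  have "ce_pi2 S' (ce_I S' ?B \<cdot>\<^bsub>B.CC\<^esub> f') ?B \<cdot>\<^bsub>B.CC\<^esub> B.sec f' ?V (e_idtm B.EE ?B) =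
    ce_pi2 S' (ce_I S' ?B) ?B \<cdot>\<^bsub>B.CC\<^esub> (e_idtm B.EE ?B \<cdot>\<^bsub>B.CC\<^esub> f')"
   using B.comp_pb(2)[OF B(3) F(2) f' B(1,4)] s(2) s' pB pV by (simp add: B.C.assoc)
  also have "... = (ce_pi2 S' (ce_I S' ?B) ?B \<cdot>\<^bsub>B.CC\<^esub> e_idtm B.EE ?B) \<cdot>\<^bsub>B.CC\<^esub> f'"
   by (rule B.C.assoc[symmetric]) (use F(2) j' pB in simp_all)
  also have "... = f'" using j(2) F B(1-3) X by simp
  finally show ?thesis .
 qed
 ultimately show ?thesis by simp
qed

text \<open>Induction on the level of the codomain. Composing with the projection lowers this level,
  so the projections of two counterparts agree, and \<open>compat_eq\<close> then expresses both
  counterparts by the same term. At level 0 the codomain is terminal.\<close>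

lemma compat_unique: "compat f f' \<Longrightarrow> compat f f'' \<Longrightarrow> f' = f''"
proof (induction "ce_lev S (Cod A.CC f)" arbitrary: f f' f'')
 case 0
 note F = compatD[OF 0(2)] and G = compatD[OF 0(3)]
 have "kp (Cod A.CC f) = ce_one S'" using B.T.level_0[of "kp (Cod A.CC f)"] F 0(1) by simp
 then show ?case using B.one_arr[of f' f''] F G by simp
next
 case (Suc n)
 note F = compatD[OF Suc.prems(1)]
 let ?X = "Cod A.CC f"
 have X: "?X \<in> Obj A.FF" "0 < ce_lev S ?X" using F Suc.hyps by simp_all
 have A: "A.ind ?X \<in> Arr A.FF" "Dom A.FF (A.ind ?X) = ?X" "ce_lev S (Cod A.FF (A.ind ?X)) = n" using X Suc.hyps(2)[symmetric] by simp_all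
 let ?g = "\<lambda>f'. ce_I S' (B.ind (kp ?X)) \<cdot>\<^bsub>B.CC\<^esub> f'"
 have c: "compat (ce_I S (A.ind ?X) \<cdot>\<^bsub>A.CC\<^esub> f) (?g f')" "compat (ce_I S (A.ind ?X) \<cdot>\<^bsub>A.CC\<^esub> f) (?g f'')"
  using compat_comp[OF compat_I[OF X]] Suc.prems A by simp_all
 have "?g f' = ?g f''" by (rule Suc.hyps(1)[OF _ c]) (use F A in simp)
 then show ?case
  using compat_eq[OF Suc.prems(1) refl X(2)] compat_eq[OF Suc.prems(2) refl X(2)] by simp
qed

text \<open>Induction on the level of the codomain: by \<open>split_arr\<close>, \<open>f\<close> is
  a connecting arrow over its projection composed with a section. The projection has a counterpart
  by induction, the connecting arrow by \<open>compat_pb\<close> and the section by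
  \<open>compat_S\<close>.\<close>

lemma compat_ex: "f \<in> Arr A.CC \<Longrightarrow> \<exists>f'. compat f f'"
proof (induction "ce_lev S (Cod A.CC f)" arbitrary: f)
 case 0
 let ?A = "A.T.bang (Dom A.CC f)"
 have c: "Cod A.CC f = ce_one S" using A.T.level_0[of "Cod A.CC f"] 0 by simp
 \<comment> \<open>An arrow to the terminal object is the image of a path of families, and a path is
   a composite of projections, whose counterparts are given by \<open>compat_I\<close>.\<close>
 have "\<exists>f'. compat (ce_I S A) f'" if "A \<in> Arr A.FF" for A
  using that
 proof (induction A rule: A.T.arr_induct)
  case (ident X)
  then show ?case using compat_id by auto
 next
  case (step g X)
  then obtain g' where "compat (ce_I S g) g'" by blast
  from compat_comp[OF this compat_I[OF step(1,2)]] show ?case using step by (auto simp: A.I_comp)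
 qed
 moreover have "ce_I S ?A = f" using A.one_arr[of "ce_I S ?A" f] c 0 by simp
 ultimately show ?case using 0 by (metis A.T.bang(1) A.dom_C_obj(1))
next
 case (Suc n)
 let ?X = "Cod A.CC f"
 have X: "?X \<in> Obj A.FF" "0 < ce_lev S ?X" using Suc by simp_all
 let ?A = "A.ind ?X"
 have A: "?A \<in> Arr A.FF" "Dom A.FF ?A = ?X" "ce_lev S (Cod A.FF ?A) = n" using X Suc.hyps(2)[symmetric] by simp_all
 let ?g = "ce_I S ?A \<cdot>\<^bsub>A.CC\<^esub> f"
 have g: "?g \<in> Arr A.CC" "Cod A.CC ?g = Cod A.FF ?A" using A Suc.prems by simp_all
 obtain s where s: "s \<in> A.TT (ce_pb S ?g ?A)" "ce_pi2 S ?g ?A \<cdot>\<^bsub>A.CC\<^esub> s = f"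
  using A.split_arr[OF Suc.prems A(1,2)] by blast
 obtain g' where g': "compat ?g g'" using Suc.hyps(1)[of ?g] g A by auto
 let ?Z = "Dom A.FF (ce_pb S ?g ?A)"
 note pb = A.pb_arr[OF g(1) A(1) g(2)[symmetric]]
 have Z: "?Z \<in> Obj A.FF" "0 < ce_lev S ?Z" "s \<in> A.TT (A.ind ?Z)" using A.indec_pb[OF X g] pb s by simp_all
 have "compat (ce_pi2 S ?g ?A \<cdot>\<^bsub>A.CC\<^esub> s) (ce_pi2 S' g' (B.ind (kp ?X)) \<cdot>\<^bsub>B.CC\<^esub> kt ?Z s)"
  by (rule compat_comp[OF compat_pb(2)[OF g' X g(2)] compat_S[OF Z]]) (use s(1) pb in \<open>simp add: A.TT_iff\<close>)
 then show ?case using s(2) by auto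
qed

definition hf :: "'a univ \<Rightarrow> 'a univ" where
 "hf f = (THE f'. compat f f')"

lemma hf: "f \<in> Arr A.CC \<Longrightarrow> compat f (hf f)"
 unfolding hf_def using compat_ex compat_unique by (metis theI)

lemma hf_eq: "compat f f' \<Longrightarrow> hf f = f'"
 using compat_unique hf compatD(1) by blast

end

context strat_cehom
begin

lemma CE2E_strat_hom: "strat_esys_hom S.EE S'.EE (CE2E_hom S H)"
 by (rule strat_esys_homI[OF S.is_esys_CE2E S.is_stratified_CE2E S'.is_esys_CE2E S'.is_stratified_CE2E
   is_pre_ehom_CE2E is_stratified_ehom_CE2E])

lemma ce2_hom: "ce2 S S' (E2B_hom S.EE (CE2E_hom S H))"
 using strat_esys_hom.is_pre_bhom_E2B[OF CE2E_strat_hom] by unfold_locales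

text \<open>A homomorphism of CE-systems commutes with pullback functors by \<open>hom_pf\<close>;
  translated by \<open>ebm\<close>, this is compatibility with respect to the homomorphism of
  B-systems that it induces.\<close>

lemma hom_compat:
 assumes f: "f \<in> Arr S.CC"
 shows "ce2.compat S S' (E2B_hom S.EE (CE2E_hom S H)) f (onArr (ceh_cat H) f)"
proof -
 interpret e: strat_esys_hom S.EE S'.EE "CE2E_hom S H" by (rule CE2E_strat_hom)
 let ?K = "E2B_hom S.EE (CE2E_hom S H)" and ?f = "onArr (ceh_cat H) f"
 interpret ce2 S S' ?K by (rule ce2_hom)
 have ob: "onObj (eh_fun (CE2E_hom S H)) X = onObj (ceh_fam H) X" if "X \<in> Obj S.FF" for X
  using that by (simp add: CE2E_hom_def)
 have kp: "kp X = onObj (ceh_fam H) X" if "X \<in> Obj S.FF" for X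
  using e.E2B_hom_simps(1)[of X "ce_lev S X"] ob[OF that] that by (simp add: kp_def)
 note F = functor_arr[OF cat_functor f]
 let ?X = "Cod S.CC f" and ?Y = "Dom S.CC f"
 have X: "?X \<in> Obj S.FF" "?Y \<in> Obj S.FF" using f by simp_all
 let ?Q = "\<lparr>eh_fun = ceh_fam H, eh_tm = (\<lambda>A x. onArr (ceh_cat H) x)\<rparr>"
 have Q0: "ehom_slice ?Q = \<lparr>s_obj = onArr (ceh_fam H), s_arr = (\<lambda>A P. onArr (ceh_fam H) P), s_tm = (\<lambda>A P t. onArr (ceh_cat H) t)\<rparr>"
  by (simp add: ehom_slice_def)
 have e0: "sfun_eq S.EE X e.hs (ehom_slice ?Q)" for X
  by (rule seqI) (simp_all add: CE2E_hom_def)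
 have eq: "sfun_eq S.EE ?X (e.hs \<star> S.pf f) (S'.pf ?f \<star> e.hs)"
  using seq_trans[OF seq_left[OF e0 S.pf_sfun[OF f]] seq_trans[OF hom_pf[OF f Q0] seq_right[OF seq_sym[OF e0]]]] .
 have hm: "bhom_eq (S.sB X) (bhom_slice (ce_lev S X) ?K) (ebm S.EE S'.EE X e.hs)" if "X \<in> Obj S.FF" for X
  using e.E2B_hom_ebm[of X] that by simp
 have gX: "e.eb.gd ?X (Cod S'.CC ?f) e.hs" using e.gd_H[of ?X] X F by (simp add: ob obj_agree)
 have "bhom_eq (S.sB ?X) (bhom_slice (ce_lev S ?Y) ?K \<ast> S.em f) (ebm S.EE S'.EE ?Y e.hs \<ast> S.em f)"
  by (rule beq_left[OF fr[OF X(1)] hm[OF X(2)] S.em_frame[OF f]])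
 also have "bhom_eq (S.sB ?X) ... (ebm S.EE S'.EE ?X (e.hs \<star> S.pf f))"
  using S.E.self.ebm_comp[OF S.gd_pf[OF f]] by simp
 also have "bhom_eq (S.sB ?X) ... (ebm S.EE S'.EE ?X (S'.pf ?f \<star> e.hs))"
  using S.E.ebm_eq[OF eq] by simp
 also have "bhom_eq (S.sB ?X) ... (S'.em ?f \<ast> ebm S.EE S'.EE ?X e.hs)"
  using beq_sym[OF e.eb.ebm_comp[OF gX]] by simp
 also have "bhom_eq (S.sB ?X) ... (S'.em ?f \<ast> bhom_slice (ce_lev S ?X) ?K)"
  by (rule beq_right[OF beq_sym[OF hm[OF X(1)]]])
 finally show ?thesis using f F X by (simp add: compat_def kp obj_agree)
qed

end

section \<open>Full faithfulness of \<open>C2B\<close>\<close>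

lemma (in csys) strat_cesys_CE: "strat_cesys (CE_obj S)"
 by (rule strat_cesysI[OF is_cesys_CE is_rooted_CE is_stratified_CE])

lemma (in csys_hom) strat_cehom_CE: "strat_cehom (CE_obj S) (CE_obj S') (CE_hom S F)"
 using is_cehom_CE S.strat_cesys_CE S'.strat_cesys_CE by (simp add: strat_cehom_def strat_cehom_axioms_def)

lemma C2B_simps:
 "onObj C2B S = E2B_obj (CE2E_obj (CE_obj S))"
 "onArr C2B (S, F, S') = (onObj C2B S, E2B_hom (CE2E_obj (CE_obj S)) (CE2E_hom (CE_obj S) (CE_hom S F)), onObj C2B S')"
 by (simp_all add: C2B_def fmap_comp_def E2B_def CE2E_def CE_def)

text \<open>Objects are types, so both functors agree on them. By \<open>hom_compat\<close> both
  send an arrow to a counterpart with respect to the same homomorphism of B-systems, and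
  counterparts are unique.\<close>

lemma C2B_faithful:
 assumes "f \<in> hom Csys X Y" "g \<in> hom Csys X Y" "onArr C2B f = onArr C2B g"
 shows "f = g"
proof -
 obtain F where F: "f = (X, F, Y)" "is_csys X" "is_csys Y" "is_csys_hom X Y F" "fmap_extensional (c_cat X) F"
  using assms(1) by (auto simp: Csys_def mk_category_hom)
 obtain G where G: "g = (X, G, Y)" "is_csys_hom X Y G" "fmap_extensional (c_cat X) G"
  using assms(2) by (auto simp: Csys_def mk_category_hom)
 interpret X: csys X by (rule csys.intro[OF F(2)])
 interpret Y: csys Y by (rule csys.intro[OF F(3)])
 interpret QX: strat_cesys "CE_obj X" by (rule X.strat_cesys_CE)
 let ?K = "E2B_hom QX.EE (CE2E_hom (CE_obj X) (CE_hom X F))"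
 have eq: "E2B_hom QX.EE (CE2E_hom (CE_obj X) (CE_hom X G)) = ?K" using assms(3) by (simp add: F G C2B_simps)
 have *: "onObj J Z = bh_ty ?K (c_len X Z) Z" "a \<in> Arr (c_cat X) \<Longrightarrow> ce2.compat (CE_obj X) (CE_obj Y) ?K a (onArr J a)"
  if J: "is_csys_hom X Y J" "E2B_hom QX.EE (CE2E_hom (CE_obj X) (CE_hom X J)) = ?K" and Z: "Z \<in> Obj (c_cat X)" for J Z a
 proof -
  interpret J: csys_hom X Y J by (rule csys_homI[OF F(2,3) J(1)])
  interpret Q: strat_cehom "CE_obj X" "CE_obj Y" "CE_hom X J"
   by (rule J.strat_cehom_CE)
  show "onObj J Z = bh_ty ?K (c_len X Z) Z"
   using Z J(2)[symmetric] by (simp add: E2B_hom_def CE2E_hom_def CE_hom_def)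
  show "ce2.compat (CE_obj X) (CE_obj Y) ?K a (onArr J a)" if a: "a \<in> Arr (c_cat X)"
   using Q.hom_compat[of a] a J(2) by (simp add: CE_hom_def)
 qed
 interpret JF: csys_hom X Y F by (rule csys_homI[OF F(2,3,4)])
 interpret Q: strat_cehom "CE_obj X" "CE_obj Y" "CE_hom X F"
  by (rule JF.strat_cehom_CE)
 interpret ce2 "CE_obj X" "CE_obj Y" ?K by (rule Q.ce2_hom)
 have "F = G"
 proof (rule fmap_eqI[OF F(5) G(3)])
  show "onObj F Z = onObj G Z" if "Z \<in> Obj (c_cat X)" for Z
   using *(1)[OF F(4) refl that] *(1)[OF G(2) eq that] by simp
  show "onArr F a = onArr G a" if "a \<in> Arr (c_cat X)" for a
   using compat_unique[OF *(2)[OF F(4) refl X.one_obj that] *(2)[OF G(2) eq X.one_obj that]] .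
 qed
 then show ?thesis using F G by simp
qed

text \<open>The functor is \<open>kp\<close> on objects and sends each arrow to its unique
  counterpart. Identities, composites, projections and connecting arrows are preserved because the
  expected value is compatible in each case, hence equal to the counterpart.\<close>

lemma C2B_full:
 assumes "X \<in> Obj Csys" "Y \<in> Obj Csys" "k \<in> hom Bsys (onObj C2B X) (onObj C2B Y)"
 shows "\<exists>f \<in> hom Csys X Y. onArr C2B f = k"
proof -
 have XY: "is_csys X" "is_csys Y" using assms by (auto simp: Csys_def)
 interpret X: csys X by (rule csys.intro[OF XY(1)])
 interpret Y: csys Y by (rule csys.intro[OF XY(2)])
 interpret QX: strat_cesys "CE_obj X" by (rule X.strat_cesys_CE)
 interpret QY: strat_cesys "CE_obj Y" by (rule Y.strat_cesys_CE)
 obtain K where k0: "k = (onObj C2B X, K, onObj C2B Y)" "is_pre_bhom QX.BS QY.BS K" "bhom_extensional QX.BS K"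
  using assms(3) by (auto simp: Bsys_def mk_category_hom C2B_simps)
 interpret ce2 "CE_obj X" "CE_obj Y" K by unfold_locales (rule k0(2))
 let ?F = "fmap_restrict (c_cat X) \<lparr>onObj = kp, onArr = hf\<rparr>"
 have I1: "ce_I (CE_obj Z) \<langle>W, Num (Suc 0)\<rangle> = c_p Z W" if "is_csys Z" "W \<in> Obj (c_cat Z)" "0 < c_len Z W" for Z :: "'a csys" and W
 proof -
  interpret Z: csys Z by (rule csys.intro[OF that(1)])
  show ?thesis using that by (simp add: CE_obj_def)
 qed
 have ix: "QX.ind W = \<langle>W, Num 1\<rangle>" if "W \<in> Obj (c_cat X)" "0 < c_len X W" for W using X.CE_indec[OF that] by simp
 have iy: "QY.ind W = \<langle>W, Num 1\<rangle>" if "W \<in> Obj (c_cat Y)" "0 < c_len Y W" for W using Y.CE_indec[OF that] by simp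
 have len: "c_len Y (kp W) = c_len X W" "kp W \<in> Obj (c_cat Y)" if "W \<in> Obj (c_cat X)" for W
  using kp(1,2)[of W] that by simp_all
 have hf': "hf a \<in> Arr (c_cat Y)" "Dom (c_cat Y) (hf a) = kp (Dom (c_cat X) a)" "Cod (c_cat Y) (hf a) = kp (Cod (c_cat X) a)"
  if "a \<in> Arr (c_cat X)" for a using compatD(2-4)[OF hf[of a]] that by simp_all
 have ft: "kp (c_ft X W) = c_ft Y (kp W)" if W: "W \<in> Obj (c_cat X)" for W
 proof (cases "c_len X W = 0")
  case True
  then have "W = c_one X" "kp W = c_one Y" using X.len_0[OF W] Y.len_0[of "kp W"] len[OF W] by auto
  then show ?thesis by simp
 next
  case False
  then show ?thesis using kp(3)[of W] W len[OF W] ix[OF W] iy[of "kp W"] X.CE_indec[of W] Y.CE_indec[of "kp W"]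
   by simp
 qed
 have p: "hf (c_p X W) = c_p Y (kp W)" if W: "W \<in> Obj (c_cat X)" "0 < c_len X W" for W
  using compat_I[of W] W len[OF W(1)] ix[OF W] iy[of "kp W"] I1[OF XY(1) W] I1[OF XY(2), of "kp W"]
  by (intro hf_eq) simp
 have q: "kp (c_pb X a W) = c_pb Y (hf a) (kp W) \<and> hf (c_q X a W) = c_q Y (hf a) (kp W)"
  if W: "W \<in> Obj (c_cat X)" "0 < c_len X W" and a: "a \<in> Arr (c_cat X)" "Cod (c_cat X) a = c_ft X W" for W a
 proof -
  have c: "Cod (CE_fam X) \<langle>W, Num (Suc 0)\<rangle> = c_ft X W" by simp
  note pb = compat_pb(1,2)[OF hf[of a], of W]
  show ?thesis
   using pb hf_eq[OF pb(2)] a W len[OF W(1)] ix[OF W] iy[of "kp W"] c by simp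
 qed
 have "is_csys_hom X Y \<lparr>onObj = kp, onArr = hf\<rparr>"
  unfolding is_csys_hom_def is_functor_def hom_def fmap.select_convs
 proof (intro conjI ballI impI CollectI)
  show "hf (Ident (c_cat X) W) = Ident (c_cat Y) (kp W)" if "W \<in> Obj (c_cat X)" for W
   using compat_id[of W] that by (intro hf_eq) simp
  show "hf (g \<cdot>\<^bsub>c_cat X\<^esub> f) = hf g \<cdot>\<^bsub>c_cat Y\<^esub> hf f"
   if "f \<in> Arr (c_cat X)" "g \<in> Arr (c_cat X)" "Dom (c_cat X) g = Cod (c_cat X) f" for f g
   using compat_comp[OF hf[of g] hf[of f]] that by (intro hf_eq) simp
  show "kp (c_one X) = c_one Y" using Y.len_0[of "kp (c_one X)"] X.len_0[of "c_one X"] len[of "c_one X"] by simp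
 qed (auto simp: len hf' ft p over_def q)
 then have F: "is_csys_hom X Y ?F" using csys_hom_restrict[OF XY(1)] by blast
 interpret JF: csys_hom X Y ?F by (rule csys_homI[OF XY F])
 let ?E = "E2B_hom QX.EE (CE2E_hom (CE_obj X) (CE_hom X ?F))"
 \<comment> \<open>On types this is the choice of \<open>kp\<close>. A term is a section, hence an
   arrow, and its counterpart is its image \<open>kt\<close> under \<open>K\<close> by
   \<open>compat_S\<close>.\<close>
 have "?E = K"
 proof (rule bhom_eqI[OF _ k0(3)])
  show "bhom_extensional QX.BS ?E" by (simp add: E2B_hom_def)
  show "bhom_eq QX.BS ?E K"
   unfolding bhom_eq_def
  proof (intro conjI allI ballI)
   show "bh_ty ?E n W = bh_ty K n W" if "W \<in> b_ty QX.BS n" for n W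
    using that by (auto simp: E2B_hom_def CE2E_hom_def CE_hom_def kp_def)
   fix n y assume y: "y \<in> b_tm QX.BS n"
   then obtain W x where W: "y = \<langle>W, x\<rangle>" "W \<in> Obj (c_cat X)" "c_len X W = n" "0 < n" "x \<in> QX.TT (QX.ind W)" by auto
   have A: "QX.ind W \<in> Arr (ce_fam (CE_obj X))" using W QX.T.indec(1)[of W] by simp
   have x: "x \<in> Arr (c_cat X)" using W(5) A by (simp add: QX.TT_iff)
   have h: "hf x = kt W x" using compat_S[of W x] W by (intro hf_eq) simp
   have "bh_tm ?E n y = \<langle>kp W, hf x\<rangle>"
    using y A x W by (simp add: E2B_hom_def CE2E_hom_def CE_hom_def)
   then show "bh_tm ?E n y = bh_tm K n y" using kt(2)[of W x n] W h by simp
  qed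
 qed
 moreover have "(X, ?F, Y) \<in> hom Csys X Y" using XY F by (simp add: Csys_def mk_category_hom)
 ultimately show ?thesis using k0(1) by (intro bexI[of _ "(X, ?F, Y)"]) (simp_all add: C2B_simps)
qed

theorem theorem5p45:
 shows "is_functor Csys rCEsys\<^sub>s (CE :: ('a csys, _, _, _) fmap) \<and>
  is_functor rCEsys\<^sub>s Esys\<^sub>s (CE2E :: ('a cesys, _, _, _) fmap) \<and>
  is_functor Esys\<^sub>s Bsys (E2B :: ('a esys, _, _, _) fmap) \<and>
  is_functor Bsys Esys\<^sub>s (B2E :: ('a bsys, _, _, _) fmap) \<and>
  is_functor Esys\<^sub>s rCEsys\<^sub>s (E2CE :: ('a esys, _, _, _) fmap) \<and>
  is_functor rCEsys\<^sub>s Csys (CE2C :: ('a cesys, _, _, _) fmap) \<and>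
  is_equivalence Csys Bsys (C2B :: ('a csys, _, 'a bsys, _) fmap) B2C"
proof -
 note fs = is_functor_CE is_functor_CE2E is_functor_E2B is_functor_B2E is_functor_E2CE is_functor_CE2C
 have F: "is_functor Csys Bsys C2B" unfolding C2B_def by (rule is_functor_comp[OF is_functor_comp[OF fs(1,2)] fs(3)])
 have G: "is_functor Bsys Csys B2C" unfolding B2C_def by (rule is_functor_comp[OF is_functor_comp[OF fs(4,5)] fs(6)])
 obtain \<epsilon> where e: "is_nat_iso Bsys Bsys ((C2B :: ('a csys, _, 'a bsys, _) fmap) \<circ>\<^sub>F B2C) fmap_id \<epsilon>" using C2B_B2C_nat by blast
 have "is_equivalence Csys Bsys (C2B :: ('a csys, _, 'a bsys, _) fmap) B2C"
  by (rule equivalence_fully_faithful[OF is_category_Csys is_category_Bsys F G C2B_faithful C2B_full e]; assumption)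
 with fs show ?thesis by blast
qed

end
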